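(* Let $\mathbf{S}(\phi)$ denote the contact Schwarzian derivative of a contactomorphism $\phi$ (between open subsets of $\mathbb{P}(\mathbb{R}^{2n})$), i.e. the difference tensor of $[{}^\phi\nabla]$ and $[\nabla]$, where $[\nabla]$ is the flat model contact projective structure on $\mathbb{P}(\mathbb{R}^{2n})$. (1') $\mathbf{S}(\phi)$ vanishes on an open set $U$ if and only if $\phi$ equals the restriction to $U$ of an element of the linear symplectic group $Sp(n,\mathbb{R})$ acting on $\mathbb{P}(\mathbb{R}^{2n})$. (3') Given any $\theta$-adapted coframe $\theta^\alpha$ and dual frame $E_\alpha$, parallel with respect to the unique representative $\nabla\in[\nabla]$ associated to the contact one-form $\theta$, there are locally $2n$ linearly independent sections of $\mathcal{E}[1]$, $f^\infty,f^1,\dots,f^{2n-2},f^0$, solving the system of PDE $$E_i(E_j(f))+E_j(E_i(f))=2\,\mathbf{S}_{ij}{}^{p}E_p(f)-\tfrac1n\left(E_p(\mathbf{S}_{ij}{}^{p})-\mathbf{S}_{pi}{}^{q}\mathbf{S}_{qj}{}^{p}\right)f,$$ and such that $\phi^\alpha=\dfrac{f^\alpha}{f^\infty}$. Here $\mathbf{S}_{ij}{}^k$ are the components of $\mathbf{S}(\phi)$ in the given frame, sections of $\mathcal{E}[1]$ are regarded locally as functions by means of $\theta$, and $\phi^\alpha=x^\alpha\circ\phi$ are the components of $\phi$ in the affine coordinates $x^\alpha=u^\alpha/u^\infty$.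
   Context: Setting: $n\ge2$; $\mathbb{R}^{2n}$ has coordinates $u^\infty,u^1,\dots,u^{2n-2},u^0$ and symplectic form $\Omega=du^\infty\wedge du^0+\frac12\omega_{pq}du^p\wedge du^q$ ($\omega_{pq}$ constant). Greek indices run over $0,\dots,2n-2$, lowercase Latin over $1,\dots,2n-2$. $Sp(n,\mathbb{R})$ is the group of linear automorphisms of $(\mathbb{R}^{2n},\Omega)$. $M=\mathbb{P}(\mathbb{R}^{2n})$ carries the $Sp(n,\mathbb{R})$-invariant contact structure $H$, which in the chart $u^\infty\ne0$ with coordinates $x^\alpha=u^\alpha/u^\infty$ is the kernel of $\frac12(dx^0+\omega_{pq}x^pdx^q)$. A contactomorphism is a diffeomorphism preserving $H$. The flat model contact projective structure is the family of curves (contact geodesics) in $M$ which are the projectivizations of the two-dimensional $\Omega$-isotropic subspaces. For a contact one-form $\theta$ (so $\ker\theta=H$) with Reeb field $T$ ($\theta(T)=1$, $i(T)d\theta=0$), a coframe $\theta^\alpha$ is $\theta$-adapted if $\theta^0=\theta$ and $\theta^i(T)=0$; its dual frame $E_\alpha$ has $E_0=T$, and the $E_i$ span $H$. In general, a contact projective structure on a contact manifold is a family of smoothly immersed one-dimensional submanifolds tangent to $H$ (contact geodesics), exactly one through each point tangent to each direction in $H$, which are among the unparametrized geodesics of some affine connection. Known fact: for each contact one-form $\theta$ there is a unique affine connection $\nabla$ (the representative associated to $\theta$) having the contact geodesics among its unparametrized geodesics and satisfying $\nabla\theta=0$, $\nabla d\theta=0$, and, for its torsion $\tau$, $\tau_{0i}{}^\alpha=0=\tau_{i0}{}^\alpha$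 and $\tau_{ip}{}^p=0=\tau_{pi}{}^p$. The structure is denoted $[\nabla]$. The difference tensor $\Pi_{ij}{}^k$ of $[\bar\nabla]$ and $[\nabla]$ is given by $\Pi(X,Y)=\bar\nabla_XY-\nabla_XY$ for $X,Y\in\Gamma(H)$, with $\bar\nabla,\nabla$ the representatives associated to the same $\theta$; it does not depend on $\theta$. The structure $[{}^\phi\nabla]$ is the one induced by the connection ${}^\phi\nabla$ defined by $\phi_*({}^\phi\nabla_XY)=\nabla_{\phi_*X}\phi_*Y$; its contact geodesics are the paths tangent to $H$ mapped by $\phi$ to contact geodesics of $[\nabla]$. $\mathcal{E}[1]$ is the line bundle associated by the representation $r\cdot s=r^{-1}s$ to the principal $\mathbb{R}^\times$-bundle $\mathbb{R}^{2n}\setminus\{0\}\to\mathbb{P}(\mathbb{R}^{2n})$ (the model for the frames in a square root of the bundle of contact one-forms): sections $u$ correspond to homogeneity one functions $\tilde u$ on $\mathbb{R}^{2n}\setminus\{0\}$, and locally a contact one-form $\theta$ represents $u$ by a function $u_\theta$ with $u_{h^2\theta}=h\,u_\theta$. Sections are linearly independent if the corresponding one-forms $d\tilde u$ are linearly independent.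
   Formalization: In (1') U is taken connected and φ is assumed to preserve the coorientation of H on U; otherwise the "only if" fails (different symplectic maps on different components of U, or the map induced by a linear g with g*Ω = −Ω). *)

theory Defs
  imports "HOL-Analysis.Analysis"
begin

subsection \<open>Smooth maps between normed spaces\<close>

text \<open>Both predicates are meant for open sets \<^term>\<open>S\<close> in finite-dimensional spaces, where
  differentiability in each fixed direction to all orders is smoothness.\<close>

primrec Ck_on :: "nat \<Rightarrow> 'a::real_normed_vector set \<Rightarrow> ('a \<Rightarrow> 'b::real_normed_vector) \<Rightarrow> bool" where
  "Ck_on 0 S f \<longleftrightarrow> continuous_on S f"
| "Ck_on (Suc k) S f \<longleftrightarrow>
     f differentiable_on S \<and> (\<forall>v. Ck_on k S (\<lambda>x. frechet_derivative f (at x) v))"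

definition smooth_on :: "'a::real_normed_vector set \<Rightarrow> ('a \<Rightarrow> 'b::real_normed_vector) \<Rightarrow> bool" where
  "smooth_on S f \<longleftrightarrow> (\<forall>k. Ck_on k S f)"


subsection \<open>Projective space as a smooth manifold\<close>

typedef (overloaded) ('k::finite) projspace = "{L :: (real ^ 'k) set. subspace L \<and> dim L = 1}"
  morphisms line_of Line
proof
  have "dim (span {axis undefined 1 :: real ^ 'k}) = 1"
    by (simp add: dim_insert axis_eq_0_iff)
  then show "span {axis undefined 1 :: real ^ 'k} \<in> {L. subspace L \<and> dim L = 1}"
    by simp
qed

definition proj :: "real ^ 'k \<Rightarrow> 'k::finite projspace" where
  "proj u = Line (span {u})"

definition cone :: "'k::finite projspace set \<Rightarrow> (real ^ 'k) set" where
  "cone U = {u. u \<noteq> 0 \<and> proj u \<in> U}"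

instantiation projspace :: (finite) topological_space
begin

definition open_projspace :: "'a projspace set \<Rightarrow> bool" where
  "open_projspace U \<longleftrightarrow> open (cone U)"

instance
proof
  have "cone (UNIV :: 'a projspace set) = - {0}"
    by (auto simp: cone_def)
  then show "open (UNIV :: 'a projspace set)"
    by (simp add: open_projspace_def open_Compl)
next
  fix S T :: "'a projspace set"
  assume "open S" "open T"
  moreover have "cone (S \<inter> T) = cone S \<inter> cone T"
    by (auto simp: cone_def)
  ultimately show "open (S \<inter> T)"
    by (simp add: open_projspace_def open_Int)
next
  fix K :: "'a projspace set set"
  assume "\<forall>S\<in>K. open S"
  moreover have "cone (\<Union>K) = (\<Union>S\<in>K. cone S)"
    by (auto simp: cone_def)
  ultimately show "open (\<Union>K)"
    by (simp add: open_projspace_def open_UN)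
qed

end

text \<open>The smooth structure is the quotient one: \<^term>\<open>proj\<close> is a submersion on the nonzero vectors,
  so a function on an open set is smooth iff its pullback to the cone is.\<close>

definition smooth_fun :: "'k::finite projspace set \<Rightarrow> ('k projspace \<Rightarrow> 'b::real_normed_vector) \<Rightarrow> bool" where
  "smooth_fun U f \<longleftrightarrow> smooth_on (cone U) (\<lambda>u. f (proj u))"

definition smooth_at :: "'k::finite projspace \<Rightarrow> ('k projspace \<Rightarrow> real) \<Rightarrow> bool" where
  "smooth_at p f \<longleftrightarrow> (\<exists>V. open V \<and> p \<in> V \<and> smooth_fun V f)"

definition smooth_map :: "'k::finite projspace set \<Rightarrow> ('k projspace \<Rightarrow> 'k projspace) \<Rightarrow> bool" where
  "smooth_map D \<phi> \<longleftrightarrow> continuous_on D \<phi> \<and>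
     (\<forall>W (f :: 'k projspace \<Rightarrow> real). open W \<and> smooth_fun W f \<longrightarrow>
        smooth_fun (D \<inter> \<phi> -` W) (\<lambda>p. f (\<phi> p)))"

definition smooth_curve :: "real set \<Rightarrow> (real \<Rightarrow> 'k::finite projspace) \<Rightarrow> bool" where
  "smooth_curve I \<gamma> \<longleftrightarrow> continuous_on I \<gamma> \<and>
     (\<forall>W (f :: 'k projspace \<Rightarrow> real). open W \<and> smooth_fun W f \<longrightarrow>
        smooth_on (I \<inter> \<gamma> -` W) (\<lambda>t. f (\<gamma> t)))"


subsection \<open>Tangent vectors, vector fields and one-forms\<close>

text \<open>A tangent vector acts as a derivation on the functions smooth near its base point; on all
  other functions it takes the value 0, so that tangent vectors are equal iff they agree on
  smooth functions. The tangent space at \<^term>\<open>proj u\<close> is the image of the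
  differential of \<^term>\<open>proj\<close> at \<^term>\<open>u\<close>.\<close>

type_synonym 'k tvec = "('k projspace \<Rightarrow> real) \<Rightarrow> real"
type_synonym 'k vfield = "'k projspace \<Rightarrow> 'k tvec"
type_synonym 'k oneform = "'k projspace \<Rightarrow> 'k tvec \<Rightarrow> real"

definition dproj :: "real ^ 'k \<Rightarrow> real ^ 'k \<Rightarrow> 'k::finite tvec" where
  "dproj u w = (\<lambda>f. if smooth_at (proj u) f
                     then frechet_derivative (\<lambda>z. f (proj z)) (at u) w else 0)"

definition tangent :: "'k::finite projspace \<Rightarrow> 'k tvec set" where
  "tangent p = {dproj u w | u w. u \<noteq> 0 \<and> proj u = p}"

definition pushforward ::
    "('k projspace \<Rightarrow> 'k projspace) \<Rightarrow> 'k projspace \<Rightarrow> 'k tvec \<Rightarrow> 'k::finite tvec" where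
  "pushforward \<phi> p v = (\<lambda>f. if smooth_at (\<phi> p) f then v (\<lambda>q. f (\<phi> q)) else 0)"

definition velocity :: "(real \<Rightarrow> 'k projspace) \<Rightarrow> real \<Rightarrow> 'k::finite tvec" where
  "velocity \<gamma> t = (\<lambda>f. if smooth_at (\<gamma> t) f then deriv (\<lambda>s. f (\<gamma> s)) t else 0)"

definition vector_field :: "'k::finite projspace set \<Rightarrow> 'k vfield \<Rightarrow> bool" where
  "vector_field V X \<longleftrightarrow> (\<forall>p\<in>V. X p \<in> tangent p) \<and>
     (\<forall>W (f :: 'k projspace \<Rightarrow> real). open W \<and> W \<subseteq> V \<and> smooth_fun W f \<longrightarrow>
        smooth_fun W (\<lambda>p. X p f))"

definition bracket :: "'k vfield \<Rightarrow> 'k vfield \<Rightarrow> 'k::finite vfield" where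
  "bracket X Y p = (\<lambda>f. if smooth_at p f
                         then X p (\<lambda>q. Y q f) - Y p (\<lambda>q. X q f) else 0)"

definition one_form :: "'k::finite projspace set \<Rightarrow> 'k oneform \<Rightarrow> bool" where
  "one_form V \<theta> \<longleftrightarrow>
     (\<forall>p\<in>V. \<forall>v\<in>tangent p. \<forall>w\<in>tangent p. \<forall>a b.
        \<theta> p (\<lambda>f. a * v f + b * w f) = a * \<theta> p v + b * \<theta> p w) \<and>
     (\<forall>W X. open W \<and> W \<subseteq> V \<and> vector_field W X \<longrightarrow> smooth_fun W (\<lambda>p. \<theta> p (X p)))"

definition ext_deriv ::
    "'k oneform \<Rightarrow> 'k vfield \<Rightarrow> 'k vfield \<Rightarrow> 'k::finite projspace \<Rightarrow> real" where
  "ext_deriv \<theta> X Y p =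
     X p (\<lambda>q. \<theta> q (Y q)) - Y p (\<lambda>q. \<theta> q (X q)) - \<theta> p (bracket X Y p)"


subsection \<open>Affine connections\<close>

text \<open>\<open>nabla p v Y\<close> is the covariant derivative at \<open>p\<close>, in the direction \<open>v\<close> tangent at \<open>p\<close>, of a
  vector field \<open>Y\<close> defined on some neighbourhood of \<open>p\<close>.\<close>

type_synonym 'k conn = "'k projspace \<Rightarrow> 'k tvec \<Rightarrow> 'k vfield \<Rightarrow> 'k tvec"

definition cov :: "'k::finite conn \<Rightarrow> 'k vfield \<Rightarrow> 'k vfield \<Rightarrow> 'k vfield" where
  "cov nabla X Y = (\<lambda>p. nabla p (X p) Y)"

definition affine_connection :: "'k::finite projspace set \<Rightarrow> 'k conn \<Rightarrow> bool" where
  "affine_connection V nabla \<longleftrightarrow>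
     (\<forall>W. open W \<and> W \<subseteq> V \<longrightarrow>
        (\<forall>Y. vector_field W Y \<longrightarrow>
           (\<forall>p\<in>W. \<forall>v\<in>tangent p.
              nabla p v Y \<in> tangent p \<and>
              (\<forall>w\<in>tangent p. \<forall>a b.
                 nabla p (\<lambda>f. a * v f + b * w f) Y = (\<lambda>f. a * nabla p v Y f + b * nabla p w Y f)) \<and>
              (\<forall>Z. vector_field W Z \<longrightarrow>
                 nabla p v (\<lambda>q f. Y q f + Z q f) = (\<lambda>f. nabla p v Y f + nabla p v Z f)) \<and>
              (\<forall>h. smooth_fun W h \<longrightarrow>
                 nabla p v (\<lambda>q f. h q * Y q f) = (\<lambda>f. v h * Y p f + h p * nabla p v Y f)) \<and>
              (\<forall>Z. vector_field W Z \<and> (\<forall>q\<in>W. Z q = Y q) \<longrightarrow> nabla p v Z = nabla p v Y)) \<and>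
           (\<forall>X. vector_field W X \<longrightarrow> vector_field W (cov nabla X Y))))"

definition torsion :: "'k conn \<Rightarrow> 'k vfield \<Rightarrow> 'k vfield \<Rightarrow> 'k::finite vfield" where
  "torsion nabla X Y p = (\<lambda>f. cov nabla X Y p f - cov nabla Y X p f - bracket X Y p f)"

definition immersed_path :: "real set \<Rightarrow> (real \<Rightarrow> 'k::finite projspace) \<Rightarrow> bool" where
  "immersed_path I \<gamma> \<longleftrightarrow>
     open I \<and> connected I \<and> smooth_curve I \<gamma> \<and> (\<forall>t\<in>I. velocity \<gamma> t \<noteq> (\<lambda>f. 0))"

text \<open>The path is a geodesic up to parametrization: its acceleration is tangent to it. The
  acceleration is computed from any local vector field extending the velocity; such extensions
  exist because the path is immersed.\<close>

definition unparam_geodesic ::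
    "'k::finite projspace set \<Rightarrow> 'k conn \<Rightarrow> real set \<Rightarrow> (real \<Rightarrow> 'k projspace) \<Rightarrow> bool" where
  "unparam_geodesic V nabla I \<gamma> \<longleftrightarrow> immersed_path I \<gamma> \<and> \<gamma> ` I \<subseteq> V \<and>
     (\<forall>t\<in>I. \<forall>W X J. open W \<and> W \<subseteq> V \<and> vector_field W X \<and> open J \<and> t \<in> J \<and> J \<subseteq> I \<and>
        (\<forall>s\<in>J. \<gamma> s \<in> W \<and> X (\<gamma> s) = velocity \<gamma> s) \<longrightarrow>
        (\<exists>c. nabla (\<gamma> t) (velocity \<gamma> t) X = (\<lambda>f. c * velocity \<gamma> t f)))"


subsection \<open>The symplectic vector space and the contact structure\<close>

text \<open>The type \<open>'m\<close> indexes the Latin indices, so it has \<open>2n - 2\<close> elements. Greek indices are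
  \<open>'m option\<close>, with \<^term>\<open>None\<close> for the index 0. The coordinates of \<open>\<real>\<^sup>2\<^sup>n\<close> are indexed by
  \<open>'m option option\<close>: \<^term>\<open>None\<close> is the index \<open>\<infinity>\<close> and \<^term>\<open>Some \<alpha>\<close> is the Greek index \<open>\<alpha>\<close>.\<close>

type_synonym 'm ix = "'m option option"

definition Omega :: "real ^ 'm ^ 'm \<Rightarrow> real ^ 'm ix \<Rightarrow> real ^ ('m::finite) ix \<Rightarrow> real" where
  "Omega \<omega> u v = u $ None * v $ Some None - u $ Some None * v $ None
     + (\<Sum>p\<in>UNIV. \<Sum>q\<in>UNIV. \<omega> $ p $ q * u $ Some (Some p) * v $ Some (Some q))"

definition Sp :: "real ^ 'm ^ 'm \<Rightarrow> (real ^ 'm ix ^ ('m::finite) ix) set" where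
  "Sp \<omega> = {A. invertible A \<and> (\<forall>u v. Omega \<omega> (A *v u) (A *v v) = Omega \<omega> u v)}"

definition proj_action :: "real ^ 'k ^ 'k \<Rightarrow> 'k projspace \<Rightarrow> 'k::finite projspace" where
  "proj_action A p = Line ((*v) A ` line_of p)"

text \<open>The contact hyperplane at \<^term>\<open>proj u\<close> is the image of the \<^term>\<open>Omega \<omega>\<close>-orthogonal
  complement of \<^term>\<open>u\<close>. Along the section \<open>x \<mapsto> (1, x)\<close> of the affine chart,
  \<open>1/2 \<Omega>(u, du)\<close> is \<open>1/2 (dx\<^sup>0 + \<omega>\<^sub>p\<^sub>q x\<^sup>p dx\<^sup>q)\<close>.\<close>

definition contact_plane :: "real ^ 'm ^ 'm \<Rightarrow> ('m::finite) ix projspace \<Rightarrow> 'm ix tvec set" where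
  "contact_plane \<omega> p = {dproj u w | u w. u \<noteq> 0 \<and> proj u = p \<and> Omega \<omega> u w = 0}"

definition affine_chart :: "('m::finite) ix projspace set" where
  "affine_chart = {proj u | u. u $ None \<noteq> 0}"

definition affine_coord :: "'m option \<Rightarrow> ('m::finite) ix projspace \<Rightarrow> real" where
  "affine_coord \<alpha> p = (let u = (SOME u. u \<noteq> 0 \<and> proj u = p) in u $ Some \<alpha> / u $ None)"

definition contactomorphism ::
    "real ^ 'm ^ 'm \<Rightarrow> ('m::finite) ix projspace set \<Rightarrow> 'm ix projspace set \<Rightarrow>
     ('m ix projspace \<Rightarrow> 'm ix projspace) \<Rightarrow> bool" where
  "contactomorphism \<omega> D D' \<phi> \<longleftrightarrow> open D \<and> open D' \<and> bij_betw \<phi> D D' \<and>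
     smooth_map D \<phi> \<and> smooth_map D' (inv_into D \<phi>) \<and>
     (\<forall>p\<in>D. pushforward \<phi> p ` contact_plane \<omega> p = contact_plane \<omega> (\<phi> p))"

text \<open>The sign of \<open>\<Omega>(u, w)\<close> depends only on the tangent vector \<^term>\<open>dproj u w\<close>, since replacing
  \<^term>\<open>u\<close> by \<open>r u\<close> multiplies it by \<open>r\<^sup>2\<close>; it distinguishes the two sides of the contact
  hyperplane. Contactomorphisms may exchange the sides; elements of \<^term>\<open>Sp \<omega>\<close> do not.\<close>

definition preserves_coorientation ::
    "real ^ 'm ^ 'm \<Rightarrow> ('m::finite) ix projspace set \<Rightarrow>
     ('m ix projspace \<Rightarrow> 'm ix projspace) \<Rightarrow> bool" where
  "preserves_coorientation \<omega> U \<phi> \<longleftrightarrow>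
     (\<forall>u w u' w'. u \<noteq> 0 \<and> u' \<noteq> 0 \<and> proj u \<in> U \<and> proj u' = \<phi> (proj u) \<and>
        pushforward \<phi> (proj u) (dproj u w) = dproj u' w' \<and> Omega \<omega> u w > 0 \<longrightarrow>
        Omega \<omega> u' w' > 0)"


subsection \<open>Contact one-forms and adapted coframes\<close>

definition contact_form ::
    "real ^ 'm ^ 'm \<Rightarrow> ('m::finite) ix projspace set \<Rightarrow> 'm ix oneform \<Rightarrow> bool" where
  "contact_form \<omega> V \<theta> \<longleftrightarrow> one_form V \<theta> \<and>
     (\<forall>p\<in>V. {v \<in> tangent p. \<theta> p v = 0} = contact_plane \<omega> p)"

definition reeb_field :: "'k::finite projspace set \<Rightarrow> 'k oneform \<Rightarrow> 'k vfield \<Rightarrow> bool" where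
  "reeb_field V \<theta> T \<longleftrightarrow> vector_field V T \<and> (\<forall>p\<in>V. \<theta> p (T p) = 1) \<and>
     (\<forall>W X. open W \<and> W \<subseteq> V \<and> vector_field W X \<longrightarrow> (\<forall>p\<in>W. ext_deriv \<theta> T X p = 0))"

text \<open>\<^term>\<open>th\<close> is a \<^term>\<open>\<theta>\<close>-adapted coframe on \<^term>\<open>V\<close> with dual frame \<^term>\<open>E\<close>. Since
  \<open>'m option\<close> has as many elements as the dimension of projective space, duality makes both bases.\<close>

definition adapted_coframe ::
    "('m::finite) ix projspace set \<Rightarrow> 'm ix oneform \<Rightarrow>
     ('m option \<Rightarrow> 'm ix oneform) \<Rightarrow> ('m option \<Rightarrow> 'm ix vfield) \<Rightarrow> bool" where
  "adapted_coframe V \<theta> th E \<longleftrightarrow>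
     (\<forall>\<alpha>. one_form V (th \<alpha>)) \<and> (\<forall>\<alpha>. vector_field V (E \<alpha>)) \<and>
     (\<forall>p\<in>V. \<forall>\<alpha> \<beta>. th \<alpha> p (E \<beta> p) = (if \<alpha> = \<beta> then 1 else 0)) \<and>
     (\<forall>p\<in>V. \<forall>v\<in>tangent p. th None p v = \<theta> p v) \<and>
     (\<exists>T. reeb_field V \<theta> T \<and> (\<forall>p\<in>V. \<forall>i. th (Some i) p (T p) = 0))"


subsection \<open>Contact projective structures and their representatives\<close>

text \<open>A contact projective structure enters through the predicate \<open>\<G>\<close> singling out the immersed
  paths that parametrize pieces of its contact geodesics.\<close>

type_synonym 'k paths = "real set \<Rightarrow> (real \<Rightarrow> 'k projspace) \<Rightarrow> bool"

definition flat_contact_geodesic :: "real ^ 'm ^ 'm \<Rightarrow> ('m::finite) ix paths" where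
  "flat_contact_geodesic \<omega> I \<gamma> \<longleftrightarrow> immersed_path I \<gamma> \<and>
     (\<exists>L. subspace L \<and> dim L = 2 \<and> (\<forall>u\<in>L. \<forall>v\<in>L. Omega \<omega> u v = 0) \<and>
        (\<forall>t\<in>I. line_of (\<gamma> t) \<subseteq> L))"

definition pullback_contact_geodesic ::
    "real ^ 'm ^ 'm \<Rightarrow> ('m::finite) ix projspace set \<Rightarrow>
     ('m ix projspace \<Rightarrow> 'm ix projspace) \<Rightarrow> 'm ix paths" where
  "pullback_contact_geodesic \<omega> D \<phi> I \<gamma> \<longleftrightarrow> immersed_path I \<gamma> \<and> \<gamma> ` I \<subseteq> D \<and>
     (\<forall>t\<in>I. velocity \<gamma> t \<in> contact_plane \<omega> (\<gamma> t)) \<and>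
     flat_contact_geodesic \<omega> I (\<lambda>t. \<phi> (\<gamma> t))"

definition representative ::
    "('m::finite) ix projspace set \<Rightarrow> 'm ix paths \<Rightarrow> 'm ix oneform \<Rightarrow> 'm ix conn \<Rightarrow> bool" where
  "representative V \<G> \<theta> nabla \<longleftrightarrow> affine_connection V nabla \<and>
     (\<forall>I \<gamma>. \<G> I \<gamma> \<and> \<gamma> ` I \<subseteq> V \<longrightarrow> unparam_geodesic V nabla I \<gamma>) \<and>
     (\<forall>W X Y. open W \<and> W \<subseteq> V \<and> vector_field W X \<and> vector_field W Y \<longrightarrow>
        (\<forall>p\<in>W. X p (\<lambda>q. \<theta> q (Y q)) - \<theta> p (cov nabla X Y p) = 0)) \<and>
     (\<forall>W X Y Z. open W \<and> W \<subseteq> V \<and> vector_field W X \<and> vector_field W Y \<and> vector_field W Z \<longrightarrow>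
        (\<forall>p\<in>W. X p (ext_deriv \<theta> Y Z) - ext_deriv \<theta> (cov nabla X Y) Z p
                  - ext_deriv \<theta> Y (cov nabla X Z) p = 0)) \<and>
     (\<forall>W th E. open W \<and> W \<subseteq> V \<and> adapted_coframe W \<theta> th E \<longrightarrow>
        (\<forall>p\<in>W. \<forall>i.
           (\<forall>\<alpha>. th \<alpha> p (torsion nabla (E None) (E (Some i)) p) = 0 \<and>
                 th \<alpha> p (torsion nabla (E (Some i)) (E None) p) = 0) \<and>
           (\<Sum>k\<in>UNIV. th (Some k) p (torsion nabla (E (Some i)) (E (Some k)) p)) = 0 \<and>
           (\<Sum>k\<in>UNIV. th (Some k) p (torsion nabla (E (Some k)) (E (Some i)) p)) = 0))"

text \<open>The description below has exactly one solution at every point \<^term>\<open>p\<close> of \<^term>\<open>D\<close>, for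
  \<^term>\<open>v\<close> and \<^term>\<open>w\<close> in the contact hyperplane: representatives exist locally and are unique,
  and the difference is tensorial and independent of \<open>\<theta>\<close>.\<close>

definition difference_tensor ::
    "real ^ 'm ^ 'm \<Rightarrow> ('m::finite) ix projspace set \<Rightarrow> 'm ix paths \<Rightarrow> 'm ix paths \<Rightarrow>
     'm ix projspace \<Rightarrow> 'm ix tvec \<Rightarrow> 'm ix tvec \<Rightarrow> 'm ix tvec" where
  "difference_tensor \<omega> D \<G>' \<G> p v w =
     (THE z. \<exists>V \<theta> nabla' nabla X Y. open V \<and> p \<in> V \<and> V \<subseteq> D \<and> contact_form \<omega> V \<theta> \<and>
        representative V \<G>' \<theta> nabla' \<and> representative V \<G> \<theta> nabla \<and>
        vector_field V X \<and> vector_field V Y \<and>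
        (\<forall>q\<in>V. X q \<in> contact_plane \<omega> q \<and> Y q \<in> contact_plane \<omega> q) \<and>
        X p = v \<and> Y p = w \<and>
        z = (\<lambda>f. cov nabla' X Y p f - cov nabla X Y p f))"

definition contact_schwarzian ::
    "real ^ 'm ^ 'm \<Rightarrow> ('m::finite) ix projspace set \<Rightarrow>
     ('m ix projspace \<Rightarrow> 'm ix projspace) \<Rightarrow>
     'm ix projspace \<Rightarrow> 'm ix tvec \<Rightarrow> 'm ix tvec \<Rightarrow> 'm ix tvec" where
  "contact_schwarzian \<omega> D \<phi> =
     difference_tensor \<omega> D (pullback_contact_geodesic \<omega> D \<phi>) (flat_contact_geodesic \<omega>)"


subsection \<open>Sections of the line bundle of weight one\<close>

text \<open>A section over \<^term>\<open>W\<close> is given by its homogeneity one function on the cone.\<close>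

definition E1_section :: "'k::finite projspace set \<Rightarrow> (real ^ 'k \<Rightarrow> real) \<Rightarrow> bool" where
  "E1_section W F \<longleftrightarrow> smooth_on (cone W) F \<and>
     (\<forall>u\<in>cone W. \<forall>r. r \<noteq> 0 \<longrightarrow> F (r *\<^sub>R u) = r * F u)"

definition E1_independent ::
    "'k::finite projspace set \<Rightarrow> ('i::finite \<Rightarrow> real ^ 'k \<Rightarrow> real) \<Rightarrow> bool" where
  "E1_independent W F \<longleftrightarrow>
     (\<forall>u\<in>cone W. \<forall>c :: 'i \<Rightarrow> real.
        (\<forall>w. (\<Sum>a\<in>UNIV. c a * frechet_derivative (F a) (at u) w) = 0) \<longrightarrow> (\<forall>a. c a = 0))"

text \<open>\<^term>\<open>\<sigma>\<close> is a square root of \<open>\<theta>\<close>: a local section of the cone over \<^term>\<open>W\<close> that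
  pulls \<open>1/2 \<Omega>(u, du)\<close> back to \<open>\<theta>\<close>, or to \<open>-\<theta>\<close> where \<open>\<theta>\<close> is negative for the coorientation.
  It is unique up to sign on connected \<^term>\<open>W\<close>. The section with homogeneous function
  \<^term>\<open>F\<close> is represented by \<open>p \<mapsto> F (\<sigma> p)\<close>; replacing \<open>\<theta>\<close> by \<open>h\<^sup>2 \<theta>\<close> replaces \<open>\<sigma>\<close> by \<open>h \<sigma>\<close>
  and thus multiplies this function by \<open>h\<close>.\<close>

definition form_root ::
    "real ^ 'm ^ 'm \<Rightarrow> ('m::finite) ix projspace set \<Rightarrow> 'm ix oneform \<Rightarrow>
     ('m ix projspace \<Rightarrow> real ^ 'm ix) \<Rightarrow> bool" where
  "form_root \<omega> W \<theta> \<sigma> \<longleftrightarrow> smooth_fun W \<sigma> \<and> (\<forall>p\<in>W. \<sigma> p \<noteq> 0 \<and> proj (\<sigma> p) = p) \<and>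
     (\<exists>s\<in>{1, -1}. \<forall>p\<in>W. \<forall>v\<in>tangent p.
        \<theta> p v = s * (1 / 2) * Omega \<omega> (\<sigma> p) (\<chi> a. v (\<lambda>q. \<sigma> q $ a)))"

end

(* A contactomorphism phi lifts locally, uniquely up to sign, to a homogeneity one map Phi of the
   symplectic vector space with D Phi symplectic up to sign, and a contact form theta is a local
   section sigma of the cone. In these terms the representative of the pulled back structure differs
   from that of the flat one, on contact vectors, by B = (D Phi)^-1 (D^2 Phi), so B represents S(phi);
   the identification rests on the uniqueness of representatives.

   (1') If S(phi) = 0, the cubic form Omega(B(a,b),c) vanishes for a, b, c in the Omega-complement of
   the base point u. Differentiating in u and using the symmetry of D^3 Phi, the arguments are freed
   one after the other, so D^2 Phi = 0 and Phi is locally linear; two elements of the projective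
   symplectic group that agree on an open set are equal, so the linear map is locally constant.

   (3') In a parallel coframe the second frame derivatives of f = Phi o sigma are expressed by the
   first ones, by f, and by its Reeb derivative. The coefficients of the first derivatives are those
   of S(phi); the commutator of two frame derivatives, applied to a first derivative of f and traced,
   determines the coefficient of f. *)
theory Submission
  imports Defs
begin

subsection \<open>Calculus of smooth maps\<close>

text \<open>The Schwarzian is a definite description over pairs of representatives, so evaluating it
  takes an explicit representative \<open>Nb\<close> and a uniqueness proof. Uniqueness is shown on
  contact directions only, which is all that the description sees; it rests on an actual geodesic in
  every contact direction together with a local field extending its velocity
  (\<open>geodesic_exists\<close>). The flat structure is treated as the pullback by the identity,
  where \<open>B\<close> vanishes, so one construction serves both representatives. Two signs run
  through the proof: \<open>s\<close> relates \<theta> to its root \<sigma>, and \<epsilon> relates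
  \<Omega> to its pullback by the lift. A lift with \<open>\<epsilon> = -1\<close> serves the PDE
  equally well, but its derivative is not in \<open>Sp\<close>; this is where (1') uses the
  coorientation. The constant 1/n comes from a trace: the zeroth order coefficient
  \<open>lam\<close> enters the traced commutator with total weight (2n-2)+2 = 2n, and symmetrizing
  the second derivatives doubles it. The same identity applied to \<sigma> itself, with vanishing
  first order coefficients, shows that the second derivatives of \<sigma> in a parallel frame have
  no \<sigma> component.\<close>

abbreviation fd :: "('a::real_normed_vector \<Rightarrow> 'b::real_normed_vector) \<Rightarrow> 'a \<Rightarrow> 'a \<Rightarrow> 'b" where
  "fd f x \<equiv> frechet_derivative f (at x)"

lemma fd_eq: "(f has_derivative f') (at x) \<Longrightarrow> fd f x = f'"
  using frechet_derivative_at by metis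

lemma fd_works: "f differentiable (at x) \<Longrightarrow> (f has_derivative fd f x) (at x)"
  using frechet_derivative_works by blast

lemma has_derivative_open_cong:
  assumes "open S" "x \<in> S" "\<And>y. y \<in> S \<Longrightarrow> f y = g y"
  shows "(f has_derivative F) (at x) \<longleftrightarrow> (g has_derivative F) (at x)"
  using assms by (metis has_derivative_transform_within_open)

lemma fd_open_cong:
  assumes "open S" "x \<in> S" "\<And>y. y \<in> S \<Longrightarrow> f y = g y"
  shows "fd f x = fd g x"
  unfolding frechet_derivative_def using has_derivative_open_cong[OF assms] by presburger

lemma Ck_on_cong:
  assumes "open S" "\<And>x. x \<in> S \<Longrightarrow> f x = g x" "Ck_on k S f"
  shows "Ck_on k S g"
  using assms(2,3)
proof (induction k arbitrary: f g)
  case 0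
  then show ?case using continuous_on_cong[of S S f g] by simp
next
  case (Suc k)
  have d: "(f has_derivative fd f x) (at x)" if "x \<in> S" for x
    using Suc.prems(2) that assms(1) fd_works[of f x] differentiable_on_eq_differentiable_at[of S f] by simp
  have g: "(g has_derivative fd f x) (at x)" if "x \<in> S" for x
    using has_derivative_transform_within_open[OF d[OF that] assms(1) that] Suc.prems(1) by blast
  have "g differentiable_on S"
    using g by (meson differentiableI differentiable_at_withinI differentiable_on_def)
  moreover have "Ck_on k S (\<lambda>x. fd g x v)" for v
  proof (rule Suc.IH)
    show "fd f x v = fd g x v" if "x \<in> S" for x
      using fd_eq[OF g[OF that]] by simp
    show "Ck_on k S (\<lambda>x. fd f x v)"
      using Suc.prems(2) by simp
  qed
  ultimately show ?case by simp
qed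

text \<open>Lets a derivative found by hand stand in for \<open>frechet_derivative\<close>, which is
  a choice operator; on an open set the two agree.\<close>

lemma Ck_on_Suc_intro:
  assumes "open S" "\<And>x. x \<in> S \<Longrightarrow> (f has_derivative f' x) (at x)" "\<And>v. Ck_on k S (\<lambda>x. f' x v)"
  shows "Ck_on (Suc k) S f"
proof -
  have "fd f x = f' x" if "x \<in> S" for x
    using assms(2) fd_eq that by blast
  then have "Ck_on k S (\<lambda>x. fd f x v)" for v
    using Ck_on_cong[OF assms(1) _ assms(3)[of v], of "\<lambda>x. fd f x v"] by simp
  moreover have "f differentiable_on S"
    using assms(2) by (meson differentiableI differentiable_at_withinI differentiable_on_def)
  ultimately show ?thesis by simp
qed

lemma Ck_on_has_derivative:
  assumes "Ck_on (Suc k) S f" "open S" "x \<in> S"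
  shows "(f has_derivative fd f x) (at x)"
  using assms fd_works[of f x] differentiable_on_eq_differentiable_at[of S f] by simp

lemma Ck_on_imp_continuous_on: "open S \<Longrightarrow> Ck_on k S f \<Longrightarrow> continuous_on S f"
  by (cases k) (auto intro: differentiable_imp_continuous_on)

lemma Ck_on_Suc_imp: "open S \<Longrightarrow> Ck_on (Suc k) S f \<Longrightarrow> Ck_on k S f"
proof (induction k arbitrary: f)
  case 0
  then show ?case using Ck_on_imp_continuous_on[of S "Suc 0" f] by simp
next
  case (Suc k)
  show ?case
    by (rule Ck_on_Suc_intro[OF Suc.prems(1), where f' = "fd f"])
      (use Suc Ck_on_has_derivative[OF Suc.prems(2)] in \<open>auto simp del: Ck_on.simps simp: Ck_on.simps(2)[of "Suc k"]\<close>)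
qed

lemma Ck_on_subset:
  assumes "open S" "open T" "T \<subseteq> S" "Ck_on k S f" shows "Ck_on k T f"
  using assms(4)
proof (induction k arbitrary: f)
  case 0
  then show ?case using assms by (auto intro: continuous_on_subset)
next
  case (Suc k)
  then show ?case using assms
    by (auto intro: differentiable_on_subset)
qed

lemma Ck_on_local:
  assumes "open S" "\<And>x. x \<in> S \<Longrightarrow> \<exists>T. open T \<and> x \<in> T \<and> Ck_on k T f"
  shows "Ck_on k S f"
  using assms(2)
proof (induction k arbitrary: f)
  case 0
  then show ?case
    using assms(1) by (metis Ck_on.simps(1) continuous_on_eq_continuous_at)
next
  case (Suc k)
  show ?case
  proof (rule Ck_on_Suc_intro[OF assms(1), where f' = "fd f"])
    show "(f has_derivative fd f x) (at x)" if "x \<in> S" for x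
      using Suc.prems[OF that] Ck_on_has_derivative by blast
    show "Ck_on k S (\<lambda>x. fd f x v)" for v
      by (rule Suc.IH) (use Suc.prems in \<open>metis Ck_on.simps(2)\<close>)
  qed
qed

lemma Ck_on_const: "open S \<Longrightarrow> Ck_on k S (\<lambda>x. c)"
proof (induction k arbitrary: c)
  case (Suc k)
  show ?case
    by (rule Ck_on_Suc_intro[where f' = "\<lambda>_ _. 0"]) (use Suc in auto)
qed simp

lemma Ck_on_bounded_linear_comp:
  assumes "bounded_linear L" "open S" "Ck_on k S f"
  shows "Ck_on k S (\<lambda>x. L (f x))"
  using assms(3)
proof (induction k arbitrary: f)
  case 0
  then show ?case
    by (simp add: assms(1) bounded_linear.continuous_on)
next
  case (Suc k)
  show ?case
  proof (rule Ck_on_Suc_intro[OF assms(2), where f' = "\<lambda>x v. L (fd f x v)"])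
    show "((\<lambda>x. L (f x)) has_derivative (\<lambda>v. L (fd f x v))) (at x)" if "x \<in> S" for x
      using bounded_linear.has_derivative[OF assms(1) Ck_on_has_derivative[OF Suc.prems assms(2) that]] .
    show "Ck_on k S (\<lambda>x. L (fd f x v))" for v
      using Suc.prems by (intro Suc.IH) simp
  qed
qed

lemma Ck_on_ident: "open S \<Longrightarrow> Ck_on k S (\<lambda>x. x)"
proof (cases k)
  case (Suc l)
  assume o: "open S"
  show ?thesis
    unfolding Suc
    by (rule Ck_on_Suc_intro[OF o, where f' = "\<lambda>_ v. v", OF has_derivative_ident Ck_on_const[OF o]])
qed (simp add: continuous_on_id)

lemma Ck_on_add:
  assumes "open S" "Ck_on k S f" "Ck_on k S g" shows "Ck_on k S (\<lambda>x. f x + g x)"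
  using assms(2,3)
proof (induction k arbitrary: f g)
  case (Suc k)
  show ?case
  proof (rule Ck_on_Suc_intro[OF assms(1), where f' = "\<lambda>x v. fd f x v + fd g x v"])
    show "((\<lambda>x. f x + g x) has_derivative (\<lambda>v. fd f x v + fd g x v)) (at x)" if "x \<in> S" for x
      by (intro has_derivative_add Ck_on_has_derivative[OF Suc.prems(1) assms(1) that]
        Ck_on_has_derivative[OF Suc.prems(2) assms(1) that])
    show "Ck_on k S (\<lambda>x. fd f x v + fd g x v)" for v
      using Suc.IH[of "\<lambda>x. fd f x v" "\<lambda>x. fd g x v"] Suc.prems by simp
  qed
next
  case 0
  then show ?case
    using continuous_on_add[of S f g] by simp
qed

lemma Ck_on_sum:
  assumes "open S" "\<And>i. i \<in> I \<Longrightarrow> Ck_on k S (f i)" shows "Ck_on k S (\<lambda>x. \<Sum>i\<in>I. f i x)"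
  using assms(2)
proof (induction I rule: infinite_finite_induct)
  case (insert i I)
  then show ?case
    using Ck_on_add[OF assms(1), of k "f i" "\<lambda>x. \<Sum>i\<in>I. f i x"] by simp
qed (use Ck_on_const[OF assms(1)] in simp_all)

lemma Ck_on_bilinear:
  assumes "bounded_bilinear B" "open S" "Ck_on k S f" "Ck_on k S g"
  shows "Ck_on k S (\<lambda>x. B (f x) (g x))"
  using assms(3,4)
proof (induction k arbitrary: f g)
  case 0
  then show ?case
    using bounded_bilinear.continuous_on[OF assms(1), of S f g] by simp
next
  case (Suc k)
  show ?case
  proof (rule Ck_on_Suc_intro[OF assms(2), where f' = "\<lambda>x v. B (f x) (fd g x v) + B (fd f x v) (g x)"])
    show "((\<lambda>x. B (f x) (g x)) has_derivative (\<lambda>v. B (f x) (fd g x v) + B (fd f x v) (g x))) (at x)"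
      if "x \<in> S" for x
      using bounded_bilinear.FDERIV[OF assms(1) Ck_on_has_derivative[OF Suc.prems(1) assms(2) that]
        Ck_on_has_derivative[OF Suc.prems(2) assms(2) that]] .
    show "Ck_on k S (\<lambda>x. B (f x) (fd g x v) + B (fd f x v) (g x))" for v
      using Suc.prems Ck_on_Suc_imp[OF assms(2) Suc.prems(1)] Ck_on_Suc_imp[OF assms(2) Suc.prems(2)]
      by (intro Ck_on_add[OF assms(2)] Suc.IH) simp_all
  qed
qed

lemma linear_Basis_expansion:
  fixes L :: "'a::euclidean_space \<Rightarrow> 'b::real_vector"
  assumes "linear L" shows "L w = (\<Sum>b\<in>Basis. (w \<bullet> b) *\<^sub>R L b)"
proof -
  have "L w = L (\<Sum>b\<in>Basis. (w \<bullet> b) *\<^sub>R b)"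
    by (simp add: euclidean_representation)
  also have "\<dots> = (\<Sum>b\<in>Basis. (w \<bullet> b) *\<^sub>R L b)"
    by (simp add: linear_sum[OF assms] linear_cmul[OF assms])
  finally show ?thesis .
qed

text \<open>\<open>Ck_on\<close> controls derivatives in a fixed direction only, whereas the chain
  rule feeds the moving vector \<open>fd f x v\<close> to the derivative of \<open>g\<close>.
  Expanding that vector in an orthonormal basis leaves fixed directions with coefficients of class
  \<open>k\<close>; hence the Euclidean middle space.\<close>

lemma Ck_on_compose:
  fixes f :: "'a::real_normed_vector \<Rightarrow> 'b::euclidean_space"
  assumes "open S" "open T" "\<And>x. x \<in> S \<Longrightarrow> f x \<in> T" "Ck_on k T g" "Ck_on k S f"
  shows "Ck_on k S (\<lambda>x. g (f x))"
  using assms(4,5)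
proof (induction k arbitrary: g)
  case 0
  then show ?case
    using assms(3) by (auto intro: continuous_on_compose2)
next
  case (Suc k)
  have l: "linear (fd g (f x))" if "x \<in> S" for x
    using Ck_on_has_derivative[OF Suc.prems(1) assms(2)] assms(3)[OF that] has_derivative_linear by blast
  show ?case
  proof (rule Ck_on_Suc_intro[OF assms(1), where f' = "\<lambda>x v. \<Sum>b\<in>Basis. (fd f x v \<bullet> b) *\<^sub>R fd g (f x) b"])
    show "((\<lambda>x. g (f x)) has_derivative (\<lambda>v. \<Sum>b\<in>Basis. (fd f x v \<bullet> b) *\<^sub>R fd g (f x) b)) (at x)"
      if "x \<in> S" for x
    proof -
      have "((\<lambda>x. g (f x)) has_derivative (\<lambda>v. fd g (f x) (fd f x v))) (at x)"
        using has_derivative_compose[OF Ck_on_has_derivative[OF Suc.prems(2) assms(1) that]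
          Ck_on_has_derivative[OF Suc.prems(1) assms(2) assms(3)[OF that]]] .
      moreover have "(\<lambda>v. fd g (f x) (fd f x v)) = (\<lambda>v. \<Sum>b\<in>Basis. (fd f x v \<bullet> b) *\<^sub>R fd g (f x) b)"
        by (rule ext, rule linear_Basis_expansion[OF l[OF that]])
      ultimately show ?thesis by (simp only:)
    qed
    show "Ck_on k S (\<lambda>x. \<Sum>b\<in>Basis. (fd f x v \<bullet> b) *\<^sub>R fd g (f x) b)" for v
    proof (intro Ck_on_sum Ck_on_bilinear[OF bounded_bilinear_scaleR] assms(1))
      show "Ck_on k S (\<lambda>x. fd f x v \<bullet> b)" for b
        using Suc.prems(2) by (intro Ck_on_bounded_linear_comp[OF bounded_linear_inner_left] assms(1)) simp
      show "Ck_on k S (\<lambda>x. fd g (f x) b)" for b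
        using Suc.IH[of "\<lambda>y. fd g y b"] Suc.prems Ck_on_Suc_imp[OF assms(1)] by auto
    qed
  qed
qed

lemma open_nonzero_real: "open {x::real. x \<noteq> 0}"
proof -
  have "{x::real. x \<noteq> 0} = - {0}" by auto
  then show ?thesis by (simp add: open_Compl)
qed

lemma open_positive_real: "open {x::real. x > 0}"
  by (intro open_Collect_less continuous_intros)

text \<open>The derivative of \<open>inverse\<close> is a polynomial in \<open>inverse\<close>, so
  class \<open>k\<close> yields class \<open>Suc k\<close>. The square root below bootstraps in the
  same way.\<close>

lemma Ck_on_inverse: "Ck_on k {x::real. x \<noteq> 0} inverse"
proof (induction k)
  case 0
  then show ?case by (auto intro: continuous_on_inverse continuous_on_id)
next
  case (Suc k)
  have o: "open {x::real. x \<noteq> 0}"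
    by (rule open_nonzero_real)
  show ?case
  proof (rule Ck_on_Suc_intro[OF o, where f' = "\<lambda>x v. - (inverse x * v * inverse x)"])
    show "(inverse has_derivative (\<lambda>v. - (inverse x * v * inverse x))) (at x)" if "x \<in> {x. x \<noteq> 0}" for x :: real
      using has_derivative_inverse' that by blast
    show "Ck_on k {x::real. x \<noteq> 0} (\<lambda>x. - (inverse x * v * inverse x))" for v
      by (intro Ck_on_bounded_linear_comp[OF bounded_linear_minus[OF bounded_linear_ident]]
        Ck_on_bilinear[OF bounded_bilinear_mult] Suc Ck_on_const o)
  qed
qed

lemma Ck_on_sqrt: "Ck_on k {x::real. x > 0} sqrt"
proof (induction k)
  case 0
  then show ?case by (auto intro: continuous_on_real_sqrt continuous_on_id)
next
  case (Suc k)
  have o: "open {x::real. x > 0}"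
    by (rule open_positive_real)
  have "Ck_on k {x::real. x > 0} (\<lambda>x. inverse (sqrt x))"
    using Ck_on_compose[OF o open_nonzero_real _ Ck_on_inverse Suc] by simp
  then have "Ck_on k {x::real. x > 0} (\<lambda>x. inverse (sqrt x) * (v / 2))" for v
    using Ck_on_bilinear[OF bounded_bilinear_mult o _ Ck_on_const[OF o]] by blast
  then show ?case
    by (intro Ck_on_Suc_intro[OF o, where f' = "\<lambda>x v. inverse (sqrt x) * (v / 2)"])
      (auto intro!: derivative_eq_intros simp: divide_simps)
qed

section \<open>Closure properties of smooth maps\<close>

lemma smooth_on_has_derivative:
  "smooth_on S f \<Longrightarrow> open S \<Longrightarrow> x \<in> S \<Longrightarrow> (f has_derivative fd f x) (at x)"
  unfolding smooth_on_def using Ck_on_has_derivative by blast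

lemma smooth_on_differentiable:
  "smooth_on S f \<Longrightarrow> open S \<Longrightarrow> x \<in> S \<Longrightarrow> f differentiable (at x)"
  using smooth_on_has_derivative differentiableI by blast

lemma smooth_on_imp_continuous_on: "smooth_on S f \<Longrightarrow> continuous_on S f"
  unfolding smooth_on_def using Ck_on.simps(1) by blast

lemma smooth_on_cong:
  "open S \<Longrightarrow> (\<And>x. x \<in> S \<Longrightarrow> f x = g x) \<Longrightarrow> smooth_on S f \<Longrightarrow> smooth_on S g"
  unfolding smooth_on_def by (blast intro: Ck_on_cong)

lemma smooth_on_subset:
  "smooth_on S f \<Longrightarrow> open S \<Longrightarrow> open T \<Longrightarrow> T \<subseteq> S \<Longrightarrow> smooth_on T f"
  unfolding smooth_on_def using Ck_on_subset by blast

lemma smooth_on_local: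
  assumes "open S" "\<And>x. x \<in> S \<Longrightarrow> \<exists>T. open T \<and> x \<in> T \<and> smooth_on T f"
  shows "smooth_on S f"
  unfolding smooth_on_def
proof
  fix k
  show "Ck_on k S f"
    by (rule Ck_on_local[OF assms(1)]) (use assms(2) in \<open>unfold smooth_on_def, blast\<close>)
qed

lemma smooth_on_const: "open S \<Longrightarrow> smooth_on S (\<lambda>x. c)"
  unfolding smooth_on_def by (rule allI, rule Ck_on_const) blast+

lemma smooth_on_ident: "open S \<Longrightarrow> smooth_on S (\<lambda>x. x)"
  unfolding smooth_on_def by (rule allI, rule Ck_on_ident) blast+

lemma smooth_on_bounded_linear:
  "bounded_linear L \<Longrightarrow> open S \<Longrightarrow> smooth_on S f \<Longrightarrow> smooth_on S (\<lambda>x. L (f x))"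
  unfolding smooth_on_def by (rule allI, rule Ck_on_bounded_linear_comp) blast+

lemma smooth_on_add: "open S \<Longrightarrow> smooth_on S f \<Longrightarrow> smooth_on S g \<Longrightarrow> smooth_on S (\<lambda>x. f x + g x)"
  unfolding smooth_on_def by (rule allI, rule Ck_on_add) blast+

lemma smooth_on_bilinear:
  "bounded_bilinear B \<Longrightarrow> open S \<Longrightarrow> smooth_on S f \<Longrightarrow> smooth_on S g \<Longrightarrow> smooth_on S (\<lambda>x. B (f x) (g x))"
  unfolding smooth_on_def by (rule allI, rule Ck_on_bilinear) blast+

lemma smooth_on_sum:
  "open S \<Longrightarrow> (\<And>i. i \<in> I \<Longrightarrow> smooth_on S (f i)) \<Longrightarrow> smooth_on S (\<lambda>x. \<Sum>i\<in>I. f i x)"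
  unfolding smooth_on_def by (rule allI, rule Ck_on_sum) blast+

lemma smooth_on_compose:
  fixes f :: "'a::real_normed_vector \<Rightarrow> 'b::euclidean_space"
  assumes "smooth_on T g" "smooth_on S f" "open S" "open T" "\<And>x. x \<in> S \<Longrightarrow> f x \<in> T"
  shows "smooth_on S (\<lambda>x. g (f x))"
  unfolding smooth_on_def
proof
  fix k
  have "Ck_on k T g" "Ck_on k S f"
    using assms(1,2) unfolding smooth_on_def by blast+
  then show "Ck_on k S (\<lambda>x. g (f x))"
    using Ck_on_compose[OF assms(3,4), of f k g] assms(5) by simp
qed

lemma smooth_on_mult:
  fixes f g :: "'a::real_normed_vector \<Rightarrow> real"
  shows "open S \<Longrightarrow> smooth_on S f \<Longrightarrow> smooth_on S g \<Longrightarrow> smooth_on S (\<lambda>x. f x * g x)"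
  by (rule smooth_on_bilinear[OF bounded_bilinear_mult])

lemma smooth_on_scaleR:
  "open S \<Longrightarrow> smooth_on S f \<Longrightarrow> smooth_on S g \<Longrightarrow> smooth_on S (\<lambda>x. f x *\<^sub>R g x)"
  by (rule smooth_on_bilinear[OF bounded_bilinear_scaleR])

lemma smooth_on_prod:
  fixes f :: "'i \<Rightarrow> 'a::real_normed_vector \<Rightarrow> real"
  assumes "open S" "\<And>i. i \<in> I \<Longrightarrow> smooth_on S (f i)" shows "smooth_on S (\<lambda>x. \<Prod>i\<in>I. f i x)"
  using assms(2)
proof (induction I rule: infinite_finite_induct)
  case (insert i I)
  then show ?case
    using smooth_on_mult[OF assms(1), of "f i" "\<lambda>x. \<Prod>i\<in>I. f i x"] by simp
qed (use smooth_on_const[OF assms(1)] in simp_all)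

lemma smooth_on_minus: "open S \<Longrightarrow> smooth_on S f \<Longrightarrow> smooth_on S (\<lambda>x. - f x)"
  by (rule smooth_on_bounded_linear[OF bounded_linear_minus[OF bounded_linear_ident]])

lemma smooth_on_diff: "open S \<Longrightarrow> smooth_on S f \<Longrightarrow> smooth_on S g \<Longrightarrow> smooth_on S (\<lambda>x. f x - g x)"
  using smooth_on_add[of S f "\<lambda>x. - g x"] smooth_on_minus by fastforce

lemma smooth_on_divide:
  fixes f g :: "'a::real_normed_vector \<Rightarrow> real"
  assumes "open S" "smooth_on S f" "smooth_on S g" "\<And>x. x \<in> S \<Longrightarrow> g x \<noteq> 0"
  shows "smooth_on S (\<lambda>x. f x / g x)"
proof -
  have "smooth_on S (\<lambda>x. inverse (g x))"
    using smooth_on_compose[of "{x. x \<noteq> 0}" inverse S g] assms Ck_on_inverse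
    unfolding smooth_on_def by (simp add: open_nonzero_real)
  then show ?thesis
    using smooth_on_mult[OF assms(1,2)] by (simp add: divide_inverse)
qed

lemma smooth_on_real_sqrt:
  assumes "open S" "smooth_on S g" "\<And>x. x \<in> S \<Longrightarrow> g x > 0"
  shows "smooth_on S (\<lambda>x. sqrt (g x))"
proof -
  have "smooth_on {x::real. x > 0} sqrt"
    using Ck_on_sqrt unfolding smooth_on_def by blast
  moreover have "open {x::real. x > 0}"
    by (rule open_positive_real)
  ultimately show ?thesis
    using smooth_on_compose[of "{x. x > 0}" sqrt S g] assms by simp
qed

lemma smooth_on_fd: "smooth_on S f \<Longrightarrow> smooth_on S (\<lambda>x. fd f x v)"
  unfolding smooth_on_def by (metis Ck_on.simps(2))

lemma linear_fd: "smooth_on S f \<Longrightarrow> open S \<Longrightarrow> x \<in> S \<Longrightarrow> linear (fd f x)"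
  using smooth_on_has_derivative has_derivative_linear by blast

text \<open>Base point and direction may both move: as in \<open>Ck_on_compose\<close>, the
  direction is first expanded in a basis.\<close>

lemma smooth_on_fd_apply:
  fixes f :: "'a::euclidean_space \<Rightarrow> 'b::real_normed_vector" and h :: "'c::real_normed_vector \<Rightarrow> 'a"
  assumes "smooth_on S f" "open S" "open T" "smooth_on T g" "smooth_on T h" "\<And>x. x \<in> T \<Longrightarrow> h x \<in> S"
  shows "smooth_on T (\<lambda>x. fd f (h x) (g x))"
proof (rule smooth_on_cong[OF assms(3)])
  show "(\<Sum>b\<in>Basis. (g x \<bullet> b) *\<^sub>R fd f (h x) b) = fd f (h x) (g x)" if "x \<in> T" for x
    by (rule linear_Basis_expansion[OF linear_fd[OF assms(1,2) assms(6)[OF that]], symmetric])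
  have "smooth_on T (\<lambda>x. fd f (h x) b)" for b
    using smooth_on_compose[OF smooth_on_fd[OF assms(1)] assms(5,3,2,6)] .
  then show "smooth_on T (\<lambda>x. \<Sum>b\<in>Basis. (g x \<bullet> b) *\<^sub>R fd f (h x) b)"
    by (intro smooth_on_sum smooth_on_scaleR assms(3) smooth_on_bounded_linear[OF bounded_linear_inner_left]
        assms(4))
qed

lemma smooth_on_vec_iff:
  fixes f :: "'a::real_normed_vector \<Rightarrow> real ^ 'k"
  assumes "open S"
  shows "smooth_on S f \<longleftrightarrow> (\<forall>i. smooth_on S (\<lambda>x. f x $ i))"
proof
  assume *: "\<forall>i. smooth_on S (\<lambda>x. f x $ i)"
  have "smooth_on S (\<lambda>x. \<Sum>i\<in>UNIV. f x $ i *\<^sub>R axis i (1::real))"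
    using * by (intro smooth_on_sum smooth_on_scaleR smooth_on_const assms) auto
  moreover have "(\<Sum>i\<in>UNIV. f x $ i *\<^sub>R axis i (1::real)) = f x" for x
    using basis_expansion[of "f x"] by (simp add: scalar_mult_eq_scaleR)
  ultimately show "smooth_on S f" by simp
qed (use smooth_on_bounded_linear[OF bounded_linear_vec_nth assms] in blast)

text \<open>The mean value theorem is applied to the difference along \<open>w\<close> as a function
  of the step along \<open>v\<close>, and then to the resulting derivative. The left side of the
  equation is symmetric in \<open>v\<close> and \<open>w\<close>, which is what will force the mixed
  derivatives to agree.\<close>

lemma second_difference_mvt:
  fixes f :: "'a::real_normed_vector \<Rightarrow> real"
  assumes f: "smooth_on S f" "open S" and h: "h > 0"
    and box: "\<And>s t. 0 \<le> s \<Longrightarrow> s \<le> h \<Longrightarrow> 0 \<le> t \<Longrightarrow> t \<le> h \<Longrightarrow> x + s *\<^sub>R v + t *\<^sub>R w \<in> S"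
  shows "\<exists>s t. 0 \<le> s \<and> s \<le> h \<and> 0 \<le> t \<and> t \<le> h \<and>
    f (x + h *\<^sub>R v + h *\<^sub>R w) - f (x + h *\<^sub>R v) - f (x + h *\<^sub>R w) + f x
      = h * h * fd (\<lambda>y. fd f y v) (x + s *\<^sub>R v + t *\<^sub>R w) w"
proof -
  have d1: "((\<lambda>s. f (x + s *\<^sub>R v + t *\<^sub>R w)) has_real_derivative fd f (x + s *\<^sub>R v + t *\<^sub>R w) v) (at s)"
    if "0 \<le> s" "s \<le> h" "0 \<le> t" "t \<le> h" for s t
  proof -
    have *: "(f has_derivative fd f (x + s *\<^sub>R v + t *\<^sub>R w)) (at (x + s *\<^sub>R v + t *\<^sub>R w))"
      using smooth_on_has_derivative[OF f box[OF that]] .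
    have "((\<lambda>s. f (x + s *\<^sub>R v + t *\<^sub>R w)) has_derivative (\<lambda>r. fd f (x + s *\<^sub>R v + t *\<^sub>R w) (r *\<^sub>R v))) (at s)"
    proof -
      have "((\<lambda>s. x + s *\<^sub>R v + t *\<^sub>R w) has_derivative (\<lambda>r. r *\<^sub>R v)) (at s)"
        by (auto intro!: derivative_eq_intros)
      from has_derivative_compose[OF this *] show ?thesis .
    qed
    then show ?thesis
      unfolding has_field_derivative_def
      using linear_cmul[OF has_derivative_linear[OF *]] by (simp add: mult_commute_abs)
  qed
  have f2: "smooth_on S (\<lambda>y. fd f y v)"
    using smooth_on_fd[OF f(1)] .
  have d2: "((\<lambda>t. fd f (x + s *\<^sub>R v + t *\<^sub>R w) v) has_real_derivative fd (\<lambda>y. fd f y v) (x + s *\<^sub>R v + t *\<^sub>R w) w) (at t)"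
    if "0 \<le> s" "s \<le> h" "0 \<le> t" "t \<le> h" for s t
  proof -
    have *: "((\<lambda>y. fd f y v) has_derivative fd (\<lambda>y. fd f y v) (x + s *\<^sub>R v + t *\<^sub>R w)) (at (x + s *\<^sub>R v + t *\<^sub>R w))"
      using smooth_on_has_derivative[OF f2 f(2) box[OF that]] .
    have "((\<lambda>t. fd f (x + s *\<^sub>R v + t *\<^sub>R w) v) has_derivative (\<lambda>r. fd (\<lambda>y. fd f y v) (x + s *\<^sub>R v + t *\<^sub>R w) (r *\<^sub>R w))) (at t)"
    proof -
      have "((\<lambda>t. x + s *\<^sub>R v + t *\<^sub>R w) has_derivative (\<lambda>r. r *\<^sub>R w)) (at t)"
        by (auto intro!: derivative_eq_intros)
      from has_derivative_compose[OF this *] show ?thesis .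
    qed
    then show ?thesis
      unfolding has_field_derivative_def
      using linear_cmul[OF has_derivative_linear[OF *]] by (simp add: mult_commute_abs)
  qed
  let ?p = "\<lambda>s. f (x + s *\<^sub>R v + h *\<^sub>R w) - f (x + s *\<^sub>R v + 0 *\<^sub>R w)"
  have "(?p has_real_derivative fd f (x + s *\<^sub>R v + h *\<^sub>R w) v - fd f (x + s *\<^sub>R v + 0 *\<^sub>R w) v) (at s)"
    if "0 \<le> s" "s \<le> h" for s
    using DERIV_diff[OF d1[OF that, of h] d1[OF that, of 0]] h by simp
  from MVT2[OF h this] obtain s where s: "0 < s" "s < h"
    "?p h - ?p 0 = (h - 0) * (fd f (x + s *\<^sub>R v + h *\<^sub>R w) v - fd f (x + s *\<^sub>R v + 0 *\<^sub>R w) v)"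
    by blast
  have "((\<lambda>t. fd f (x + s *\<^sub>R v + t *\<^sub>R w) v) has_real_derivative fd (\<lambda>y. fd f y v) (x + s *\<^sub>R v + t *\<^sub>R w) w) (at t)"
    if "0 \<le> t" "t \<le> h" for t
    using d2 s that by simp
  from MVT2[OF h this] obtain t where t: "0 < t" "t < h"
    "fd f (x + s *\<^sub>R v + h *\<^sub>R w) v - fd f (x + s *\<^sub>R v + 0 *\<^sub>R w) v
      = (h - 0) * fd (\<lambda>y. fd f y v) (x + s *\<^sub>R v + t *\<^sub>R w) w"
    by blast
  have "f (x + h *\<^sub>R v + h *\<^sub>R w) - f (x + h *\<^sub>R v) - f (x + h *\<^sub>R w) + f x = ?p h - ?p 0"
    by simp
  also have "\<dots> = h * h * fd (\<lambda>y. fd f y v) (x + s *\<^sub>R v + t *\<^sub>R w) w"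
    using s(3) t(3) by simp
  finally show ?thesis
    using s t by (intro exI[of _ s] exI[of _ t]) simp
qed

text \<open>If the mixed derivatives differed at \<open>x\<close>, continuity would keep each of
  them within half the gap of its value at \<open>x\<close> on a small ball, while the second
  difference makes them take a common value at two points of that ball.\<close>

lemma fd_fd_commute_real:
  fixes f :: "'a::real_normed_vector \<Rightarrow> real"
  assumes f: "smooth_on S f" "open S" and x: "x \<in> S"
  shows "fd (\<lambda>y. fd f y v) x w = fd (\<lambda>y. fd f y w) x v"
proof (rule ccontr)
  define A where "A = (\<lambda>y. fd (\<lambda>y. fd f y v) y w)"
  define B where "B = (\<lambda>y. fd (\<lambda>y. fd f y w) y v)"
  assume "fd (\<lambda>y. fd f y v) x w \<noteq> fd (\<lambda>y. fd f y w) x v"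
  then have e: "\<bar>A x - B x\<bar> / 2 > 0"
    unfolding A_def B_def by simp
  have "isCont A x" "isCont B x"
    unfolding A_def B_def
    using smooth_on_imp_continuous_on[OF smooth_on_fd[OF smooth_on_fd[OF f(1)]]] f(2) x continuous_on_eq_continuous_at by blast+
  then obtain d1 d2 where d: "d1 > 0" "\<And>y. dist y x < d1 \<Longrightarrow> dist (A y) (A x) < \<bar>A x - B x\<bar> / 2"
      "d2 > 0" "\<And>y. dist y x < d2 \<Longrightarrow> dist (B y) (B x) < \<bar>A x - B x\<bar> / 2"
    using e unfolding continuous_at_eps_delta by metis
  obtain d3 where d3: "d3 > 0" "ball x d3 \<subseteq> S"
    using f(2) x openE by blast
  define r where "r = min d1 (min d2 d3)"
  \<comment> \<open>The \<open>1\<close> keeps the denominator positive when both directions vanish;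
    the factor 2 keeps the parallelogram strictly inside the ball of radius
    \<open>r\<close>.\<close>
  define h where "h = r / (2 * (norm v + norm w + 1))"
  have r: "r > 0" "r \<le> d1" "r \<le> d2" "r \<le> d3"
    unfolding r_def using d d3 by auto
  then have h: "h > 0"
    unfolding h_def by (simp add: add_nonneg_pos)
  have near: "dist (x + s *\<^sub>R v + t *\<^sub>R w) x < r" if "0 \<le> s" "s \<le> h" "0 \<le> t" "t \<le> h" for s t
  proof -
    have "dist (x + s *\<^sub>R v + t *\<^sub>R w) x = norm (s *\<^sub>R v + t *\<^sub>R w)"
      by (simp add: dist_norm)
    also have "\<dots> \<le> s * norm v + t * norm w"
      using norm_triangle_ineq[of "s *\<^sub>R v" "t *\<^sub>R w"] that by simp
    also have "\<dots> \<le> h * norm v + h * norm w"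
      using that by (intro add_mono mult_right_mono) auto
    also have "\<dots> \<le> h * (norm v + norm w + 1)"
      using h by (simp add: algebra_simps)
    also have "\<dots> = r / 2"
    proof -
      have "norm v + norm w + 1 \<noteq> 0"
        by (smt (verit) norm_ge_zero)
      then show ?thesis unfolding h_def by (simp add: field_simps)
    qed
    finally show ?thesis using r by simp
  qed
  have S: "x + s *\<^sub>R v + t *\<^sub>R w \<in> S" if "0 \<le> s" "s \<le> h" "0 \<le> t" "t \<le> h" for s t
    using near[OF that] r d3 by (auto simp: dist_commute)
  obtain s t where st: "0 \<le> s" "s \<le> h" "0 \<le> t" "t \<le> h"
    "f (x + h *\<^sub>R v + h *\<^sub>R w) - f (x + h *\<^sub>R v) - f (x + h *\<^sub>R w) + f x = h * h * A (x + s *\<^sub>R v + t *\<^sub>R w)"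
    using second_difference_mvt[OF f h, of x v w] S unfolding A_def by blast
  have S': "x + t *\<^sub>R w + s *\<^sub>R v \<in> S" if "0 \<le> s" "s \<le> h" "0 \<le> t" "t \<le> h" for s t
    using S[OF that] by (simp add: algebra_simps)
  obtain s' t' where st': "0 \<le> s'" "s' \<le> h" "0 \<le> t'" "t' \<le> h"
    "f (x + h *\<^sub>R w + h *\<^sub>R v) - f (x + h *\<^sub>R w) - f (x + h *\<^sub>R v) + f x = h * h * B (x + s' *\<^sub>R w + t' *\<^sub>R v)"
    using second_difference_mvt[OF f h, of x w v] S' unfolding B_def by blast
  have "h * h * A (x + s *\<^sub>R v + t *\<^sub>R w) = h * h * B (x + s' *\<^sub>R w + t' *\<^sub>R v)"
    using st(5) st'(5) by (simp add: algebra_simps)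
  then have "A (x + s *\<^sub>R v + t *\<^sub>R w) = B (x + t' *\<^sub>R v + s' *\<^sub>R w)"
    using h by (simp add: add.assoc add.commute[of "s' *\<^sub>R w"])
  moreover have "dist (A (x + s *\<^sub>R v + t *\<^sub>R w)) (A x) < \<bar>A x - B x\<bar> / 2"
    using d(2) near[OF st(1-4)] r by force
  moreover have "dist (B (x + t' *\<^sub>R v + s' *\<^sub>R w)) (B x) < \<bar>A x - B x\<bar> / 2"
    using d(4) near[OF st'(3,4,1,2)] r by force
  ultimately have "\<bar>B (x + t' *\<^sub>R v + s' *\<^sub>R w) - A x\<bar> + \<bar>B (x + t' *\<^sub>R v + s' *\<^sub>R w) - B x\<bar> < \<bar>A x - B x\<bar>"
    unfolding dist_real_def by simp
  moreover have "\<bar>a - b\<bar> \<le> \<bar>c - a\<bar> + \<bar>c - b\<bar>" for a b c :: real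
    by linarith
  ultimately show False
    by (meson linorder_not_le)
qed

lemma fd_vec_nth:
  fixes f :: "'a::real_normed_vector \<Rightarrow> real ^ 'k"
  assumes "f differentiable (at x)"
  shows "fd (\<lambda>y. f y $ i) x v = fd f x v $ i"
  using fd_eq[OF bounded_linear.has_derivative[OF bounded_linear_vec_nth fd_works[OF assms]]]
  by metis

lemma fd_fd_commute:
  fixes f :: "'a::real_normed_vector \<Rightarrow> real ^ 'k"
  assumes f: "smooth_on S f" "open S" and x: "x \<in> S"
  shows "fd (\<lambda>y. fd f y v) x w = fd (\<lambda>y. fd f y w) x v"
proof (subst vec_eq_iff, rule allI)
  fix i
  have "fd (\<lambda>y. fd f y v) x w $ i = fd (\<lambda>y. fd (\<lambda>z. f z $ i) y v) x w" for v w
  proof -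
    have "fd (\<lambda>y. fd f y v) x w $ i = fd (\<lambda>y. fd f y v $ i) x w"
      using fd_vec_nth[OF smooth_on_differentiable[OF smooth_on_fd[OF f(1)] f(2) x]] by simp
    also have "\<dots> = fd (\<lambda>y. fd (\<lambda>z. f z $ i) y v) x w"
      using fd_open_cong[OF f(2) x, of "\<lambda>y. fd f y v $ i" "\<lambda>y. fd (\<lambda>z. f z $ i) y v"]
        fd_vec_nth[OF smooth_on_differentiable[OF f]] by simp
    finally show ?thesis .
  qed
  moreover have "smooth_on S (\<lambda>z. f z $ i)"
    using smooth_on_vec_iff[OF f(2)] f(1) by blast
  ultimately show "fd (\<lambda>y. fd f y v) x w $ i = fd (\<lambda>y. fd f y w) x v $ i"
    using fd_fd_commute_real[OF _ f(2) x] by metis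
qed

lemma fd_compose:
  assumes "f differentiable (at x)" "g differentiable (at (f x))"
  shows "fd (\<lambda>x. g (f x)) x v = fd g (f x) (fd f x v)"
  using fd_eq[OF has_derivative_compose[OF fd_works[OF assms(1)] fd_works[OF assms(2)]]] by metis

subsection \<open>Functions and tangent vectors on projective space\<close>

lemma line_of_proj: "u \<noteq> 0 \<Longrightarrow> line_of (proj u) = span {u}"
  unfolding proj_def by (rule Line_inverse) (simp add: dim_insert)

lemma proj_surj: "\<exists>u. u \<noteq> 0 \<and> proj u = p"
proof -
  have d: "subspace (line_of p)" "dim (line_of p) = 1"
    using line_of[of p] by auto
  then obtain u where u: "u \<in> line_of p" "u \<noteq> 0"
    by (metis dim_eq_0 singletonI subsetI zero_neq_one)
  have "span {u} \<subseteq> line_of p"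
    using d u by (simp add: span_minimal)
  moreover have "dim (span {u}) = 1"
    using u by (simp add: dim_insert)
  ultimately have "span {u} = line_of p"
    using d dim_eq_span[of "span {u}" "line_of p"] span_eq_iff[of "line_of p"] by (metis order_refl span_span)
  then show ?thesis
    using u unfolding proj_def by (metis line_of_inverse)
qed

lemma proj_scale: "r \<noteq> 0 \<Longrightarrow> proj (r *\<^sub>R u) = proj u"
proof -
  assume r: "r \<noteq> 0"
  have "span {r *\<^sub>R u} = span {u}"
    using span_image_scale[of "{u}" "\<lambda>_. r"] r by simp
  then show ?thesis unfolding proj_def by simp
qed

lemma proj_eq_iff:
  assumes "u \<noteq> 0" "v \<noteq> 0"
  shows "proj u = proj v \<longleftrightarrow> (\<exists>r. r \<noteq> 0 \<and> v = r *\<^sub>R u)"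
proof
  assume "proj u = proj v"
  then have "v \<in> span {u}"
    using line_of_proj assms span_base by (metis singletonI)
  then obtain r where "v = r *\<^sub>R u"
    by (auto simp: span_singleton)
  then show "\<exists>r. r \<noteq> 0 \<and> v = r *\<^sub>R u"
    using assms by (intro exI[of _ r]) auto
qed (use proj_scale in metis)

lemma mem_cone: "u \<in> cone U \<longleftrightarrow> u \<noteq> 0 \<and> proj u \<in> U"
  by (simp add: cone_def)

lemma open_cone: "open U \<Longrightarrow> open (cone U)"
  by (simp add: open_projspace_def)

lemma scale_in_cone: "u \<in> cone U \<Longrightarrow> r \<noteq> 0 \<Longrightarrow> r *\<^sub>R u \<in> cone U"
  by (simp add: mem_cone proj_scale)

lemma cone_mono: "U \<subseteq> V \<Longrightarrow> cone U \<subseteq> cone V"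
  by (auto simp: mem_cone)

text \<open>The cone over the image is the union of the nonzero multiples of \<open>C\<close>, each
  of which is open.\<close>

lemma open_proj_image:
  fixes C :: "(real ^ 'k::finite) set"
  assumes "open C" "0 \<notin> C"
  shows "open (proj ` C)"
proof -
  have "cone (proj ` C) = (\<Union>r\<in>-{0}. (*\<^sub>R) r ` C)"
  proof (intro equalityI subsetI)
    fix u assume "u \<in> cone (proj ` C)"
    then obtain c where c: "c \<in> C" "u \<noteq> 0" "proj u = proj c"
      by (auto simp: mem_cone)
    then obtain r where "r \<noteq> 0" "u = r *\<^sub>R c"
      using proj_eq_iff[of c u] assms(2) by metis
    then show "u \<in> (\<Union>r\<in>-{0}. (*\<^sub>R) r ` C)" using c by auto
  next
    fix u assume "u \<in> (\<Union>r\<in>-{0}. (*\<^sub>R) r ` C)"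
    then obtain r c where "r \<noteq> 0" "c \<in> C" "u = r *\<^sub>R c" by auto
    moreover have "c \<noteq> 0" using \<open>c \<in> C\<close> assms(2) by blast
    ultimately show "u \<in> cone (proj ` C)"
      using proj_scale[of r c] by (simp add: mem_cone)
  qed
  moreover have "open ((*\<^sub>R) r ` C)" if "r \<noteq> 0" for r
    using open_scaling[OF that assms(1)] by simp
  ultimately show ?thesis
    unfolding open_projspace_def by (metis (no_types, lifting) ComplD UN_iff open_UN singletonI)
qed

lemma open_proj_Collect:
  fixes P :: "real ^ 'k::finite \<Rightarrow> bool"
  assumes "open {u. P u}" "\<not> P 0" "\<And>u r. r \<noteq> 0 \<Longrightarrow> P u \<Longrightarrow> P (r *\<^sub>R u)"
  shows "open (proj ` {u. P u})" "u \<in> cone (proj ` {u. P u}) \<longleftrightarrow> P u"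
proof -
  show "open (proj ` {u. P u})"
    using open_proj_image[OF assms(1)] assms(2) by simp
  show "u \<in> cone (proj ` {u. P u}) \<longleftrightarrow> P u"
  proof
    assume "u \<in> cone (proj ` {u. P u})"
    then obtain c where c: "P c" "u \<noteq> 0" "proj u = proj c" by (auto simp: mem_cone)
    then have "c \<noteq> 0" using assms(2) by blast
    then show "P u" using proj_eq_iff[of c u] c assms(3) by metis
  next
    assume "P u"
    then show "u \<in> cone (proj ` {u. P u})" using assms(2) by (auto simp: mem_cone)
  qed
qed

text \<open>Meant for \<open>F\<close> homogeneous of degree zero, where the chosen representative
  of the line does not matter.\<close>

definition descend :: "(real ^ 'k \<Rightarrow> 'b) \<Rightarrow> 'k::finite projspace \<Rightarrow> 'b" where
  "descend F p = F (SOME u. u \<noteq> 0 \<and> proj u = p)"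

lemma descend_proj:
  assumes "u \<noteq> 0" "\<And>r. r \<noteq> 0 \<Longrightarrow> F (r *\<^sub>R u) = F u"
  shows "descend F (proj u) = F u"
proof -
  define c where "c = (SOME c. c \<noteq> 0 \<and> proj c = proj u)"
  have c: "c \<noteq> 0 \<and> proj c = proj u"
    unfolding c_def using assms(1) by (metis (mono_tags, lifting) someI_ex)
  then obtain r where "r \<noteq> 0" "c = r *\<^sub>R u"
    using proj_eq_iff[of u c] assms(1) by metis
  then show ?thesis
    unfolding descend_def c_def[symmetric] using assms(2) by metis
qed

lemma smooth_fun_descend:
  assumes "open W" "smooth_on (cone W) F" "\<And>u r. u \<in> cone W \<Longrightarrow> r \<noteq> 0 \<Longrightarrow> F (r *\<^sub>R u) = F u"
  shows "smooth_fun W (descend F)"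
  unfolding smooth_fun_def
  by (rule smooth_on_cong[OF open_cone[OF assms(1)] _ assms(2)])
    (use descend_proj assms(3) in \<open>metis mem_cone\<close>)

lemma smooth_fun_cong:
  assumes "open W" "\<And>p. p \<in> W \<Longrightarrow> f p = g p" "smooth_fun W f"
  shows "smooth_fun W g"
  using assms(3) unfolding smooth_fun_def
  by (rule smooth_on_cong[OF open_cone[OF assms(1)], rotated]) (simp add: mem_cone assms(2))

lemma smooth_fun_subset:
  "smooth_fun W f \<Longrightarrow> open W \<Longrightarrow> open V \<Longrightarrow> V \<subseteq> W \<Longrightarrow> smooth_fun V f"
  unfolding smooth_fun_def by (meson smooth_on_subset open_cone cone_mono)

lemma smooth_fun_const: "open W \<Longrightarrow> smooth_fun W (\<lambda>p. c)"
  unfolding smooth_fun_def by (simp add: smooth_on_const open_cone)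

lemma smooth_fun_add: "open W \<Longrightarrow> smooth_fun W f \<Longrightarrow> smooth_fun W g \<Longrightarrow> smooth_fun W (\<lambda>p. f p + g p)"
  unfolding smooth_fun_def by (rule smooth_on_add[OF open_cone])

lemma smooth_fun_diff: "open W \<Longrightarrow> smooth_fun W f \<Longrightarrow> smooth_fun W g \<Longrightarrow> smooth_fun W (\<lambda>p. f p - g p)"
  unfolding smooth_fun_def by (rule smooth_on_diff[OF open_cone])

lemma smooth_fun_mult:
  fixes f g :: "'k::finite projspace \<Rightarrow> real"
  shows "open W \<Longrightarrow> smooth_fun W f \<Longrightarrow> smooth_fun W g \<Longrightarrow> smooth_fun W (\<lambda>p. f p * g p)"
  unfolding smooth_fun_def by (rule smooth_on_mult[OF open_cone])

lemma smooth_fun_bilinear: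
  "bounded_bilinear B \<Longrightarrow> open W \<Longrightarrow> smooth_fun W f \<Longrightarrow> smooth_fun W g \<Longrightarrow> smooth_fun W (\<lambda>p. B (f p) (g p))"
  unfolding smooth_fun_def by (rule smooth_on_bilinear[OF _ open_cone])

lemma smooth_fun_scaleR:
  "open W \<Longrightarrow> smooth_fun W f \<Longrightarrow> smooth_fun W g \<Longrightarrow> smooth_fun W (\<lambda>p. f p *\<^sub>R g p)"
  by (rule smooth_fun_bilinear[OF bounded_bilinear_scaleR])

lemma smooth_fun_sum:
  "open W \<Longrightarrow> (\<And>i. i \<in> I \<Longrightarrow> smooth_fun W (f i)) \<Longrightarrow> smooth_fun W (\<lambda>p. \<Sum>i\<in>I. f i p)"
  unfolding smooth_fun_def by (rule smooth_on_sum[OF open_cone])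

lemma smooth_fun_vec_iff:
  fixes f :: "'k::finite projspace \<Rightarrow> real ^ 'j"
  assumes "open W"
  shows "smooth_fun W f \<longleftrightarrow> (\<forall>i. smooth_fun W (\<lambda>p. f p $ i))"
  unfolding smooth_fun_def by (rule smooth_on_vec_iff[OF open_cone[OF assms]])

lemma smooth_fun_nth:
  fixes f :: "'k::finite projspace \<Rightarrow> real ^ 'j"
  shows "open W \<Longrightarrow> smooth_fun W f \<Longrightarrow> smooth_fun W (\<lambda>p. f p $ i)"
  using smooth_fun_vec_iff by blast

lemma smooth_fun_imp_smooth_at: "smooth_fun W f \<Longrightarrow> open W \<Longrightarrow> p \<in> W \<Longrightarrow> smooth_at p f"
  unfolding smooth_at_def by blast

lemma smooth_fun_compose:
  fixes g :: "real ^ 'k::finite \<Rightarrow> 'b::real_normed_vector"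
  assumes "smooth_on T g" "open T" "open W" "smooth_fun W f" "\<And>p. p \<in> W \<Longrightarrow> f p \<in> T"
  shows "smooth_fun W (\<lambda>p. g (f p))"
  unfolding smooth_fun_def
  by (rule smooth_on_compose[OF assms(1) assms(4)[unfolded smooth_fun_def] open_cone[OF assms(3)] assms(2)])
    (simp add: assms(5) mem_cone)

lemma smooth_fun_fd_apply:
  fixes g :: "real ^ 'k::finite \<Rightarrow> 'b::real_normed_vector"
  assumes "smooth_on T g" "open T" "open W" "smooth_fun W f" "smooth_fun W h" "\<And>p. p \<in> W \<Longrightarrow> f p \<in> T"
  shows "smooth_fun W (\<lambda>p. fd g (f p) (h p))"
  unfolding smooth_fun_def
  by (rule smooth_on_fd_apply[OF assms(1,2) open_cone[OF assms(3)] assms(5)[unfolded smooth_fun_def]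
      assms(4)[unfolded smooth_fun_def]])
    (simp add: assms(6) mem_cone)

lemma smooth_fun_has_derivative:
  "smooth_fun W f \<Longrightarrow> open W \<Longrightarrow> u \<in> cone W \<Longrightarrow> ((\<lambda>z. f (proj z)) has_derivative fd (\<lambda>z. f (proj z)) u) (at u)"
  unfolding smooth_fun_def by (rule smooth_on_has_derivative[OF _ open_cone])

lemma smooth_at_has_derivative:
  assumes "smooth_at (proj u) f" "u \<noteq> 0"
  shows "((\<lambda>z. f (proj z)) has_derivative fd (\<lambda>z. f (proj z)) u) (at u)"
  using assms smooth_fun_has_derivative unfolding smooth_at_def by (metis mem_cone)

section \<open>Tangent vectors represented by vectors of the linear space\<close>

lemma dproj_apply:
  assumes "smooth_fun W f" "open W" "u \<in> cone W"
  shows "dproj u w f = fd (\<lambda>z. f (proj z)) u w"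
  using smooth_fun_imp_smooth_at[OF assms(1,2)] assms(3) unfolding dproj_def mem_cone by simp

lemma dproj_linear:
  assumes "u \<noteq> 0"
  shows "dproj u (a *\<^sub>R w + b *\<^sub>R w') = (\<lambda>f. a * dproj u w f + b * dproj u w' f)"
proof
  fix f
  show "dproj u (a *\<^sub>R w + b *\<^sub>R w') f = a * dproj u w f + b * dproj u w' f"
  proof (cases "smooth_at (proj u) f")
    case True
    have "linear (fd (\<lambda>z. f (proj z)) u)"
      using smooth_at_has_derivative[OF True assms] has_derivative_linear by blast
    then show ?thesis
      using True by (simp add: dproj_def linear_add linear_cmul)
  qed (simp add: dproj_def)
qed

lemma dproj_add: "u \<noteq> 0 \<Longrightarrow> dproj u (w + w') = (\<lambda>f. dproj u w f + dproj u w' f)"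
  using dproj_linear[of u 1 w 1 w'] by simp

lemma dproj_diff: "u \<noteq> 0 \<Longrightarrow> dproj u (w - w') = (\<lambda>f. dproj u w f - dproj u w' f)"
  using dproj_linear[of u 1 w "-1" w'] by simp

lemma dproj_cmul: "u \<noteq> 0 \<Longrightarrow> dproj u (a *\<^sub>R w) = (\<lambda>f. a * dproj u w f)"
  using dproj_linear[of u a w 0 w] by simp

lemma dproj_zero: "u \<noteq> 0 \<Longrightarrow> dproj u 0 = (\<lambda>f. 0)"
  using dproj_cmul[of u 0 0] by simp

text \<open>The map \<open>proj\<close> is constant along the ray through \<open>u\<close>. That
  radial vectors are the whole kernel of its differential is \<open>dproj_eq_zeroD\<close>.\<close>

lemma dproj_self: assumes "u \<noteq> 0" shows "dproj u u = (\<lambda>f. 0)"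
proof
  fix f
  show "dproj u u f = 0"
  proof (cases "smooth_at (proj u) f")
    case True
    have "((\<lambda>t::real. u + t *\<^sub>R u) has_derivative (\<lambda>t. t *\<^sub>R u)) (at 0)"
      by (auto intro!: derivative_eq_intros)
    moreover have "((\<lambda>z. f (proj z)) has_derivative fd (\<lambda>z. f (proj z)) u) (at (u + 0 *\<^sub>R u))"
      using smooth_at_has_derivative[OF True assms] by simp
    ultimately have "((\<lambda>t. f (proj (u + t *\<^sub>R u))) has_derivative (\<lambda>t. fd (\<lambda>z. f (proj z)) u (t *\<^sub>R u))) (at 0)"
      by (rule has_derivative_compose)
    moreover have "f (proj (u + t *\<^sub>R u)) = f (proj u)" if "t \<in> ball (0::real) 1" for t
    proof -
      have "u + t *\<^sub>R u = (1 + t) *\<^sub>R u" by (simp add: scaleR_add_left)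
      moreover have "1 + t \<noteq> 0" using that by (auto simp: dist_real_def)
      ultimately show ?thesis using proj_scale by metis
    qed
    ultimately have "((\<lambda>t. f (proj u)) has_derivative (\<lambda>t. fd (\<lambda>z. f (proj z)) u (t *\<^sub>R u))) (at (0::real))"
      using has_derivative_open_cong[of "ball (0::real) 1" 0 "\<lambda>t. f (proj (u + t *\<^sub>R u))" "\<lambda>t. f (proj u)"]
      by simp
    then have "(\<lambda>t. fd (\<lambda>z. f (proj z)) u (t *\<^sub>R u)) = (\<lambda>t::real. 0)"
      using has_derivative_const has_derivative_unique by blast
    from fun_cong[OF this, of 1] show ?thesis
      using True by (simp add: dproj_def)
  qed (simp add: dproj_def)
qed

text \<open>The relation \<open>proj (r *\<^sub>R z) = proj z\<close>, differentiated at
  \<open>u\<close>.\<close>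

lemma dproj_scale:
  assumes "u \<noteq> 0" "r \<noteq> 0" shows "dproj (r *\<^sub>R u) (r *\<^sub>R w) = dproj u w"
proof
  fix f
  show "dproj (r *\<^sub>R u) (r *\<^sub>R w) f = dproj u w f"
  proof (cases "smooth_at (proj u) f")
    case True
    have "((\<lambda>z. f (proj z)) has_derivative fd (\<lambda>z. f (proj z)) (r *\<^sub>R u)) (at (r *\<^sub>R u))"
      using smooth_at_has_derivative[of "r *\<^sub>R u"] True assms by (simp add: proj_scale)
    from has_derivative_compose[OF has_derivative_scaleR_right[OF has_derivative_ident] this]
    have "((\<lambda>z. f (proj (r *\<^sub>R z))) has_derivative (\<lambda>w. fd (\<lambda>z. f (proj z)) (r *\<^sub>R u) (r *\<^sub>R w))) (at u)" .
    then have "((\<lambda>z. f (proj z)) has_derivative (\<lambda>w. fd (\<lambda>z. f (proj z)) (r *\<^sub>R u) (r *\<^sub>R w))) (at u)"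
      using assms(2) by (simp add: proj_scale)
    from fd_eq[OF this] show ?thesis
      using True assms by (simp add: dproj_def proj_scale)
  qed (simp add: dproj_def proj_scale assms)
qed

lemma dproj_scale_divide:
  assumes "u \<noteq> 0" "r \<noteq> 0" shows "dproj (r *\<^sub>R u) w = dproj u ((1 / r) *\<^sub>R w)"
  using dproj_scale[OF assms, of "(1 / r) *\<^sub>R w"] assms by simp

lemma tangent_proj: assumes "u \<noteq> 0" shows "tangent (proj u) = range (dproj u)"
proof (intro equalityI subsetI)
  fix v assume "v \<in> tangent (proj u)"
  then obtain c w where c: "v = dproj c w" "c \<noteq> 0" "proj c = proj u"
    unfolding tangent_def by blast
  then obtain r where "r \<noteq> 0" "c = r *\<^sub>R u"
    using proj_eq_iff[of u c] assms by metis
  then show "v \<in> range (dproj u)"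
    using c dproj_scale_divide assms by blast
qed (use assms in \<open>auto simp: tangent_def\<close>)

lemma tangentE:
  assumes "v \<in> tangent p" obtains u w where "u \<noteq> 0" "p = proj u" "v = dproj u w"
  using assms unfolding tangent_def by blast

definition chart :: "'k::finite \<Rightarrow> 'k projspace set" where
  "chart k = proj ` {u. u $ k \<noteq> 0}"

definition chart_coord :: "'k::finite \<Rightarrow> 'k \<Rightarrow> 'k projspace \<Rightarrow> real" where
  "chart_coord k i = descend (\<lambda>u. u $ i / u $ k)"

lemma open_chart: "open (chart k)" and mem_cone_chart: "u \<in> cone (chart k) \<longleftrightarrow> u $ k \<noteq> 0"
proof -
  have "open {u :: real ^ 'a. u $ k \<noteq> 0}"
    by (intro open_Collect_neq continuous_intros)
  from open_proj_Collect[OF this] show "open (chart k)" "u \<in> cone (chart k) \<longleftrightarrow> u $ k \<noteq> 0"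
    unfolding chart_def by auto
qed

lemma chart_coord_proj: "u $ k \<noteq> 0 \<Longrightarrow> chart_coord k i (proj u) = u $ i / u $ k"
  unfolding chart_coord_def by (rule descend_proj) auto

lemma smooth_on_nth: "open S \<Longrightarrow> smooth_on S (\<lambda>u :: real ^ 'k. u $ i)"
  by (rule smooth_on_bounded_linear[OF bounded_linear_vec_nth _ smooth_on_ident])

lemma smooth_chart_coord: "smooth_fun (chart k) (chart_coord k i)"
  unfolding chart_coord_def
  by (intro smooth_fun_descend smooth_on_divide open_chart open_cone smooth_on_nth)
    (auto simp: mem_cone_chart)

text \<open>The quotients \<open>z $ i / z $ k\<close> descend to smooth functions on a chart around
  \<open>proj u\<close>. If \<open>w\<close> annihilates all of them, then each coordinate of
  \<open>w\<close> is \<open>w $ k / u $ k\<close> times that of \<open>u\<close>.\<close>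

lemma dproj_eq_zeroD:
  assumes "u \<noteq> 0" "dproj u w = (\<lambda>f. 0)"
  shows "\<exists>c. w = c *\<^sub>R u"
proof -
  obtain k where k: "u $ k \<noteq> 0"
    using assms(1) by (metis vec_eq_iff zero_index)
  have "w $ i = (w $ k / u $ k) * u $ i" for i
  proof -
    have c: "u \<in> cone (chart k)" using k by (simp add: mem_cone_chart)
    have "((\<lambda>z. z $ i / z $ k) has_derivative
        (\<lambda>w. (w $ i * u $ k - u $ i * w $ k) / (u $ k * u $ k))) (at u)"
      by (rule has_derivative_divide'[OF bounded_linear.has_derivative[OF bounded_linear_vec_nth has_derivative_ident]
            bounded_linear.has_derivative[OF bounded_linear_vec_nth has_derivative_ident] k])
    then have "((\<lambda>z. chart_coord k i (proj z)) has_derivative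
        (\<lambda>w. (w $ i * u $ k - u $ i * w $ k) / (u $ k * u $ k))) (at u)"
      using has_derivative_open_cong[OF open_cone[OF open_chart[of k]] c,
          of "\<lambda>z. z $ i / z $ k" "\<lambda>z. chart_coord k i (proj z)"]
      by (simp add: mem_cone_chart chart_coord_proj)
    from fd_eq[OF this] have "dproj u w (chart_coord k i) = (w $ i * u $ k - u $ i * w $ k) / (u $ k * u $ k)"
      using dproj_apply[OF smooth_chart_coord open_chart c] by simp
    then show ?thesis using k assms(2) by (simp add: field_simps)
  qed
  then have "\<forall>i. w $ i = ((w $ k / u $ k) *\<^sub>R u) $ i"
    unfolding vector_scaleR_component real_scaleR_def by blast
  then have "w = (w $ k / u $ k) *\<^sub>R u"
    by (rule vec_eq_iff[THEN iffD2])
  then show ?thesis by blast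
qed

lemma dproj_eqD:
  assumes "u \<noteq> 0" "dproj u w = dproj u w'"
  shows "\<exists>c. w' = w + c *\<^sub>R u"
proof -
  have "dproj u (w' - w) = (\<lambda>f. 0)" using dproj_diff[OF assms(1), of w' w] assms(2) by simp
  then obtain c where "w' - w = c *\<^sub>R u" using dproj_eq_zeroD[OF assms(1)] by blast
  then show ?thesis by (intro exI[of _ c]) (simp add: algebra_simps)
qed

lemma dproj_add_self: "u \<noteq> 0 \<Longrightarrow> dproj u (w + c *\<^sub>R u) = dproj u w"
  by (simp add: dproj_add dproj_cmul dproj_self)

lemma contact_plane_proj:
  assumes "u \<noteq> 0" "\<And>u. Omega \<omega> u u = 0"
  shows "contact_plane \<omega> (proj u) = dproj u ` {w. Omega \<omega> u w = 0}"
proof -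
  have s: "Omega \<omega> (r *\<^sub>R x) y = r * Omega \<omega> x y" "Omega \<omega> x (r *\<^sub>R y) = r * Omega \<omega> x y" for r x y
    unfolding Omega_def by (simp_all add: algebra_simps sum_distrib_left)
  show ?thesis
  proof (intro equalityI subsetI)
    fix v assume "v \<in> contact_plane \<omega> (proj u)"
    then obtain c w where c: "v = dproj c w" "c \<noteq> 0" "proj c = proj u" "Omega \<omega> c w = 0"
      unfolding contact_plane_def by blast
    then obtain r where r: "r \<noteq> 0" "c = r *\<^sub>R u"
      using proj_eq_iff[of u c] assms(1) by metis
    then have "v = dproj u ((1 / r) *\<^sub>R w)" "Omega \<omega> u ((1 / r) *\<^sub>R w) = 0"
      using c dproj_scale_divide[OF assms(1)] by (auto simp: s)
    then show "v \<in> dproj u ` {w. Omega \<omega> u w = 0}" by blast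
  qed (use assms in \<open>auto simp: contact_plane_def\<close>)
qed

text \<open>Taken componentwise because a tangent vector accepts real functions only. For a section
  \<sigma> of the cone, \<open>dv v \<sigma>\<close> is the differential of \<sigma> at
  \<open>v\<close>, the standard way below to represent \<open>v\<close> by a vector of the linear
  space.\<close>

definition dv :: "'k tvec \<Rightarrow> ('k projspace \<Rightarrow> real ^ 'j) \<Rightarrow> real ^ 'j" where
  "dv v g = (\<chi> a. v (\<lambda>q. g q $ a))"

lemma dv_dproj:
  assumes "smooth_fun W g" "open W" "u \<in> cone W"
  shows "dv (dproj u w) g = fd (\<lambda>z. g (proj z)) u w"
proof (subst vec_eq_iff, rule allI)
  fix i
  have "(\<lambda>z. g (proj z)) differentiable (at u)"
    using smooth_fun_has_derivative[OF assms] differentiableI by blast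
  then show "dv (dproj u w) g $ i = fd (\<lambda>z. g (proj z)) u w $ i"
    unfolding dv_def
    using dproj_apply[OF smooth_fun_nth[OF assms(2,1), of i] assms(2,3)] fd_vec_nth by simp
qed

lemma dv_linear: "dv (\<lambda>f. a * v f + b * w f) g = a *\<^sub>R dv v g + b *\<^sub>R dv w g"
  by (simp add: dv_def vec_eq_iff)

lemma dv_zero: "dv (\<lambda>f. 0) g = 0"
  by (simp add: dv_def vec_eq_iff)

lemma dv_diff: "dv (\<lambda>f. v f - w f) g = dv v g - dv w g"
  by (simp add: dv_def vec_eq_iff)

lemma dv_add: "dv (\<lambda>f. v f + w f) g = dv v g + dv w g"
  by (simp add: dv_def vec_eq_iff)

lemma dv_cmul: "dv (\<lambda>f. a * w f) g = a *\<^sub>R dv w g"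
  by (simp add: dv_def vec_eq_iff)

lemma dv_sum: "dv (\<lambda>f. \<Sum>i\<in>I. c i * w i f) g = (\<Sum>i\<in>I. c i *\<^sub>R dv (w i) g)"
  by (simp add: dv_def vec_eq_iff)

text \<open>Both smoothness near the point and the derivative there depend on the germ alone, so the
  two functions fall into the same case of \<open>dproj\<close>, including the case with default
  value 0.\<close>

lemma fun_tvec_cong:
  assumes "v \<in> tangent p" "open W" "p \<in> W" "\<And>q. q \<in> W \<Longrightarrow> f q = g q"
  shows "v f = v g"
proof -
  obtain u w where u: "u \<noteq> 0" "p = proj u" "v = dproj u w"
    using assms(1) by (rule tangentE)
  have uc: "u \<in> cone W" using u assms by (simp add: mem_cone)
  have "smooth_at p f \<longleftrightarrow> smooth_at p g"
  proof -
    have *: "smooth_at p g" if sf: "smooth_at p f" and e: "\<And>q. q \<in> W \<Longrightarrow> f q = g q" for f g :: "'a projspace \<Rightarrow> real"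
    proof -
      obtain V where V: "open V" "p \<in> V" "smooth_fun V f"
        using sf unfolding smooth_at_def by blast
      have o: "open (V \<inter> W)" using V assms by blast
      have "smooth_fun (V \<inter> W) g"
        by (rule smooth_fun_cong[OF o _ smooth_fun_subset[OF V(3,1) o]]) (use e in auto)
      then show ?thesis unfolding smooth_at_def using V assms o by blast
    qed
    show ?thesis using *[of f g] *[of g f] assms(4) by metis
  qed
  moreover have "fd (\<lambda>z. f (proj z)) u = fd (\<lambda>z. g (proj z)) u"
    by (rule fd_open_cong[OF open_cone[OF assms(2)] uc]) (simp add: mem_cone assms(4))
  ultimately show ?thesis unfolding u(2,3) dproj_def by simp
qed

lemma dv_cong:
  assumes "v \<in> tangent p" "open W" "p \<in> W" "\<And>q. q \<in> W \<Longrightarrow> f q = g q"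
  shows "dv v f = dv v g"
proof -
  have "v (\<lambda>q. f q $ i) = v (\<lambda>q. g q $ i)" for i
    by (rule fun_tvec_cong[OF assms(1-3)]) (simp add: assms(4))
  then show ?thesis by (simp add: dv_def)
qed

lemma tvec_const:
  assumes "v \<in> tangent p" shows "v (\<lambda>q. c) = 0"
proof -
  obtain u w where u: "u \<noteq> 0" "p = proj u" "v = dproj u w"
    using assms by (rule tangentE)
  then show ?thesis
    using dproj_apply[OF smooth_fun_const[OF open_UNIV], of u w c]
    by (simp add: mem_cone frechet_derivative_const)
qed

lemma dv_const: assumes "v \<in> tangent p" shows "dv v (\<lambda>q. c) = 0"
  unfolding dv_def by (simp add: tvec_const[OF assms] vec_eq_iff)

lemma tvec_bilinear:
  fixes g :: "'k::finite projspace \<Rightarrow> real ^ 'i" and h :: "'k projspace \<Rightarrow> real ^ 'j"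
  assumes "bounded_bilinear B" "v \<in> tangent p" "p \<in> W" "open W" "smooth_fun W g" "smooth_fun W h"
  shows "v (\<lambda>q. B (g q) (h q)) = B (g p) (dv v h) + (B (dv v g) (h p) :: real)"
proof -
  obtain u w where u: "u \<noteq> 0" "p = proj u" "v = dproj u w"
    using assms(2) by (rule tangentE)
  have c: "u \<in> cone W" using u assms by (simp add: mem_cone)
  have "((\<lambda>z. B (g (proj z)) (h (proj z))) has_derivative
      (\<lambda>w. B (g (proj u)) (fd (\<lambda>z. h (proj z)) u w) + B (fd (\<lambda>z. g (proj z)) u w) (h (proj u)))) (at u)"
    by (rule bounded_bilinear.FDERIV[OF assms(1)])
      (use smooth_fun_has_derivative assms(4-6) c in blast)+
  from fd_eq[OF this] show ?thesis
    using dproj_apply[OF smooth_fun_bilinear[OF assms(1,4,5,6)] assms(4) c, of w]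
      dv_dproj[OF assms(5,4) c] dv_dproj[OF assms(6,4) c] u by simp
qed

lemma tvec_mult:
  fixes f g :: "'k::finite projspace \<Rightarrow> real"
  assumes "v \<in> tangent p" "p \<in> W" "open W" "smooth_fun W f" "smooth_fun W g"
  shows "v (\<lambda>q. f q * g q) = f p * v g + v f * g p"
proof -
  obtain u w where u: "u \<noteq> 0" "p = proj u" "v = dproj u w"
    using assms(1) by (rule tangentE)
  have c: "u \<in> cone W" using u assms by (simp add: mem_cone)
  have "((\<lambda>z. f (proj z) * g (proj z)) has_derivative
      (\<lambda>w. f (proj u) * (fd (\<lambda>z. g (proj z)) u w) + (fd (\<lambda>z. f (proj z)) u w) * (g (proj u)))) (at u)"
    by (rule bounded_bilinear.FDERIV[OF bounded_bilinear_mult])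
      (use smooth_fun_has_derivative assms(3-5) c in blast)+
  from fd_eq[OF this] show ?thesis
    using dproj_apply[OF smooth_fun_mult[OF assms(3,4,5)] assms(3) c, of w]
      dproj_apply[OF assms(5,3) c] dproj_apply[OF assms(4,3) c] u by simp
qed

lemma tvec_add:
  fixes f g :: "'k::finite projspace \<Rightarrow> real"
  assumes "v \<in> tangent p" "p \<in> W" "open W" "smooth_fun W f" "smooth_fun W g"
  shows "v (\<lambda>q. f q + g q) = v f + v g"
proof -
  obtain u w where u: "u \<noteq> 0" "p = proj u" "v = dproj u w"
    using assms(1) by (rule tangentE)
  have c: "u \<in> cone W" using u assms by (simp add: mem_cone)
  have "((\<lambda>z. f (proj z) + g (proj z)) has_derivative
      (\<lambda>w. fd (\<lambda>z. f (proj z)) u w + fd (\<lambda>z. g (proj z)) u w)) (at u)"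
    by (rule has_derivative_add)
      (use smooth_fun_has_derivative assms(3-5) c in blast)+
  from fd_eq[OF this] show ?thesis
    using dproj_apply[OF smooth_fun_add[OF assms(3,4,5)] assms(3) c, of w]
      dproj_apply[OF assms(5,3) c] dproj_apply[OF assms(4,3) c] u by simp
qed

lemma tvec_cmul:
  fixes f :: "'k::finite projspace \<Rightarrow> real"
  assumes "v \<in> tangent p" "p \<in> W" "open W" "smooth_fun W f"
  shows "v (\<lambda>q. c * f q) = c * v f"
  using tvec_mult[OF assms(1-3) smooth_fun_const[OF assms(3)] assms(4), of c] tvec_const[OF assms(1)] by simp

lemma dv_scaleR_fun:
  fixes f :: "'k::finite projspace \<Rightarrow> real" and g :: "'k projspace \<Rightarrow> real ^ 'j"
  assumes "v \<in> tangent p" "p \<in> W" "open W" "smooth_fun W f" "smooth_fun W g"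
  shows "dv v (\<lambda>q. f q *\<^sub>R g q) = f p *\<^sub>R dv v g + v f *\<^sub>R g p"
  unfolding vec_eq_iff dv_def
  using tvec_mult[OF assms(1-4) smooth_fun_nth[OF assms(3,5)]] by simp

lemma dv_add_fun:
  fixes f g :: "'k::finite projspace \<Rightarrow> real ^ 'j"
  assumes "v \<in> tangent p" "p \<in> W" "open W" "smooth_fun W f" "smooth_fun W g"
  shows "dv v (\<lambda>q. f q + g q) = dv v f + dv v g"
  unfolding vec_eq_iff dv_def
  using tvec_add[OF assms(1-3) smooth_fun_nth[OF assms(3,4)] smooth_fun_nth[OF assms(3,5)]] by simp

lemma dv_sum_fun:
  fixes f :: "'i \<Rightarrow> 'k::finite projspace \<Rightarrow> real ^ 'j"
  assumes "v \<in> tangent p" "p \<in> W" "open W" "\<And>i. i \<in> I \<Longrightarrow> smooth_fun W (f i)"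
  shows "dv v (\<lambda>q. \<Sum>i\<in>I. f i q) = (\<Sum>i\<in>I. dv v (f i))"
  using assms(4)
proof (induction I rule: infinite_finite_induct)
  case (insert i I)
  have "smooth_fun W (\<lambda>q. \<Sum>i\<in>I. f i q)"
    using insert.prems by (intro smooth_fun_sum assms(3)) simp
  then show ?case
    using insert dv_add_fun[OF assms(1-3), of "f i" "\<lambda>q. \<Sum>i\<in>I. f i q"] by simp
qed (simp_all add: dv_const[OF assms(1)])

lemma tvec_sum_fun:
  fixes f :: "'i \<Rightarrow> 'k::finite projspace \<Rightarrow> real"
  assumes "v \<in> tangent p" "p \<in> W" "open W" "\<And>i. i \<in> I \<Longrightarrow> smooth_fun W (f i)"
  shows "v (\<lambda>q. \<Sum>i\<in>I. f i q) = (\<Sum>i\<in>I. v (f i))"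
  using assms(4)
proof (induction I rule: infinite_finite_induct)
  case (insert i I)
  have "smooth_fun W (\<lambda>q. \<Sum>i\<in>I. f i q)"
    using insert.prems by (intro smooth_fun_sum assms(3)) simp
  then show ?case
    using insert tvec_add[OF assms(1-3), of "f i" "\<lambda>q. \<Sum>i\<in>I. f i q"] by simp
qed (simp_all add: tvec_const[OF assms(1)])

lemma dv_compose:
  fixes g :: "real ^ 'i \<Rightarrow> real ^ 'j" and f :: "'k::finite projspace \<Rightarrow> real ^ 'i"
  assumes "v \<in> tangent p" "p \<in> W" "open W" "smooth_fun W f" "smooth_on T g" "open T" "\<And>q. q \<in> W \<Longrightarrow> f q \<in> T"
  shows "dv v (\<lambda>q. g (f q)) = fd g (f p) (dv v f)"
proof -
  obtain u w where u: "u \<noteq> 0" "p = proj u" "v = dproj u w"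
    using assms(1) by (rule tangentE)
  have c: "u \<in> cone W" using u assms by (simp add: mem_cone)
  have "f (proj u) \<in> T" using assms u by simp
  then have "((\<lambda>z. g (f (proj z))) has_derivative
      (\<lambda>w. fd g (f (proj u)) (fd (\<lambda>z. f (proj z)) u w))) (at u)"
    by (rule has_derivative_compose[OF smooth_fun_has_derivative[OF assms(4,3) c]
          smooth_on_has_derivative[OF assms(5,6)]])
  from fd_eq[OF this] show ?thesis
    using dv_dproj[OF smooth_fun_compose[OF assms(5,6,3,4,7)] assms(3) c, of w]
      dv_dproj[OF assms(4,3) c] u by simp
qed

lemma tangent_linear_comb:
  assumes "v \<in> tangent p" "w \<in> tangent p"
  shows "(\<lambda>f. a * v f + b * w f) \<in> tangent p"
proof -
  obtain u where u: "u \<noteq> 0" "proj u = p" using proj_surj by blast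
  obtain x y where "v = dproj u x" "w = dproj u y"
    using assms tangent_proj[OF u(1)] u(2) by auto
  then show ?thesis
    using dproj_linear[OF u(1), of a x b y] tangent_proj[OF u(1)] u(2) by (metis rangeI)
qed

lemma zero_in_tangent: "(\<lambda>f. 0) \<in> tangent p"
proof -
  obtain u where u: "u \<noteq> 0" "proj u = p" using proj_surj by blast
  then show ?thesis using dproj_zero[OF u(1)] tangent_proj[OF u(1)] by (metis rangeI)
qed

section \<open>Vector fields and their brackets\<close>

lemma vector_field_tangent: "vector_field V X \<Longrightarrow> p \<in> V \<Longrightarrow> X p \<in> tangent p"
  unfolding vector_field_def by blast

lemma vector_field_smooth:
  "vector_field V X \<Longrightarrow> open W \<Longrightarrow> W \<subseteq> V \<Longrightarrow> smooth_fun W f \<Longrightarrow> smooth_fun W (\<lambda>p. X p f)"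
  unfolding vector_field_def by blast

lemma vector_field_smooth_dv:
  assumes "vector_field V X" "open W" "W \<subseteq> V" "smooth_fun W g"
  shows "smooth_fun W (\<lambda>p. dv (X p) g)"
  unfolding smooth_fun_vec_iff[OF assms(2)] dv_def
  using vector_field_smooth[OF assms(1-3) smooth_fun_nth[OF assms(2,4)]] by simp

lemma vector_fieldI:
  assumes "\<And>p. p \<in> V \<Longrightarrow> X p \<in> tangent p"
    and "\<And>W f. open W \<Longrightarrow> W \<subseteq> V \<Longrightarrow> smooth_fun W f \<Longrightarrow> smooth_fun W (\<lambda>p. X p f)"
  shows "vector_field V X"
  unfolding vector_field_def
proof (intro conjI ballI allI impI)
  show "X p \<in> tangent p" if "p \<in> V" for p
    using assms(1)[OF that] .
  show "smooth_fun W (\<lambda>p. X p f)" if "open W \<and> W \<subseteq> V \<and> smooth_fun W f" for W f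
    by (rule assms(2)) (use that in simp_all)
qed

lemma vector_field_subset: "vector_field V X \<Longrightarrow> W \<subseteq> V \<Longrightarrow> vector_field W X"
  by (rule vector_fieldI) (auto intro: vector_field_tangent vector_field_smooth)

lemma linear_axis_expansion:
  fixes L :: "real ^ 'k \<Rightarrow> 'b::real_vector"
  assumes "linear L" shows "L z = (\<Sum>i\<in>UNIV. z $ i *\<^sub>R L (axis i 1))"
proof -
  have "L z = L (\<Sum>i\<in>UNIV. z $ i *\<^sub>R axis i 1)"
    using basis_expansion[of z] by (simp add: scalar_mult_eq_scaleR)
  also have "\<dots> = (\<Sum>i\<in>UNIV. z $ i *\<^sub>R L (axis i 1))"
    by (simp only: linear_sum[OF assms] linear_cmul[OF assms])
  finally show ?thesis .
qed

lemma bracket_apply: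
  assumes "smooth_fun V f" "open V" "p \<in> V"
  shows "bracket X Y p f = X p (\<lambda>q. Y q f) - Y p (\<lambda>q. X q f)"
  using smooth_fun_imp_smooth_at[OF assms] by (simp add: bracket_def)

lemma dv_bracket:
  assumes "smooth_fun V g" "open V" "p \<in> V"
  shows "dv (bracket X Y p) g = dv (X p) (\<lambda>q. dv (Y q) g) - dv (Y p) (\<lambda>q. dv (X q) g)"
proof (subst vec_eq_iff, rule allI)
  fix i
  show "dv (bracket X Y p) g $ i = (dv (X p) (\<lambda>q. dv (Y q) g) - dv (Y p) (\<lambda>q. dv (X q) g)) $ i"
    unfolding dv_def using bracket_apply[OF smooth_fun_nth[OF assms(2,1)] assms(2,3)] by simp
qed

text \<open>A local section of the cone. Since \<open>proj\<close> undoes \<sigma>, the map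
  \<open>dv _ \<sigma>\<close> is a right inverse of \<open>dproj (\<sigma> p)\<close>, and geometry
  on projective space becomes calculus in the linear space.\<close>

locale proj_section =
  fixes W :: "'k::finite projspace set" and \<sigma> :: "'k projspace \<Rightarrow> real ^ 'k"
  assumes W_open: "open W" and sec_smooth: "smooth_fun W \<sigma>"
    and sec_nonzero: "p \<in> W \<Longrightarrow> \<sigma> p \<noteq> 0" and proj_sec: "p \<in> W \<Longrightarrow> proj (\<sigma> p) = p"
begin

lemma sec_cone: "p \<in> V \<Longrightarrow> p \<in> W \<Longrightarrow> \<sigma> p \<in> cone V"
  by (simp add: mem_cone sec_nonzero proj_sec)

lemma dproj_dv:
  assumes "p \<in> W" "v \<in> tangent p"
  shows "dproj (\<sigma> p) (dv v \<sigma>) = v"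
proof -
  have u: "\<sigma> p \<noteq> 0" "proj (\<sigma> p) = p" "\<sigma> p \<in> cone W"
    using assms sec_nonzero proj_sec sec_cone by auto
  obtain w where w: "v = dproj (\<sigma> p) w"
    using tangent_proj[OF u(1)] u(2) assms(2) by auto
  have "dproj (\<sigma> p) (dv v \<sigma>) f = v f" for f
  proof (cases "smooth_at p f")
    case True
    then obtain V where V: "open V" "p \<in> V" "smooth_fun V f"
      unfolding smooth_at_def by blast
    have o: "open (cone (V \<inter> W))" "\<sigma> p \<in> cone (V \<inter> W)"
      using V W_open u assms by (auto intro!: open_cone simp: mem_cone)
    have d: "(\<lambda>z. \<sigma> (proj z)) differentiable (at (\<sigma> p))"
      using smooth_fun_has_derivative[OF sec_smooth W_open u(3)] differentiableI by blast
    have "(\<lambda>z. f (proj z)) differentiable (at (\<sigma> p))"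
      using smooth_at_has_derivative[of "\<sigma> p" f] True u differentiableI by metis
    then have "fd (\<lambda>z. f (proj (\<sigma> (proj z)))) (\<sigma> p) w
        = fd (\<lambda>z. f (proj z)) (\<sigma> p) (fd (\<lambda>z. \<sigma> (proj z)) (\<sigma> p) w)"
      using fd_compose[OF d, of "\<lambda>z. f (proj z)"] u(2) by simp
    moreover have "fd (\<lambda>z. f (proj (\<sigma> (proj z)))) (\<sigma> p) = fd (\<lambda>z. f (proj z)) (\<sigma> p)"
      by (rule fd_open_cong[OF o]) (simp add: mem_cone proj_sec)
    ultimately show ?thesis
      using True u(2) dv_dproj[OF sec_smooth W_open u(3)] by (simp add: w dproj_def)
  qed (simp add: dproj_def w u)
  then show ?thesis by blast
qed

lemma tangent_eqI:
  "p \<in> W \<Longrightarrow> v \<in> tangent p \<Longrightarrow> w \<in> tangent p \<Longrightarrow> dv v \<sigma> = dv w \<sigma> \<Longrightarrow> v = w"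
  using dproj_dv by metis

lemma dproj_tangent: "p \<in> W \<Longrightarrow> dproj (\<sigma> p) z \<in> tangent p"
  using tangent_proj[OF sec_nonzero] proj_sec by (metis rangeI)

lemma tvec_apply:
  assumes "open V" "p \<in> V" "p \<in> W" "smooth_fun V f" "v \<in> tangent p"
  shows "v f = fd (\<lambda>z. f (proj z)) (\<sigma> p) (dv v \<sigma>)"
  using dproj_apply[OF assms(4,1) sec_cone[OF assms(2,3)], of "dv v \<sigma>"] dproj_dv[OF assms(3,5)] by simp

lemma vector_field_dproj:
  assumes "open V" "V \<subseteq> W" "smooth_fun V \<xi>"
  shows "vector_field V (\<lambda>q. dproj (\<sigma> q) (\<xi> q))"
proof (rule vector_fieldI)
  show "dproj (\<sigma> p) (\<xi> p) \<in> tangent p" if "p \<in> V" for p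
    using dproj_tangent that assms by blast
  fix V' and f :: "'k projspace \<Rightarrow> real"
  assume V': "open V'" "V' \<subseteq> V" "smooth_fun V' f"
  have "smooth_fun V' (\<lambda>q. fd (\<lambda>z. f (proj z)) (\<sigma> q) (\<xi> q))"
    by (rule smooth_fun_fd_apply[OF V'(3)[unfolded smooth_fun_def] open_cone[OF V'(1)] V'(1)
          smooth_fun_subset[OF sec_smooth W_open V'(1)] smooth_fun_subset[OF assms(3,1) V'(1,2)]])
      (use V' assms in \<open>auto intro: sec_cone\<close>)
  then show "smooth_fun V' (\<lambda>p. dproj (\<sigma> p) (\<xi> p) f)"
    by (rule smooth_fun_cong[OF V'(1), rotated])
      (use dproj_apply[OF V'(3,1) sec_cone] V' assms in auto)
qed

text \<open>With \<open>f\<close> pulled back to the cone, \<open>X (Y f)\<close> is a second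
  derivative in the two represented directions plus a first derivative along the derivative of the
  represented field \<open>Y\<close>. The second derivatives are symmetric and cancel in the
  commutator.\<close>

lemma bracket_dproj:
  assumes V: "open V" "V \<subseteq> W" and X: "vector_field V X" and Y: "vector_field V Y" and p: "p \<in> V"
  shows "bracket X Y p = dproj (\<sigma> p) (dv (X p) (\<lambda>q. dv (Y q) \<sigma>) - dv (Y p) (\<lambda>q. dv (X q) \<sigma>))"
proof
  fix f
  have pW: "p \<in> W" using p V by blast
  show "bracket X Y p f = dproj (\<sigma> p) (dv (X p) (\<lambda>q. dv (Y q) \<sigma>) - dv (Y p) (\<lambda>q. dv (X q) \<sigma>)) f"
  proof (cases "smooth_at p f")
    case True
    then obtain V0 where "open V0" "p \<in> V0" "smooth_fun V0 f"
      unfolding smooth_at_def by blast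
    then have V': "open (V0 \<inter> V)" "p \<in> V0 \<inter> V" "smooth_fun (V0 \<inter> V) f" "V0 \<inter> V \<subseteq> V" "V0 \<inter> V \<subseteq> W"
      using V p smooth_fun_subset[of V0 f "V0 \<inter> V"] by auto
    define V' where "V' = V0 \<inter> V"
    note V' = V'[folded V'_def]
    define F where "F = (\<lambda>z. f (proj z))"
    have F: "smooth_on (cone V') F" "open (cone V')"
      using V'(1,3) unfolding F_def smooth_fun_def by (simp_all add: open_cone)
    have s: "smooth_fun V' \<sigma>"
      using smooth_fun_subset[OF sec_smooth W_open] V' by blast
    have c: "\<sigma> q \<in> cone V'" if "q \<in> V'" for q
      using sec_cone that V' by blast
    have uc: "\<sigma> p \<in> cone V'" using c V' by blast
    have *: "X p (\<lambda>q. Y q f) = fd (\<lambda>z. fd F z (dv (Y p) \<sigma>)) (\<sigma> p) (dv (X p) \<sigma>)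
        + fd F (\<sigma> p) (dv (X p) (\<lambda>q. dv (Y q) \<sigma>))"
      if X: "vector_field V X" and Y: "vector_field V Y" for X Y
    proof -
      define \<eta> where "\<eta> = (\<lambda>q. dv (Y q) \<sigma>)"
      have tX: "X p \<in> tangent p" using X p vector_field_tangent by blast
      have sY: "smooth_fun V' \<eta>"
        unfolding \<eta>_def by (rule vector_field_smooth_dv[OF Y V'(1,4) s])
      have e1: "Y q f = fd F (\<sigma> q) (\<eta> q)" if "q \<in> V'" for q
        unfolding F_def \<eta>_def
        by (rule tvec_apply[OF V'(1) that _ V'(3)])
          (use that V' vector_field_tangent[OF Y] in auto)
      \<comment> \<open>The direction \<open>\<eta> q\<close> moves with \<open>q\<close>; it is
        split into fixed directions before the product rule is applied.\<close>
      have e2: "fd F (\<sigma> q) (\<eta> q) = (\<Sum>i\<in>UNIV. \<eta> q $ i * fd F (\<sigma> q) (axis i 1))" if "q \<in> V'" for q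
        unfolding real_scaleR_def[symmetric] by (rule linear_axis_expansion[OF linear_fd[OF F c[OF that]]])
      have "X p (\<lambda>q. Y q f) = X p (\<lambda>q. \<Sum>i\<in>UNIV. \<eta> q $ i * fd F (\<sigma> q) (axis i 1))"
        by (rule fun_tvec_cong[OF tX V'(1,2)]) (use e1 e2 in metis)
      also have "\<dots> = (\<Sum>i\<in>UNIV. X p (\<lambda>q. \<eta> q $ i * fd F (\<sigma> q) (axis i 1)))"
        by (rule tvec_sum_fun[OF tX V'(2,1)])
          (intro smooth_fun_mult V'(1) smooth_fun_nth[OF V'(1) sY]
            smooth_fun_compose[OF smooth_on_fd[OF F(1)] F(2) V'(1) s] c)
      also have "\<dots> = (\<Sum>i\<in>UNIV. \<eta> p $ i * fd (\<lambda>z. fd F z (axis i 1)) (\<sigma> p) (dv (X p) \<sigma>)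
          + dv (X p) \<eta> $ i * fd F (\<sigma> p) (axis i 1))"
      proof (rule sum.cong[OF refl])
        fix i
        have sm: "smooth_fun V' (\<lambda>q. fd F (\<sigma> q) (axis i 1))"
          by (rule smooth_fun_compose[OF smooth_on_fd[OF F(1)] F(2) V'(1) s c])
        have "X p (\<lambda>q. fd F (\<sigma> q) (axis i 1)) = fd (\<lambda>z. fd F (\<sigma> (proj z)) (axis i 1)) (\<sigma> p) (dv (X p) \<sigma>)"
          using tvec_apply[OF V'(1,2) pW sm tX] .
        also have "\<dots> = fd (\<lambda>z. fd F z (axis i 1)) (\<sigma> p) (fd (\<lambda>z. \<sigma> (proj z)) (\<sigma> p) (dv (X p) \<sigma>))"
          using fd_compose[where x = "\<sigma> p" and f = "\<lambda>z. \<sigma> (proj z)" and g = "\<lambda>z. fd F z (axis i 1)"]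
            smooth_fun_has_derivative[OF s V'(1) uc] smooth_on_differentiable[OF smooth_on_fd[OF F(1)] F(2) uc]
            proj_sec[OF pW] by (metis differentiableI)
        also have "fd (\<lambda>z. \<sigma> (proj z)) (\<sigma> p) (dv (X p) \<sigma>) = dv (X p) \<sigma>"
          using dv_dproj[OF s V'(1) uc, of "dv (X p) \<sigma>"] dproj_dv[OF pW tX] by simp
        finally show "X p (\<lambda>q. \<eta> q $ i * fd F (\<sigma> q) (axis i 1)) =
            \<eta> p $ i * fd (\<lambda>z. fd F z (axis i 1)) (\<sigma> p) (dv (X p) \<sigma>)
            + dv (X p) \<eta> $ i * fd F (\<sigma> p) (axis i 1)"
          using tvec_mult[OF tX V'(2,1) smooth_fun_nth[OF V'(1) sY] sm] by (simp add: dv_def)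
      qed
      also have "\<dots> = fd (\<lambda>z. fd F z (\<eta> p)) (\<sigma> p) (dv (X p) \<sigma>) + fd F (\<sigma> p) (dv (X p) \<eta>)"
      proof -
        have f1: "fd F (\<sigma> p) z = (\<Sum>i\<in>UNIV. z $ i * fd F (\<sigma> p) (axis i 1))" for z
          unfolding real_scaleR_def[symmetric] by (rule linear_axis_expansion[OF linear_fd[OF F uc]])
        have f2: "fd (\<lambda>z. fd F z (\<eta> p)) (\<sigma> p) w
            = (\<Sum>i\<in>UNIV. \<eta> p $ i * fd (\<lambda>z. fd F z (axis i 1)) (\<sigma> p) w)" for w
        proof -
          have "fd (\<lambda>z. fd F z (\<eta> p)) (\<sigma> p) = fd (\<lambda>z. \<Sum>i\<in>UNIV. \<eta> p $ i * fd F z (axis i 1)) (\<sigma> p)"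
          proof (rule fd_open_cong[OF F(2) uc])
            fix z assume "z \<in> cone V'"
            then show "fd F z (\<eta> p) = (\<Sum>i\<in>UNIV. \<eta> p $ i * fd F z (axis i 1))"
              unfolding real_scaleR_def[symmetric] by (intro linear_axis_expansion linear_fd[OF F])
          qed
          also have "\<dots> = (\<lambda>w. \<Sum>i\<in>UNIV. \<eta> p $ i * fd (\<lambda>z. fd F z (axis i 1)) (\<sigma> p) w)"
            by (rule fd_eq, rule has_derivative_sum, rule has_derivative_mult_right)
              (rule smooth_on_has_derivative[OF smooth_on_fd[OF F(1)] F(2) uc])
          finally show ?thesis by simp
        qed
        show ?thesis
          unfolding f1[of "dv (X p) \<eta>"] f2[of "dv (X p) \<sigma>"] by (rule sum.distrib)
      qed
      finally show ?thesis unfolding \<eta>_def .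
    qed
    have "bracket X Y p f = X p (\<lambda>q. Y q f) - Y p (\<lambda>q. X q f)"
      using True by (simp add: bracket_def)
    also have "\<dots> = fd F (\<sigma> p) (dv (X p) (\<lambda>q. dv (Y q) \<sigma>)) - fd F (\<sigma> p) (dv (Y p) (\<lambda>q. dv (X q) \<sigma>))"
      using *[OF X Y] *[OF Y X] fd_fd_commute_real[OF F uc] by simp
    also have "\<dots> = fd F (\<sigma> p) (dv (X p) (\<lambda>q. dv (Y q) \<sigma>) - dv (Y p) (\<lambda>q. dv (X q) \<sigma>))"
      by (simp add: linear_diff[OF linear_fd[OF F uc]])
    finally show ?thesis
      using True pW by (simp add: F_def dproj_def proj_sec)
  qed (use pW in \<open>simp add: bracket_def dproj_def proj_sec\<close>)
qed

lemma bracket_tangent: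
  assumes "open V" "V \<subseteq> W" "vector_field V X" "vector_field V Y" "p \<in> V"
  shows "bracket X Y p \<in> tangent p"
  using bracket_dproj[OF assms] dproj_tangent assms by (metis subsetD)

end

text \<open>The section picks on each line the point of the affine hyperplane where \<open>l\<close>
  equals 1.\<close>

lemma linear_functional_section:
  fixes l :: "real ^ 'k::finite \<Rightarrow> real"
  assumes l: "linear l"
  defines "W \<equiv> proj ` {u. l u \<noteq> 0}" and "\<sigma> \<equiv> descend (\<lambda>u. (1 / l u) *\<^sub>R u)"
  shows "proj_section W \<sigma>" "u \<in> cone W \<longleftrightarrow> l u \<noteq> 0" "l u \<noteq> 0 \<Longrightarrow> \<sigma> (proj u) = (1 / l u) *\<^sub>R u"
proof -
  have "bounded_linear l" using l by (rule linear_conv_bounded_linear[THEN iffD1])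
  then have sl: "smooth_on S l" if "open S" for S
    using smooth_on_bounded_linear[OF _ that smooth_on_ident[OF that]] by blast
  have "open {u. l u \<noteq> 0}"
    by (intro open_Collect_neq continuous_on_const linear_continuous_on \<open>bounded_linear l\<close>)
  from open_proj_Collect[OF this] have o: "open W" and c: "\<And>u. u \<in> cone W \<longleftrightarrow> l u \<noteq> 0"
    unfolding W_def using linear_0[OF l] linear_cmul[OF l] by auto
  have s: "\<sigma> (proj u) = (1 / l u) *\<^sub>R u" if "l u \<noteq> 0" for u
    unfolding \<sigma>_def
    by (rule descend_proj) (use that linear_0[OF l] linear_cmul[OF l] in auto)
  show "proj_section W \<sigma>"
  proof
    show "open W" by (rule o)
    show "smooth_fun W \<sigma>"
      unfolding \<sigma>_def
      by (intro smooth_fun_descend smooth_on_scaleR smooth_on_divide o open_cone smooth_on_const smooth_on_ident sl)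
        (auto simp: c linear_cmul[OF l])
    fix p assume "p \<in> W"
    then obtain u where u: "p = proj u" "l u \<noteq> 0" unfolding W_def by blast
    then have "u \<noteq> 0" using linear_0[OF l] by auto
    then show "\<sigma> p \<noteq> 0" "proj (\<sigma> p) = p"
      using u by (simp_all add: s proj_scale)
  qed
  show "u \<in> cone W \<longleftrightarrow> l u \<noteq> 0" "l u \<noteq> 0 \<Longrightarrow> \<sigma> (proj u) = (1 / l u) *\<^sub>R u"
    using c s by auto
qed

subsection \<open>The symplectic form\<close>

lemma sum_UNIV_option: "(\<Sum>x\<in>UNIV. f x) = f None + (\<Sum>x\<in>UNIV. f (Some x))" for f :: "'a::finite option \<Rightarrow> 'b::comm_monoid_add"
  by (simp add: UNIV_option_conv sum.reindex)

locale symp =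
  fixes \<omega> :: "real ^ 'm::finite ^ 'm"
  assumes skew: "\<And>p q. \<omega> $ p $ q = - \<omega> $ q $ p" and nondeg: "invertible \<omega>" and card2: "CARD('m) \<ge> 2"
begin

abbreviation Om :: "real ^ 'm ix \<Rightarrow> real ^ 'm ix \<Rightarrow> real" where "Om \<equiv> Omega \<omega>"

lemma bounded_bilinear_Om: "bounded_bilinear Om"
proof (rule bilinear_conv_bounded_bilinear[THEN iffD1])
  show "bilinear Om"
    unfolding bilinear_def
    by (intro conjI allI linearI)
      (simp_all add: Omega_def algebra_simps sum.distrib sum_distrib_left)
qed

sublocale Om: bounded_bilinear Om by (rule bounded_bilinear_Om)

lemma Om_skew: "Om u v = - Om v u"
proof -
  have "(\<Sum>p\<in>UNIV. \<Sum>q\<in>UNIV. \<omega> $ p $ q * u $ Some (Some p) * v $ Some (Some q))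
      = (\<Sum>q\<in>UNIV. \<Sum>p\<in>UNIV. \<omega> $ p $ q * u $ Some (Some p) * v $ Some (Some q))"
    by (rule sum.swap)
  also have "\<dots> = (\<Sum>q\<in>UNIV. \<Sum>p\<in>UNIV. - (\<omega> $ q $ p * v $ Some (Some q) * u $ Some (Some p)))"
    using skew by (intro sum.cong refl) (metis mult.commute mult.left_commute mult_minus_left)
  finally show ?thesis
    by (simp add: Omega_def sum_negf algebra_simps)
qed

lemma Om_self [simp]: "Om u u = 0"
  using Om_skew[of u u] by simp

text \<open>The basis whose pairing from the left under \<Omega> reads off coordinates
  (\<open>Om_dual\<close>); this dictates the minus sign at \<infinity> and the inverse of \<omega>
  on the Latin indices.\<close>

definition dual :: "'m ix \<Rightarrow> real ^ 'm ix" where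
  "dual a = (case a of None \<Rightarrow> - axis (Some None) 1 | Some None \<Rightarrow> axis None 1
     | Some (Some q) \<Rightarrow> (\<Sum>p\<in>UNIV. matrix_inv \<omega> $ q $ p *\<^sub>R axis (Some (Some p)) 1))"

lemma Om_dual: "Om (dual a) w = w $ a"
proof -
  have ax: "Om (axis (Some None) 1) w = - w $ None" "Om (axis None 1) w = w $ Some None"
    by (simp_all add: Omega_def axis_def)
  have axq: "Om (axis (Some (Some p)) 1) w = (\<Sum>q\<in>UNIV. \<omega> $ p $ q * w $ Some (Some q))" for p
  proof -
    have "Om (axis (Some (Some p)) 1) w
        = (\<Sum>p'\<in>UNIV. \<Sum>q\<in>UNIV. \<omega> $ p' $ q * (if p' = p then 1 else 0) * w $ Some (Some q))"
      by (simp add: Omega_def axis_def)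
    also have "\<dots> = (\<Sum>p'\<in>UNIV. if p' = p then (\<Sum>q\<in>UNIV. \<omega> $ p $ q * w $ Some (Some q)) else 0)"
      by (intro sum.cong refl) auto
    finally show ?thesis by simp
  qed
  consider "a = None" | "a = Some None" | q where "a = Some (Some q)"
    by (metis option.exhaust)
  then show ?thesis
  proof cases
    case 3
    have i: "(\<Sum>p\<in>UNIV. matrix_inv \<omega> $ q $ p * \<omega> $ p $ r) = (if q = r then 1 else 0)" for r
    proof -
      have "matrix_inv \<omega> ** \<omega> = mat 1"
        using nondeg unfolding invertible_def matrix_inv_def by (metis (mono_tags, lifting) someI_ex)
      then show ?thesis
        by (simp add: matrix_matrix_mult_def mat_def vec_eq_iff)
    qed
    have "Om (dual a) w = (\<Sum>p\<in>UNIV. matrix_inv \<omega> $ q $ p * (\<Sum>r\<in>UNIV. \<omega> $ p $ r * w $ Some (Some r)))"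
      by (simp add: dual_def 3 Om.sum_left Om.scaleR_left axq)
    also have "\<dots> = (\<Sum>r\<in>UNIV. (\<Sum>p\<in>UNIV. matrix_inv \<omega> $ q $ p * \<omega> $ p $ r) * w $ Some (Some r))"
      by (simp add: sum_distrib_left sum_distrib_right mult.assoc) (rule sum.swap)
    also have "\<dots> = w $ a" by (simp add: i 3 if_distrib[of "\<lambda>x. x * _"] cong: if_cong)
    finally show ?thesis .
  qed (simp_all add: dual_def ax Om.minus_left)
qed

text \<open>The vector that represents a functional through \<Omega>. The explicit sum makes it
  visibly smooth when the functional depends smoothly on a parameter.\<close>

definition sharp :: "(real ^ 'm ix \<Rightarrow> real) \<Rightarrow> real ^ 'm ix" where
  "sharp l = (\<Sum>a\<in>UNIV. l (axis a 1) *\<^sub>R dual a)"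

lemma Om_sharp: assumes "linear l" shows "Om (sharp l) w = l w"
proof -
  have "Om (sharp l) w = (\<Sum>a\<in>UNIV. w $ a *\<^sub>R l (axis a 1))"
    by (simp add: sharp_def Om.sum_left Om.scaleR_left Om_dual mult.commute)
  then show ?thesis
    using linear_axis_expansion[OF assms, of w] by (simp only:)
qed

lemma Om_eqI: assumes "\<And>w. Om z w = Om z' w" shows "z = z'"
proof (subst vec_eq_iff, rule allI)
  fix a
  have "z $ a = - Om z (dual a)" for z using Om_dual Om_skew by metis
  then show "z $ a = z' $ a" using assms by simp
qed

lemma ex_Om_1: assumes "u \<noteq> 0" shows "\<exists>\<tau>. Om u \<tau> = 1"
proof -
  have "\<exists>w. Om u w \<noteq> 0"
    using Om_eqI[of u 0] assms by (auto simp: Om.zero_left)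
  then obtain w where "Om u w \<noteq> 0" ..
  then show ?thesis by (intro exI[of _ "(1 / Om u w) *\<^sub>R w"]) (simp add: Om.scaleR_right)
qed

text \<open>Subtracting \<open>Om u w *\<^sub>R \<tau>\<close> moves \<open>w\<close> into the
  \<Omega>-complement of \<open>u\<close>, so only the \<tau>-component is seen by
  \<open>l\<close>.\<close>

lemma functional_on_perp:
  assumes "Om u \<tau> = 1" "linear l" "\<And>w. Om u w = 0 \<Longrightarrow> l w = 0"
  shows "l w = l \<tau> * Om u w"
proof -
  have "Om u (w - Om u w *\<^sub>R \<tau>) = 0" by (simp add: Om.diff_right Om.scaleR_right assms(1))
  then have "l (w - Om u w *\<^sub>R \<tau>) = 0" by (rule assms(3))
  then show ?thesis by (simp add: linear_diff[OF assms(2)] linear_cmul[OF assms(2)])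
qed

lemma linear_Om_right: "linear (Om a)"
  by (intro linearI) (simp_all add: Om.add_right Om.scaleR_right)

text \<open>Otherwise \<open>Om a\<close> would vanish on the complement of \<open>u\<close> and be
  a multiple of \<open>Om u\<close>: the double complement of a line is the line.\<close>

lemma ex_perp_Om_nonzero:
  assumes "u \<noteq> 0" "\<And>c. a \<noteq> c *\<^sub>R u"
  shows "\<exists>d. Om u d = 0 \<and> Om d a \<noteq> 0"
proof (rule ccontr)
  assume n: "\<nexists>d. Om u d = 0 \<and> Om d a \<noteq> 0"
  obtain \<tau> where t: "Om u \<tau> = 1" using ex_Om_1[OF assms(1)] ..
  have *: "Om a w = Om a \<tau> * Om u w" for w
    by (rule functional_on_perp[OF t linear_Om_right]) (use n Om_skew in \<open>metis minus_zero\<close>)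
  have "a = Om a \<tau> *\<^sub>R u"
    by (rule Om_eqI) (simp only: Om.scaleR_left real_scaleR_def *[symmetric])
  then show False using assms(2) by blast
qed

lemma card_ix: "CARD('m ix) \<ge> 4" "CARD('m ix) = CARD('m) + 2"
  using card2 by (simp_all add: card_UNIV_option)

lemma ex_not_in_span2:
  fixes u v :: "real ^ 'm ix"
  shows "\<exists>a. a \<notin> span {u, v}"
proof (rule ccontr)
  assume "\<nexists>a. a \<notin> span {u, v}"
  then have "span {u, v} = UNIV" by blast
  then have "dim {u, v} = CARD('m ix)"
    using dim_span[of "{u, v}"] by (simp add: dim_UNIV)
  moreover have "dim {u, v} \<le> card {u, v}" by (rule dim_le_card') simp
  moreover have "card {u, v} \<le> 2" by (simp add: card_insert_le_m1)
  ultimately show False using card_ix by linarith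
qed

text \<open>The dimension is at least 4, so some vector lies outside the plane of \<open>u\<close>
  and \<tau>. Corrected by a multiple of \<tau> it enters the complement of \<open>u\<close> without
  becoming a multiple of \<open>u\<close>.\<close>

lemma ex_perp_pair:
  assumes "u \<noteq> 0"
  shows "\<exists>a d. Om u a = 0 \<and> Om u d = 0 \<and> Om d a \<noteq> 0"
proof -
  obtain \<tau> where t: "Om u \<tau> = 1" using ex_Om_1[OF assms] ..
  obtain z where z: "z \<notin> span {u, \<tau>}" using ex_not_in_span2 by blast
  define a where "a = z - Om u z *\<^sub>R \<tau>"
  have a: "Om u a = 0" by (simp add: a_def Om.diff_right Om.scaleR_right t)
  have "a \<noteq> c *\<^sub>R u" for c
  proof
    assume "a = c *\<^sub>R u"
    then have "z = c *\<^sub>R u + Om u z *\<^sub>R \<tau>" unfolding a_def by (simp add: algebra_simps)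
    moreover have "c *\<^sub>R u + Om u z *\<^sub>R \<tau> \<in> span {u, \<tau>}"
      by (intro span_add span_scale span_base) auto
    ultimately show False using z by simp
  qed
  then show ?thesis using ex_perp_Om_nonzero[OF assms] a by blast
qed

end

subsection \<open>Homogeneous symplectic lifts\<close>

lemma fd_scaled:
  assumes "open C" "\<And>x r. x \<in> C \<Longrightarrow> r \<noteq> 0 \<Longrightarrow> r *\<^sub>R x \<in> C" "smooth_on C F"
    and "\<And>x. x \<in> C \<Longrightarrow> F (r *\<^sub>R x) = c *\<^sub>R F x" and "r \<noteq> 0" "u \<in> C"
  shows "r *\<^sub>R fd F (r *\<^sub>R u) w = c *\<^sub>R fd F u w"
proof -
  have ru: "r *\<^sub>R u \<in> C" using assms by blast
  have 1: "((\<lambda>x. F (r *\<^sub>R x)) has_derivative (\<lambda>w. fd F (r *\<^sub>R u) (r *\<^sub>R w))) (at u)"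
    using has_derivative_compose[OF has_derivative_scaleR_right[OF has_derivative_ident]
        smooth_on_has_derivative[OF assms(3,1) ru]] .
  have 2: "((\<lambda>x. c *\<^sub>R F x) has_derivative (\<lambda>w. c *\<^sub>R fd F u w)) (at u)"
    by (rule has_derivative_scaleR_right[OF smooth_on_has_derivative[OF assms(3,1,6)]])
  have "((\<lambda>x. F (r *\<^sub>R x)) has_derivative (\<lambda>w. c *\<^sub>R fd F u w)) (at u)"
    using has_derivative_open_cong[OF assms(1,6), of "\<lambda>x. F (r *\<^sub>R x)" "\<lambda>x. c *\<^sub>R F x"] assms(4) 2 by blast
  from fun_cong[OF has_derivative_unique[OF 1 this], of w] show ?thesis
    by (simp add: linear_cmul[OF linear_fd[OF assms(3,1) ru]])
qed

text \<open>Euler's relation. The general scaling law \<open>h\<close> covers degree one, for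
  \<Phi>, and degree zero, for its derivative.\<close>

lemma fd_radial:
  assumes "F differentiable (at u)" "\<And>r. r \<noteq> 0 \<Longrightarrow> F (r *\<^sub>R u) = h r *\<^sub>R F u"
    and "(h has_real_derivative h') (at 1)"
  shows "fd F u u = h' *\<^sub>R F u"
proof -
  have "((\<lambda>t::real. t *\<^sub>R u) has_derivative (\<lambda>t. t *\<^sub>R u)) (at 1)"
    by (auto intro!: derivative_eq_intros)
  moreover have "(F has_derivative fd F u) (at (1 *\<^sub>R u))"
    using fd_works[OF assms(1)] by simp
  ultimately have 1: "((\<lambda>t. F (t *\<^sub>R u)) has_derivative (\<lambda>t. fd F u (t *\<^sub>R u))) (at (1::real))"
    by (rule has_derivative_compose)
  have 2: "((\<lambda>t. h t *\<^sub>R F u) has_derivative (\<lambda>t. (h' * t) *\<^sub>R F u)) (at 1)"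
    using has_derivative_scaleR_left[OF assms(3)[unfolded has_field_derivative_def], of "F u"]
    by simp
  have "((\<lambda>t. F (t *\<^sub>R u)) has_derivative (\<lambda>t. (h' * t) *\<^sub>R F u)) (at 1)"
    using has_derivative_open_cong[OF open_nonzero_real, of 1 "\<lambda>t. F (t *\<^sub>R u)" "\<lambda>t. h t *\<^sub>R F u"] assms(2) 2
    by simp
  from fun_cong[OF has_derivative_unique[OF 1 this], of 1] show ?thesis by simp
qed

lemma fd_bilinear:
  assumes "bounded_bilinear B" "f differentiable (at x)" "g differentiable (at x)"
  shows "fd (\<lambda>x. B (f x) (g x)) x v = B (f x) (fd g x v) + B (fd f x v) (g x)"
  using fd_eq[OF bounded_bilinear.FDERIV[OF assms(1) fd_works[OF assms(2)] fd_works[OF assms(3)]]] by simp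

context symp
begin

text \<open>A tensor depending on a base point \<open>x\<close> that vanishes on the \<open>\<Omega>\<close>-complement of \<open>x\<close> at every
  \<open>x\<close>: its derivative at \<open>u\<close> is found by replacing an argument \<open>a\<close> with
  \<open>\<Omega>(x, \<tau>) a - \<Omega>(x, a) \<tau>\<close>, which is in the complement of \<open>x\<close>.\<close>

lemma variation1:
  fixes P :: "real ^ 'm ix \<Rightarrow> real ^ 'm ix \<Rightarrow> real"
  assumes C: "open C" "u \<in> C" and t: "Om u \<tau> = 1" and a: "Om u a = 0"
    and d: "\<And>a. (\<lambda>x. P x a) differentiable (at u)"
    and l: "\<And>x. x \<in> C \<Longrightarrow> linear (P x)"
    and z: "\<And>x a. x \<in> C \<Longrightarrow> Om x a = 0 \<Longrightarrow> P x a = 0"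
  shows "fd (\<lambda>x. P x a) u w = Om w a * P u \<tau>"
proof -
  have O: "(\<lambda>x. Om x y) differentiable (at u)" "fd (\<lambda>x. Om x y) u w = Om w y" for y
    using fd_eq[OF bounded_linear_imp_has_derivative[OF Om.bounded_linear_left[of y]], of u]
      bounded_linear_imp_differentiable[OF Om.bounded_linear_left] by auto
  have e: "Om x \<tau> * P x a = Om x a * P x \<tau>" if "x \<in> C" for x
  proof -
    have "P x (Om x \<tau> *\<^sub>R a - Om x a *\<^sub>R \<tau>) = 0"
      by (rule z[OF that]) (simp add: Om.diff_right Om.scaleR_right)
    then show ?thesis by (simp add: linear_diff[OF l[OF that]] linear_cmul[OF l[OF that]])
  qed
  have "fd (\<lambda>x. Om x \<tau> * P x a) u w = fd (\<lambda>x. Om x a * P x \<tau>) u w"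
    using fd_open_cong[OF C, of "\<lambda>x. Om x \<tau> * P x a" "\<lambda>x. Om x a * P x \<tau>"] e by simp
  then show ?thesis
    using fd_bilinear[OF bounded_bilinear_mult O(1) d] O(2) t a z[OF C(2) a] by simp
qed

lemma variation2:
  fixes P :: "real ^ 'm ix \<Rightarrow> real ^ 'm ix \<Rightarrow> real ^ 'm ix \<Rightarrow> real"
  assumes C: "open C" "u \<in> C" and t: "Om u \<tau> = 1" and ab: "Om u a = 0" "Om u b = 0"
    and d: "\<And>a b. (\<lambda>x. P x a b) differentiable (at u)"
    and l: "\<And>x b. x \<in> C \<Longrightarrow> linear (\<lambda>a. P x a b)" "\<And>x a. x \<in> C \<Longrightarrow> linear (P x a)"
    and z: "\<And>x a b. x \<in> C \<Longrightarrow> Om x a = 0 \<Longrightarrow> Om x b = 0 \<Longrightarrow> P x a b = 0"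
  shows "fd (\<lambda>x. P x a b) u w = Om w a * P u \<tau> b + Om w b * P u a \<tau>"
proof -
  have O: "(\<lambda>x. Om x y) differentiable (at u)" "fd (\<lambda>x. Om x y) u w = Om w y" for y
    using fd_eq[OF bounded_linear_imp_has_derivative[OF Om.bounded_linear_left[of y]], of u]
      bounded_linear_imp_differentiable[OF Om.bounded_linear_left] by auto
  define P' where "P' = (\<lambda>x a. Om x \<tau> * P x a b - Om x b * P x a \<tau>)"
  have m: "(\<lambda>x. Om x y * P x c e) differentiable (at u)" for y c e
    by (intro differentiable_mult O d)
  have "fd (\<lambda>x. P' x a) u w = Om w a * P' u \<tau>"
  proof (rule variation1[OF C t ab(1)])
    show "(\<lambda>x. P' x a) differentiable (at u)" for a
      unfolding P'_def by (intro differentiable_diff m)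
    fix x assume x: "x \<in> C"
    show "linear (P' x)"
      unfolding P'_def
      by (intro linearI) (simp_all add: linear_add[OF l(1)[OF x]] linear_cmul[OF l(1)[OF x]] algebra_simps)
    fix a assume "Om x a = 0"
    then have "P x a (Om x \<tau> *\<^sub>R b - Om x b *\<^sub>R \<tau>) = 0"
      by (intro z[OF x]) (simp_all add: Om.diff_right Om.scaleR_right)
    then show "P' x a = 0"
      by (simp add: P'_def linear_diff[OF l(2)[OF x]] linear_cmul[OF l(2)[OF x]])
  qed
  moreover have "fd (\<lambda>x. P' x a) u w = fd (\<lambda>x. Om x \<tau> * P x a b) u w - fd (\<lambda>x. Om x b * P x a \<tau>) u w"
    unfolding P'_def using fd_eq[OF has_derivative_diff[OF fd_works[OF m] fd_works[OF m]]] by simp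
  ultimately show ?thesis
    using fd_bilinear[OF bounded_bilinear_mult O(1) d] O(2) t ab z[OF C(2) ab] by (simp add: P'_def)
qed

lemma variation3:
  fixes P :: "real ^ 'm ix \<Rightarrow> real ^ 'm ix \<Rightarrow> real ^ 'm ix \<Rightarrow> real ^ 'm ix \<Rightarrow> real"
  assumes C: "open C" "u \<in> C" and t: "Om u \<tau> = 1" and abc: "Om u a = 0" "Om u b = 0" "Om u c = 0"
    and d: "\<And>a b c. (\<lambda>x. P x a b c) differentiable (at u)"
    and l: "\<And>x b c. x \<in> C \<Longrightarrow> linear (\<lambda>a. P x a b c)" "\<And>x a c. x \<in> C \<Longrightarrow> linear (\<lambda>b. P x a b c)"
      "\<And>x a b. x \<in> C \<Longrightarrow> linear (P x a b)"
    and z: "\<And>x a b c. x \<in> C \<Longrightarrow> Om x a = 0 \<Longrightarrow> Om x b = 0 \<Longrightarrow> Om x c = 0 \<Longrightarrow> P x a b c = 0"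
  shows "fd (\<lambda>x. P x a b c) u w = Om w a * P u \<tau> b c + Om w b * P u a \<tau> c + Om w c * P u a b \<tau>"
proof -
  have O: "(\<lambda>x. Om x y) differentiable (at u)" "fd (\<lambda>x. Om x y) u w = Om w y" for y
    using fd_eq[OF bounded_linear_imp_has_derivative[OF Om.bounded_linear_left[of y]], of u]
      bounded_linear_imp_differentiable[OF Om.bounded_linear_left] by auto
  define P' where "P' = (\<lambda>x a b. Om x \<tau> * P x a b c - Om x c * P x a b \<tau>)"
  have m: "(\<lambda>x. Om x y * P x c e f) differentiable (at u)" for y c e f
    by (intro differentiable_mult O d)
  have "fd (\<lambda>x. P' x a b) u w = Om w a * P' u \<tau> b + Om w b * P' u a \<tau>"
  proof (rule variation2[OF C t abc(1,2)])
    show "(\<lambda>x. P' x a b) differentiable (at u)" for a b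
      unfolding P'_def by (intro differentiable_diff m)
    fix x assume x: "x \<in> C"
    show "linear (\<lambda>a. P' x a b)" for b
      unfolding P'_def
      by (intro linearI) (simp_all add: linear_add[OF l(1)[OF x]] linear_cmul[OF l(1)[OF x]] algebra_simps)
    show "linear (P' x a)" for a
      unfolding P'_def
      by (intro linearI) (simp_all add: linear_add[OF l(2)[OF x]] linear_cmul[OF l(2)[OF x]] algebra_simps)
    fix a b assume "Om x a = 0" "Om x b = 0"
    then have "P x a b (Om x \<tau> *\<^sub>R c - Om x c *\<^sub>R \<tau>) = 0"
      by (intro z[OF x]) (simp_all add: Om.diff_right Om.scaleR_right)
    then show "P' x a b = 0"
      by (simp add: P'_def linear_diff[OF l(3)[OF x]] linear_cmul[OF l(3)[OF x]])
  qed
  moreover have "fd (\<lambda>x. P' x a b) u w = fd (\<lambda>x. Om x \<tau> * P x a b c) u w - fd (\<lambda>x. Om x c * P x a b \<tau>) u w"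
    unfolding P'_def using fd_eq[OF has_derivative_diff[OF fd_works[OF m] fd_works[OF m]]] by simp
  ultimately show ?thesis
    using fd_bilinear[OF bounded_bilinear_mult O(1) d] O(2) t abc z[OF C(2) abc] by (simp add: P'_def)
qed

end

text \<open>Differentiating \<open>Phi_contact\<close> shows that the derivative of \<open>\<Phi>\<close> is symplectic up to the
  sign \<open>\<epsilon>\<close>, which is \<open>-1\<close> when \<open>\<Phi>\<close> lifts a map reversing the coorientation.\<close>

locale symp_lift = symp \<omega> for \<omega> :: "real ^ 'm::finite ^ 'm" +
  fixes U :: "'m ix projspace set" and \<Phi> :: "real ^ 'm ix \<Rightarrow> real ^ 'm ix" and \<epsilon> :: real
  assumes U_open: "open U" and Phi_smooth: "smooth_on (cone U) \<Phi>"
    and Phi_hom: "u \<in> cone U \<Longrightarrow> r \<noteq> 0 \<Longrightarrow> \<Phi> (r *\<^sub>R u) = r *\<^sub>R \<Phi> u"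
    and eps: "\<epsilon> = 1 \<or> \<epsilon> = -1"
    and Phi_contact: "u \<in> cone U \<Longrightarrow> Om (\<Phi> u) (fd \<Phi> u w) = \<epsilon> * Om u w"
begin

lemma open_C: "open (cone U)" by (rule open_cone[OF U_open])

lemma eps_sq [simp]: "\<epsilon> * \<epsilon> = 1" "\<epsilon> * (\<epsilon> * x) = x" "\<epsilon> \<noteq> 0"
  using eps by auto

lemma DPhi_smooth: "smooth_on (cone U) (\<lambda>x. fd \<Phi> x a)"
  by (rule smooth_on_fd[OF Phi_smooth])

lemma linear_DPhi: "u \<in> cone U \<Longrightarrow> linear (fd \<Phi> u)"
  by (rule linear_fd[OF Phi_smooth open_C])

lemma DPhi_hom: "u \<in> cone U \<Longrightarrow> r \<noteq> 0 \<Longrightarrow> fd \<Phi> (r *\<^sub>R u) w = fd \<Phi> u w"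
  using fd_scaled[OF open_C scale_in_cone Phi_smooth, of r r u w] Phi_hom by simp

lemma DPhi_self: assumes "u \<in> cone U" shows "fd \<Phi> u u = \<Phi> u"
proof -
  have "fd \<Phi> u u = 1 *\<^sub>R \<Phi> u"
    by (rule fd_radial[where h = "\<lambda>r. r", OF smooth_on_differentiable[OF Phi_smooth open_C assms] Phi_hom[OF assms]])
      (auto intro: derivative_intros)
  then show ?thesis by simp
qed

definition D2 :: "real ^ 'm ix \<Rightarrow> real ^ 'm ix \<Rightarrow> real ^ 'm ix \<Rightarrow> real ^ 'm ix" where
  "D2 u a b = fd (\<lambda>x. fd \<Phi> x a) u b"

lemma D2_sym: "u \<in> cone U \<Longrightarrow> D2 u a b = D2 u b a"
  unfolding D2_def by (rule fd_fd_commute[OF Phi_smooth open_C])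

lemma linear_D2_right: "u \<in> cone U \<Longrightarrow> linear (D2 u a)"
  unfolding D2_def by (rule linear_fd[OF DPhi_smooth open_C])

lemma linear_D2_left: assumes "u \<in> cone U" shows "linear (\<lambda>a. D2 u a b)"
proof -
  have "(\<lambda>a. D2 u a b) = D2 u b" using D2_sym[OF assms] by blast
  then show ?thesis using linear_D2_right[OF assms] by simp
qed

lemma D2_smooth: "smooth_on (cone U) (\<lambda>x. D2 x a b)"
  unfolding D2_def by (rule smooth_on_fd[OF DPhi_smooth])

lemma D2_self: assumes "u \<in> cone U" shows "D2 u a u = 0"
proof -
  have "D2 u a u = 0 *\<^sub>R fd \<Phi> u a"
    unfolding D2_def
    by (rule fd_radial[where h = "\<lambda>r. 1", OF smooth_on_differentiable[OF DPhi_smooth open_C assms]])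
      (auto simp: DPhi_hom[OF assms])
  then show ?thesis by simp
qed

text \<open>Differentiating \<open>Phi_contact\<close> along \<open>v\<close> leaves the extra term
  \<open>Om (\<Phi> u) (D2 u w v)\<close>, which is symmetric in \<open>v\<close> and
  \<open>w\<close> and disappears on antisymmetrizing.\<close>

lemma DPhi_symplectic:
  assumes u: "u \<in> cone U" shows "Om (fd \<Phi> u v) (fd \<Phi> u w) = \<epsilon> * Om v w"
proof -
  have d: "Om (\<Phi> u) (D2 u w v) + Om (fd \<Phi> u v) (fd \<Phi> u w) = \<epsilon> * Om v w" for v w
  proof -
    have "fd (\<lambda>x. Om (\<Phi> x) (fd \<Phi> x w)) u v = Om (\<Phi> u) (D2 u w v) + Om (fd \<Phi> u v) (fd \<Phi> u w)"
      unfolding D2_def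
      by (rule fd_bilinear[OF bounded_bilinear_Om])
        (rule smooth_on_differentiable[OF _ open_C u], rule Phi_smooth,
          rule smooth_on_differentiable[OF _ open_C u], rule DPhi_smooth)
    moreover have "fd (\<lambda>x. Om (\<Phi> x) (fd \<Phi> x w)) u = fd (\<lambda>x. \<epsilon> * Om x w) u"
      by (rule fd_open_cong[OF open_C u]) (rule Phi_contact)
    moreover have "fd (\<lambda>x. \<epsilon> * Om x w) u = (\<lambda>v. \<epsilon> * Om v w)"
      by (rule fd_eq) (intro bounded_linear_imp_has_derivative bounded_linear_const_mult Om.bounded_linear_left)
    ultimately show ?thesis by simp
  qed
  show ?thesis
    using d[of v w] d[of w v] D2_sym[OF u, of v w] Om_skew[of v w] Om_skew[of "fd \<Phi> u v" "fd \<Phi> u w"]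
    by simp
qed

lemma DPhi_inj: assumes u: "u \<in> cone U" and "fd \<Phi> u v = fd \<Phi> u w" shows "v = w"
proof (rule Om_eqI)
  fix z
  have "\<epsilon> * Om v z = \<epsilon> * Om w z"
    using DPhi_symplectic[OF u, of v z] DPhi_symplectic[OF u, of w z] assms(2) by simp
  then show "Om v z = Om w z" by simp
qed

lemma DPhi_surj: assumes u: "u \<in> cone U" shows "\<exists>v. fd \<Phi> u v = z"
proof -
  have "inj (fd \<Phi> u)" using DPhi_inj[OF u] by (intro injI)
  then have "surj (fd \<Phi> u)"
    using linear_injective_imp_surjective[OF linear_DPhi[OF u]] by blast
  then show ?thesis by (metis surjD)
qed

text \<open>The inverse of \<open>fd \<Phi> u\<close>, written as \<epsilon> times its
  \<Omega>-adjoint so that smoothness in \<open>u\<close> is evident.\<close>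

definition DPhi_inv :: "real ^ 'm ix \<Rightarrow> real ^ 'm ix \<Rightarrow> real ^ 'm ix" where
  "DPhi_inv u z = sharp (\<lambda>c. \<epsilon> * Om z (fd \<Phi> u c))"

lemma Om_DPhi_inv: assumes u: "u \<in> cone U" shows "Om (DPhi_inv u z) w = \<epsilon> * Om z (fd \<Phi> u w)"
  unfolding DPhi_inv_def
  by (rule Om_sharp, rule linearI)
    (simp_all add: linear_add[OF linear_DPhi[OF u]] linear_cmul[OF linear_DPhi[OF u]] Om.add_right Om.scaleR_right algebra_simps)

lemma DPhi_DPhi_inv: assumes u: "u \<in> cone U" shows "fd \<Phi> u (DPhi_inv u z) = z"
proof (rule Om_eqI)
  fix w
  obtain v where "fd \<Phi> u v = w" using DPhi_surj[OF u] by blast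
  then show "Om (fd \<Phi> u (DPhi_inv u z)) w = Om z w"
    using DPhi_symplectic[OF u, of "DPhi_inv u z" v] Om_DPhi_inv[OF u, of z v] by simp
qed

lemma DPhi_inv_DPhi: "u \<in> cone U \<Longrightarrow> DPhi_inv u (fd \<Phi> u z) = z"
  using DPhi_inj DPhi_DPhi_inv by blast

lemma linear_DPhi_inv: assumes "u \<in> cone U" shows "linear (DPhi_inv u)"
  by (rule linearI; rule DPhi_inj[OF assms])
    (simp_all add: DPhi_DPhi_inv[OF assms] linear_add[OF linear_DPhi[OF assms]] linear_cmul[OF linear_DPhi[OF assms]])

lemma smooth_DPhi_inv:
  assumes "smooth_on (cone U) f"
  shows "smooth_on (cone U) (\<lambda>u. DPhi_inv u (f u))"
  unfolding DPhi_inv_def sharp_def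
  by (intro smooth_on_sum smooth_on_scaleR smooth_on_mult smooth_on_const open_C
      smooth_on_bilinear[OF bounded_bilinear_Om] assms DPhi_smooth)

text \<open>The Christoffel symbols on the cone of the flat connection pulled back by
  \<Phi>.\<close>

definition B :: "real ^ 'm ix \<Rightarrow> real ^ 'm ix \<Rightarrow> real ^ 'm ix \<Rightarrow> real ^ 'm ix" where
  "B u a b = DPhi_inv u (D2 u a b)"

lemma DPhi_B: "u \<in> cone U \<Longrightarrow> fd \<Phi> u (B u a b) = D2 u a b"
  unfolding B_def by (rule DPhi_DPhi_inv)

lemma B_sym: "u \<in> cone U \<Longrightarrow> B u a b = B u b a"
  unfolding B_def using D2_sym by simp

lemma linear_B: assumes "u \<in> cone U" shows "linear (B u a)"
proof -
  have "B u a = DPhi_inv u \<circ> D2 u a" by (rule ext) (simp add: B_def)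
  then show ?thesis
    using linear_compose[OF linear_D2_right[OF assms] linear_DPhi_inv[OF assms]] by simp
qed

lemma B_self: "u \<in> cone U \<Longrightarrow> B u a u = 0"
  unfolding B_def by (simp add: D2_self linear_0[OF linear_DPhi_inv])

lemma smooth_B: "smooth_on (cone U) (\<lambda>u. B u a b)"
  unfolding B_def by (rule smooth_DPhi_inv[OF D2_smooth])

lemma B_hom: assumes u: "u \<in> cone U" and "r \<noteq> 0" shows "B (r *\<^sub>R u) a b = (1 / r) *\<^sub>R B u a b"
proof (rule DPhi_inj[OF u])
  have ru: "r *\<^sub>R u \<in> cone U" using assms scale_in_cone by blast
  have "r *\<^sub>R D2 (r *\<^sub>R u) a b = 1 *\<^sub>R D2 u a b"
    unfolding D2_def
    by (rule fd_scaled[OF open_C scale_in_cone DPhi_smooth _ assms(2,1)])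
      (simp_all add: DPhi_hom assms)
  then have "(1 / r) *\<^sub>R (r *\<^sub>R D2 (r *\<^sub>R u) a b) = (1 / r) *\<^sub>R D2 u a b" by simp
  then have "D2 (r *\<^sub>R u) a b = (1 / r) *\<^sub>R D2 u a b" using assms(2) by simp
  moreover have "fd \<Phi> u (B (r *\<^sub>R u) a b) = D2 (r *\<^sub>R u) a b"
    using DPhi_B[OF ru] DPhi_hom[OF assms] by simp
  ultimately show "fd \<Phi> u (B (r *\<^sub>R u) a b) = fd \<Phi> u ((1 / r) *\<^sub>R B u a b)"
    by (simp add: linear_cmul[OF linear_DPhi[OF u]] DPhi_B[OF u])
qed

text \<open>\<open>B\<close> with its value lowered by \<Omega>, up to the sign \<epsilon>. The next
  lemmas show that it is totally symmetric, hence a cubic form.\<close>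

definition Q :: "real ^ 'm ix \<Rightarrow> real ^ 'm ix \<Rightarrow> real ^ 'm ix \<Rightarrow> real ^ 'm ix \<Rightarrow> real" where
  "Q u a b c = Om (D2 u a b) (fd \<Phi> u c)"

lemma Q_B: "u \<in> cone U \<Longrightarrow> Om (B u a b) c = \<epsilon> * Q u a b c"
  unfolding B_def Q_def by (rule Om_DPhi_inv)

lemma Q_sym1: "u \<in> cone U \<Longrightarrow> Q u a b c = Q u b a c"
  unfolding Q_def using D2_sym by simp

text \<open>\<open>Om (fd \<Phi> x b) (fd \<Phi> x c)\<close> does not depend on \<open>x\<close>,
  so its derivative vanishes: \<open>B u a\<close> lies in the symplectic Lie algebra.\<close>

lemma Q_sym2: assumes u: "u \<in> cone U" shows "Q u a b c = Q u a c b"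
proof -
  have "fd (\<lambda>x. Om (fd \<Phi> x b) (fd \<Phi> x c)) u a = Om (fd \<Phi> u b) (D2 u c a) + Om (D2 u b a) (fd \<Phi> u c)"
    unfolding D2_def
    by (rule fd_bilinear[OF bounded_bilinear_Om])
      (rule smooth_on_differentiable[OF _ open_C u], rule DPhi_smooth)+
  moreover have "fd (\<lambda>x. Om (fd \<Phi> x b) (fd \<Phi> x c)) u = fd (\<lambda>x. \<epsilon> * Om b c) u"
    by (rule fd_open_cong[OF open_C u]) (rule DPhi_symplectic)
  ultimately have "Om (fd \<Phi> u b) (D2 u c a) + Om (D2 u b a) (fd \<Phi> u c) = 0"
    by (simp add: frechet_derivative_const)
  then show ?thesis
    using Om_skew[of "fd \<Phi> u b"] by (simp add: Q_def D2_sym[OF u, of a])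
qed

lemma Om_B_sym: "u \<in> cone U \<Longrightarrow> Om (B u a b) c = Om (B u a c) b"
  using Q_B Q_sym2 by simp

text \<open>Total symmetry moves \<open>u\<close> into a slot of \<open>B\<close>, where
  \<open>B_self\<close> kills it.\<close>

lemma B_perp: "u \<in> cone U \<Longrightarrow> Om u (B u a b) = 0"
  using Om_B_sym[of u a b u] B_self[of u a] Om_skew[of u] by (simp add: Om.zero_left)

lemma Q_differentiable: "u \<in> cone U \<Longrightarrow> (\<lambda>x. Q x a b c) differentiable (at u)"
  unfolding Q_def
  by (rule smooth_on_differentiable[OF smooth_on_bilinear[OF bounded_bilinear_Om open_C D2_smooth DPhi_smooth] open_C])

lemma linear_Q: assumes u: "u \<in> cone U"
  shows "linear (\<lambda>a. Q u a b c)" "linear (\<lambda>b. Q u a b c)" "linear (\<lambda>c. Q u a b c)"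
  unfolding Q_def
  by (intro linearI; simp add: linear_add[OF linear_D2_left[OF u]] linear_cmul[OF linear_D2_left[OF u]]
     linear_add[OF linear_D2_right[OF u]] linear_cmul[OF linear_D2_right[OF u]]
     linear_add[OF linear_DPhi[OF u]] linear_cmul[OF linear_DPhi[OF u]]
     Om.add_left Om.add_right Om.scaleR_left Om.scaleR_right)+

lemma D3_sym: assumes u: "u \<in> cone U" shows "fd (\<lambda>x. D2 x a b) u d = fd (\<lambda>x. D2 x a d) u b"
  unfolding D2_def by (rule fd_fd_commute[OF DPhi_smooth open_C u])

lemma fd_Q: assumes u: "u \<in> cone U"
  shows "fd (\<lambda>x. Q x a b c) u d = Om (D2 u a b) (D2 u c d) + Om (fd (\<lambda>x. D2 x a b) u d) (fd \<Phi> u c)"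
  unfolding Q_def D2_def[of _ c]
  by (rule fd_bilinear[OF bounded_bilinear_Om])
    (rule smooth_on_differentiable[OF _ open_C u], rule D2_smooth DPhi_smooth)+

lemma perp_decomp:
  assumes "Om u \<tau> = 1" shows "\<exists>a. Om u a = 0 \<and> c = a + Om u c *\<^sub>R \<tau>"
  by (intro exI[of _ "c - Om u c *\<^sub>R \<tau>"]) (simp add: Om.diff_right Om.scaleR_right assms)

lemma B_span_if_Q_zero:
  assumes u: "u \<in> cone U" and "\<And>c. Om u c = 0 \<Longrightarrow> Q u a b c = 0"
  shows "\<exists>k. B u a b = k *\<^sub>R u"
proof -
  have "u \<noteq> 0" using u by (simp add: mem_cone)
  then obtain \<tau> where t: "Om u \<tau> = 1" using ex_Om_1 by blast
  have *: "Om (B u a b) w = Om (B u a b) \<tau> * Om u w" for w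
    by (rule functional_on_perp[OF t linear_Om_right]) (simp add: Q_B[OF u] assms(2))
  have "B u a b = Om (B u a b) \<tau> *\<^sub>R u"
    by (rule Om_eqI) (simp only: Om.scaleR_left real_scaleR_def *[symmetric])
  then show ?thesis ..
qed

text \<open>For \<open>a\<close>, \<open>b\<close> in the complement of \<open>u\<close> the
  hypothesis alone makes \<open>D2 u a b\<close> a multiple of \<open>\<Phi> u\<close>. That the
  multiple is zero comes from varying the base point: third derivatives of \<Phi> may be permuted,
  while the variation of \<open>Q\<close> produces its values at \<tau> with coefficients that do
  not respect the permutation.\<close>

lemma Q_zero_on_perp:
  assumes H: "\<And>x a b c. x \<in> cone U \<Longrightarrow> Om x a = 0 \<Longrightarrow> Om x b = 0 \<Longrightarrow> Om x c = 0 \<Longrightarrow> Q x a b c = 0"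
    and u: "u \<in> cone U" and ab: "Om u a = 0" "Om u b = 0"
  shows "D2 u a b = 0"
proof -
  have u0: "u \<noteq> 0" using u by (simp add: mem_cone)
  then obtain \<tau> where t: "Om u \<tau> = 1" using ex_Om_1 by blast
  \<comment> \<open>Second derivatives along the complement are all multiples of the one vector
    \<open>\<Phi> u\<close>, so the product term in the derivative of \<open>Q\<close>
    vanishes.\<close>
  have isot: "Om (D2 u a b) (D2 u c d) = 0"
    if h: "Om u a = 0" "Om u b = 0" "Om u c = 0" "Om u d = 0" for a b c d
  proof -
    have ex: "\<exists>k. D2 u a b = k *\<^sub>R \<Phi> u" if ab: "Om u a = 0" "Om u b = 0" for a b
    proof -
      obtain k where "B u a b = k *\<^sub>R u" using B_span_if_Q_zero[OF u H[OF u ab]] by blast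
      then have "D2 u a b = k *\<^sub>R \<Phi> u"
        using DPhi_B[OF u, of a b] DPhi_self[OF u] linear_cmul[OF linear_DPhi[OF u]] by metis
      then show ?thesis ..
    qed
    obtain k where "D2 u a b = k *\<^sub>R \<Phi> u" using ex[OF h(1,2)] ..
    moreover obtain l where "D2 u c d = l *\<^sub>R \<Phi> u" using ex[OF h(3,4)] ..
    ultimately show ?thesis by (simp add: Om.scaleR_left Om.scaleR_right)
  qed
  have r: "Q u a a \<tau> = 0" if a: "Om u a = 0" for a
  proof (cases "\<exists>c. a = c *\<^sub>R u")
    case True
    then obtain c where "a = c *\<^sub>R u" ..
    then show ?thesis
      unfolding Q_def by (simp add: linear_cmul[OF linear_D2_right[OF u]] D2_self[OF u] Om.zero_left)
  next
    case False
    then obtain d where d: "Om u d = 0" "Om d a \<noteq> 0"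
      using ex_perp_Om_nonzero[OF u0] by blast
    have v: "fd (\<lambda>x. Q x a b c) u w = Om w a * Q u \<tau> b c + Om w b * Q u a \<tau> c + Om w c * Q u a b \<tau>"
      if "Om u a = 0" "Om u b = 0" "Om u c = 0" for a b c w
      by (rule variation3[OF open_C u t that Q_differentiable[OF u] linear_Q H])
    have "fd (\<lambda>x. Q x a a a) u d = fd (\<lambda>x. Q x a d a) u a"
      using fd_Q[OF u] D3_sym[OF u, of a a d] isot a d by simp
    \<comment> \<open>On the left all three arguments vary and give equal terms by total symmetry;
      on the right only the argument \<open>d\<close> contributes, with coefficient
      \<open>Om a d = - Om d a\<close>. Together
      \<open>4 * Om d a * Q u a a \<tau> = 0\<close>.\<close>
    then have "3 * Om d a * Q u a a \<tau> = Om a d * Q u a a \<tau>"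
      using v[OF a a a, of d] v[OF a d(1) a, of a]
        Q_sym1[OF u, of a \<tau> a] Q_sym2[OF u, of a \<tau> a] by simp
    then show ?thesis using d Om_skew[of a d] by simp
  qed
  have "Q u (a + b) (a + b) \<tau> = 0" using r[of "a + b"] ab by (simp add: Om.add_right)
  then have rab: "Q u a b \<tau> = 0"
    using r[OF ab(1)] r[OF ab(2)] Q_sym1[OF u, of a b \<tau>]
    by (simp add: linear_add[OF linear_Q(1)[OF u]] linear_add[OF linear_Q(2)[OF u]])
  have "Om (B u a b) c = Om 0 c" for c
  proof -
    obtain c' where "Om u c' = 0" "c = c' + Om u c *\<^sub>R \<tau>" using perp_decomp[OF t] by blast
    then have "Q u a b c = Q u a b c' + Om u c * Q u a b \<tau>"
      using linear_add[OF linear_Q(3)[OF u]] linear_cmul[OF linear_Q(3)[OF u]] by (metis real_scaleR_def)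
    then show ?thesis using H[OF u ab \<open>Om u c' = 0\<close>] rab by (simp add: Q_B[OF u] Om.zero_left)
  qed
  then have "B u a b = 0" by (rule Om_eqI)
  then show ?thesis using DPhi_B[OF u, of a b] linear_0[OF linear_DPhi[OF u]] by simp
qed

lemma fd_Om_D2: assumes u: "u \<in> cone U"
  shows "fd (\<lambda>x. Om (D2 x a b) z) u d = Om (fd (\<lambda>x. D2 x a b) u d) z"
  using fd_eq[OF bounded_linear.has_derivative[OF Om.bounded_linear_left
    smooth_on_has_derivative[OF D2_smooth open_C u]]] by simp

lemma Om_D2_properties:
  assumes "u \<in> cone U"
  shows "(\<lambda>x. Om (D2 x a b) z) differentiable (at u)"
    "linear (\<lambda>a. Om (D2 u a b) z)" "linear (\<lambda>b. Om (D2 u a b) z)"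
proof -
  show "(\<lambda>x. Om (D2 x a b) z) differentiable (at u)"
    by (rule smooth_on_differentiable[OF smooth_on_bounded_linear[OF Om.bounded_linear_left open_C D2_smooth] open_C assms])
  show "linear (\<lambda>a. Om (D2 u a b) z)" "linear (\<lambda>b. Om (D2 u a b) z)"
    by (intro linearI; simp add: linear_add[OF linear_D2_left[OF assms]] linear_cmul[OF linear_D2_left[OF assms]]
     linear_add[OF linear_D2_right[OF assms]] linear_cmul[OF linear_D2_right[OF assms]] Om.add_left Om.scaleR_left)+
qed

text \<open>With \<open>Om u \<tau> = 1\<close> it remains to kill \<open>D2 u \<tau> b\<close> and \<open>D2 u \<tau> \<tau>\<close>: their multiples appear in the
  derivative of \<open>D2\<close> on the complement of \<open>u\<close>, which is symmetric in the direction and an argument.\<close>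

lemma D2_zero:
  assumes H: "\<And>x a b c. x \<in> cone U \<Longrightarrow> Om x a = 0 \<Longrightarrow> Om x b = 0 \<Longrightarrow> Om x c = 0 \<Longrightarrow> Q x a b c = 0"
    and u: "u \<in> cone U"
  shows "D2 u a b = 0"
proof -
  have H1: "D2 x a b = 0" if "x \<in> cone U" "Om x a = 0" "Om x b = 0" for x a b
    by (rule Q_zero_on_perp[OF _ that]) (rule H)
  have H2: "D2 x a b = 0" if x: "x \<in> cone U" and ab: "Om x a = 0" for x a b
  proof -
    have x0: "x \<noteq> 0" using x by (simp add: mem_cone)
    then obtain \<tau> where t: "Om x \<tau> = 1" using ex_Om_1 by blast
    have ta: "D2 x \<tau> a = 0" if a: "Om x a = 0" for a
    proof (cases "\<exists>c. a = c *\<^sub>R x")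
      case True
      then show ?thesis using D2_self[OF x] linear_cmul[OF linear_D2_right[OF x]] by (metis scaleR_zero_right)
    next
      case False
      then obtain d where d: "Om x d = 0" "Om d a \<noteq> 0"
        using ex_perp_Om_nonzero[OF x0] by blast
      have v: "Om (fd (\<lambda>x. D2 x a b) x w) z = Om w a * Om (D2 x \<tau> b) z + Om w b * Om (D2 x a \<tau>) z"
        if "Om x a = 0" "Om x b = 0" for a b w z
        unfolding fd_Om_D2[OF x, symmetric]
        by (rule variation2[OF open_C x t that Om_D2_properties(1)[OF x] Om_D2_properties(2,3)])
          (simp_all add: H1 Om.zero_left)
      \<comment> \<open>Varying \<open>D2 x a a\<close> along \<open>d\<close> gives two equal
        terms; varying \<open>D2 x a d\<close> along \<open>a\<close> gives one, of the opposite
        sign.\<close>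
      have "3 * Om d a * Om (D2 x \<tau> a) z = 0" for z
        using v[OF a a, of d z] v[OF a d(1), of a z] D3_sym[OF x, of a a d] Om_skew[of a d]
          D2_sym[OF x, of a \<tau>] by simp
      then have "Om (D2 x \<tau> a) z = Om 0 z" for z using d by (simp add: Om.zero_left)
      then show ?thesis by (rule Om_eqI)
    qed
    obtain b' where b': "Om x b' = 0" "b = b' + Om x b *\<^sub>R \<tau>" using perp_decomp[OF t] by blast
    have "D2 x a (b' + Om x b *\<^sub>R \<tau>) = D2 x a b' + Om x b *\<^sub>R D2 x a \<tau>"
      by (simp only: linear_add[OF linear_D2_right[OF x]] linear_cmul[OF linear_D2_right[OF x]])
    then have "D2 x a b = D2 x a b' + Om x b *\<^sub>R D2 x a \<tau>"
      unfolding b'(2)[symmetric] .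
    moreover have "D2 x a b' = 0" by (rule H1[OF x ab b'(1)])
    moreover have "D2 x a \<tau> = 0" by (subst D2_sym[OF x]) (rule ta[OF ab])
    ultimately show ?thesis by (simp only: scaleR_zero_right add_0_left)
  qed
  have u0: "u \<noteq> 0" using u by (simp add: mem_cone)
  then obtain \<tau> where t: "Om u \<tau> = 1" using ex_Om_1 by blast
  \<comment> \<open>A pair in the complement of \<open>u\<close> on which \<Omega> does not vanish
    exists because the dimension is at least 4. Exchanging \<open>c\<close> and \<open>d\<close>
    flips the sign of the variation but not of the third derivative.\<close>
  obtain c d where cd: "Om u c = 0" "Om u d = 0" "Om d c \<noteq> 0" using ex_perp_pair[OF u0] by blast
  have v: "Om (fd (\<lambda>x. D2 x a \<tau>) u w) z = Om w a * Om (D2 u \<tau> \<tau>) z" if "Om u a = 0" for a w z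
    unfolding fd_Om_D2[OF u, symmetric]
    by (rule variation1[OF open_C u t that Om_D2_properties(1)[OF u] Om_D2_properties(2)])
      (simp_all add: H2 Om.zero_left)
  have "fd (\<lambda>x. D2 x c \<tau>) u d = fd (\<lambda>x. D2 x d \<tau>) u c"
  proof -
    have *: "fd (\<lambda>x. D2 x c \<tau>) u = fd (\<lambda>x. D2 x \<tau> c) u" for c
      by (rule fd_open_cong[OF open_C u]) (rule D2_sym)
    show ?thesis unfolding * using D3_sym[OF u] by simp
  qed
  then have *: "Om d c * Om (D2 u \<tau> \<tau>) z = Om c d * Om (D2 u \<tau> \<tau>) z" for z
    unfolding v[OF cd(1), of d z, symmetric] v[OF cd(2), of c z, symmetric] by simp
  have "Om (D2 u \<tau> \<tau>) z = Om 0 z" for z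
  proof -
    have "2 * Om d c * Om (D2 u \<tau> \<tau>) z = 0"
      using *[of z] Om_skew[of c d] by simp
    then show ?thesis using cd(3) by (simp add: Om.zero_left)
  qed
  then have tt: "D2 u \<tau> \<tau> = 0" by (rule Om_eqI)
  obtain a' where a': "Om u a' = 0" "a = a' + Om u a *\<^sub>R \<tau>" using perp_decomp[OF t] by blast
  obtain b' where b': "Om u b' = 0" "b = b' + Om u b *\<^sub>R \<tau>" using perp_decomp[OF t] by blast
  have "D2 u (a' + Om u a *\<^sub>R \<tau>) b = D2 u a' b + Om u a *\<^sub>R D2 u \<tau> b"
    by (simp only: linear_add[OF linear_D2_left[OF u]] linear_cmul[OF linear_D2_left[OF u]])
  then have "D2 u a b = D2 u a' b + Om u a *\<^sub>R D2 u \<tau> b"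
    unfolding a'(2)[symmetric] .
  moreover have "D2 u \<tau> (b' + Om u b *\<^sub>R \<tau>) = D2 u \<tau> b' + Om u b *\<^sub>R D2 u \<tau> \<tau>"
    by (simp only: linear_add[OF linear_D2_right[OF u]] linear_cmul[OF linear_D2_right[OF u]])
  then have "D2 u \<tau> b = D2 u \<tau> b' + Om u b *\<^sub>R D2 u \<tau> \<tau>"
    unfolding b'(2)[symmetric] .
  moreover have "D2 u \<tau> b' = 0" by (subst D2_sym[OF u]) (rule H2[OF u b'(1)])
  ultimately show ?thesis
    using H2[OF u a'(1), of b] tt by simp
qed

text \<open>On a ball \<open>fd \<Phi>\<close> is constant, so \<Phi> is affine there; Euler's
  relation \<open>fd \<Phi> u u = \<Phi> u\<close> removes the additive constant.\<close>

lemma locally_linear: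
  assumes D2: "\<And>x a b. x \<in> cone U \<Longrightarrow> D2 x a b = 0" and u: "u \<in> cone U"
  shows "\<exists>e>0. ball u e \<subseteq> cone U \<and> (\<forall>x\<in>ball u e. \<Phi> x = fd \<Phi> u x)"
proof -
  obtain e where e: "e > 0" "ball u e \<subseteq> cone U" using open_C u openE by blast
  have c: "fd \<Phi> x a = fd \<Phi> u a" if x: "x \<in> ball u e" for x a
  proof (rule has_derivative_zero_unique[OF convex_ball _ x])
    show "u \<in> ball u e" using e by simp
    fix y assume "y \<in> ball u e"
    then have y: "y \<in> cone U" using e by blast
    have "fd (\<lambda>x. fd \<Phi> x a) y = (\<lambda>h. 0)"
      using D2[OF y] unfolding D2_def by blast
    then show "((\<lambda>x. fd \<Phi> x a) has_derivative (\<lambda>h. 0)) (at y within ball u e)"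
      using smooth_on_has_derivative[OF DPhi_smooth open_C y, of a] has_derivative_at_withinI by metis
  qed
  have "\<Phi> x - fd \<Phi> u x = \<Phi> u - fd \<Phi> u u" if x: "x \<in> ball u e" for x
  proof (rule has_derivative_zero_unique[OF convex_ball _ x])
    show "u \<in> ball u e" using e by simp
    fix y assume yb: "y \<in> ball u e"
    then have y: "y \<in> cone U" using e by blast
    have "((\<lambda>x. \<Phi> x - fd \<Phi> u x) has_derivative (\<lambda>h. fd \<Phi> y h - fd \<Phi> u h)) (at y)"
      by (intro has_derivative_diff smooth_on_has_derivative[OF Phi_smooth open_C y]
          linear_imp_has_derivative linear_DPhi[OF u])
    then show "((\<lambda>x. \<Phi> x - fd \<Phi> u x) has_derivative (\<lambda>h. 0)) (at y within ball u e)"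
      using c[OF yb] by (simp add: has_derivative_at_withinI)
  qed
  then show ?thesis using e DPhi_self[OF u] by (intro exI[of _ e]) simp
qed

end

section \<open>Linear combinations of tangent vectors and their pairing with one-forms\<close>

lemma dproj_sum:
  assumes "u \<noteq> 0" shows "dproj u (\<Sum>i\<in>I. c i *\<^sub>R w i) = (\<lambda>f. \<Sum>i\<in>I. c i * dproj u (w i) f)"
  by (induction I rule: infinite_finite_induct)
    (simp_all add: dproj_zero[OF assms] dproj_add[OF assms] dproj_cmul[OF assms])

lemma tangent_sum:
  assumes "\<And>i. i \<in> I \<Longrightarrow> v i \<in> tangent p"
  shows "(\<lambda>f. \<Sum>i\<in>I. c i * v i f) \<in> tangent p"
  using assms
proof (induction I rule: infinite_finite_induct)
  case (insert i I)
  then have "(\<lambda>f. c i * v i f + 1 * (\<Sum>i\<in>I. c i * v i f)) \<in> tangent p"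
    by (intro tangent_linear_comb[of "v i" p "\<lambda>f. \<Sum>i\<in>I. c i * v i f" "c i" 1]) auto
  then show ?case using insert by simp
qed (simp_all add: zero_in_tangent)

lemma one_form_linear:
  "one_form V \<theta> \<Longrightarrow> p \<in> V \<Longrightarrow> v \<in> tangent p \<Longrightarrow> w \<in> tangent p \<Longrightarrow>
    \<theta> p (\<lambda>f. a * v f + b * w f) = a * \<theta> p v + b * \<theta> p w"
  unfolding one_form_def by blast

lemma one_form_cmul:
  "one_form V \<theta> \<Longrightarrow> p \<in> V \<Longrightarrow> v \<in> tangent p \<Longrightarrow> \<theta> p (\<lambda>f. a * v f) = a * \<theta> p v"
  using one_form_linear[of V \<theta> p v v a 0] by simp

lemma one_form_zero:
  "one_form V \<theta> \<Longrightarrow> p \<in> V \<Longrightarrow> \<theta> p (\<lambda>f. 0) = 0"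
  using one_form_cmul[of V \<theta> p "\<lambda>f. 0" 0] zero_in_tangent[of p] by simp

lemma one_form_sum:
  assumes "one_form V \<theta>" "p \<in> V" "\<And>i. i \<in> I \<Longrightarrow> v i \<in> tangent p"
  shows "\<theta> p (\<lambda>f. \<Sum>i\<in>I. c i * v i f) = (\<Sum>i\<in>I. c i * \<theta> p (v i))"
  using assms(3)
proof (induction I rule: infinite_finite_induct)
  case (insert i I)
  then have "\<theta> p (\<lambda>f. c i * v i f + 1 * (\<Sum>i\<in>I. c i * v i f)) = c i * \<theta> p (v i) + 1 * \<theta> p (\<lambda>f. \<Sum>i\<in>I. c i * v i f)"
    by (intro one_form_linear[OF assms(1,2), of "v i" "\<lambda>f. \<Sum>i\<in>I. c i * v i f" "c i" 1] tangent_sum) auto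
  then show ?case using insert by simp
qed (simp_all add: one_form_zero[OF assms(1,2)])

subsection \<open>Square roots of contact forms\<close>

text \<open>The form \<theta> is half of the pullback of \<Omega>(u, du) by \<sigma>, up to the sign
  \<open>s\<close>, so that every computation with \<theta> becomes one with \<Omega>.\<close>

locale root_section = symp \<omega> + proj_section W \<sigma>
  for \<omega> :: "real ^ 'm::finite ^ 'm" and W :: "'m ix projspace set" and \<sigma> +
  fixes s :: real and \<theta> :: "'m ix oneform"
  assumes sgn: "s = 1 \<or> s = -1"
    and root: "p \<in> W \<Longrightarrow> v \<in> tangent p \<Longrightarrow> \<theta> p v = s / 2 * Om (\<sigma> p) (dv v \<sigma>)"
begin

lemma s_sq [simp]: "s * s = 1" "s * (s * x) = x" "s \<noteq> 0"
  using sgn by auto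

text \<open>The radial coefficient in the splitting of a vector into a part tangent to the image of
  \<sigma> and a multiple of \<open>\<sigma> p\<close> (\<open>decomp\<close>). The quotient of
  inner products is merely a formula that shows its smoothness in \<open>p\<close>.\<close>

definition ell :: "'m ix projspace \<Rightarrow> real ^ 'm ix \<Rightarrow> real" where
  "ell p z = ((z - dv (dproj (\<sigma> p) z) \<sigma>) \<bullet> \<sigma> p) / (\<sigma> p \<bullet> \<sigma> p)"

lemma decomp:
  assumes p: "p \<in> W" shows "z = dv (dproj (\<sigma> p) z) \<sigma> + ell p z *\<^sub>R \<sigma> p"
proof -
  have "dproj (\<sigma> p) (dv (dproj (\<sigma> p) z) \<sigma>) = dproj (\<sigma> p) z"
    using dproj_dv[OF p dproj_tangent[OF p]] .
  then obtain c where c: "z = dv (dproj (\<sigma> p) z) \<sigma> + c *\<^sub>R \<sigma> p"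
    using dproj_eqD[OF sec_nonzero[OF p]] by blast
  then have "z - dv (dproj (\<sigma> p) z) \<sigma> = c *\<^sub>R \<sigma> p" by (metis add_diff_cancel_left')
  then have "ell p z = c" using sec_nonzero[OF p] by (simp add: ell_def)
  then show ?thesis using c by metis
qed

lemma linear_ell: assumes p: "p \<in> W" shows "linear (ell p)"
  by (intro linearI)
    (simp_all add: ell_def dproj_add[OF sec_nonzero[OF p]] dproj_cmul[OF sec_nonzero[OF p]] dv_add dv_cmul
      algebra_simps inner_add_left inner_diff_left add_divide_distrib diff_divide_distrib)

lemma ell_tangent: "p \<in> W \<Longrightarrow> v \<in> tangent p \<Longrightarrow> ell p (dv v \<sigma>) = 0"
  by (simp add: ell_def dproj_dv)

lemma ell_sec: "p \<in> W \<Longrightarrow> ell p (\<sigma> p) = 1"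
  using sec_nonzero by (simp add: ell_def dproj_self dv_zero)

lemma smooth_ell: "smooth_fun W (\<lambda>p. ell p z)"
proof -
  have v: "vector_field W (\<lambda>q. dproj (\<sigma> q) z)"
    by (rule vector_field_dproj[OF W_open order_refl smooth_fun_const[OF W_open]])
  have i: "smooth_fun W (\<lambda>p. f p \<bullet> g p)" if "smooth_fun W f" "smooth_fun W g"
    for f g :: "'m ix projspace \<Rightarrow> real ^ 'm ix"
    by (rule smooth_fun_bilinear[OF bounded_bilinear_inner W_open that])
  have n: "smooth_fun W (\<lambda>p. (z - dv (dproj (\<sigma> p) z) \<sigma>) \<bullet> \<sigma> p)"
    by (rule i[OF smooth_fun_diff[OF W_open smooth_fun_const[OF W_open]
          vector_field_smooth_dv[OF v W_open order_refl sec_smooth]] sec_smooth])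
  show ?thesis
    unfolding ell_def smooth_fun_def
    by (rule smooth_on_divide[OF open_cone[OF W_open]])
      (use n i[OF sec_smooth sec_smooth] sec_nonzero in \<open>auto simp: smooth_fun_def mem_cone\<close>)
qed

text \<open>The derivative of \<open>\<sigma>\<close> along the Reeb field is the \<open>\<Omega>\<close>-normal of the image of the differential
  of \<open>\<sigma>\<close>, normalized by \<open>Om (\<sigma> p) (t p) = 2 * s\<close>.\<close>

definition t :: "'m ix projspace \<Rightarrow> real ^ 'm ix" where
  "t p = sharp (\<lambda>z. - 2 * s * ell p z)"

lemma Om_t: assumes "p \<in> W" shows "Om (t p) z = - 2 * s * ell p z"
proof -
  have "linear (\<lambda>z. - 2 * s * ell p z)"
    using linear_ell[OF assms] by (intro linearI) (simp_all add: linear_add linear_cmul algebra_simps)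
  then show ?thesis unfolding t_def by (rule Om_sharp)
qed

lemma t_smooth: "smooth_fun W t"
proof -
  have "smooth_fun W (\<lambda>p. (- 2 * s * ell p z) *\<^sub>R c)" for z and c :: "real ^ 'm ix"
    by (rule smooth_fun_scaleR[OF W_open smooth_fun_mult[OF W_open smooth_fun_const[OF W_open] smooth_ell]
      smooth_fun_const[OF W_open]])
  then have "smooth_fun W (\<lambda>p. \<Sum>a\<in>UNIV. (- 2 * s * ell p (axis a 1)) *\<^sub>R dual a)"
    by (intro smooth_fun_sum W_open)
  then show ?thesis unfolding t_def[abs_def] sharp_def .
qed

lemma Om_t_tangent: "p \<in> W \<Longrightarrow> v \<in> tangent p \<Longrightarrow> Om (t p) (dv v \<sigma>) = 0" "p \<in> W \<Longrightarrow> v \<in> tangent p \<Longrightarrow> Om (dv v \<sigma>) (t p) = 0"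
  using Om_t ell_tangent Om_skew[of "dv v \<sigma>" "t p"] by simp_all

lemma Om_t_sec: "p \<in> W \<Longrightarrow> Om (t p) (\<sigma> p) = - 2 * s" "p \<in> W \<Longrightarrow> Om (\<sigma> p) (t p) = 2 * s"
  using Om_t ell_sec Om_skew[of "\<sigma> p" "t p"] by simp_all

text \<open>\<open>Om (t p)\<close> is a nonzero multiple of \<open>ell p\<close>, so vectors that
  it annihilates have no radial part and are tangent to the image of \<sigma>.\<close>

lemma dv_dproj_perp:
  assumes "p \<in> W" "Om (t p) z = 0" shows "dv (dproj (\<sigma> p) z) \<sigma> = z"
  using decomp[OF assms(1), of z] Om_t[OF assms(1), of z] assms(2) by simp

definition T :: "'m ix vfield" where "T p = dproj (\<sigma> p) (t p)"

lemma T_tangent: "p \<in> W \<Longrightarrow> T p \<in> tangent p"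
  unfolding T_def by (rule dproj_tangent)

lemma dv_T: "p \<in> W \<Longrightarrow> dv (T p) \<sigma> = t p"
  unfolding T_def by (rule dv_dproj_perp) simp_all

lemma T_field: "vector_field W T"
  unfolding T_def[abs_def] by (rule vector_field_dproj[OF W_open order_refl t_smooth])

text \<open>An extension of \<theta> to all vectors of the linear space: it agrees with \<theta> on
  the image of the differential of \<sigma> and vanishes on \<open>\<sigma> p\<close>.\<close>

definition th :: "'m ix projspace \<Rightarrow> real ^ 'm ix \<Rightarrow> real" where
  "th p a = s / 2 * Om (\<sigma> p) a"

lemma theta_th: "p \<in> W \<Longrightarrow> v \<in> tangent p \<Longrightarrow> \<theta> p v = th p (dv v \<sigma>)"
  unfolding th_def by (rule root)

lemma th_t: "p \<in> W \<Longrightarrow> th p (t p) = 1"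
  by (simp add: th_def Om_t_sec)

lemma th_add: "th p (a + b) = th p a + th p b" and th_scaleR: "th p (r *\<^sub>R a) = r * th p a"
  by (simp_all add: th_def Om.add_right Om.scaleR_right algebra_simps)

lemma smooth_th: assumes "open V" "V \<subseteq> W" "smooth_fun V a" shows "smooth_fun V (\<lambda>q. th q (a q))"
  unfolding th_def
  by (rule smooth_fun_mult[OF assms(1) smooth_fun_const[OF assms(1)]
        smooth_fun_bilinear[OF bounded_bilinear_Om assms(1) smooth_fun_subset[OF sec_smooth W_open assms(1,2)] assms(3)]])

lemma sec_smooth_on: "open V \<Longrightarrow> V \<subseteq> W \<Longrightarrow> smooth_fun V \<sigma>"
  by (rule smooth_fun_subset[OF sec_smooth W_open])

lemma t_smooth_on: "open V \<Longrightarrow> V \<subseteq> W \<Longrightarrow> smooth_fun V t"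
  by (rule smooth_fun_subset[OF t_smooth W_open])

lemma field_smooth: "open V \<Longrightarrow> V \<subseteq> W \<Longrightarrow> vector_field V X \<Longrightarrow> smooth_fun V (\<lambda>q. dv (X q) \<sigma>)"
  by (rule vector_field_smooth_dv[OF _ _ order_refl sec_smooth_on])

lemma tvec_theta:
  assumes V: "open V" "V \<subseteq> W" and X: "vector_field V X" and Y: "vector_field V Y" and p: "p \<in> V"
  shows "X p (\<lambda>q. \<theta> q (Y q)) = X p (\<lambda>q. th q (dv (Y q) \<sigma>))"
    "X p (\<lambda>q. th q (dv (Y q) \<sigma>)) = th p (dv (X p) (\<lambda>q. dv (Y q) \<sigma>)) + s / 2 * Om (dv (X p) \<sigma>) (dv (Y p) \<sigma>)"
proof -
  have tX: "X p \<in> tangent p" using vector_field_tangent[OF X p] .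
  show "X p (\<lambda>q. \<theta> q (Y q)) = X p (\<lambda>q. th q (dv (Y q) \<sigma>))"
    by (rule fun_tvec_cong[OF tX V(1) p]) (use theta_th vector_field_tangent[OF Y] V in blast)
  have "smooth_fun V (\<lambda>q. Om (\<sigma> q) (dv (Y q) \<sigma>))"
    by (rule smooth_fun_bilinear[OF bounded_bilinear_Om V(1) sec_smooth_on[OF V] field_smooth[OF V Y]])
  from tvec_cmul[OF tX p V(1) this, of "s / 2"]
  show "X p (\<lambda>q. th q (dv (Y q) \<sigma>)) = th p (dv (X p) (\<lambda>q. dv (Y q) \<sigma>)) + s / 2 * Om (dv (X p) \<sigma>) (dv (Y p) \<sigma>)"
    using tvec_bilinear[OF bounded_bilinear_Om tX p V(1) sec_smooth_on[OF V] field_smooth[OF V Y]]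
    by (simp add: th_def algebra_simps)
qed

text \<open>The second derivatives of \<sigma> cancel against the bracket term; what remains are two
  equal halves of \<Omega>, because differentiating \<open>th\<close> also differentiates its base
  point \<open>\<sigma>\<close>.\<close>

lemma ext_deriv_eq:
  assumes V: "open V" "V \<subseteq> W" and X: "vector_field V X" and Y: "vector_field V Y" and p: "p \<in> V"
  shows "ext_deriv \<theta> X Y p = s * Om (dv (X p) \<sigma>) (dv (Y p) \<sigma>)"
proof -
  have pW: "p \<in> W" using p V by blast
  have "\<theta> p (bracket X Y p) = th p (dv (X p) (\<lambda>q. dv (Y q) \<sigma>) - dv (Y p) (\<lambda>q. dv (X q) \<sigma>))"
    using theta_th[OF pW bracket_tangent[OF V X Y p]] dv_bracket[OF sec_smooth_on[OF V] V(1) p] by simp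
  then show ?thesis
    unfolding ext_deriv_def tvec_theta(1)[OF V X Y p] tvec_theta(1)[OF V Y X p]
      tvec_theta(2)[OF V X Y p] tvec_theta(2)[OF V Y X p]
    using Om_skew[of "dv (Y p) \<sigma>" "dv (X p) \<sigma>"]
    by (simp add: th_def Om.diff_right algebra_simps)
qed

lemma reeb_T: assumes V: "open V" "V \<subseteq> W" shows "reeb_field V \<theta> T"
  unfolding reeb_field_def
proof (intro conjI ballI allI impI)
  show TV: "vector_field V T" using vector_field_subset[OF T_field V(2)] .
  show "\<theta> p (T p) = 1" if "p \<in> V" for p
    using that V theta_th[OF _ T_tangent] dv_T th_t by (simp add: subset_iff)
  fix V' X p assume V': "open V' \<and> V' \<subseteq> V \<and> vector_field V' X" and p: "p \<in> V'"
  then have V'W: "open V'" "V' \<subseteq> W" and X: "vector_field V' X" using V by auto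
  have pW: "p \<in> W" using p V'W by blast
  have T': "vector_field V' T" using vector_field_subset[OF T_field V'W(2)] .
  show "ext_deriv \<theta> T X p = 0"
    using ext_deriv_eq[OF V'W T' X p] Om_t_tangent(1)[OF pW vector_field_tangent[OF X p]] dv_T[OF pW] by simp
qed

text \<open>The conditions on \<theta> and on its exterior derivative prescribe the
  \<Omega>-pairings of the represented field with \<open>\<sigma> p\<close> and with all directions
  tangent to the image of \<sigma>. These span the linear space.\<close>

lemma reeb_unique:
  assumes V: "open V" "V \<subseteq> W" and R: "reeb_field V \<theta> T'" and p: "p \<in> V"
  shows "T' p = T p"
proof (rule tangent_eqI)
  show pW: "p \<in> W" using p V by blast
  have T': "vector_field V T'" using R unfolding reeb_field_def by blast
  show tT: "T' p \<in> tangent p" using vector_field_tangent[OF T' p] .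
  show "T p \<in> tangent p" using T_tangent[OF pW] .
  have "\<theta> p (T' p) = 1" using R p unfolding reeb_field_def by blast
  then have "Om (\<sigma> p) (dv (T' p) \<sigma>) = 2 * s"
    using root[OF pW tT] sgn by auto
  then have a: "Om (dv (T' p) \<sigma>) (\<sigma> p) = - 2 * s"
    using Om_skew[of "\<sigma> p" "dv (T' p) \<sigma>"] by simp
  have b: "Om (dv (T' p) \<sigma>) (dv (dproj (\<sigma> p) z) \<sigma>) = 0" for z
  proof -
    have X: "vector_field V (\<lambda>q. dproj (\<sigma> q) z)"
      by (rule vector_field_dproj[OF V smooth_fun_const[OF V(1)]])
    then have "ext_deriv \<theta> T' (\<lambda>q. dproj (\<sigma> q) z) p = 0"
      using R p V(1) unfolding reeb_field_def by blast
    then show ?thesis using ext_deriv_eq[OF V T' X p] by simp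
  qed
  have "Om (dv (T' p) \<sigma>) z = Om (t p) z" for z
  proof -
    have "Om (dv (T' p) \<sigma>) z = Om (dv (T' p) \<sigma>) (dv (dproj (\<sigma> p) z) \<sigma> + ell p z *\<^sub>R \<sigma> p)"
      using decomp[OF pW, of z] by simp
    also have "\<dots> = - 2 * s * ell p z"
      using a b by (simp add: Om.add_right Om.scaleR_right)
    finally show ?thesis using Om_t[OF pW] by simp
  qed
  then show "dv (T' p) \<sigma> = dv (T p) \<sigma>"
    unfolding dv_T[OF pW] by (rule Om_eqI)
qed

lemma contact_plane_eq:
  assumes p: "p \<in> W"
  shows "v \<in> contact_plane \<omega> p \<longleftrightarrow> v \<in> tangent p \<and> Om (\<sigma> p) (dv v \<sigma>) = 0"
proof -
  have e: "contact_plane \<omega> p = dproj (\<sigma> p) ` {w. Om (\<sigma> p) w = 0}"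
    using contact_plane_proj[OF sec_nonzero[OF p] Om_self] proj_sec[OF p] by simp
  show ?thesis
  proof
    assume "v \<in> contact_plane \<omega> p"
    then obtain w where w: "v = dproj (\<sigma> p) w" "Om (\<sigma> p) w = 0" using e by blast
    have "Om (\<sigma> p) (dv v \<sigma> + ell p w *\<^sub>R \<sigma> p) = Om (\<sigma> p) (dv v \<sigma>)"
      by (simp add: Om.add_right Om.scaleR_right)
    moreover have "Om (\<sigma> p) w = Om (\<sigma> p) (dv v \<sigma> + ell p w *\<^sub>R \<sigma> p)"
      unfolding w(1) by (rule arg_cong[OF decomp[OF p]])
    ultimately have "Om (\<sigma> p) (dv v \<sigma>) = 0" using w(2) by (simp only:)
    moreover have "v \<in> tangent p" unfolding w(1) by (rule dproj_tangent[OF p])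
    ultimately show "v \<in> tangent p \<and> Om (\<sigma> p) (dv v \<sigma>) = 0" by blast
  next
    assume h: "v \<in> tangent p \<and> Om (\<sigma> p) (dv v \<sigma>) = 0"
    show "v \<in> contact_plane \<omega> p"
      unfolding e by (rule image_eqI[of _ _ "dv v \<sigma>"]) (use h dproj_dv[OF p, of v] in auto)
  qed
qed

lemma one_form_root: assumes V: "open V" "V \<subseteq> W" shows "one_form V \<theta>"
  unfolding one_form_def
proof (intro conjI ballI allI impI)
  fix p v w a b assume h: "p \<in> V" "v \<in> tangent p" "w \<in> tangent p"
  then have pW: "p \<in> W" using V by blast
  show "\<theta> p (\<lambda>f. a * v f + b * w f) = a * \<theta> p v + b * \<theta> p w"
    using theta_th[OF pW tangent_linear_comb[OF h(2,3)]] theta_th[OF pW h(2)] theta_th[OF pW h(3)]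
    by (simp add: dv_linear th_add th_scaleR)
next
  fix V' X assume h: "open V' \<and> V' \<subseteq> V \<and> vector_field V' X"
  then have V': "open V'" "V' \<subseteq> W" "vector_field V' X" using V by auto
  show "smooth_fun V' (\<lambda>p. \<theta> p (X p))"
    by (rule smooth_fun_cong[OF V'(1) _ smooth_th[OF V'(1,2) field_smooth[OF V']]])
      (use theta_th vector_field_tangent[OF V'(3)] V'(2) in \<open>simp add: subset_iff\<close>)
qed

lemma contact_form_root: assumes V: "open V" "V \<subseteq> W" shows "contact_form \<omega> V \<theta>"
  unfolding contact_form_def
proof (intro conjI ballI one_form_root[OF V])
  fix p assume "p \<in> V"
  then have p: "p \<in> W" using V by blast
  show "{v \<in> tangent p. \<theta> p v = 0} = contact_plane \<omega> p"
  proof -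
    have "\<theta> p v = 0 \<longleftrightarrow> Om (\<sigma> p) (dv v \<sigma>) = 0" if "v \<in> tangent p" for v
      unfolding root[OF p that] by simp
    then show ?thesis using contact_plane_eq[OF p] by blast
  qed
qed

text \<open>Duality makes \<open>\<sigma> p\<close> and the represented frame vectors independent,
  and their number is the dimension of the linear space, so they also span it. The map
  \<open>L\<close> packages this count.\<close>

lemma coframe_expand:
  assumes V: "open V" "V \<subseteq> W" and A: "adapted_coframe V \<theta> ch E" and p: "p \<in> V" and v: "v \<in> tangent p"
  shows "v = (\<lambda>f. \<Sum>\<alpha>\<in>UNIV. ch \<alpha> p v * E \<alpha> p f)"
proof -
  have pW: "p \<in> W" using p V by blast
  note s0 = sec_nonzero[OF pW]
  have o: "one_form V (ch \<alpha>)" "vector_field V (E \<alpha>)" for \<alpha>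
    using A unfolding adapted_coframe_def by blast+
  have d: "ch \<alpha> p (E \<beta> p) = (if \<alpha> = \<beta> then 1 else 0)" for \<alpha> \<beta>
    using A p unfolding adapted_coframe_def by blast
  have tE: "E \<alpha> p \<in> tangent p" for \<alpha> using vector_field_tangent[OF o(2) p] .
  define e where "e = (\<lambda>\<alpha>. dv (E \<alpha> p) \<sigma>)"
  have e: "dproj (\<sigma> p) (e \<alpha>) = E \<alpha> p" for \<alpha> unfolding e_def by (rule dproj_dv[OF pW tE])
  define L where "L = (\<lambda>c :: real ^ 'm ix. c $ None *\<^sub>R \<sigma> p + (\<Sum>\<alpha>\<in>UNIV. c $ Some \<alpha> *\<^sub>R e \<alpha>))"
  have lin: "linear L"
    unfolding L_def
    by (intro linearI) (simp_all add: scaleR_add_left sum.distrib scaleR_right_distrib scaleR_sum_right)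
  have Ld: "dproj (\<sigma> p) (L c) = (\<lambda>f. \<Sum>\<alpha>\<in>UNIV. c $ Some \<alpha> * E \<alpha> p f)" for c
    unfolding L_def by (simp add: dproj_add[OF s0] dproj_cmul[OF s0] dproj_self[OF s0] dproj_sum[OF s0] e)
  have cc: "ch \<beta> p (dproj (\<sigma> p) (L c)) = c $ Some \<beta>" for c \<beta>
    unfolding Ld using one_form_sum[where I = UNIV and v = "\<lambda>\<alpha>. E \<alpha> p" and c = "\<lambda>\<alpha>. c $ Some \<alpha>", OF o(1) p tE]
    by (simp add: d if_distrib cong: if_cong)
  have "inj L"
  proof (rule linear_injective_0[OF lin, THEN iffD2], intro allI impI)
    fix c assume L0: "L c = 0"
    have "c $ Some \<beta> = 0" for \<beta>
      using cc[of \<beta> c] L0 one_form_zero[OF o(1) p] dproj_zero[OF s0] by simp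
    moreover from this have "c $ None = 0" using L0 s0 by (simp add: L_def)
    ultimately have "c $ a = 0" for a by (cases a) auto
    then show "c = 0" by (simp add: vec_eq_iff)
  qed
  then obtain c where c: "L c = dv v \<sigma>"
    using linear_injective_imp_surjective[OF lin] by (metis surjD)
  have vL: "dproj (\<sigma> p) (L c) = v" using c dproj_dv[OF pW v] by simp
  have cc': "c $ Some \<alpha> = ch \<alpha> p v" for \<alpha> using cc[of \<alpha> c] unfolding vL by (rule sym)
  have "v = (\<lambda>f. \<Sum>\<alpha>\<in>UNIV. c $ Some \<alpha> * E \<alpha> p f)" using Ld[of c] unfolding vL .
  then show ?thesis unfolding cc' .
qed

lemma coframe_eqI:
  assumes V: "open V" "V \<subseteq> W" and A: "adapted_coframe V \<theta> ch E" and p: "p \<in> V" and v: "v \<in> tangent p"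
    and w: "w \<in> tangent p" and e: "\<And>\<alpha>. ch \<alpha> p v = ch \<alpha> p w"
  shows "v = w"
proof -
  have "v = (\<lambda>f. \<Sum>\<alpha>\<in>UNIV. ch \<alpha> p w * E \<alpha> p f)"
    using coframe_expand[OF V A p v] unfolding e .
  then show ?thesis using coframe_expand[OF V A p w] by (rule trans[OF _ sym])
qed

lemma coframe_Reeb:
  assumes V: "open V" "V \<subseteq> W" and A: "adapted_coframe V \<theta> ch E" and p: "p \<in> V"
  shows "E None p = T p" "ch (Some i) p (T p) = 0" "\<theta> p (E (Some i) p) = 0"
proof -
  have pW: "p \<in> W" using p V by blast
  obtain T' where T': "reeb_field V \<theta> T'" "\<And>p i. p \<in> V \<Longrightarrow> ch (Some i) p (T' p) = 0"
    using A unfolding adapted_coframe_def by blast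
  have TT: "T' p = T p" by (rule reeb_unique[OF V T'(1) p])
  have d: "ch \<alpha> p (E \<beta> p) = (if \<alpha> = \<beta> then 1 else 0)" for \<alpha> \<beta>
    using A p unfolding adapted_coframe_def by blast
  have n: "ch None p v = \<theta> p v" if "v \<in> tangent p" for v
    using A p that unfolding adapted_coframe_def by blast
  have tE: "E \<alpha> p \<in> tangent p" for \<alpha>
    using A p vector_field_tangent unfolding adapted_coframe_def by blast
  show ci: "ch (Some i) p (T p) = 0" for i using T'(2)[OF p] TT by simp
  have "\<theta> p (T p) = 1" using T'(1) TT p unfolding reeb_field_def by metis
  then have cn: "ch None p (T p) = 1" using n[OF T_tangent[OF pW]] by simp
  show "E None p = T p"
  proof (rule coframe_eqI[OF V A p tE T_tangent[OF pW]])
    show "ch \<alpha> p (E None p) = ch \<alpha> p (T p)" for \<alpha>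
      using ci cn d by (cases \<alpha>) simp_all
  qed
  show "\<theta> p (E (Some i) p) = 0" using n[OF tE, of "Some i"] d[of None "Some i"] by simp
qed

text \<open>The projection along \<open>\<sigma> p\<close> and \<open>t p\<close> onto their common \<open>\<Omega>\<close>-complement, which represents the
  contact hyperplane.\<close>

definition pi :: "'m ix projspace \<Rightarrow> real ^ 'm ix \<Rightarrow> real ^ 'm ix" where
  "pi p z = z - (s / 2 * Om z (t p)) *\<^sub>R \<sigma> p - th p z *\<^sub>R t p"

lemma linear_pi: "linear (pi p)"
  unfolding pi_def th_def
  by (intro linearI) (simp_all add: Om.add_left Om.add_right Om.scaleR_left Om.scaleR_right algebra_simps)

lemma Om_pi:
  assumes "p \<in> W"
  shows "Om (\<sigma> p) (pi p z) = 0" "Om (t p) (pi p z) = 0"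
  using Om_t_sec[OF assms] Om_skew[of "t p" z]
  by (simp_all add: pi_def th_def Om.diff_right Om.scaleR_right)

lemma pi_id: "Om z (t p) = 0 \<Longrightarrow> Om (\<sigma> p) z = 0 \<Longrightarrow> pi p z = z"
  by (simp add: pi_def th_def)

lemma pi_sec: "p \<in> W \<Longrightarrow> pi p (\<sigma> p) = 0" and pi_t: "p \<in> W \<Longrightarrow> pi p (t p) = 0"
  by (simp_all add: pi_def th_def Om_t_sec)

lemma Om_pi_tangent: "Om (t p) z = 0 \<Longrightarrow> Om (pi p w) z = Om w (z - th p z *\<^sub>R t p)"
  by (simp add: pi_def th_def Om.add_left Om.diff_left Om.diff_right Om.scaleR_left Om.scaleR_right algebra_simps)

lemma smooth_pi: assumes V: "open V" "V \<subseteq> W" "smooth_fun V z" shows "smooth_fun V (\<lambda>q. pi q (z q))"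
  unfolding pi_def
  by (intro smooth_fun_diff smooth_fun_scaleR V(1) V(3) smooth_th[OF V] t_smooth_on[OF V(1,2)] sec_smooth_on[OF V(1,2)]
      smooth_fun_mult smooth_fun_const smooth_fun_bilinear[OF bounded_bilinear_Om])

end

subsection \<open>The representative connection of a contact form\<close>

text \<open>A representative is built here from any symmetric tensor \<open>B\<close> along the
  section; geodesics enter only later. The symmetry \<open>B_Om\<close> under \<Omega> is what makes
  the exterior derivative of \<theta> parallel.\<close>

locale canonical = root_section \<omega> W \<sigma> s \<theta>
  for \<omega> :: "real ^ 'm::finite ^ 'm" and W :: "'m ix projspace set" and \<sigma> s \<theta> +
  fixes B :: "'m ix projspace \<Rightarrow> real ^ 'm ix \<Rightarrow> real ^ 'm ix \<Rightarrow> real ^ 'm ix"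
  assumes B_linear: "p \<in> W \<Longrightarrow> linear (B p a)"
    and B_sym: "p \<in> W \<Longrightarrow> B p a b = B p b a"
    and B_Om: "p \<in> W \<Longrightarrow> Om (B p a b) c = Om (B p a c) b"
    and B_smooth: "open V \<Longrightarrow> V \<subseteq> W \<Longrightarrow> smooth_fun V f \<Longrightarrow> smooth_fun V g \<Longrightarrow> smooth_fun V (\<lambda>q. B q (f q) (g q))"
begin

text \<open>Removes the Reeb component; applied to a vector tangent to the image of \<sigma> the
  result is in the complement of both \<open>\<sigma> p\<close> and \<open>t p\<close>.\<close>

definition horiz :: "'m ix projspace \<Rightarrow> real ^ 'm ix \<Rightarrow> real ^ 'm ix" where
  "horiz p a = a - th p a *\<^sub>R t p"

text \<open>In the value \<open>nabla_v Y\<close> the arguments \<open>x, tx\<close> are the derivatives of \<^term>\<open>\<sigma>\<close> and \<^term>\<open>t\<close>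
  along \<open>v\<close>, \<open>y, ty\<close> those along \<open>Y\<close>, \<open>A\<close> is the derivative along \<open>v\<close> of the representation
  of \<open>Y\<close>, and \<open>f\<close> that of \<open>\<theta>(Y)\<close>. On the contact hyperplane only \<open>pi p (A + B p x y)\<close> remains; the
  other terms encode that the Reeb field is parallel and has no torsion with other fields.\<close>

definition KK where
  "KK p x tx y ty A f = pi p (A - th p y *\<^sub>R tx - th p x *\<^sub>R ty + (th p x * th p y) *\<^sub>R dv (T p) t
     + B p (horiz p x) (horiz p y)) + f *\<^sub>R t p"

definition Nvec :: "'m ix projspace \<Rightarrow> 'm ix tvec \<Rightarrow> 'm ix vfield \<Rightarrow> real ^ 'm ix" where
  "Nvec p v Y = KK p (dv v \<sigma>) (dv v t) (dv (Y p) \<sigma>) (dv (Y p) t)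
     (dv v (\<lambda>q. dv (Y q) \<sigma>)) (v (\<lambda>q. th q (dv (Y q) \<sigma>)))"

definition Nb :: "'m ix conn" where
  "Nb p v Y = dproj (\<sigma> p) (Nvec p v Y)"

lemma horiz_linear: "horiz p (a + b) = horiz p a + horiz p b" "horiz p (r *\<^sub>R a) = r *\<^sub>R horiz p a"
  by (simp_all add: horiz_def th_add th_scaleR algebra_simps)

lemma B_add: "p \<in> W \<Longrightarrow> B p (a + b) c = B p a c + B p b c" "p \<in> W \<Longrightarrow> B p a (b + c) = B p a b + B p a c"
proof -
  show *: "p \<in> W \<Longrightarrow> B p a (b + c) = B p a b + B p a c" for a b c by (rule linear_add[OF B_linear])
  show "p \<in> W \<Longrightarrow> B p (a + b) c = B p a c + B p b c"
    using *[of c a b] B_sym[of p c] by metis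
qed

lemma B_scaleR: "p \<in> W \<Longrightarrow> B p (r *\<^sub>R a) c = r *\<^sub>R B p a c" "p \<in> W \<Longrightarrow> B p a (r *\<^sub>R c) = r *\<^sub>R B p a c"
proof -
  show *: "p \<in> W \<Longrightarrow> B p a (r *\<^sub>R c) = r *\<^sub>R B p a c" for a c by (rule linear_cmul[OF B_linear])
  show "p \<in> W \<Longrightarrow> B p (r *\<^sub>R a) c = r *\<^sub>R B p a c"
    using *[of c a] B_sym[of p c] by metis
qed

lemma KK_expand:
  "KK p x tx y ty A f = pi p A - th p y *\<^sub>R pi p tx - th p x *\<^sub>R pi p ty + (th p x * th p y) *\<^sub>R pi p (dv (T p) t)
     + pi p (B p (horiz p x) (horiz p y)) + f *\<^sub>R t p"
  unfolding KK_def by (simp add: linear_add[OF linear_pi] linear_diff[OF linear_pi] linear_cmul[OF linear_pi])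

lemma KK_linear1:
  assumes "p \<in> W"
  shows "KK p (a *\<^sub>R x + b *\<^sub>R x') (a *\<^sub>R tx + b *\<^sub>R tx') y ty (a *\<^sub>R A + b *\<^sub>R A') (a * f + b * f')
    = a *\<^sub>R KK p x tx y ty A f + b *\<^sub>R KK p x' tx' y ty A' f'"
  unfolding KK_expand
  by (simp add: linear_add[OF linear_pi] linear_cmul[OF linear_pi] th_add th_scaleR horiz_linear
      B_add[OF assms] B_scaleR[OF assms] algebra_simps)

lemma KK_add2:
  assumes "p \<in> W"
  shows "KK p x tx (y + y') (ty + ty') (A + A') (f + f')
    = KK p x tx y ty A f + KK p x tx y' ty' A' f'"
  unfolding KK_expand
  by (simp add: linear_add[OF linear_pi] th_add horiz_linear B_add[OF assms] algebra_simps)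

lemma KK_leibniz:
  assumes "p \<in> W" and y: "Om (t p) y = 0"
  shows "KK p x tx (h *\<^sub>R y) (h *\<^sub>R ty) (h *\<^sub>R A + c *\<^sub>R y) (h * f + c * th p y)
    = h *\<^sub>R KK p x tx y ty A f + c *\<^sub>R y"
proof -
  have "pi p y = y - th p y *\<^sub>R t p" using y Om_skew[of y "t p"] by (simp add: pi_def)
  note piy = this
  show ?thesis
    unfolding KK_expand linear_add[OF linear_pi] linear_cmul[OF linear_pi] piy th_scaleR horiz_linear B_scaleR[OF assms(1)]
    by (simp add: algebra_simps)
qed

lemma Om_KK: "p \<in> W \<Longrightarrow> Om (t p) (KK p x tx y ty A f) = 0" "p \<in> W \<Longrightarrow> th p (KK p x tx y ty A f) = f"
  unfolding KK_def
  by (simp_all add: th_add th_scaleR th_t Om.add_right Om.scaleR_right Om_pi) (simp add: th_def Om_pi)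

lemma dv_Nb: "p \<in> W \<Longrightarrow> dv (Nb p v Y) \<sigma> = Nvec p v Y"
  unfolding Nb_def by (rule dv_dproj_perp) (simp_all add: Nvec_def Om_KK)

lemma Nb_tangent: "p \<in> W \<Longrightarrow> Nb p v Y \<in> tangent p"
  unfolding Nb_def by (rule dproj_tangent)

lemma smooth_theta_field: "open V \<Longrightarrow> V \<subseteq> W \<Longrightarrow> vector_field V Y \<Longrightarrow> smooth_fun V (\<lambda>q. th q (dv (Y q) \<sigma>))"
  by (rule smooth_th[OF _ _ field_smooth])

lemma smooth_Nvec:
  assumes V: "open V" "V \<subseteq> W" and X: "vector_field V X" and Y: "vector_field V Y"
  shows "smooth_fun V (\<lambda>q. Nvec q (X q) Y)"
proof -
  have tV: "vector_field V T" using vector_field_subset[OF T_field V(2)] .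
  note d = vector_field_smooth_dv[OF _ V(1) order_refl]
  have h: "smooth_fun V (\<lambda>q. horiz q (dv (X q) \<sigma>))" if X: "vector_field V X" for X
    unfolding horiz_def
    by (rule smooth_fun_diff[OF V(1) field_smooth[OF V X]
          smooth_fun_scaleR[OF V(1) smooth_theta_field[OF V X] t_smooth_on[OF V]]])
  show ?thesis
    unfolding Nvec_def KK_def
    by (intro smooth_fun_add smooth_fun_diff smooth_fun_scaleR smooth_fun_mult smooth_pi V
        smooth_theta_field[OF V X] smooth_theta_field[OF V Y] d[OF X t_smooth_on[OF V]] d[OF Y t_smooth_on[OF V]]
        d[OF tV t_smooth_on[OF V]] d[OF X field_smooth[OF V Y]] B_smooth[OF V h[OF X] h[OF Y]]
        vector_field_smooth[OF X V(1) order_refl smooth_theta_field[OF V Y]] t_smooth_on[OF V])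
qed

lemma affine_connection_Nb: assumes V: "open V" "V \<subseteq> W" shows "affine_connection V Nb"
  unfolding affine_connection_def
proof (intro allI impI conjI ballI)
  fix W' X Y assume "open W' \<and> W' \<subseteq> V" and Y: "vector_field W' Y"
  then have W': "open W'" "W' \<subseteq> W" using V by auto
  show "vector_field W' (cov Nb X Y)" if X: "vector_field W' X"
    unfolding cov_def Nb_def by (rule vector_field_dproj[OF W' smooth_Nvec[OF W' X Y]])
  fix p v assume p: "p \<in> W'" and v: "v \<in> tangent p"
  have pW: "p \<in> W" using p W' by blast
  note s0 = sec_nonzero[OF pW]
  show "Nb p v Y \<in> tangent p" by (rule Nb_tangent[OF pW])
  show "Nb p (\<lambda>f. a * v f + b * w f) Y = (\<lambda>f. a * Nb p v Y f + b * Nb p w Y f)" if "w \<in> tangent p" for w a b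
    unfolding Nb_def Nvec_def by (simp add: dv_linear KK_linear1[OF pW] dproj_linear[OF s0])
  have tp: "Om (t p) (dv (Y p) \<sigma>) = 0" by (rule Om_t_tangent(1)[OF pW vector_field_tangent[OF Y p]])
  show "Nb p v (\<lambda>q f. Y q f + Z q f) = (\<lambda>f. Nb p v Y f + Nb p v Z f)" if Z: "vector_field W' Z" for Z
  proof -
    have "dv v (\<lambda>q. dv (\<lambda>f. Y q f + Z q f) \<sigma>) = dv v (\<lambda>q. dv (Y q) \<sigma>) + dv v (\<lambda>q. dv (Z q) \<sigma>)"
      unfolding dv_add by (rule dv_add_fun[OF v p W'(1) field_smooth[OF W' Y] field_smooth[OF W' Z]])
    moreover have "v (\<lambda>q. th q (dv (\<lambda>f. Y q f + Z q f) \<sigma>)) = v (\<lambda>q. th q (dv (Y q) \<sigma>)) + v (\<lambda>q. th q (dv (Z q) \<sigma>))"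
      unfolding dv_add th_add
      by (rule tvec_add[OF v p W'(1) smooth_theta_field[OF W' Y] smooth_theta_field[OF W' Z]])
    ultimately have "Nvec p v (\<lambda>q f. Y q f + Z q f) = Nvec p v Y + Nvec p v Z"
      unfolding Nvec_def by (simp add: dv_add KK_add2[OF pW])
    then show ?thesis unfolding Nb_def by (simp add: dproj_add[OF s0])
  qed
  show "Nb p v (\<lambda>q f. h q * Y q f) = (\<lambda>f. v h * Y p f + h p * Nb p v Y f)" if h: "smooth_fun W' h" for h
  proof -
    have "dv v (\<lambda>q. dv (\<lambda>f. h q * Y q f) \<sigma>) = h p *\<^sub>R dv v (\<lambda>q. dv (Y q) \<sigma>) + v h *\<^sub>R dv (Y p) \<sigma>"
      unfolding dv_cmul by (rule dv_scaleR_fun[OF v p W'(1) h field_smooth[OF W' Y]])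
    moreover have "v (\<lambda>q. th q (dv (\<lambda>f. h q * Y q f) \<sigma>)) = h p * v (\<lambda>q. th q (dv (Y q) \<sigma>)) + v h * th p (dv (Y p) \<sigma>)"
      unfolding dv_cmul th_scaleR by (rule tvec_mult[OF v p W'(1) h smooth_theta_field[OF W' Y]])
    ultimately have "Nvec p v (\<lambda>q f. h q * Y q f) = h p *\<^sub>R Nvec p v Y + v h *\<^sub>R dv (Y p) \<sigma>"
      unfolding Nvec_def by (simp add: dv_cmul KK_leibniz[OF pW tp])
    then show ?thesis
      unfolding Nb_def
      by (simp add: dproj_add[OF s0] dproj_cmul[OF s0] dproj_dv[OF pW vector_field_tangent[OF Y p]] add.commute)
  qed
  show "Nb p v Z = Nb p v Y" if Z: "vector_field W' Z \<and> (\<forall>q\<in>W'. Z q = Y q)" for Z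
  proof -
    have "dv v (\<lambda>q. dv (Z q) \<sigma>) = dv v (\<lambda>q. dv (Y q) \<sigma>)"
      by (rule dv_cong[OF v W'(1) p]) (use Z in simp)
    moreover have "v (\<lambda>q. th q (dv (Z q) \<sigma>)) = v (\<lambda>q. th q (dv (Y q) \<sigma>))"
      by (rule fun_tvec_cong[OF v W'(1) p]) (use Z in simp)
    moreover have "Z p = Y p" using Z p by blast
    ultimately show ?thesis unfolding Nb_def Nvec_def by simp
  qed
qed

lemma Nb_preserves_theta:
  assumes V: "open V" "V \<subseteq> W" and X: "vector_field V X" and Y: "vector_field V Y" and p: "p \<in> V"
  shows "X p (\<lambda>q. \<theta> q (Y q)) - \<theta> p (cov Nb X Y p) = 0"
proof -
  have pW: "p \<in> W" using p V by blast
  have "\<theta> p (cov Nb X Y p) = X p (\<lambda>q. th q (dv (Y q) \<sigma>))"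
    unfolding cov_def theta_th[OF pW Nb_tangent[OF pW]] dv_Nb[OF pW]
    by (simp add: Nvec_def Om_KK[OF pW])
  then show ?thesis using tvec_theta(1)[OF V X Y p] by simp
qed

text \<open>Obtained by differentiating \<open>Om (t q) (dv (Y q) \<sigma>) = 0\<close>, that is,
  the fact that \<open>t\<close> is \<Omega>-normal to the image of \<sigma>.\<close>

lemma derivative_perp_t:
  assumes V: "open V" "V \<subseteq> W" and Y: "vector_field V Y" and p: "p \<in> V" and v: "v \<in> tangent p"
  shows "Om (dv v t) (dv (Y p) \<sigma>) = - Om (t p) (dv v (\<lambda>q. dv (Y q) \<sigma>))"
proof -
  have "v (\<lambda>q. Om (t q) (dv (Y q) \<sigma>)) = v (\<lambda>q. 0)"
    by (rule fun_tvec_cong[OF v V(1) p]) (use Om_t_tangent(1) vector_field_tangent[OF Y] V(2) in blast)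
  then show ?thesis
    using tvec_bilinear[OF bounded_bilinear_Om v p V(1) t_smooth_on[OF V] field_smooth[OF V Y]] tvec_const[OF v]
    by simp
qed

text \<open>Symmetry of the second fundamental form of the image of \<sigma> for the normal
  \<open>t\<close>; as usual it holds because the bracket of two tangent fields is tangent.\<close>

lemma derivative_t_symmetric:
  assumes V: "open V" "V \<subseteq> W" and Y: "vector_field V Y" and Z: "vector_field V Z" and p: "p \<in> V"
  shows "Om (dv (Y p) t) (dv (Z p) \<sigma>) = Om (dv (Z p) t) (dv (Y p) \<sigma>)"
proof -
  have pW: "p \<in> W" using p V by blast
  have "Om (t p) (dv (bracket Y Z p) \<sigma>) = 0"
    by (rule Om_t_tangent(1)[OF pW bracket_tangent[OF V Y Z p]])
  then show ?thesis
    using derivative_perp_t[OF V Y p vector_field_tangent[OF Z p]]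
      derivative_perp_t[OF V Z p vector_field_tangent[OF Y p]] dv_bracket[OF sec_smooth_on[OF V] V(1) p, of Y Z]
    by (simp add: Om.diff_right)
qed

text \<open>In the sum of the two connection terms the derivatives of \<open>t\<close> cancel by
  \<open>derivative_perp_t\<close> and \<open>derivative_t_symmetric\<close>, and the two
  \<open>B\<close> terms cancel by \<open>B_Om\<close>. What is left is the product rule for
  \<Omega>.\<close>

lemma Nb_preserves_dtheta:
  assumes V: "open V" "V \<subseteq> W" and X: "vector_field V X" and Y: "vector_field V Y" and Z: "vector_field V Z"
    and p: "p \<in> V"
  shows "X p (ext_deriv \<theta> Y Z) - ext_deriv \<theta> (cov Nb X Y) Z p - ext_deriv \<theta> Y (cov Nb X Z) p = 0"
proof -
  have pW: "p \<in> W" using p V by blast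
  have tX: "X p \<in> tangent p" using vector_field_tangent[OF X p] .
  have c: "vector_field V (cov Nb X Y)" if "vector_field V Y" for Y
    unfolding cov_def Nb_def by (rule vector_field_dproj[OF V smooth_Nvec[OF V X that]])
  have TV: "vector_field V T" using vector_field_subset[OF T_field V(2)] .
  define x y z tt where "x = dv (X p) \<sigma>" and "y = dv (Y p) \<sigma>" and "z = dv (Z p) \<sigma>" and "tt = dv (T p) t"
  define tx ty tz where "tx = dv (X p) t" and "ty = dv (Y p) t" and "tz = dv (Z p) t"
  define A C where "A = dv (X p) (\<lambda>q. dv (Y q) \<sigma>)" and "C = dv (X p) (\<lambda>q. dv (Z q) \<sigma>)"
  define \<alpha> \<gamma> where "\<alpha> = X p (\<lambda>q. th q (dv (Y q) \<sigma>))" and "\<gamma> = X p (\<lambda>q. th q (dv (Z q) \<sigma>))"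
  note defs = x_def y_def z_def tt_def tx_def ty_def tz_def A_def C_def \<alpha>_def \<gamma>_def
  have ty0: "Om (t p) y = 0" "Om (t p) z = 0"
    unfolding defs using Om_t_tangent(1)[OF pW] vector_field_tangent[OF Y p] vector_field_tangent[OF Z p] by blast+
  have At: "Om A (t p) = Om tx y" "Om C (t p) = Om tx z"
    unfolding defs derivative_perp_t[OF V Y p tX] derivative_perp_t[OF V Z p tX] by (rule Om_skew)+
  have q: "Om tz y = Om ty z" "Om ty (t p) = Om tt y" "Om tz (t p) = Om tt z"
    using derivative_t_symmetric[OF V Y Z p] derivative_t_symmetric[OF V Y TV p]
      derivative_t_symmetric[OF V Z TV p] dv_T[OF pW] unfolding defs by simp_all
  have N: "Nvec p (X p) Y = KK p x tx y ty A \<alpha>" "Nvec p (X p) Z = KK p x tx z tz C \<gamma>"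
    unfolding Nvec_def defs by (rule refl)+
  have "ext_deriv \<theta> (cov Nb X Y) Z p = s * Om (KK p x tx y ty A \<alpha>) z"
    using ext_deriv_eq[OF V c[OF Y] Z p] dv_Nb[OF pW] by (simp add: cov_def N z_def)
  moreover have "ext_deriv \<theta> Y (cov Nb X Z) p = s * Om y (KK p x tx z tz C \<gamma>)"
    using ext_deriv_eq[OF V Y c[OF Z] p] dv_Nb[OF pW] by (simp add: cov_def N y_def)
  moreover have "X p (ext_deriv \<theta> Y Z) = s * (Om y C + Om A z)"
  proof -
    have sm: "smooth_fun V (\<lambda>q. Om (dv (Y q) \<sigma>) (dv (Z q) \<sigma>))"
      by (rule smooth_fun_bilinear[OF bounded_bilinear_Om V(1) field_smooth[OF V Y] field_smooth[OF V Z]])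
    have "X p (ext_deriv \<theta> Y Z) = X p (\<lambda>q. s * Om (dv (Y q) \<sigma>) (dv (Z q) \<sigma>))"
      by (rule fun_tvec_cong[OF tX V(1) p]) (rule ext_deriv_eq[OF V Y Z])
    also have "\<dots> = s * X p (\<lambda>q. Om (dv (Y q) \<sigma>) (dv (Z q) \<sigma>))"
      by (rule tvec_cmul[OF tX p V(1) sm])
    finally show ?thesis
      using tvec_bilinear[OF bounded_bilinear_Om tX p V(1) field_smooth[OF V Y] field_smooth[OF V Z]]
      unfolding defs by simp
  qed
  moreover have "Om (KK p x tx y ty A \<alpha>) z + Om y (KK p x tx z tz C \<gamma>) = Om A z + Om y C"
  proof -
    have e: "Om (KK p x tx y ty A \<alpha>) z = Om A z - th p z * Om A (t p) - th p y * (Om tx z - th p z * Om tx (t p))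
        - th p x * (Om ty z - th p z * Om ty (t p)) + th p x * th p y * (Om tt z - th p z * Om tt (t p))
        + Om (B p (horiz p x) (horiz p y)) (horiz p z)"
      if "Om (t p) z = 0" for y ty A \<alpha> z
      unfolding KK_def Om.add_left Om_pi_tangent[OF that] Om.scaleR_left that horiz_def[of p z, symmetric]
      by (simp add: Om.add_left Om.diff_left Om.scaleR_left horiz_def[of p z] Om.diff_right Om.scaleR_right tt_def algebra_simps)
    have b: "Om (B p (horiz p x) (horiz p z)) (horiz p y) = Om (B p (horiz p x) (horiz p y)) (horiz p z)"
      by (rule B_Om[OF pW])
    show ?thesis
      unfolding Om_skew[of y "KK p x tx z tz C \<gamma>"] Om_skew[of y C] e[OF ty0(1)] e[OF ty0(2)] At q b
      by (simp add: algebra_simps)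
  qed
  ultimately show ?thesis
    using sgn by (metis (no_types, lifting) add.commute diff_diff_add diff_self distrib_left)
qed

text \<open>The right side is the exterior derivative of \<theta> times the Reeb field.
  \<open>B\<close> drops out by symmetry, and the \<theta>-component of the torsion has this value
  because \<theta> is parallel.\<close>

lemma torsion_Nb:
  assumes V: "open V" "V \<subseteq> W" and X: "vector_field V X" and Y: "vector_field V Y" and p: "p \<in> V"
  shows "torsion Nb X Y p = (\<lambda>f. (s * Om (dv (X p) \<sigma>) (dv (Y p) \<sigma>)) * T p f)"
proof -
  have pW: "p \<in> W" using p V by blast
  note s0 = sec_nonzero[OF pW]
  define \<beta> where "\<beta> = dv (X p) (\<lambda>q. dv (Y q) \<sigma>) - dv (Y p) (\<lambda>q. dv (X q) \<sigma>)"
  have b: "\<beta> = dv (bracket X Y p) \<sigma>"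
    unfolding \<beta>_def using dv_bracket[OF sec_smooth_on[OF V] V(1) p] by simp
  have bt: "Om \<beta> (t p) = 0" unfolding b by (rule Om_t_tangent(2)[OF pW bracket_tangent[OF V X Y p]])
  have e: "X p (\<lambda>q. th q (dv (Y q) \<sigma>)) - Y p (\<lambda>q. th q (dv (X q) \<sigma>)) - th p \<beta> = s * Om (dv (X p) \<sigma>) (dv (Y p) \<sigma>)"
    using ext_deriv_eq[OF V X Y p] tvec_theta(1)[OF V X Y p] tvec_theta(1)[OF V Y X p]
      theta_th[OF pW bracket_tangent[OF V X Y p]] unfolding b ext_deriv_def by simp
  have "Nvec p (X p) Y - Nvec p (Y p) X = pi p \<beta> + (X p (\<lambda>q. th q (dv (Y q) \<sigma>)) - Y p (\<lambda>q. th q (dv (X q) \<sigma>))) *\<^sub>R t p"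
    unfolding Nvec_def KK_expand \<beta>_def linear_diff[OF linear_pi]
    using B_sym[OF pW, of "horiz p (dv (X p) \<sigma>)"] by (simp add: algebra_simps)
  also have "\<dots> = \<beta> + (s * Om (dv (X p) \<sigma>) (dv (Y p) \<sigma>)) *\<^sub>R t p"
    unfolding e[symmetric] pi_def bt by (simp add: algebra_simps)
  finally have n: "Nvec p (X p) Y - Nvec p (Y p) X - \<beta> = (s * Om (dv (X p) \<sigma>) (dv (Y p) \<sigma>)) *\<^sub>R t p" by simp
  have "bracket X Y p = dproj (\<sigma> p) \<beta>" unfolding \<beta>_def by (rule bracket_dproj[OF V X Y p])
  then have "torsion Nb X Y p = dproj (\<sigma> p) (Nvec p (X p) Y - Nvec p (Y p) X - \<beta>)"
    unfolding torsion_def cov_def Nb_def dproj_diff[OF s0] by simp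
  then show ?thesis unfolding n dproj_cmul[OF s0] T_def .
qed

text \<open>A torsion that is proportional to the Reeb field and vanishes when one argument is the
  Reeb field satisfies both torsion normalizations; the geodesic condition is passed on as the
  premise \<open>G\<close>.\<close>

lemma representative_Nb:
  assumes V: "open V" "V \<subseteq> W"
    and G: "\<And>I \<gamma>. \<G> I \<gamma> \<Longrightarrow> \<gamma> ` I \<subseteq> V \<Longrightarrow> unparam_geodesic V Nb I \<gamma>"
  shows "representative V \<G> \<theta> Nb"
  unfolding representative_def
proof (intro conjI allI impI ballI affine_connection_Nb[OF V])
  show "unparam_geodesic V Nb I \<gamma>" if "\<G> I \<gamma> \<and> \<gamma> ` I \<subseteq> V" for I \<gamma> using G that by blast
next
  fix W' X Y p assume "open W' \<and> W' \<subseteq> V \<and> vector_field W' X \<and> vector_field W' Y" "p \<in> W'"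
  then show "X p (\<lambda>q. \<theta> q (Y q)) - \<theta> p (cov Nb X Y p) = 0"
    using Nb_preserves_theta[of W' X Y p] V by auto
next
  fix W' X Y Z p assume "open W' \<and> W' \<subseteq> V \<and> vector_field W' X \<and> vector_field W' Y \<and> vector_field W' Z" "p \<in> W'"
  then show "X p (ext_deriv \<theta> Y Z) - ext_deriv \<theta> (cov Nb X Y) Z p - ext_deriv \<theta> Y (cov Nb X Z) p = 0"
    using Nb_preserves_dtheta[of W' X Y Z p] V by auto
next
  fix W' ch E p i
  assume "open W' \<and> W' \<subseteq> V \<and> adapted_coframe W' \<theta> ch E" and p: "p \<in> W'"
  then have W': "open W'" "W' \<subseteq> W" and ad: "adapted_coframe W' \<theta> ch E" using V by auto
  have pW: "p \<in> W" using p W' by blast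
  have E: "vector_field W' (E \<alpha>)" and o: "one_form W' (ch \<alpha>)" for \<alpha> using ad unfolding adapted_coframe_def by blast+
  note R = coframe_Reeb[OF W' ad p]
  have tor: "torsion Nb (E \<alpha>) (E \<beta>) p = (\<lambda>f. (s * Om (dv (E \<alpha> p) \<sigma>) (dv (E \<beta> p) \<sigma>)) * T p f)" for \<alpha> \<beta>
    by (rule torsion_Nb[OF W' E E p])
  have ch0: "ch (Some k) p (torsion Nb (E \<alpha>) (E \<beta>) p) = 0" for k \<alpha> \<beta>
    unfolding tor one_form_cmul[OF o p T_tangent[OF pW]] R(2) by simp
  have z: "Om (dv (E None p) \<sigma>) (dv (E \<alpha> p) \<sigma>) = 0" "Om (dv (E \<alpha> p) \<sigma>) (dv (E None p) \<sigma>) = 0" for \<alpha>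
    unfolding R(1) dv_T[OF pW]
    using Om_t_tangent[OF pW vector_field_tangent[OF E p]] by simp_all
  have tz: "torsion Nb (E None) (E \<alpha>) p = (\<lambda>f. 0)" "torsion Nb (E \<alpha>) (E None) p = (\<lambda>f. 0)" for \<alpha>
    unfolding tor z by simp_all
  show "ch \<alpha> p (torsion Nb (E None) (E (Some i)) p) = 0" "ch \<alpha> p (torsion Nb (E (Some i)) (E None) p) = 0" for \<alpha>
    unfolding tz by (rule one_form_zero[OF o p])+
  show "(\<Sum>k\<in>UNIV. ch (Some k) p (torsion Nb (E (Some i)) (E (Some k)) p)) = 0"
    "(\<Sum>k\<in>UNIV. ch (Some k) p (torsion Nb (E (Some k)) (E (Some i)) p)) = 0"
    by (simp_all add: ch0)
qed

end

subsection \<open>Curves\<close>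

lemma smooth_curve_preimage:
  assumes "smooth_curve I \<gamma>" "open I" "open W" shows "open (I \<inter> \<gamma> -` W)"
  using assms unfolding smooth_curve_def by (intro continuous_open_preimage) blast+

lemma smooth_curve_fun:
  fixes f :: "'k::finite projspace \<Rightarrow> real"
  assumes "smooth_curve I \<gamma>" "open W" "smooth_fun W f"
  shows "smooth_on (I \<inter> \<gamma> -` W) (\<lambda>s. f (\<gamma> s))"
  using assms unfolding smooth_curve_def by blast

lemma smooth_curve_vec:
  fixes g :: "'k::finite projspace \<Rightarrow> real ^ 'j"
  assumes "smooth_curve I \<gamma>" "open I" "open W" "smooth_fun W g"
  shows "smooth_on (I \<inter> \<gamma> -` W) (\<lambda>s. g (\<gamma> s))"
  unfolding smooth_on_vec_iff[OF smooth_curve_preimage[OF assms(1-3)]]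
  using smooth_curve_fun[OF assms(1,3) smooth_fun_nth[OF assms(3,4)]] by blast

lemma deriv_eq_fd:
  fixes f :: "real \<Rightarrow> real"
  assumes "f differentiable (at t)" shows "deriv f t = fd f t 1"
proof -
  have d: "(f has_derivative fd f t) (at t)" by (rule fd_works[OF assms])
  have "fd f t x = fd f t 1 * x" for x
    using linear_cmul[OF has_derivative_linear[OF d], of x 1] by simp
  then have "fd f t = (*) (fd f t 1)" by blast
  then have "(f has_real_derivative fd f t 1) (at t)"
    using d by (simp add: has_field_derivative_def)
  then show ?thesis by (rule DERIV_imp_deriv)
qed

lemma velocity_apply:
  fixes f :: "'k::finite projspace \<Rightarrow> real"
  assumes "smooth_curve I \<gamma>" "open I" "open W" "smooth_fun W f" "t \<in> I" "\<gamma> t \<in> W"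
  shows "velocity \<gamma> t f = fd (\<lambda>s. f (\<gamma> s)) t 1"
proof -
  have "(\<lambda>s. f (\<gamma> s)) differentiable (at t)"
    by (rule smooth_on_differentiable[OF smooth_curve_fun[OF assms(1,3,4)] smooth_curve_preimage[OF assms(1-3)]])
      (use assms in simp)
  then show ?thesis
    using smooth_fun_imp_smooth_at[OF assms(4,3,6)] deriv_eq_fd by (simp add: velocity_def)
qed

lemma dv_velocity:
  fixes g :: "'k::finite projspace \<Rightarrow> real ^ 'j"
  assumes "smooth_curve I \<gamma>" "open I" "open W" "smooth_fun W g" "t \<in> I" "\<gamma> t \<in> W"
  shows "dv (velocity \<gamma> t) g = fd (\<lambda>s. g (\<gamma> s)) t 1"
proof -
  have d: "(\<lambda>s. g (\<gamma> s)) differentiable (at t)"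
    by (rule smooth_on_differentiable[OF smooth_curve_vec[OF assms(1-4)] smooth_curve_preimage[OF assms(1-3)]])
      (use assms in simp)
  have "velocity \<gamma> t (\<lambda>q. g q $ i) = fd (\<lambda>s. g (\<gamma> s)) t 1 $ i" for i
    using velocity_apply[OF assms(1-3) smooth_fun_nth[OF assms(3,4)] assms(5,6), of i] fd_vec_nth[OF d] by simp
  then show ?thesis by (simp add: dv_def vec_eq_iff)
qed

lemma smooth_on_curve_derivative:
  fixes c :: "real \<Rightarrow> 'b::real_normed_vector"
  shows "smooth_on I c \<Longrightarrow> smooth_on I (\<lambda>s. fd c s 1)"
  by (rule smooth_on_fd)

lemma (in proj_section) velocity_section:
  assumes "smooth_curve I \<gamma>" "open I" "\<gamma> ` I \<subseteq> W" "t \<in> I"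
  shows "velocity \<gamma> t = dproj (\<sigma> (\<gamma> t)) (fd (\<lambda>s. \<sigma> (\<gamma> s)) t 1)"
    and "velocity \<gamma> t \<in> tangent (\<gamma> t)"
    and "dv (velocity \<gamma> t) \<sigma> = fd (\<lambda>s. \<sigma> (\<gamma> s)) t 1"
    and "smooth_on I (\<lambda>s. \<sigma> (\<gamma> s))"
proof -
  have gt: "\<gamma> t \<in> W" using assms by blast
  have IW: "I \<inter> \<gamma> -` W = I" using assms(3) by blast
  show sm: "smooth_on I (\<lambda>s. \<sigma> (\<gamma> s))"
    using smooth_curve_vec[OF assms(1,2) W_open sec_smooth] unfolding IW .
  show "dv (velocity \<gamma> t) \<sigma> = fd (\<lambda>s. \<sigma> (\<gamma> s)) t 1"
    by (rule dv_velocity[OF assms(1,2) W_open sec_smooth assms(4) gt])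
  show e: "velocity \<gamma> t = dproj (\<sigma> (\<gamma> t)) (fd (\<lambda>s. \<sigma> (\<gamma> s)) t 1)"
  proof
    fix f
    show "velocity \<gamma> t f = dproj (\<sigma> (\<gamma> t)) (fd (\<lambda>s. \<sigma> (\<gamma> s)) t 1) f"
    proof (cases "smooth_at (\<gamma> t) f")
      case True
      then obtain V where V: "open V" "\<gamma> t \<in> V" "smooth_fun V f" unfolding smooth_at_def by blast
      have c: "\<sigma> (\<gamma> t) \<in> cone V" using sec_cone[OF V(2) gt] .
      have o: "open (I \<inter> \<gamma> -` V)" "t \<in> I \<inter> \<gamma> -` V"
        using smooth_curve_preimage[OF assms(1,2) V(1)] V assms by auto
      have "fd (\<lambda>s. f (proj (\<sigma> (\<gamma> s)))) t 1 = fd (\<lambda>z. f (proj z)) (\<sigma> (\<gamma> t)) (fd (\<lambda>s. \<sigma> (\<gamma> s)) t 1)"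
        using fd_compose[where x = t and f = "\<lambda>s. \<sigma> (\<gamma> s)" and g = "\<lambda>z. f (proj z)", OF smooth_on_differentiable[OF sm assms(2,4)]]
          smooth_fun_has_derivative[OF V(3,1) c] differentiableI by blast
      moreover have "fd (\<lambda>s. f (proj (\<sigma> (\<gamma> s)))) t = fd (\<lambda>s. f (\<gamma> s)) t"
        by (rule fd_open_cong[OF assms(2,4)]) (use assms(3) proj_sec in \<open>simp add: image_subset_iff\<close>)
      ultimately show ?thesis
        using velocity_apply[OF assms(1,2) V(1,3) assms(4) V(2)] dproj_apply[OF V(3,1) c] by simp
    qed (simp add: velocity_def dproj_def proj_sec[OF gt])
  qed
  show "velocity \<gamma> t \<in> tangent (\<gamma> t)" unfolding e by (rule dproj_tangent[OF gt])
qed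

text \<open>For a curve tangent to the contact planes, \<open>KK\<close> reduces to
  \<open>pi\<close> of the acceleration corrected by \<open>B\<close>. The projection kills
  \<open>\<sigma>\<close> and fixes the velocity, so a corrected acceleration in the plane of
  position and velocity becomes a multiple of the velocity.\<close>

lemma (in canonical) unparam_geodesic_Nb:
  assumes V: "open V" "V \<subseteq> W" and im: "immersed_path I \<gamma>" "\<gamma> ` I \<subseteq> V"
    and hor: "\<And>t. t \<in> I \<Longrightarrow> Om (\<sigma> (\<gamma> t)) (fd (\<lambda>s. \<sigma> (\<gamma> s)) t 1) = 0"
    and acc: "\<And>t. t \<in> I \<Longrightarrow> \<exists>\<alpha> \<beta>. fd (\<lambda>r. fd (\<lambda>s. \<sigma> (\<gamma> s)) r 1) t 1
       + B (\<gamma> t) (fd (\<lambda>s. \<sigma> (\<gamma> s)) t 1) (fd (\<lambda>s. \<sigma> (\<gamma> s)) t 1)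
       = \<alpha> *\<^sub>R \<sigma> (\<gamma> t) + \<beta> *\<^sub>R fd (\<lambda>s. \<sigma> (\<gamma> s)) t 1"
  shows "unparam_geodesic V Nb I \<gamma>"
  unfolding unparam_geodesic_def
proof (intro conjI ballI allI impI im)
  fix t0 W' X J
  assume t0: "t0 \<in> I" and "open W' \<and> W' \<subseteq> V \<and> vector_field W' X \<and> open J \<and> t0 \<in> J \<and> J \<subseteq> I \<and>
       (\<forall>s\<in>J. \<gamma> s \<in> W' \<and> X (\<gamma> s) = velocity \<gamma> s)"
  then have W': "open W'" "W' \<subseteq> W" "vector_field W' X" and J: "open J" "t0 \<in> J" "J \<subseteq> I"
    and X: "\<And>s. s \<in> J \<Longrightarrow> \<gamma> s \<in> W'" "\<And>s. s \<in> J \<Longrightarrow> X (\<gamma> s) = velocity \<gamma> s"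
    using V by auto
  have sc: "smooth_curve I \<gamma>" "open I" using im(1) unfolding immersed_path_def by blast+
  have gW: "\<gamma> ` I \<subseteq> W" using im V by blast
  define p where "p = \<gamma> t0"
  define c where "c = (\<lambda>s. \<sigma> (\<gamma> s))"
  have pW: "p \<in> W" and pW': "p \<in> W'" unfolding p_def using gW t0 X J by auto
  note vs = velocity_section[OF sc gW, folded c_def]
  have v: "velocity \<gamma> t0 \<in> tangent p" "dv (velocity \<gamma> t0) \<sigma> = fd c t0 1" unfolding p_def using vs t0 by blast+
  have eta: "dv (X (\<gamma> s)) \<sigma> = fd c s 1" if "s \<in> J" for s
    using X(2)[OF that] vs(3) J that by auto
  have A: "dv (velocity \<gamma> t0) (\<lambda>q. dv (X q) \<sigma>) = fd (\<lambda>r. fd c r 1) t0 1"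
  proof -
    have "dv (velocity \<gamma> t0) (\<lambda>q. dv (X q) \<sigma>) = fd (\<lambda>s. dv (X (\<gamma> s)) \<sigma>) t0 1"
      by (rule dv_velocity[OF sc W'(1) field_smooth[OF W'] t0 pW'[unfolded p_def]])
    also have "fd (\<lambda>s. dv (X (\<gamma> s)) \<sigma>) t0 = fd (\<lambda>r. fd c r 1) t0"
      by (rule fd_open_cong[OF J(1,2) eta])
    finally show ?thesis .
  qed
  have th0: "th (\<gamma> s) (dv (X (\<gamma> s)) \<sigma>) = 0" if "s \<in> J" for s
    using eta[OF that] hor[of s] J that by (auto simp: th_def c_def)
  have f: "velocity \<gamma> t0 (\<lambda>q. th q (dv (X q) \<sigma>)) = 0"
  proof -
    have "velocity \<gamma> t0 (\<lambda>q. th q (dv (X q) \<sigma>)) = fd (\<lambda>s. th (\<gamma> s) (dv (X (\<gamma> s)) \<sigma>)) t0 1"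
      by (rule velocity_apply[OF sc W'(1) smooth_theta_field[OF W'] t0 pW'[unfolded p_def]])
    also have "fd (\<lambda>s. th (\<gamma> s) (dv (X (\<gamma> s)) \<sigma>)) t0 = fd (\<lambda>s. 0) t0"
      by (rule fd_open_cong[OF J(1,2) th0])
    finally show ?thesis by (simp add: frechet_derivative_const)
  qed
  define x where "x = fd c t0 1"
  have thx: "th p x = 0" using hor[OF t0] by (simp add: th_def p_def x_def c_def)
  have Xp: "dv (X p) \<sigma> = x" unfolding p_def x_def by (rule eta[OF J(2)])
  obtain \<alpha> \<beta> where ab: "fd (\<lambda>r. fd c r 1) t0 1 + B p x x = \<alpha> *\<^sub>R \<sigma> p + \<beta> *\<^sub>R x"
    using acc[OF t0] unfolding c_def p_def x_def by blast
  have "Nvec p (velocity \<gamma> t0) X = pi p (fd (\<lambda>r. fd c r 1) t0 1 + B p x x)"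
    unfolding Nvec_def KK_def A f v(2) Xp x_def[symmetric] by (simp add: thx horiz_def)
  also have "\<dots> = \<beta> *\<^sub>R x"
  proof -
    have "Om x (t p) = 0" using Om_t_tangent(2)[OF pW v(1)] v(2) by (simp add: x_def)
    then have "pi p x = x" using thx by (simp add: pi_def)
    then show ?thesis
      unfolding ab by (simp add: linear_add[OF linear_pi] linear_cmul[OF linear_pi] pi_sec[OF pW])
  qed
  finally have "Nb p (velocity \<gamma> t0) X = dproj (\<sigma> p) (\<beta> *\<^sub>R x)" unfolding Nb_def by simp
  also have "\<dots> = (\<lambda>f. \<beta> * velocity \<gamma> t0 f)"
    unfolding dproj_cmul[OF sec_nonzero[OF pW]] using vs(1)[OF t0] by (simp add: p_def c_def x_def)
  finally show "\<exists>c. Nb (\<gamma> t0) (velocity \<gamma> t0) X = (\<lambda>f. c * velocity \<gamma> t0 f)"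
    unfolding p_def by blast
qed

section \<open>Curves in linear subspaces and their preimages under a lift\<close>

lemma fd_apply_derivative:
  fixes F :: "real ^ 'k \<Rightarrow> real ^ 'j" and c k :: "real \<Rightarrow> real ^ 'k"
  assumes F: "smooth_on S F" "open S" and I: "open I" "t \<in> I" "\<And>s. s \<in> I \<Longrightarrow> c s \<in> S"
    and c: "c differentiable (at t)" and k: "k differentiable (at t)"
  shows "fd (\<lambda>s. fd F (c s) (k s)) t r = fd (\<lambda>x. fd F x (k t)) (c t) (fd c t r) + fd F (c t) (fd k t r)"
proof -
  have ct: "c t \<in> S" using I by blast
  have ex: "fd F x z = (\<Sum>i\<in>UNIV. z $ i *\<^sub>R fd F x (axis i 1))" if "x \<in> S" for x z
    by (rule linear_axis_expansion[OF linear_fd[OF F that]])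
  have dF: "((\<lambda>x. fd F x b) has_derivative fd (\<lambda>x. fd F x b) (c t)) (at (c t))" for b
    by (rule smooth_on_has_derivative[OF smooth_on_fd[OF F(1)] F(2) ct])
  have 1: "fd (\<lambda>s. fd F (c s) (k s)) t = fd (\<lambda>s. \<Sum>i\<in>UNIV. k s $ i *\<^sub>R fd F (c s) (axis i 1)) t"
    by (rule fd_open_cong[OF I(1,2)]) (rule ex[OF I(3)])
  have 2: "fd (\<lambda>s. \<Sum>i\<in>UNIV. k s $ i *\<^sub>R fd F (c s) (axis i 1)) t
      = (\<lambda>r. \<Sum>i\<in>UNIV. k t $ i *\<^sub>R fd (\<lambda>x. fd F x (axis i 1)) (c t) (fd c t r) + fd k t r $ i *\<^sub>R fd F (c t) (axis i 1))"
    by (rule fd_eq, rule has_derivative_sum,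
        rule bounded_bilinear.FDERIV[OF bounded_bilinear_scaleR])
      (rule bounded_linear.has_derivative[OF bounded_linear_vec_nth fd_works[OF k]],
        rule has_derivative_compose[OF fd_works[OF c] dF])
  have 3: "fd (\<lambda>x. fd F x (k t)) (c t) w = (\<Sum>i\<in>UNIV. k t $ i *\<^sub>R fd (\<lambda>x. fd F x (axis i 1)) (c t) w)" for w
  proof -
    have "fd (\<lambda>x. fd F x (k t)) (c t) = fd (\<lambda>x. \<Sum>i\<in>UNIV. k t $ i *\<^sub>R fd F x (axis i 1)) (c t)"
      by (rule fd_open_cong[OF F(2) ct]) (rule ex)
    also have "\<dots> = (\<lambda>w. \<Sum>i\<in>UNIV. k t $ i *\<^sub>R fd (\<lambda>x. fd F x (axis i 1)) (c t) w)"
      by (rule fd_eq, rule has_derivative_sum, rule has_derivative_scaleR_right, rule dF)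
    finally show ?thesis by simp
  qed
  show ?thesis unfolding 1 2 3 ex[OF ct, of "fd k t r"] by (rule sum.distrib)
qed

text \<open>Inner products with vectors orthogonal to \<open>L\<close> vanish along the curve and
  hence so do their derivatives; \<open>L\<close> is its own double orthogonal complement.\<close>

lemma fd_in_subspace:
  fixes f :: "real \<Rightarrow> 'a::euclidean_space"
  assumes L: "subspace L" and I: "open I" "t \<in> I" "\<And>s. s \<in> I \<Longrightarrow> f s \<in> L" and d: "f differentiable (at t)"
  shows "fd f t r \<in> L"
proof -
  have "orthogonal (fd f t r) y" if y: "y \<in> L\<^sup>\<bottom>" for y
  proof -
    have z: "f s \<bullet> y = 0" if "s \<in> I" for s
      using I(3)[OF that] y unfolding orthogonal_comp_def orthogonal_def by (metis (mono_tags, lifting) inner_commute mem_Collect_eq)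
    have "fd (\<lambda>s. f s \<bullet> y) t = (\<lambda>r. fd f t r \<bullet> y)"
      by (rule fd_eq) (rule bounded_linear.has_derivative[OF bounded_linear_inner_left fd_works[OF d]])
    moreover have "fd (\<lambda>s. f s \<bullet> y) t = fd (\<lambda>s. 0) t"
      by (rule fd_open_cong[OF I(1,2) z])
    ultimately show ?thesis unfolding orthogonal_def by (metis frechet_derivative_const)
  qed
  then have "fd f t r \<in> L\<^sup>\<bottom>\<^sup>\<bottom>"
    unfolding orthogonal_comp_def[of "L\<^sup>\<bottom>"] by (simp add: orthogonal_commute)
  then show ?thesis using orthogonal_comp_self[OF L] by simp
qed

lemma span_pair_eq:
  fixes a b :: "'a::euclidean_space"
  assumes L: "subspace L" "dim L = 2" and ab: "a \<in> L" "b \<in> L" "a \<noteq> 0" "\<And>k. b \<noteq> k *\<^sub>R a" and z: "z \<in> L"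
  shows "\<exists>\<alpha> \<beta>. z = \<alpha> *\<^sub>R a + \<beta> *\<^sub>R b"
proof -
  have "b \<notin> span {a}" using ab(4) by (auto simp: span_singleton)
  then have "dim {b, a} = 2" using ab(3) by (simp add: dim_insert)
  then have "dim (span {a, b}) = dim L" using L(2) by (simp add: insert_commute)
  moreover have "span {a, b} \<subseteq> L" using L(1) ab by (intro span_minimal) auto
  ultimately have "span (span {a, b}) = span L"
    by (intro dim_eq_span) simp_all
  then have "span {a, b} = span L" unfolding span_span .
  then have "z \<in> span {a, b}" using z span_base by blast
  then show ?thesis
    by (auto simp: span_insert span_singleton) (metis add.commute diff_add_cancel)
qed

context symp_lift
begin

lemma Phi_nonzero: assumes "u \<in> cone U" shows "\<Phi> u \<noteq> 0"
proof
  assume "\<Phi> u = 0"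
  then have "fd \<Phi> u u = fd \<Phi> u 0"
    using DPhi_self[OF assms] linear_0[OF linear_DPhi[OF assms]] by simp
  then have "u = 0" by (rule DPhi_inj[OF assms])
  then show False using assms by (simp add: mem_cone)
qed

lemma DPhi_not_multiple:
  assumes u: "u \<in> cone U" and a: "\<And>k. a \<noteq> k *\<^sub>R u" shows "fd \<Phi> u a \<noteq> k *\<^sub>R \<Phi> u"
proof
  assume "fd \<Phi> u a = k *\<^sub>R \<Phi> u"
  then have "fd \<Phi> u a = fd \<Phi> u (k *\<^sub>R u)"
    using DPhi_self[OF u] linear_cmul[OF linear_DPhi[OF u]] by simp
  then show False using DPhi_inj[OF u] a by blast
qed

text \<open>The composition of \<Phi> with \<open>c\<close> stays in \<open>L\<close> with its first
  two derivatives, and \<open>L\<close> is spanned by the first two of these three vectors. Undoing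
  \<open>fd \<Phi>\<close> in this linear relation turns the second derivative of \<Phi> into
  \<open>B\<close>.\<close>

lemma plane_curve:
  fixes c :: "real \<Rightarrow> real ^ 'm ix"
  assumes I: "open I" and c: "smooth_on I c" "\<And>s. s \<in> I \<Longrightarrow> c s \<in> cone U"
    and imm: "\<And>s k. s \<in> I \<Longrightarrow> fd c s 1 \<noteq> k *\<^sub>R c s"
    and L: "subspace L" "dim L = 2" "\<And>u v. u \<in> L \<Longrightarrow> v \<in> L \<Longrightarrow> Om u v = 0" "\<And>s. s \<in> I \<Longrightarrow> \<Phi> (c s) \<in> L"
    and t: "t \<in> I"
  shows "Om (c t) (fd c t 1) = 0"
    "\<exists>\<alpha> \<beta>. fd (\<lambda>r. fd c r 1) t 1 + B (c t) (fd c t 1) (fd c t 1) = \<alpha> *\<^sub>R c t + \<beta> *\<^sub>R fd c t 1"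
proof -
  have dc: "c differentiable (at s)" if "s \<in> I" for s by (rule smooth_on_differentiable[OF c(1) I that])
  have dP: "\<Phi> differentiable (at (c s))" if "s \<in> I" for s
    by (rule smooth_on_differentiable[OF Phi_smooth open_C c(2)[OF that]])
  have f1: "fd (\<lambda>s. \<Phi> (c s)) s r = fd \<Phi> (c s) (fd c s r)" if "s \<in> I" for s r
    by (rule fd_compose[OF dc dP]) (rule that)+
  have L1: "fd \<Phi> (c s) (fd c s 1) \<in> L" if s: "s \<in> I" for s
    unfolding f1[OF s, symmetric]
    by (rule fd_in_subspace[where f = "\<lambda>s. \<Phi> (c s)", OF L(1) I s L(4)])
      (use differentiable_chain_at[OF dc[OF s] dP[OF s]] in \<open>simp_all add: comp_def\<close>)
  have ct: "c t \<in> cone U" using c(2)[OF t] .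
  have "Om (\<Phi> (c t)) (fd \<Phi> (c t) (fd c t 1)) = 0" using L(3)[OF L(4)[OF t] L1[OF t]] .
  then show "Om (c t) (fd c t 1) = 0" unfolding Phi_contact[OF ct] by simp
  have dc1: "(\<lambda>r. fd c r 1) differentiable (at t)"
    by (rule smooth_on_differentiable[OF smooth_on_curve_derivative[OF c(1)] I t])
  have "smooth_on I (\<lambda>s. fd \<Phi> (c s) (fd c s 1))"
    by (rule smooth_on_fd_apply[OF Phi_smooth open_C I smooth_on_curve_derivative[OF c(1)] c])
  then have "fd (\<lambda>s. fd \<Phi> (c s) (fd c s 1)) t 1 \<in> L"
    by (intro fd_in_subspace[OF L(1) I t L1] smooth_on_differentiable[OF _ I t])
  moreover have "fd (\<lambda>s. fd \<Phi> (c s) (fd c s 1)) t 1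
      = D2 (c t) (fd c t 1) (fd c t 1) + fd \<Phi> (c t) (fd (\<lambda>r. fd c r 1) t 1)"
    unfolding D2_def by (rule fd_apply_derivative[OF Phi_smooth open_C I t c(2) dc[OF t] dc1])
  ultimately have "D2 (c t) (fd c t 1) (fd c t 1) + fd \<Phi> (c t) (fd (\<lambda>r. fd c r 1) t 1) \<in> L"
    by (simp only:)
  then have "fd \<Phi> (c t) (fd (\<lambda>r. fd c r 1) t 1 + B (c t) (fd c t 1) (fd c t 1)) \<in> L"
    unfolding DPhi_B[OF ct, symmetric] linear_add[OF linear_DPhi[OF ct], symmetric] by (simp add: add.commute)
  then obtain \<alpha> \<beta> where "fd \<Phi> (c t) (fd (\<lambda>r. fd c r 1) t 1 + B (c t) (fd c t 1) (fd c t 1))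
      = \<alpha> *\<^sub>R \<Phi> (c t) + \<beta> *\<^sub>R fd \<Phi> (c t) (fd c t 1)"
    using span_pair_eq[OF L(1,2) L(4)[OF t] L1[OF t] Phi_nonzero[OF ct] DPhi_not_multiple[OF ct imm[OF t]]] by blast
  also have "\<dots> = fd \<Phi> (c t) (\<alpha> *\<^sub>R c t + \<beta> *\<^sub>R fd c t 1)"
    using DPhi_self[OF ct] by (simp add: linear_add[OF linear_DPhi[OF ct]] linear_cmul[OF linear_DPhi[OF ct]])
  finally have "fd (\<lambda>r. fd c r 1) t 1 + B (c t) (fd c t 1) (fd c t 1) = \<alpha> *\<^sub>R c t + \<beta> *\<^sub>R fd c t 1"
    by (rule DPhi_inj[OF ct])
  then show "\<exists>\<alpha> \<beta>. fd (\<lambda>r. fd c r 1) t 1 + B (c t) (fd c t 1) (fd c t 1) = \<alpha> *\<^sub>R c t + \<beta> *\<^sub>R fd c t 1"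
    by blast
qed

end

section \<open>Projected straight lines as paths\<close>

lemma smooth_curve_cong:
  assumes "smooth_curve I \<gamma>" "open I" "\<And>s. s \<in> I \<Longrightarrow> \<gamma> s = \<gamma>' s"
  shows "smooth_curve I \<gamma>'"
  unfolding smooth_curve_def
proof (intro conjI allI impI)
  show "continuous_on I \<gamma>'"
    using assms(1) continuous_on_cong[of I I \<gamma> \<gamma>'] assms(3) unfolding smooth_curve_def by simp
  fix W and f :: "'a projspace \<Rightarrow> real" assume W: "open W \<and> smooth_fun W f"
  have e: "I \<inter> \<gamma>' -` W = I \<inter> \<gamma> -` W" using assms(3) by auto
  have o: "open (I \<inter> \<gamma> -` W)" using smooth_curve_preimage[OF assms(1,2)] W by blast
  have "smooth_on (I \<inter> \<gamma> -` W) (\<lambda>t. f (\<gamma> t))" using smooth_curve_fun[OF assms(1)] W by blast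
  then show "smooth_on (I \<inter> \<gamma>' -` W) (\<lambda>t. f (\<gamma>' t))"
    unfolding e by (rule smooth_on_cong[OF o, rotated]) (simp add: assms(3))
qed

lemma velocity_cong:
  fixes \<gamma> :: "real \<Rightarrow> 'k::finite projspace"
  assumes "open I" "t \<in> I" "\<And>s. s \<in> I \<Longrightarrow> \<gamma> s = \<gamma>' s"
  shows "velocity \<gamma> t = velocity \<gamma>' t"
proof
  fix f :: "'k projspace \<Rightarrow> real"
  have "eventually (\<lambda>s. f (\<gamma> s) = f (\<gamma>' s)) (nhds t)"
    unfolding eventually_nhds using assms by (intro exI[of _ I]) auto
  from deriv_cong_ev[OF this refl] show "velocity \<gamma> t f = velocity \<gamma>' t f"
    using assms by (simp add: velocity_def)
qed

lemma immersed_path_cong: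
  assumes "immersed_path I \<gamma>" "\<And>s. s \<in> I \<Longrightarrow> \<gamma> s = \<gamma>' s"
  shows "immersed_path I \<gamma>'"
  using assms smooth_curve_cong[of I \<gamma> \<gamma>'] velocity_cong[of I _ \<gamma> \<gamma>'] unfolding immersed_path_def by metis

lemma smooth_curve_line:
  fixes a b :: "real ^ 'k::finite"
  assumes "open I" "\<And>s. s \<in> I \<Longrightarrow> a + s *\<^sub>R b \<noteq> 0"
  shows "smooth_curve I (\<lambda>s. proj (a + s *\<^sub>R b))"
    and "t \<in> I \<Longrightarrow> velocity (\<lambda>s. proj (a + s *\<^sub>R b)) t = dproj (a + t *\<^sub>R b) b"
proof -
  have hd: "((\<lambda>s. a + s *\<^sub>R b) has_derivative (\<lambda>r. r *\<^sub>R b)) (at s)" for s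
    by (auto intro!: derivative_eq_intros)
  have cl: "continuous_on UNIV (\<lambda>s. a + s *\<^sub>R b)" by (intro continuous_intros)
  have pre: "I \<inter> (\<lambda>s. proj (a + s *\<^sub>R b)) -` W = I \<inter> (\<lambda>s. a + s *\<^sub>R b) -` cone W" for W
    using assms(2) by (auto simp: mem_cone)
  have o: "open (I \<inter> (\<lambda>s. proj (a + s *\<^sub>R b)) -` W)" if "open W" for W
    unfolding pre using assms(1) open_vimage[OF open_cone[OF that] cl] by (rule open_Int)
  show "smooth_curve I (\<lambda>s. proj (a + s *\<^sub>R b))"
    unfolding smooth_curve_def
  proof (intro conjI allI impI)
    show "continuous_on I (\<lambda>s. proj (a + s *\<^sub>R b))"
      unfolding continuous_on_open_vimage[OF assms(1)] using o by (simp add: Int_commute)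
    fix W and f :: "'k projspace \<Rightarrow> real" assume W: "open W \<and> smooth_fun W f"
    have oo: "open (I \<inter> (\<lambda>s. proj (a + s *\<^sub>R b)) -` W)" using o W by blast
    have "smooth_on (I \<inter> (\<lambda>s. proj (a + s *\<^sub>R b)) -` W) (\<lambda>s. a + s *\<^sub>R b)"
      by (intro smooth_on_add smooth_on_scaleR smooth_on_const smooth_on_ident oo)
    then show "smooth_on (I \<inter> (\<lambda>s. proj (a + s *\<^sub>R b)) -` W) (\<lambda>t. f (proj (a + t *\<^sub>R b)))"
      by (rule smooth_on_compose[of "cone W" "\<lambda>z. f (proj z)", rotated])
        (use W oo pre in \<open>auto simp: smooth_fun_def open_cone\<close>)
  qed
  assume t: "t \<in> I"
  show "velocity (\<lambda>s. proj (a + s *\<^sub>R b)) t = dproj (a + t *\<^sub>R b) b"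
  proof
    fix f
    show "velocity (\<lambda>s. proj (a + s *\<^sub>R b)) t f = dproj (a + t *\<^sub>R b) b f"
    proof (cases "smooth_at (proj (a + t *\<^sub>R b)) f")
      case True
      have F: "((\<lambda>z. f (proj z)) has_derivative fd (\<lambda>z. f (proj z)) (a + t *\<^sub>R b)) (at (a + t *\<^sub>R b))"
        by (rule smooth_at_has_derivative[OF True assms(2)[OF t]])
      from has_derivative_compose[OF hd this]
      have d: "((\<lambda>s. f (proj (a + s *\<^sub>R b))) has_derivative (\<lambda>r. fd (\<lambda>z. f (proj z)) (a + t *\<^sub>R b) (r *\<^sub>R b))) (at t)" .
      have "deriv (\<lambda>s. f (proj (a + s *\<^sub>R b))) t = fd (\<lambda>z. f (proj z)) (a + t *\<^sub>R b) (1 *\<^sub>R b)"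
        using deriv_eq_fd[OF differentiableI[OF d]] fd_eq[OF d] by simp
      then show ?thesis using True by (simp add: velocity_def dproj_def)
    qed (simp add: velocity_def dproj_def)
  qed
qed

subsection \<open>Existence of adapted coframes\<close>

lemma open_smooth_nonzero:
  fixes f :: "'k::finite projspace \<Rightarrow> real"
  assumes "open V" "smooth_fun V f" shows "open {q \<in> V. f q \<noteq> 0}"
proof -
  have "cone {q \<in> V. f q \<noteq> 0} = cone V \<inter> (\<lambda>u. f (proj u)) -` (- {0})"
    by (auto simp: mem_cone)
  moreover have "open (cone V \<inter> (\<lambda>u. f (proj u)) -` (- {0}))"
    by (rule continuous_open_preimage[OF smooth_on_imp_continuous_on open_cone[OF assms(1)]])
      (use assms(2) in \<open>auto simp: smooth_fun_def open_Compl\<close>)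
  ultimately show ?thesis unfolding open_projspace_def by simp
qed

lemma smooth_fun_divide:
  fixes f g :: "'k::finite projspace \<Rightarrow> real"
  assumes "open V" "smooth_fun V f" "smooth_fun V g" "\<And>q. q \<in> V \<Longrightarrow> g q \<noteq> 0"
  shows "smooth_fun V (\<lambda>q. f q / g q)"
  using assms(2,3) unfolding smooth_fun_def
  by (rule smooth_on_divide[OF open_cone[OF assms(1)]]) (simp add: assms(4) mem_cone)

lemma smooth_fun_prod:
  fixes f :: "'i \<Rightarrow> 'k::finite projspace \<Rightarrow> real"
  assumes "open V" "\<And>i. i \<in> I \<Longrightarrow> smooth_fun V (f i)" shows "smooth_fun V (\<lambda>q. \<Prod>i\<in>I. f i q)"
  using assms(2) unfolding smooth_fun_def by (rule smooth_on_prod[OF open_cone[OF assms(1)]])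

lemma smooth_fun_det:
  fixes A :: "'k::finite projspace \<Rightarrow> real ^ 'n ^ 'n"
  assumes "open V" "\<And>i j. smooth_fun V (\<lambda>q. A q $ i $ j)"
  shows "smooth_fun V (\<lambda>q. det (A q))"
  unfolding det_def
  by (intro smooth_fun_sum smooth_fun_mult smooth_fun_prod smooth_fun_const assms)

lemma matrix_inv_mult:
  fixes A :: "real ^ 'n ^ 'n" assumes "det A \<noteq> 0"
  shows "A ** matrix_inv A = mat 1" "matrix_inv A ** A = mat 1"
proof -
  have "invertible A" using assms by (simp add: invertible_det_nz)
  then have "A ** matrix_inv A = mat 1 \<and> matrix_inv A ** A = mat 1"
    unfolding invertible_def matrix_inv_def by (rule someI_ex)
  then show "A ** matrix_inv A = mat 1" "matrix_inv A ** A = mat 1" by auto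
qed

text \<open>Cramer's rule writes each entry as a quotient of determinants.\<close>

lemma smooth_fun_matrix_inv:
  fixes A :: "'k::finite projspace \<Rightarrow> real ^ 'n ^ 'n"
  assumes "open V" "\<And>i j. smooth_fun V (\<lambda>q. A q $ i $ j)" "\<And>q. q \<in> V \<Longrightarrow> det (A q) \<noteq> 0"
  shows "smooth_fun V (\<lambda>q. matrix_inv (A q) $ l $ k)"
proof (rule smooth_fun_cong[OF assms(1)])
  show "smooth_fun V (\<lambda>q. det (\<chi> i j. if j = l then axis k 1 $ i else A q $ i $ j) / det (A q))"
  proof (rule smooth_fun_divide[OF assms(1) smooth_fun_det[OF assms(1)] smooth_fun_det[OF assms(1,2)] assms(3)])
    show "smooth_fun V (\<lambda>q. (\<chi> i j. if j = l then axis k 1 $ i else A q $ i $ j) $ i $ j)" for i j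
      by (cases "j = l") (simp_all add: smooth_fun_const assms(1,2))
  qed
  fix q assume q: "q \<in> V"
  have "A q *v (matrix_inv (A q) *v axis k 1) = axis k 1"
    by (simp add: matrix_vector_mul_assoc matrix_inv_mult(1)[OF assms(3)[OF q]])
  from cramer[OF assms(3)[OF q], THEN iffD1, OF this]
  have "(matrix_inv (A q) *v axis k 1) $ l = det (\<chi> i j. if j = l then axis k 1 $ i else A q $ i $ j) / det (A q)"
    by simp
  then show "det (\<chi> i j. if j = l then axis k 1 $ i else A q $ i $ j) / det (A q) = matrix_inv (A q) $ l $ k"
    by (simp add: matrix_vector_mul_component column_def matrix_vector_mult_basis)
qed

context root_section
begin

lemma span_decomp:
  assumes "p \<in> W" shows "\<exists>\<alpha> \<beta>. z = pi p z + \<alpha> *\<^sub>R \<sigma> p + \<beta> *\<^sub>R t p"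
  by (intro exI[of _ "s / 2 * Om z (t p)"] exI[of _ "th p z"]) (simp add: pi_def)

text \<open>\<open>dproj (\<sigma> p)\<close> maps this space isomorphically onto the contact
  hyperplane at \<open>p\<close>, and \<Omega> is nondegenerate on it.\<close>

definition K :: "'m ix projspace \<Rightarrow> (real ^ 'm ix) set" where
  "K p = {z. Om (\<sigma> p) z = 0 \<and> Om (t p) z = 0}"

lemma pi_in_K: "p \<in> W \<Longrightarrow> pi p z \<in> K p"
  by (simp add: K_def Om_pi)

lemma pi_K: "z \<in> K p \<Longrightarrow> pi p z = z"
  using Om_skew[of z "t p"] by (simp add: K_def pi_id)

lemma subspace_K: "subspace (K p)"
  by (rule subspaceI) (simp_all add: K_def Om.add_right Om.scaleR_right Om.zero_right)

lemma K_nondegenerate: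
  assumes p: "p \<in> W" and w: "w \<in> K p" and o: "\<And>z. z \<in> K p \<Longrightarrow> Om w z = 0"
  shows "w = 0"
proof (rule Om_eqI)
  fix z
  obtain \<alpha> \<beta> where z: "z = pi p z + \<alpha> *\<^sub>R \<sigma> p + \<beta> *\<^sub>R t p" using span_decomp[OF p] by blast
  have "Om w (\<sigma> p) = 0" "Om w (t p) = 0"
    using w Om_skew[of w] by (simp_all add: K_def)
  then have "Om w (pi p z + \<alpha> *\<^sub>R \<sigma> p + \<beta> *\<^sub>R t p) = 0"
    using o[OF pi_in_K[OF p]] by (simp add: Om.add_right Om.scaleR_right)
  then show "Om w z = Om 0 z" using z by (simp add: Om.zero_left)
qed

text \<open>Through the vectors \<open>g u\<close> that represent \<open>Om u\<close> by the inner
  product, \<open>K p\<close> is the orthogonal complement of two independent vectors in dimension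
  \<open>CARD('m) + 2\<close>.\<close>

lemma dim_K: assumes p: "p \<in> W" shows "dim (K p) = CARD('m)"
proof -
  define g where "g = (\<lambda>u. \<Sum>i\<in>UNIV. Om u (axis i 1) *\<^sub>R axis i (1::real) :: real ^ 'm ix)"
  have g: "g u \<bullet> z = Om u z" for u z
  proof -
    have "Om u z = (\<Sum>i\<in>UNIV. z $ i *\<^sub>R Om u (axis i 1))"
      by (rule linear_axis_expansion[OF linear_Om_right])
    also have "\<dots> = g u \<bullet> z"
      by (simp add: g_def inner_sum_left inner_axis' mult.commute)
    finally show ?thesis by simp
  qed
  have lin: "a *\<^sub>R g (\<sigma> p) + b *\<^sub>R g (t p) = 0 \<Longrightarrow> a = 0 \<and> b = 0" for a b
  proof -
    assume h: "a *\<^sub>R g (\<sigma> p) + b *\<^sub>R g (t p) = 0"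
    have "a * Om (\<sigma> p) z + b * Om (t p) z = 0" for z
      using arg_cong[OF h, of "\<lambda>x. x \<bullet> z"] by (simp add: inner_add_left g)
    from this[of "\<sigma> p"] this[of "t p"] show "a = 0 \<and> b = 0"
      using Om_t_sec[OF p] by simp
  qed
  have "g (\<sigma> p) \<noteq> 0" using lin[of 1 0] by auto
  moreover have "g (t p) \<notin> span {g (\<sigma> p)}"
  proof
    assume "g (t p) \<in> span {g (\<sigma> p)}"
    then obtain k where "g (t p) = k *\<^sub>R g (\<sigma> p)" by (auto simp: span_singleton)
    then show False using lin[of "- k" 1] by simp
  qed
  ultimately have d2: "dim (span {g (t p), g (\<sigma> p)}) = 2" by (simp add: dim_insert)
  have "K p = {y \<in> UNIV. \<forall>x\<in>span {g (t p), g (\<sigma> p)}. orthogonal x y}"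
  proof (intro equalityI subsetI)
    fix y assume y: "y \<in> K p"
    have "orthogonal y x" if "x \<in> span {g (t p), g (\<sigma> p)}" for x
      by (rule orthogonal_to_span[OF that]) (use y g in \<open>auto simp: K_def orthogonal_def inner_commute[of y]\<close>)
    then show "y \<in> {y \<in> UNIV. \<forall>x\<in>span {g (t p), g (\<sigma> p)}. orthogonal x y}"
      by (simp add: orthogonal_commute)
  next
    fix y assume "y \<in> {y \<in> UNIV. \<forall>x\<in>span {g (t p), g (\<sigma> p)}. orthogonal x y}"
    then have "orthogonal (g (t p)) y" "orthogonal (g (\<sigma> p)) y"
      using span_base[of "g (t p)" "{g (t p), g (\<sigma> p)}"] span_base[of "g (\<sigma> p)" "{g (t p), g (\<sigma> p)}"] by auto
    then show "y \<in> K p" by (simp add: K_def orthogonal_def g)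
  qed
  then have "dim (K p) + 2 = CARD('m ix)"
    using dim_subspace_orthogonal_to_vectors[of "span {g (t p), g (\<sigma> p)}" UNIV] d2 by (simp add: dim_UNIV)
  then show ?thesis using card_ix(2) by linarith
qed

lemma ex_K_basis:
  assumes p: "p \<in> W"
  shows "\<exists>b :: 'm \<Rightarrow> real ^ 'm ix. (\<forall>i. b i \<in> K p) \<and> (\<forall>z\<in>K p. \<exists>c. z = (\<Sum>i\<in>UNIV. c i *\<^sub>R b i)) \<and>
     (\<forall>c. (\<Sum>i\<in>UNIV. c i *\<^sub>R b i) = 0 \<longrightarrow> (\<forall>i. c i = 0))"
proof -
  obtain Bs where Bs: "Bs \<subseteq> K p" "independent Bs" "K p \<subseteq> span Bs" "card Bs = dim (K p)"
    using basis_exists by blast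
  have fin: "finite Bs" using Bs(2) independent_bound by blast
  have "card Bs = CARD('m)" using Bs(4) dim_K[OF p] by simp
  then obtain b :: "'m \<Rightarrow> real ^ 'm ix" where b: "bij_betw b UNIV Bs"
    using finite_same_card_bij[OF finite_class.finite_UNIV fin] by metis
  have inj: "inj b" and im: "range b = Bs" using b by (auto simp: bij_betw_def)
  show ?thesis
  proof (intro exI[of _ b] conjI allI ballI impI)
    show "b i \<in> K p" for i using im Bs(1) by blast
    fix z assume "z \<in> K p"
    then have "z \<in> span Bs" using Bs(3) by blast
    then obtain u where "z = (\<Sum>v\<in>Bs. u v *\<^sub>R v)" using span_finite[OF fin] by auto
    also have "\<dots> = (\<Sum>i\<in>UNIV. u (b i) *\<^sub>R b i)"
      unfolding im[symmetric] using sum.reindex[OF inj, of "\<lambda>v. u v *\<^sub>R v"] by simp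
    finally show "\<exists>c. z = (\<Sum>i\<in>UNIV. c i *\<^sub>R b i)" by (rule exI[of _ "\<lambda>i. u (b i)"])
  next
    fix c i assume z: "(\<Sum>i\<in>UNIV. c i *\<^sub>R b i) = 0"
    define u where "u = (\<lambda>v. c (the_inv b v))"
    have "(\<Sum>v\<in>Bs. u v *\<^sub>R v) = (\<Sum>i\<in>UNIV. c i *\<^sub>R b i)"
      unfolding im[symmetric] using sum.reindex[OF inj, of "\<lambda>v. u v *\<^sub>R v"]
      by (simp add: u_def the_inv_f_f[OF inj])
    then have "\<forall>v\<in>Bs. u v = 0" using Bs(2) z independent_explicit_finite_subsets[of Bs] fin by auto
    then have "u (b i) = 0" using im by blast
    then show "c i = 0" by (simp add: u_def the_inv_f_f[OF inj])
  qed
qed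

text \<open>A basis of \<open>K p\<close> is carried to nearby points by the projections
  \<open>pi q\<close>. Its Gram matrix under \<Omega> is invertible at \<open>p\<close>, hence
  nearby, and the inverse matrix yields the dual forms; the Reeb field and \<theta> complete the
  pair.\<close>

lemma ex_adapted_coframe:
  assumes V: "open V" "V \<subseteq> W" and p: "p \<in> V"
  shows "\<exists>W' ch E. open W' \<and> W' \<subseteq> V \<and> p \<in> W' \<and> adapted_coframe W' \<theta> ch E"
proof -
  have pW: "p \<in> W" using p V by blast
  obtain b :: "'m \<Rightarrow> real ^ 'm ix" where b: "\<And>i. b i \<in> K p"
    "\<And>z. z \<in> K p \<Longrightarrow> \<exists>c. z = (\<Sum>i\<in>UNIV. c i *\<^sub>R b i)"
    "\<And>c i. (\<Sum>i\<in>UNIV. c i *\<^sub>R b i) = 0 \<Longrightarrow> c i = 0"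
    using ex_K_basis[OF pW] by blast
  define e where "e = (\<lambda>i q. pi q (b i))"
  define k where "k = (\<lambda>q. \<chi> i j. Om (e i q) (e j q) :: real ^ 'm ^ 'm)"
  have se: "smooth_fun V (e i)" for i
    unfolding e_def by (rule smooth_pi[OF V smooth_fun_const[OF V(1)]])
  have sk: "smooth_fun V (\<lambda>q. k q $ i $ j)" for i j
    unfolding k_def using smooth_fun_bilinear[OF bounded_bilinear_Om V(1) se se] by simp
  define W' where "W' = {q \<in> V. det (k q) \<noteq> 0}"
  have oW': "open W'" unfolding W'_def by (rule open_smooth_nonzero[OF V(1) smooth_fun_det[OF V(1) sk]])
  have W'V: "W' \<subseteq> V" "W' \<subseteq> W" unfolding W'_def using V by auto
  have "det (k p) \<noteq> 0"
  proof
    assume "det (k p) = 0"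
    then have "\<not> invertible (k p)" by (simp add: invertible_det_nz)
    then have "\<not> invertible (transpose (k p))" by (simp add: invertible_det_nz)
    then obtain x where x: "transpose (k p) *v x = 0" "x \<noteq> 0"
      using matrix_left_invertible_ker[of "transpose (k p)"] invertible_left_inverse[of "transpose (k p)"] by blast
    define w where "w = (\<Sum>i\<in>UNIV. x $ i *\<^sub>R b i)"
    have eb: "e i p = b i" for i unfolding e_def by (rule pi_K[OF b(1)])
    have "Om w (b j) = 0" for j
    proof -
      have "Om w (b j) = (transpose (k p) *v x) $ j"
        by (simp add: w_def k_def eb Om.sum_left Om.scaleR_left matrix_vector_mult_def transpose_def mult.commute)
      then show ?thesis using x by simp
    qed
    then have "Om w z = 0" if "z \<in> K p" for z
      using b(2)[OF that] by (auto simp: Om.sum_right Om.scaleR_right)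
    moreover have "w \<in> K p"
      unfolding w_def by (intro subspace_sum[OF subspace_K] subspace_scale[OF subspace_K] b(1))
    ultimately have "w = 0" by (intro K_nondegenerate[OF pW])
    then have "x $ i = 0" for i using b(3)[of "\<lambda>i. x $ i" i] by (simp add: w_def)
    then show False using x(2) by (simp add: vec_eq_iff)
  qed
  then have pW': "p \<in> W'" unfolding W'_def using p by simp
  have dk: "det (k q) \<noteq> 0" if "q \<in> W'" for q using that unfolding W'_def by simp
  define E where "E = (\<lambda>\<alpha>. case \<alpha> of None \<Rightarrow> T | Some i \<Rightarrow> (\<lambda>q. dproj (\<sigma> q) (e i q)))"
  define ch :: "'m option \<Rightarrow> 'm ix oneform" where "ch = (\<lambda>\<alpha>. case \<alpha> of None \<Rightarrow> \<theta>
    | Some i \<Rightarrow> (\<lambda>q v. \<Sum>l\<in>UNIV. Om (dv v \<sigma>) (e l q) * matrix_inv (k q) $ l $ i))"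
  have seW: "smooth_fun W' (e i)" for i by (rule smooth_fun_subset[OF se V(1) oW' W'V(1)])
  have E: "vector_field W' (E \<alpha>)" for \<alpha>
  proof (cases \<alpha>)
    case None
    then show ?thesis using vector_field_subset[OF T_field W'V(2)] by (simp add: E_def)
  next
    case (Some i)
    then show ?thesis using vector_field_dproj[OF oW' W'V(2) seW] by (simp add: E_def)
  qed
  have dvE: "dv (dproj (\<sigma> q) (e i q)) \<sigma> = e i q" if "q \<in> W'" for q i
    by (rule dv_dproj_perp) (use that W'V Om_pi(2) in \<open>auto simp: e_def\<close>)
  have of: "one_form W' (ch \<alpha>)" for \<alpha>
  proof (cases \<alpha>)
    case None
    then show ?thesis using one_form_root[OF oW' W'V(2)] by (simp add: ch_def)
  next
    case (Some i)
    have ch: "ch \<alpha> = (\<lambda>q v. \<Sum>l\<in>UNIV. Om (dv v \<sigma>) (e l q) * matrix_inv (k q) $ l $ i)"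
      by (simp add: ch_def Some)
    show ?thesis
      unfolding one_form_def ch
    proof (intro conjI ballI allI impI)
      fix q v w a c
      show "(\<Sum>l\<in>UNIV. Om (dv (\<lambda>f. a * v f + c * w f) \<sigma>) (e l q) * matrix_inv (k q) $ l $ i)
        = a * (\<Sum>l\<in>UNIV. Om (dv v \<sigma>) (e l q) * matrix_inv (k q) $ l $ i)
          + c * (\<Sum>l\<in>UNIV. Om (dv w \<sigma>) (e l q) * matrix_inv (k q) $ l $ i)"
        by (simp add: dv_linear Om.add_left Om.scaleR_left sum_distrib_left sum.distrib algebra_simps)
    next
      fix V' X assume h: "open V' \<and> V' \<subseteq> W' \<and> vector_field V' X"
      then have V': "open V'" "V' \<subseteq> W'" "V' \<subseteq> V" "V' \<subseteq> W" "vector_field V' X" using W'V by auto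
      have i: "smooth_fun V' (\<lambda>q. matrix_inv (k q) $ l $ i)" for l
        by (rule smooth_fun_matrix_inv[OF V'(1) smooth_fun_subset[OF sk V(1) V'(1,3)]]) (use dk V' in blast)
      show "smooth_fun V' (\<lambda>q. \<Sum>l\<in>UNIV. Om (dv (X q) \<sigma>) (e l q) * matrix_inv (k q) $ l $ i)"
        by (rule smooth_fun_sum[OF V'(1)], rule smooth_fun_mult[OF V'(1) _ i],
            rule smooth_fun_bilinear[OF bounded_bilinear_Om V'(1) field_smooth[OF V'(1,4,5)] smooth_fun_subset[OF se V(1) V'(1,3)]])
    qed
  qed
  have "adapted_coframe W' \<theta> ch E"
    unfolding adapted_coframe_def
  proof (intro conjI allI ballI of E)
    fix q assume q: "q \<in> W'"
    then have qW: "q \<in> W" using W'V by blast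
    have Te: "Om (t q) (e l q) = 0" "Om (\<sigma> q) (e l q) = 0" for l unfolding e_def using Om_pi[OF qW] by simp_all
    have c1: "(\<Sum>l\<in>UNIV. Om (e j q) (e l q) * matrix_inv (k q) $ l $ i) = (if i = j then 1 else 0)" for i j
      using matrix_inv_mult(1)[OF dk[OF q]]
      by (auto simp: vec_eq_iff matrix_matrix_mult_def k_def mat_def)
    have tT: "\<theta> q (T q) = 1" using theta_th[OF qW T_tangent[OF qW]] dv_T[OF qW] th_t[OF qW] by simp
    have te: "\<theta> q (dproj (\<sigma> q) (e i q)) = 0" for i
      unfolding theta_th[OF qW dproj_tangent[OF qW]] dvE[OF q] th_def Te by simp
    show "ch \<alpha> q (E \<beta> q) = (if \<alpha> = \<beta> then 1 else 0)" for \<alpha> \<beta>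
      by (cases \<alpha>; cases \<beta>) (simp_all add: ch_def E_def tT te dv_T[OF qW] dvE[OF q] Te c1)
    show "ch None q v = \<theta> q v" for v by (simp add: ch_def)
  next
    show "\<exists>T. reeb_field W' \<theta> T \<and> (\<forall>p\<in>W'. \<forall>i. ch (Some i) p (T p) = 0)"
    proof (intro exI[of _ T] conjI ballI allI reeb_T[OF oW' W'V(2)])
      fix q i assume "q \<in> W'"
      then have qW: "q \<in> W" using W'V by blast
      show "ch (Some i) q (T q) = 0"
        using Om_pi(2)[OF qW] by (simp add: ch_def dv_T[OF qW] e_def)
    qed
  qed
  then show ?thesis using oW' W'V pW' by blast
qed

lemma coframe_K:
  assumes V: "open V" "V \<subseteq> W" and A: "adapted_coframe V \<theta> ch E" and p: "p \<in> V"
  shows "dv (E (Some i) p) \<sigma> \<in> K p"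
proof -
  have pW: "p \<in> W" using p V by blast
  have tE: "E (Some i) p \<in> tangent p"
    using A p vector_field_tangent unfolding adapted_coframe_def by blast
  have "\<theta> p (E (Some i) p) = 0" by (rule coframe_Reeb(3)[OF V A p])
  then have "Om (\<sigma> p) (dv (E (Some i) p) \<sigma>) = 0" unfolding root[OF pW tE] by simp
  then show ?thesis using Om_t_tangent(1)[OF pW tE] by (simp add: K_def)
qed

lemma coframe_K_expand:
  assumes V: "open V" "V \<subseteq> W" and A: "adapted_coframe V \<theta> ch E" and p: "p \<in> V" and w: "w \<in> K p"
  shows "w = (\<Sum>l\<in>UNIV. ch (Some l) p (dproj (\<sigma> p) w) *\<^sub>R dv (E (Some l) p) \<sigma>)"
proof -
  have pW: "p \<in> W" using p V by blast
  note tw = dproj_tangent[OF pW, of w]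
  have dw: "dv (dproj (\<sigma> p) w) \<sigma> = w" by (rule dv_dproj_perp[OF pW]) (use w in \<open>simp add: K_def\<close>)
  have "ch None p (dproj (\<sigma> p) w) = \<theta> p (dproj (\<sigma> p) w)"
    using A p tw unfolding adapted_coframe_def by blast
  then have c0: "ch None p (dproj (\<sigma> p) w) = 0"
    unfolding root[OF pW tw] dw using w by (simp add: K_def)
  from arg_cong[OF coframe_expand[OF V A p tw], of "\<lambda>v. dv v \<sigma>"]
  have "dv (dproj (\<sigma> p) w) \<sigma> = (\<Sum>\<alpha>\<in>UNIV. ch \<alpha> p (dproj (\<sigma> p) w) *\<^sub>R dv (E \<alpha> p) \<sigma>)"
    unfolding dv_sum .
  then show ?thesis unfolding dw sum_UNIV_option by (simp add: c0)
qed

text \<open>A kernel vector of the Gram matrix would give a combination of frame vectors orthogonal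
  to all of \<open>K p\<close>, against \<open>K_nondegenerate\<close>.\<close>

lemma coframe_K_det:
  assumes V: "open V" "V \<subseteq> W" and A: "adapted_coframe V \<theta> ch E" and p: "p \<in> V"
  shows "det (\<chi> i j. Om (dv (E (Some i) p) \<sigma>) (dv (E (Some j) p) \<sigma>)) \<noteq> 0"
proof
  have pW: "p \<in> W" using p V by blast
  define z where "z = (\<lambda>i. dv (E (Some i) p) \<sigma>)"
  have zK: "z i \<in> K p" for i unfolding z_def by (rule coframe_K[OF V A p])
  have o: "one_form V (ch \<alpha>)" for \<alpha> using A unfolding adapted_coframe_def by blast
  have tE: "E \<alpha> p \<in> tangent p" for \<alpha>
    using A p vector_field_tangent unfolding adapted_coframe_def by blast
  have chE: "ch \<alpha> p (E \<beta> p) = (if \<alpha> = \<beta> then 1 else 0)" for \<alpha> \<beta>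
    using A p unfolding adapted_coframe_def by blast
  assume "det (\<chi> i j. Om (dv (E (Some i) p) \<sigma>) (dv (E (Some j) p) \<sigma>)) = 0"
  then have "\<not> invertible (transpose (\<chi> i j. Om (z i) (z j)))" by (simp add: invertible_det_nz z_def)
  then obtain x where x: "transpose (\<chi> i j. Om (z i) (z j)) *v x = 0" "x \<noteq> 0"
    using matrix_left_invertible_ker[of "transpose (\<chi> i j. Om (z i) (z j))"]
      invertible_left_inverse[of "transpose (\<chi> i j. Om (z i) (z j))"] by blast
  define w where "w = (\<Sum>i\<in>UNIV. x $ i *\<^sub>R z i)"
  have wK: "w \<in> K p" unfolding w_def by (intro subspace_sum[OF subspace_K] subspace_scale[OF subspace_K] zK)
  have wz: "Om w (z j) = 0" for j
  proof -
    have "Om w (z j) = (transpose (\<chi> i j. Om (z i) (z j)) *v x) $ j"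
      by (simp add: w_def Om.sum_left Om.scaleR_left matrix_vector_mult_def transpose_def mult.commute)
    then show ?thesis using x by simp
  qed
  have "w = 0"
  proof (rule K_nondegenerate[OF pW wK])
    fix y assume y: "y \<in> K p"
    have "Om w (\<Sum>l\<in>UNIV. ch (Some l) p (dproj (\<sigma> p) y) *\<^sub>R z l) = 0"
      by (simp add: Om.sum_right Om.scaleR_right wz)
    then show "Om w y = 0" unfolding z_def coframe_K_expand[OF V A p y, symmetric] .
  qed
  then have d0: "dproj (\<sigma> p) w = (\<lambda>f. 0)" using dproj_zero[OF sec_nonzero[OF pW]] by simp
  have "dproj (\<sigma> p) w = (\<lambda>f. \<Sum>i\<in>UNIV. x $ i * E (Some i) p f)"
    unfolding w_def dproj_sum[OF sec_nonzero[OF pW]] z_def dproj_dv[OF pW tE] ..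
  then have "ch (Some l) p (\<lambda>f. \<Sum>i\<in>UNIV. x $ i * E (Some i) p f) = 0" for l
    using d0 one_form_zero[OF o p] by simp
  then have "x $ l = 0" for l
    using one_form_sum[where I = UNIV and v = "\<lambda>i. E (Some i) p" and c = "\<lambda>i. x $ i", OF o p tE, of "Some l"]
    by (simp add: chE if_distrib cong: if_cong)
  then show False using x(2) by (simp add: vec_eq_iff)
qed

end

subsection \<open>Linear algebra of the difference tensor\<close>

text \<open>The hypotheses put \<open>m\<close> into the symplectic Lie algebra of \<open>k\<close>:
  conjugation by \<open>k\<close> turns the transpose of \<open>m\<close> into \<open>- m\<close>,
  and trace is invariant under both operations.\<close>

lemma trace_zero_symplectic:
  fixes k m :: "real ^ 'n ^ 'n"
  assumes k: "transpose k = - k" "det k \<noteq> 0" and s: "transpose (m ** k) = m ** k"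
  shows "trace m = 0"
proof -
  have "m ** k = transpose k ** transpose m" using s by (simp add: matrix_transpose_mul)
  then have "m ** k = - (k ** transpose m)"
    unfolding k(1) by (simp add: matrix_matrix_mult_def vec_eq_iff sum_negf)
  then have "m ** k ** matrix_inv k = - (k ** transpose m) ** matrix_inv k" by simp
  then have "m = - (k ** transpose m) ** matrix_inv k"
    by (simp add: matrix_mul_assoc[symmetric] matrix_inv_mult(1)[OF k(2)])
  then have "trace m = trace (- (k ** transpose m) ** matrix_inv k)" by (rule arg_cong)
  also have "\<dots> = - trace (k ** transpose m ** matrix_inv k)"
    by (simp add: trace_def matrix_matrix_mult_def sum_negf)
  also have "trace (k ** transpose m ** matrix_inv k) = trace (matrix_inv k ** k ** transpose m)"
    using trace_mul_sym[of "k ** transpose m" "matrix_inv k"] by (simp add: matrix_mul_assoc)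
  also have "\<dots> = trace m"
    unfolding matrix_inv_mult(2)[OF k(2)] by (simp add: trace_def transpose_def)
  finally show ?thesis by simp
qed

lemma symplectic_trace_sum:
  fixes k :: "'n::finite \<Rightarrow> 'n \<Rightarrow> real"
  assumes "\<And>i j. k i j = - k j i" "det (\<chi> i j. k i j) \<noteq> 0"
    and "\<And>j l. (\<Sum>p\<in>UNIV. M j p * k p l) = (\<Sum>p\<in>UNIV. M l p * k p j)"
  shows "(\<Sum>p\<in>UNIV. M p p) = (0::real)"
proof -
  have "trace (\<chi> i j. M i j) = 0"
  proof (rule trace_zero_symplectic[OF _ assms(2)])
    show "transpose (\<chi> i j. k i j) = - (\<chi> i j. k i j)"
      by (simp add: transpose_def vec_eq_iff) (intro allI assms(1))
    show "transpose ((\<chi> i j. M i j) ** (\<chi> i j. k i j)) = (\<chi> i j. M i j) ** (\<chi> i j. k i j)"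
      by (simp add: transpose_def vec_eq_iff matrix_matrix_mult_def) (intro allI assms(3))
  qed
  then show ?thesis by (simp add: trace_def)
qed

lemma row_kernel:
  fixes k :: "'n::finite \<Rightarrow> 'n \<Rightarrow> real"
  assumes "det (\<chi> i j. k i j) \<noteq> 0" "\<And>l. (\<Sum>p\<in>UNIV. x p * k p l) = 0"
  shows "x q = 0"
proof -
  define A where "A = (\<chi> i j. k i j)"
  have "(\<chi> i. x i) v* A = 0"
    using assms(2) by (simp add: vector_matrix_mult_def A_def vec_eq_iff mult.commute)
  then have "(\<chi> i. x i) v* A v* matrix_inv A = 0" by simp
  then have "(\<chi> i. x i) v* (A ** matrix_inv A) = 0" by (simp add: vector_matrix_mul_assoc)
  then have "(\<chi> i. x i) = 0"
    using matrix_inv_mult(1)[of A] assms(1) by (simp add: A_def vector_matrix_mul_rid)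
  then show ?thesis by (metis vec_lambda_beta zero_index)
qed

text \<open>The difference of two representatives, in a frame: the contact geodesics force the symmetric part
  to be \<open>\<lambda> \<odot> id\<close>, the trace condition on the torsion gives \<open>\<lambda> = 0\<close>, and a tensor that is skew in its
  first two and symmetric in its last two indices vanishes.\<close>

lemma difference_components_zero:
  fixes k :: "'n::finite \<Rightarrow> 'n \<Rightarrow> real" and M :: "'n \<Rightarrow> 'n \<Rightarrow> 'n \<Rightarrow> real"
  assumes k: "\<And>i j. k i j = - k j i" "det (\<chi> i j. k i j) \<noteq> 0"
    and sp: "\<And>i j l. (\<Sum>p\<in>UNIV. M i j p * k p l) = (\<Sum>p\<in>UNIV. M i l p * k p j)"
    and geo: "\<And>i j p. M i j p + M j i p = (if j = p then lam i else 0) + (if i = p then lam j else 0)"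
    and tor: "\<And>i. (\<Sum>p\<in>UNIV. M i p p - M p i p) = 0"
  shows "M i j l = 0"
proof -
  have t0: "(\<Sum>p\<in>UNIV. M i p p) = 0" for i
    by (rule symplectic_trace_sum[OF k sp])
  have lam0: "lam i = 0" for i
  proof -
    have "(\<Sum>p\<in>UNIV. M p i p) = 0" using t0[of i] tor[of i] by (simp add: sum_subtractf)
    then have "(\<Sum>p\<in>UNIV. M i p p + M p i p) = 0" using t0[of i] by (simp add: sum.distrib)
    moreover have "(\<Sum>p\<in>UNIV. M i p p + M p i p) = (real CARD('n) + 1) * lam i"
      unfolding geo by (simp add: sum.distrib algebra_simps)
    ultimately show ?thesis by (smt (verit) mult_eq_0_iff of_nat_0_le_iff)
  qed
  have skew: "M i j p = - M j i p" for i j p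
  proof -
    have "M i j p + M j i p = 0" unfolding geo lam0 by simp
    then show ?thesis by linarith
  qed
  define C where "C = (\<lambda>i j l. \<Sum>p\<in>UNIV. M i j p * k p l)"
  have C1: "C i j l = C i l j" for i j l unfolding C_def by (rule sp)
  have C2: "C i j l = - C j i l" for i j l
    unfolding C_def using skew[of i j] by (simp add: sum_negf[symmetric])
  \<comment> \<open>Alternating the two symmetries leads around all index orders and back to the
    start with three sign changes.\<close>
  have "C i j l = 0" for i j l
    using C1[of i j l] C2[of i l j] C1[of l i j] C2[of l j i] C1[of j l i] C2[of j i l] by linarith
  then show ?thesis unfolding C_def by (rule row_kernel[OF k(2)])
qed

subsection \<open>Uniqueness of representatives along the contact hyperplanes\<close>

lemma vector_field_zero: "vector_field W (\<lambda>q f. 0)"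
  by (rule vector_fieldI) (simp_all add: zero_in_tangent smooth_fun_const)

lemma vector_field_add:
  assumes "vector_field W X" "vector_field W Y" shows "vector_field W (\<lambda>q f. X q f + Y q f)"
proof (rule vector_fieldI)
  show "(\<lambda>f. X p f + Y p f) \<in> tangent p" if "p \<in> W" for p
    using tangent_linear_comb[OF vector_field_tangent[OF assms(1) that] vector_field_tangent[OF assms(2) that], of 1 1] by simp
  show "smooth_fun V (\<lambda>p. X p f + Y p f)" if "open V" "V \<subseteq> W" "smooth_fun V f" for V f
    by (rule smooth_fun_add[OF that(1) vector_field_smooth[OF assms(1) that] vector_field_smooth[OF assms(2) that]])
qed

lemma vector_field_mult:
  assumes "open W" "vector_field W X" "smooth_fun W h" shows "vector_field W (\<lambda>q f. h q * X q f)"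
proof (rule vector_fieldI)
  show "(\<lambda>f. h p * X p f) \<in> tangent p" if "p \<in> W" for p
    using tangent_linear_comb[OF vector_field_tangent[OF assms(2) that] zero_in_tangent, of "h p" 0] by simp
  show "smooth_fun V (\<lambda>p. h p * X p f)" if "open V" "V \<subseteq> W" "smooth_fun V f" for V f
    by (rule smooth_fun_mult[OF that(1) smooth_fun_subset[OF assms(3,1) that(1,2)] vector_field_smooth[OF assms(2) that]])
qed

lemma connD:
  assumes "affine_connection V n" "open W" "W \<subseteq> V" "vector_field W Y"
  shows conn_tangent: "p \<in> W \<Longrightarrow> v \<in> tangent p \<Longrightarrow> n p v Y \<in> tangent p"
    and conn_linear: "p \<in> W \<Longrightarrow> v \<in> tangent p \<Longrightarrow> w \<in> tangent p \<Longrightarrow>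
      n p (\<lambda>f. a * v f + b * w f) Y = (\<lambda>f. a * n p v Y f + b * n p w Y f)"
    and conn_add: "p \<in> W \<Longrightarrow> v \<in> tangent p \<Longrightarrow> vector_field W Z \<Longrightarrow>
      n p v (\<lambda>q f. Y q f + Z q f) = (\<lambda>f. n p v Y f + n p v Z f)"
    and conn_mult: "p \<in> W \<Longrightarrow> v \<in> tangent p \<Longrightarrow> smooth_fun W h \<Longrightarrow>
      n p v (\<lambda>q f. h q * Y q f) = (\<lambda>f. v h * Y p f + h p * n p v Y f)"
    and conn_cong: "p \<in> W \<Longrightarrow> v \<in> tangent p \<Longrightarrow> vector_field W Z \<Longrightarrow> (\<And>q. q \<in> W \<Longrightarrow> Z q = Y q) \<Longrightarrow>
      n p v Z = n p v Y"
    and conn_cov: "vector_field W X \<Longrightarrow> vector_field W (cov n X Y)"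
proof -
  note A = assms(1)[unfolded affine_connection_def, rule_format, OF conjI[OF assms(2,3)] assms(4)]
  show "p \<in> W \<Longrightarrow> v \<in> tangent p \<Longrightarrow> n p v Y \<in> tangent p" using A by blast
  show "p \<in> W \<Longrightarrow> v \<in> tangent p \<Longrightarrow> w \<in> tangent p \<Longrightarrow>
      n p (\<lambda>f. a * v f + b * w f) Y = (\<lambda>f. a * n p v Y f + b * n p w Y f)" using A by blast
  show "p \<in> W \<Longrightarrow> v \<in> tangent p \<Longrightarrow> vector_field W Z \<Longrightarrow>
      n p v (\<lambda>q f. Y q f + Z q f) = (\<lambda>f. n p v Y f + n p v Z f)" using A by blast
  show "p \<in> W \<Longrightarrow> v \<in> tangent p \<Longrightarrow> smooth_fun W h \<Longrightarrow>
      n p v (\<lambda>q f. h q * Y q f) = (\<lambda>f. v h * Y p f + h p * n p v Y f)" using A by blast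
  show "p \<in> W \<Longrightarrow> v \<in> tangent p \<Longrightarrow> vector_field W Z \<Longrightarrow> (\<And>q. q \<in> W \<Longrightarrow> Z q = Y q) \<Longrightarrow>
      n p v Z = n p v Y" using A by blast
  show "vector_field W X \<Longrightarrow> vector_field W (cov n X Y)" using A by blast
qed

lemma representativeD:
  assumes "representative V \<G> \<theta> m"
  shows rep_conn: "affine_connection V m"
    and rep_geodesic: "\<G> I \<gamma> \<Longrightarrow> \<gamma> ` I \<subseteq> V \<Longrightarrow> unparam_geodesic V m I \<gamma>"
    and rep_theta: "open W \<Longrightarrow> W \<subseteq> V \<Longrightarrow> vector_field W X \<Longrightarrow> vector_field W Y \<Longrightarrow> p \<in> W \<Longrightarrow>
      X p (\<lambda>q. \<theta> q (Y q)) - \<theta> p (cov m X Y p) = 0"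
    and rep_dtheta: "open W \<Longrightarrow> W \<subseteq> V \<Longrightarrow> vector_field W X \<Longrightarrow> vector_field W Y \<Longrightarrow> vector_field W Z \<Longrightarrow> p \<in> W \<Longrightarrow>
      X p (ext_deriv \<theta> Y Z) - ext_deriv \<theta> (cov m X Y) Z p - ext_deriv \<theta> Y (cov m X Z) p = 0"
    and rep_torsion_Reeb: "open W \<Longrightarrow> W \<subseteq> V \<Longrightarrow> adapted_coframe W \<theta> ch E \<Longrightarrow> p \<in> W \<Longrightarrow>
      ch \<alpha> p (torsion m (E None) (E (Some i)) p) = 0"
    and rep_torsion_trace: "open W \<Longrightarrow> W \<subseteq> V \<Longrightarrow> adapted_coframe W \<theta> ch E \<Longrightarrow> p \<in> W \<Longrightarrow>
      (\<Sum>k\<in>UNIV. ch (Some k) p (torsion m (E (Some i)) (E (Some k)) p)) = 0"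
proof -
  note A = assms[unfolded representative_def]
  show "affine_connection V m" using A by (rule conjunct1)
  show "\<G> I \<gamma> \<Longrightarrow> \<gamma> ` I \<subseteq> V \<Longrightarrow> unparam_geodesic V m I \<gamma>"
    using A[THEN conjunct2, THEN conjunct1, rule_format, of I \<gamma>] by simp
  show "open W \<Longrightarrow> W \<subseteq> V \<Longrightarrow> vector_field W X \<Longrightarrow> vector_field W Y \<Longrightarrow> p \<in> W \<Longrightarrow>
      X p (\<lambda>q. \<theta> q (Y q)) - \<theta> p (cov m X Y p) = 0"
    by (rule A[THEN conjunct2, THEN conjunct2, THEN conjunct1, rule_format, of W X Y p]) simp_all
  show "open W \<Longrightarrow> W \<subseteq> V \<Longrightarrow> vector_field W X \<Longrightarrow> vector_field W Y \<Longrightarrow> vector_field W Z \<Longrightarrow> p \<in> W \<Longrightarrow>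
      X p (ext_deriv \<theta> Y Z) - ext_deriv \<theta> (cov m X Y) Z p - ext_deriv \<theta> Y (cov m X Z) p = 0"
    by (rule A[THEN conjunct2, THEN conjunct2, THEN conjunct2, THEN conjunct1, rule_format, of W X Y Z p]) simp_all
  note T = A[THEN conjunct2, THEN conjunct2, THEN conjunct2, THEN conjunct2, THEN spec, of W, THEN spec, of ch, THEN spec, of E]
  show "open W \<Longrightarrow> W \<subseteq> V \<Longrightarrow> adapted_coframe W \<theta> ch E \<Longrightarrow> p \<in> W \<Longrightarrow>
      ch \<alpha> p (torsion m (E None) (E (Some i)) p) = 0"
    "open W \<Longrightarrow> W \<subseteq> V \<Longrightarrow> adapted_coframe W \<theta> ch E \<Longrightarrow> p \<in> W \<Longrightarrow>
      (\<Sum>k\<in>UNIV. ch (Some k) p (torsion m (E (Some i)) (E (Some k)) p)) = 0"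
    using T by simp_all
qed

lemma conn_sum:
  fixes n :: "'k::finite conn"
  assumes n: "affine_connection V n" and W: "open W" "W \<subseteq> V" and p: "p \<in> W" "v \<in> tangent p"
    and F: "\<And>i. vector_field W (F i)" and h: "\<And>i. smooth_fun W (h i)"
  shows "vector_field W (\<lambda>q f. \<Sum>i\<in>I. h i q * F i q f)"
    "n p v (\<lambda>q f. \<Sum>i\<in>I. h i q * F i q f) = (\<lambda>f. \<Sum>i\<in>I. v (h i) * F i p f + h i p * n p v (F i) f)"
proof -
  have z: "n p v (\<lambda>q f. 0) = (\<lambda>f. 0)"
    using conn_mult[OF n W vector_field_zero p smooth_fun_const[OF W(1), of 0]] tvec_const[OF p(2)] by simp
  have "vector_field W (\<lambda>q f. \<Sum>i\<in>I. h i q * F i q f) \<and>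
    n p v (\<lambda>q f. \<Sum>i\<in>I. h i q * F i q f) = (\<lambda>f. \<Sum>i\<in>I. v (h i) * F i p f + h i p * n p v (F i) f)"
  proof (induction I rule: infinite_finite_induct)
    case (insert i I)
    have m: "vector_field W (\<lambda>q f. h i q * F i q f)" by (rule vector_field_mult[OF W(1) F h])
    have vI: "vector_field W (\<lambda>q f. \<Sum>i\<in>I. h i q * F i q f)" using insert by blast
    have "n p v (\<lambda>q f. h i q * F i q f + (\<Sum>i\<in>I. h i q * F i q f))
        = (\<lambda>f. n p v (\<lambda>q f. h i q * F i q f) f + n p v (\<lambda>q f. \<Sum>i\<in>I. h i q * F i q f) f)"
      by (rule conn_add[OF n W m p vI])
    then show ?case
      using insert vector_field_add[OF m vI] conn_mult[OF n W F p h, of i i] by simp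
  qed (simp_all add: z vector_field_zero)
  then show "vector_field W (\<lambda>q f. \<Sum>i\<in>I. h i q * F i q f)"
    "n p v (\<lambda>q f. \<Sum>i\<in>I. h i q * F i q f) = (\<lambda>f. \<Sum>i\<in>I. v (h i) * F i p f + h i p * n p v (F i) f)"
    by blast+
qed

context root_section
begin

text \<open>The field represented by a constant vector. The fields of the coordinate axes are one
  too many for a frame, but they generate all fields, which is all that is needed to evaluate a
  connection.\<close>

definition cf :: "real ^ 'm ix \<Rightarrow> 'm ix vfield" where "cf b q = dproj (\<sigma> q) b"

lemma cf_field: "open V \<Longrightarrow> V \<subseteq> W \<Longrightarrow> vector_field V (cf b)"
  unfolding cf_def[abs_def] by (rule vector_field_dproj) (auto intro: smooth_fun_const)

text \<open>Formed from the generators \<open>cf (axis i 1)\<close>. By \<open>conn_diff_eq\<close>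
  it represents the difference of the two connections on arbitrary fields, since the Leibniz terms
  cancel.\<close>

definition conn_diff :: "'m ix conn \<Rightarrow> 'm ix conn \<Rightarrow> 'm ix projspace \<Rightarrow> real ^ 'm ix \<Rightarrow> real ^ 'm ix \<Rightarrow> real ^ 'm ix" where
  "conn_diff n1 n2 p a b = (\<Sum>i\<in>UNIV. b $ i *\<^sub>R
     (dv (n1 p (dproj (\<sigma> p) a) (cf (axis i 1))) \<sigma> - dv (n2 p (dproj (\<sigma> p) a) (cf (axis i 1))) \<sigma>))"

lemma conn_expand:
  assumes n: "affine_connection V n" and V: "V \<subseteq> W" and W': "open W'" "W' \<subseteq> V"
    and Y: "vector_field W' Y" and p: "p \<in> W'" and v: "v \<in> tangent p"
  shows "dv (n p v Y) \<sigma> = (\<Sum>i\<in>UNIV. v (\<lambda>q. dv (Y q) \<sigma> $ i) *\<^sub>R dv (cf (axis i 1) p) \<sigma>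
     + dv (Y p) \<sigma> $ i *\<^sub>R dv (n p v (cf (axis i 1))) \<sigma>)"
proof -
  have W'W: "W' \<subseteq> W" using W' V by blast
  have h: "smooth_fun W' (\<lambda>q. dv (Y q) \<sigma> $ i)" for i
    by (rule smooth_fun_nth[OF W'(1) field_smooth[OF W'(1) W'W Y]])
  have F: "vector_field W' (cf (axis i 1))" for i by (rule cf_field[OF W'(1) W'W])
  note cs = conn_sum[where I = UNIV, OF n W' p v F h]
  have "Y q = (\<lambda>f. \<Sum>i\<in>UNIV. dv (Y q) \<sigma> $ i * cf (axis i 1) q f)" if q: "q \<in> W'" for q
  proof -
    have qW: "q \<in> W" using q W'W by blast
    have "Y q = dproj (\<sigma> q) (dv (Y q) \<sigma>)" by (rule dproj_dv[OF qW vector_field_tangent[OF Y q], symmetric])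
    also have "\<dots> = dproj (\<sigma> q) (\<Sum>i\<in>UNIV. dv (Y q) \<sigma> $ i *\<^sub>R axis i 1)"
      using basis_expansion[of "dv (Y q) \<sigma>"] by (simp add: scalar_mult_eq_scaleR)
    finally show ?thesis unfolding dproj_sum[OF sec_nonzero[OF qW]] cf_def .
  qed
  then have "n p v Y = n p v (\<lambda>q f. \<Sum>i\<in>UNIV. dv (Y q) \<sigma> $ i * cf (axis i 1) q f)"
    by (rule conn_cong[OF n W' cs(1) p v Y])
  then have "n p v Y = (\<lambda>f. \<Sum>i\<in>UNIV. v (\<lambda>q. dv (Y q) \<sigma> $ i) * cf (axis i 1) p f + dv (Y p) \<sigma> $ i * n p v (cf (axis i 1)) f)"
    unfolding cs(2) .
  then show ?thesis by (simp add: dv_def vec_eq_iff sum.distrib)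
qed

lemma conn_diff_eq:
  assumes n1: "affine_connection V n1" and n2: "affine_connection V n2" and V: "V \<subseteq> W" and W': "open W'" "W' \<subseteq> V"
    and Y: "vector_field W' Y" and p: "p \<in> W'" and v: "v \<in> tangent p"
  shows "dv (n1 p v Y) \<sigma> - dv (n2 p v Y) \<sigma> = conn_diff n1 n2 p (dv v \<sigma>) (dv (Y p) \<sigma>)"
proof -
  have pW: "p \<in> W" using p W' V by blast
  show ?thesis
    unfolding conn_expand[OF n1 V W' Y p v] conn_expand[OF n2 V W' Y p v] conn_diff_def dproj_dv[OF pW v]
    by (simp add: sum_subtractf[symmetric] scaleR_diff_right)
qed

lemma conn_diff_linear2: "conn_diff n1 n2 p a (x *\<^sub>R b + y *\<^sub>R c) = x *\<^sub>R conn_diff n1 n2 p a b + y *\<^sub>R conn_diff n1 n2 p a c"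
  unfolding conn_diff_def by (simp add: sum.distrib scaleR_sum_right scaleR_add_left)

lemma conn_diff_linear1:
  assumes n1: "affine_connection V n1" and n2: "affine_connection V n2" and V: "open V" "V \<subseteq> W" and p: "p \<in> V"
  shows "conn_diff n1 n2 p (x *\<^sub>R b + y *\<^sub>R c) a = x *\<^sub>R conn_diff n1 n2 p b a + y *\<^sub>R conn_diff n1 n2 p c a"
proof -
  have pW: "p \<in> W" using p V by blast
  note F = cf_field[OF V]
  have d: "dproj (\<sigma> p) (x *\<^sub>R b + y *\<^sub>R c) = (\<lambda>f. x * dproj (\<sigma> p) b f + y * dproj (\<sigma> p) c f)"
    by (rule dproj_linear[OF sec_nonzero[OF pW]])
  have "dv (n p (dproj (\<sigma> p) (x *\<^sub>R b + y *\<^sub>R c)) (cf (axis i 1))) \<sigma>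
    = x *\<^sub>R dv (n p (dproj (\<sigma> p) b) (cf (axis i 1))) \<sigma> + y *\<^sub>R dv (n p (dproj (\<sigma> p) c) (cf (axis i 1))) \<sigma>"
    if "affine_connection V n" for n i
    unfolding d conn_linear[OF that V(1) order_refl F p dproj_tangent[OF pW] dproj_tangent[OF pW]] by (rule dv_linear)
  then show ?thesis
    unfolding conn_diff_def using n1 n2 by (simp add: sum.distrib[symmetric] scaleR_sum_right algebra_simps)
qed

text \<open>On contact vectors the difference \<open>D\<close> of the connections preserves the
  contact plane, is symplectic, maps each pair of equal vectors to a multiple of that vector, and
  has no torsion trace; its components in an adapted coframe then vanish by
  \<open>difference_components_zero\<close>. The premise \<open>full\<close> supplies a geodesic in
  each contact direction and a field extending its velocity, so that the geodesic condition can be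
  tested.\<close>

lemma representative_unique:
  assumes V: "open V" "V \<subseteq> W"
    and R1: "representative V \<G> \<theta> n1" and R2: "representative V \<G> \<theta> n2"
    and full: "\<And>p v. p \<in> V \<Longrightarrow> v \<in> contact_plane \<omega> p \<Longrightarrow> v \<noteq> (\<lambda>f. 0) \<Longrightarrow>
      \<exists>I \<gamma> r X W'. \<G> I \<gamma> \<and> \<gamma> ` I \<subseteq> V \<and> r \<in> I \<and> \<gamma> r = p \<and> velocity \<gamma> r = v \<and> open W' \<and> W' \<subseteq> V \<and>
        vector_field W' X \<and> (\<forall>s\<in>I. \<gamma> s \<in> W' \<and> X (\<gamma> s) = velocity \<gamma> s)"
    and W': "open W'" "W' \<subseteq> V" "p \<in> W'" and v: "v \<in> contact_plane \<omega> p"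
    and Y: "vector_field W' Y" "Y p \<in> contact_plane \<omega> p"
  shows "n1 p v Y = n2 p v Y"
proof -
  have pV: "p \<in> V" and pW: "p \<in> W" using W' V by auto
  note s0 = sec_nonzero[OF pW]
  have n: "affine_connection V n1" "affine_connection V n2"
    by (rule rep_conn[OF R1], rule rep_conn[OF R2])
  define D where "D = conn_diff n1 n2 p"
  have D_eq: "dv (n1 p v Y) \<sigma> - dv (n2 p v Y) \<sigma> = D (dv v \<sigma>) (dv (Y p) \<sigma>)"
    if "open W'" "W' \<subseteq> V" "p \<in> W'" "vector_field W' Y" "v \<in> tangent p" for W' Y v
    unfolding D_def by (rule conn_diff_eq[OF n V(2) that(1,2,4,3,5)])
  have lin2: "D a (x *\<^sub>R b + y *\<^sub>R c) = x *\<^sub>R D a b + y *\<^sub>R D a c" for a b c x y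
    unfolding D_def by (rule conn_diff_linear2)
  have lin1: "D (x *\<^sub>R b + y *\<^sub>R c) a = x *\<^sub>R D b a + y *\<^sub>R D c a" for a b c x y
    unfolding D_def by (rule conn_diff_linear1[OF n V pV])
  have KK: "dproj (\<sigma> p) a \<in> contact_plane \<omega> p" "dv (dproj (\<sigma> p) a) \<sigma> = a" if "a \<in> K p" for a
  proof -
    show *: "dv (dproj (\<sigma> p) a) \<sigma> = a" by (rule dv_dproj_perp[OF pW]) (use that in \<open>simp add: K_def\<close>)
    show "dproj (\<sigma> p) a \<in> contact_plane \<omega> p"
      using contact_plane_eq[OF pW, of "dproj (\<sigma> p) a"] * that dproj_tangent[OF pW] by (simp add: K_def)
  qed
  have HK: "dv v \<sigma> \<in> K p" if "v \<in> contact_plane \<omega> p" for v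
    using that contact_plane_eq[OF pW, of v] Om_t_tangent(1)[OF pW] by (simp add: K_def)
  have cfv: "dv (cf a p) \<sigma> = a" if "a \<in> K p" for a unfolding cf_def by (rule KK(2)[OF that])
  note F = cf_field[OF V]
  have tcf: "cf a p \<in> tangent p" for a by (rule vector_field_tangent[OF F pV])
  have D_cf: "dv (n1 p (cf a p) (cf b)) \<sigma> - dv (n2 p (cf a p) (cf b)) \<sigma> = D a b" if "a \<in> K p" "b \<in> K p" for a b
    using D_eq[OF V(1) order_refl pV F tcf, of a b] cfv that by simp
  have nt: "n1 p v Y \<in> tangent p" "n2 p v Y \<in> tangent p"
    if "open W'" "W' \<subseteq> V" "p \<in> W'" "vector_field W' Y" "v \<in> tangent p" for W' Y v
    using conn_tangent[OF n(1) that(1,2,4,3,5)] conn_tangent[OF n(2) that(1,2,4,3,5)] by blast+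
  \<comment> \<open>Both connections make \<theta> parallel, so the \<theta>-components of the two
    derivatives agree.\<close>
  have DK: "D a b \<in> K p" if ab: "a \<in> K p" "b \<in> K p" for a b
  proof -
    have th: "cf a p (\<lambda>q. \<theta> q (cf b q)) - \<theta> p (cov m (cf a) (cf b) p) = 0" if "representative V \<G> \<theta> m" for m
      by (rule rep_theta[OF that V(1) order_refl F F pV])
    have "\<theta> p (n1 p (cf a p) (cf b)) = \<theta> p (n2 p (cf a p) (cf b))"
      using th[OF R1] th[OF R2] unfolding cov_def by simp
    then have "Om (\<sigma> p) (dv (n1 p (cf a p) (cf b)) \<sigma>) = Om (\<sigma> p) (dv (n2 p (cf a p) (cf b)) \<sigma>)"
      unfolding root[OF pW nt(1)[OF V(1) order_refl pV F tcf]] root[OF pW nt(2)[OF V(1) order_refl pV F tcf]] by simp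
    moreover have "Om (t p) (dv (n1 p (cf a p) (cf b)) \<sigma>) = 0" "Om (t p) (dv (n2 p (cf a p) (cf b)) \<sigma>) = 0"
      using Om_t_tangent(1)[OF pW] nt[OF V(1) order_refl pV F tcf] by blast+
    ultimately show ?thesis unfolding D_cf[OF ab, symmetric] K_def by (simp add: Om.diff_right)
  qed
  \<comment> \<open>Both connections make the exterior derivative of \<theta> parallel, so
    \<open>D a\<close> lies in the symplectic Lie algebra of \<open>K p\<close>.\<close>
  have Dsp: "Om (D a b) c = Om (D a c) b" if abc: "a \<in> K p" "b \<in> K p" "c \<in> K p" for a b c
  proof -
    have e: "cf a p (ext_deriv \<theta> (cf b) (cf c)) - ext_deriv \<theta> (cov m (cf a) (cf b)) (cf c) p
        - ext_deriv \<theta> (cf b) (cov m (cf a) (cf c)) p = 0" if "representative V \<G> \<theta> m" for m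
      by (rule rep_dtheta[OF that V(1) order_refl F F F pV])
    have x: "ext_deriv \<theta> (cov m (cf a) (cf b)) (cf c) p = s * Om (dv (m p (cf a p) (cf b)) \<sigma>) c"
      "ext_deriv \<theta> (cf b) (cov m (cf a) (cf c)) p = s * Om b (dv (m p (cf a p) (cf c)) \<sigma>)"
      if "affine_connection V m" for m
      using ext_deriv_eq[OF V conn_cov[OF that V(1) order_refl F F] F pV, of a b c]
        ext_deriv_eq[OF V F conn_cov[OF that V(1) order_refl F F] pV, of b a c] abc
      by (simp_all add: cov_def cfv)
    have "s * (Om (dv (n1 p (cf a p) (cf b)) \<sigma>) c + Om b (dv (n1 p (cf a p) (cf c)) \<sigma>))
      = s * (Om (dv (n2 p (cf a p) (cf b)) \<sigma>) c + Om b (dv (n2 p (cf a p) (cf c)) \<sigma>))"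
      using e[OF R1] e[OF R2] unfolding x[OF n(1)] x[OF n(2)] by (simp add: algebra_simps)
    then have "Om (D a b) c + Om b (D a c) = 0"
      unfolding D_cf[OF abc(1,2), symmetric] D_cf[OF abc(1,3), symmetric]
      by (simp add: Om.diff_left Om.diff_right)
    then show ?thesis using Om_skew[of b "D a c"] by simp
  qed
  \<comment> \<open>Both connections differentiate the same extension of the velocity of a common
    geodesic to a multiple of that velocity.\<close>
  have Dgeo: "\<exists>c. D a a = c *\<^sub>R a" if a: "a \<in> K p" for a
  proof (cases "a = 0")
    case True
    have "D 0 0 = 0" using lin2[of 0 0 0 0 0] by simp
    then show ?thesis using True by simp
  next
    case False
    have "dproj (\<sigma> p) a \<noteq> (\<lambda>f. 0)" using KK(2)[OF a] False dv_zero by metis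
    then obtain I \<gamma> r X W' where g: "\<G> I \<gamma>" "\<gamma> ` I \<subseteq> V" "r \<in> I" "\<gamma> r = p" "velocity \<gamma> r = dproj (\<sigma> p) a"
      "open W'" "W' \<subseteq> V" "vector_field W' X" "\<forall>s\<in>I. \<gamma> s \<in> W' \<and> X (\<gamma> s) = velocity \<gamma> s"
      using full[OF pV KK(1)[OF a]] by blast
    have Xp: "X p = dproj (\<sigma> p) a" "p \<in> W'" using g by auto
    have ex: "\<exists>c. m p (dproj (\<sigma> p) a) X = (\<lambda>f. c * dproj (\<sigma> p) a f)" if "representative V \<G> \<theta> m" for m
    proof -
      have "unparam_geodesic V m I \<gamma>" by (rule rep_geodesic[OF that g(1,2)])
      then have "immersed_path I \<gamma>" and *: "\<forall>t\<in>I. \<forall>W X J. open W \<and> W \<subseteq> V \<and> vector_field W X \<and> open J \<and> t \<in> J \<and> J \<subseteq> I \<and>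
        (\<forall>s\<in>J. \<gamma> s \<in> W \<and> X (\<gamma> s) = velocity \<gamma> s) \<longrightarrow>
        (\<exists>c. m (\<gamma> t) (velocity \<gamma> t) X = (\<lambda>f. c * velocity \<gamma> t f))"
        unfolding unparam_geodesic_def by blast+
      then have "open I" unfolding immersed_path_def by blast
      then have "\<exists>c. m (\<gamma> r) (velocity \<gamma> r) X = (\<lambda>f. c * velocity \<gamma> r f)"
        using *[rule_format, of r W' X I] g by blast
      then show ?thesis unfolding g(4,5) .
    qed
    obtain c1 c2 where c: "n1 p (dproj (\<sigma> p) a) X = (\<lambda>f. c1 * dproj (\<sigma> p) a f)" "n2 p (dproj (\<sigma> p) a) X = (\<lambda>f. c2 * dproj (\<sigma> p) a f)"
      using ex[OF R1] ex[OF R2] by blast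
    have "D a a = c1 *\<^sub>R a - c2 *\<^sub>R a"
      using D_eq[OF g(6,7) Xp(2) g(8) dproj_tangent[OF pW], of a] KK(2)[OF a]
      unfolding c Xp(1) dv_cmul by simp
    then show ?thesis by (metis scaleR_diff_left)
  qed
  obtain V' ch E where V': "open V'" "V' \<subseteq> V" "p \<in> V'" and ad: "adapted_coframe V' \<theta> ch E"
    using ex_adapted_coframe[OF V pV] by blast
  have V'W: "V' \<subseteq> W" using V' V by blast
  have E: "vector_field V' (E \<alpha>)" and o: "one_form V' (ch \<alpha>)" for \<alpha> using ad unfolding adapted_coframe_def by blast+
  have tE: "E \<alpha> p \<in> tangent p" for \<alpha> by (rule vector_field_tangent[OF E V'(3)])
  have chE: "ch \<alpha> p (E \<beta> p) = (if \<alpha> = \<beta> then 1 else 0)" for \<alpha> \<beta>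
    using ad V'(3) unfolding adapted_coframe_def by blast
  define z where "z = (\<lambda>i. dv (E (Some i) p) \<sigma>)"
  have zK: "z i \<in> K p" for i unfolding z_def by (rule coframe_K[OF V'(1) V'W ad V'(3)])
  define cp where "cp = (\<lambda>k w. ch (Some k) p (dproj (\<sigma> p) w))"
  have cp_lin: "cp k (x *\<^sub>R a + y *\<^sub>R b) = x * cp k a + y * cp k b" for k x y a b
    unfolding cp_def dproj_linear[OF s0] by (rule one_form_linear[OF o V'(3) dproj_tangent[OF pW] dproj_tangent[OF pW]])
  have cpz: "cp k (z i) = (if k = i then 1 else 0)" for k i
    unfolding cp_def z_def dproj_dv[OF pW tE] chE by simp
  have expand: "w = (\<Sum>l\<in>UNIV. cp l w *\<^sub>R z l)" if "w \<in> K p" for w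
    unfolding cp_def z_def by (rule coframe_K_expand[OF V'(1) V'W ad V'(3) that])
  define k where "k = (\<lambda>i j. Om (z i) (z j))"
  define M where "M = (\<lambda>i j l. cp l (D (z i) (z j)))"
  have Mz: "D (z i) (z j) = (\<Sum>l\<in>UNIV. M i j l *\<^sub>R z l)" for i j
    unfolding M_def by (rule expand[OF DK[OF zK zK]])
  have Mk: "(\<Sum>l\<in>UNIV. M i j l * k l r) = Om (D (z i) (z j)) (z r)" for i j r
    unfolding Mz k_def by (simp add: Om.sum_left Om.scaleR_left)
  have kdet: "det (\<chi> i j. k i j) \<noteq> 0"
    unfolding k_def z_def by (rule coframe_K_det[OF V'(1) V'W ad V'(3)])
  obtain lam where lam: "\<And>i. D (z i) (z i) = lam i *\<^sub>R z i" using Dgeo[OF zK] by metis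
  have geo: "M i j l + M j i l = (if j = l then lam i else 0) + (if i = l then lam j else 0)" for i j l
  proof (cases "i = j")
    case True
    have "cp l (lam i *\<^sub>R z i + 0 *\<^sub>R z i) = lam i * cp l (z i)" unfolding cp_lin by simp
    then show ?thesis using True lam[of i] by (simp add: M_def cpz)
  next
    case False
    have "z i + z j \<in> K p" "z i - z j \<in> K p"
      using zK subspace_add[OF subspace_K] subspace_diff[OF subspace_K] by blast+
    then obtain a b where ab: "D (z i + z j) (z i + z j) = a *\<^sub>R (z i + z j)" "D (z i - z j) (z i - z j) = b *\<^sub>R (z i - z j)"
      using Dgeo by blast
    define S where "S = D (z i) (z j) + D (z j) (z i)"
    have e1: "D (z i + z j) (z i + z j) = lam i *\<^sub>R z i + lam j *\<^sub>R z j + S"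
      using lin1[of 1 "z i" 1 "z j"] lin2[of _ 1 "z i" 1 "z j"] lam by (simp add: S_def)
    have e2: "D (z i - z j) (z i - z j) = lam i *\<^sub>R z i + lam j *\<^sub>R z j - S"
      using lin1[of 1 "z i" "-1" "z j"] lin2[of _ 1 "z i" "-1" "z j"] lam by (simp add: S_def)
    have S1: "S = (a - lam i) *\<^sub>R z i + (a - lam j) *\<^sub>R z j"
      using e1 ab(1) by (simp add: algebra_simps)
    have S2: "S = (lam i - b) *\<^sub>R z i + (lam j + b) *\<^sub>R z j"
      using e2 ab(2) by (simp add: algebra_simps)
    have "cp i S = a - lam i" "cp j S = a - lam j" unfolding S1 cp_lin cpz using False by simp_all
    moreover have "cp i S = lam i - b" "cp j S = lam j + b" unfolding S2 cp_lin cpz using False by simp_all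
    \<comment> \<open>The coefficients read off from \<open>z i + z j\<close> and from
      \<open>z i - z j\<close> are compared; adding the two equations eliminates
      \<open>b\<close>.\<close>
    ultimately have "a = lam i + lam j" by linarith
    then have S3: "S = lam j *\<^sub>R z i + lam i *\<^sub>R z j" using S1 by simp
    have "cp l S = (if l = i then lam j else 0) + (if l = j then lam i else 0)"
      unfolding S3 cp_lin[of l "lam j" "z i" "lam i" "z j"] cpz by simp
    moreover have "cp l S = M i j l + M j i l"
      using cp_lin[of l 1 "D (z i) (z j)" 1 "D (z j) (z i)"] by (simp add: S_def M_def)
    ultimately show ?thesis by auto
  qed
  \<comment> \<open>The bracket is common to both torsions, so their difference is the skew part of
    \<open>D\<close>.\<close>
  have tor: "(\<Sum>l\<in>UNIV. M i l l - M l i l) = 0" for i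
  proof -
    have T0: "(\<Sum>l\<in>UNIV. ch (Some l) p (torsion m (E (Some i)) (E (Some l)) p)) = 0" if "representative V \<G> \<theta> m" for m
      by (rule rep_torsion_trace[OF that V'(1,2) ad V'(3)])
    have "M i l l - M l i l = ch (Some l) p (torsion n1 (E (Some i)) (E (Some l)) p)
        - ch (Some l) p (torsion n2 (E (Some i)) (E (Some l)) p)" for l
    proof -
      define A1 A2 where "A1 = torsion n1 (E (Some i)) (E (Some l)) p" and "A2 = torsion n2 (E (Some i)) (E (Some l)) p"
      have tt: "torsion m (E (Some i)) (E (Some l)) p \<in> tangent p" if m: "affine_connection V m" for m
      proof -
        have a: "m p (E (Some i) p) (E (Some l)) \<in> tangent p" "m p (E (Some l) p) (E (Some i)) \<in> tangent p"
          using conn_tangent[OF m V'(1,2) E V'(3) tE] by blast+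
        have b: "bracket (E (Some i)) (E (Some l)) p \<in> tangent p" by (rule bracket_tangent[OF V'(1) V'W E E V'(3)])
        have "(\<lambda>f. 1 * (1 * m p (E (Some i) p) (E (Some l)) f + (-1) * m p (E (Some l) p) (E (Some i)) f)
            + (-1) * bracket (E (Some i)) (E (Some l)) p f) \<in> tangent p"
          by (rule tangent_linear_comb[OF tangent_linear_comb[OF a] b])
        then show ?thesis by (simp add: torsion_def cov_def)
      qed
      have "dv A1 \<sigma> - dv A2 \<sigma> = (dv (n1 p (E (Some i) p) (E (Some l))) \<sigma> - dv (n2 p (E (Some i) p) (E (Some l))) \<sigma>)
          - (dv (n1 p (E (Some l) p) (E (Some i))) \<sigma> - dv (n2 p (E (Some l) p) (E (Some i))) \<sigma>)"
        unfolding A1_def A2_def torsion_def cov_def dv_diff by simp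
      also have "\<dots> = D (z i) (z l) - D (z l) (z i)"
        unfolding D_eq[OF V' E tE] z_def by (rule refl)
      finally have dd: "dv A1 \<sigma> - dv A2 \<sigma> = D (z i) (z l) - D (z l) (z i)" .
      have "cp l (dv A1 \<sigma>) - cp l (dv A2 \<sigma>) = cp l (dv A1 \<sigma> - dv A2 \<sigma>)"
        using cp_lin[of l 1 "dv A1 \<sigma>" "-1" "dv A2 \<sigma>"] by simp
      also have "\<dots> = M i l l - M l i l"
        unfolding dd M_def using cp_lin[of l 1 "D (z i) (z l)" "-1" "D (z l) (z i)"] by simp
      finally show ?thesis
        unfolding cp_def A1_def A2_def dproj_dv[OF pW tt[OF n(1)]] dproj_dv[OF pW tt[OF n(2)]] by simp
    qed
    then show ?thesis using T0[OF R1] T0[OF R2] by (simp add: sum_subtractf)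
  qed
  have M0: "M i j l = 0" for i j l
  proof (rule difference_components_zero[OF _ kdet _ geo tor])
    show "k i j = - k j i" for i j unfolding k_def by (rule Om_skew)
    show "(\<Sum>r\<in>UNIV. M i j r * k r l) = (\<Sum>r\<in>UNIV. M i l r * k r j)" for i j l
      unfolding Mk by (rule Dsp[OF zK zK zK])
  qed
  have Dz: "D (z i) (z j) = 0" for i j unfolding Mz M0 by simp
  have D2: "D a (\<Sum>j\<in>A. c j *\<^sub>R z j) = (\<Sum>j\<in>A. c j *\<^sub>R D a (z j))" for a A and c :: "'m \<Rightarrow> real"
  proof (induction A rule: infinite_finite_induct)
    case (insert j A)
    then show ?case using lin2[of a "c j" "z j" 1 "\<Sum>j\<in>A. c j *\<^sub>R z j"] by simp
  qed (use lin2[of a 0 0 0 0] in simp_all)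
  have D1: "D (\<Sum>j\<in>A. c j *\<^sub>R z j) a = (\<Sum>j\<in>A. c j *\<^sub>R D (z j) a)" for a A and c :: "'m \<Rightarrow> real"
  proof (induction A rule: infinite_finite_induct)
    case (insert j A)
    then show ?case using lin1[of "c j" "z j" 1 "\<Sum>j\<in>A. c j *\<^sub>R z j" a] by simp
  qed (use lin1[of 0 0 0 0 a] in simp_all)
  have D0: "D (\<Sum>i\<in>UNIV. c i *\<^sub>R z i) (\<Sum>j\<in>UNIV. d j *\<^sub>R z j) = 0" for c d
    unfolding D1 D2 Dz by simp
  have tv: "v \<in> tangent p" using v contact_plane_eq[OF pW] by blast
  have "D (dv v \<sigma>) (dv (Y p) \<sigma>) = 0"
    using D0[of "\<lambda>i. cp i (dv v \<sigma>)" "\<lambda>i. cp i (dv (Y p) \<sigma>)"]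
    unfolding expand[OF HK[OF v], symmetric] expand[OF HK[OF Y(2)], symmetric] .
  then have "dv (n1 p v Y) \<sigma> = dv (n2 p v Y) \<sigma>" using D_eq[OF W' Y(1) tv] by simp
  then show ?thesis by (rule tangent_eqI[OF pW nt[OF W' Y(1) tv]])
qed

end

subsection \<open>Contact geodesics of a pulled back structure\<close>

locale contact_lift = symp_lift \<omega> U \<Phi> \<epsilon>
  for \<omega> :: "real ^ 'm::finite ^ 'm" and U \<Phi> \<epsilon> +
  fixes Dom Ran :: "'m ix projspace set" and \<phi> :: "'m ix projspace \<Rightarrow> 'm ix projspace"
  assumes contacto: "contactomorphism \<omega> Dom Ran \<phi>" and U_Dom: "U \<subseteq> Dom"
    and lift: "u \<in> cone U \<Longrightarrow> proj (\<Phi> u) = \<phi> (proj u)"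

locale lift_section = contact_lift \<omega> W \<Phi> \<epsilon> Dom Ran \<phi> + root_section \<omega> W \<sigma> s \<theta>
  for \<omega> :: "real ^ 'm::finite ^ 'm" and W \<Phi> \<epsilon> Dom Ran \<phi> \<sigma> s \<theta>
begin

lemma smooth_fun_B:
  assumes V: "open V" "V \<subseteq> W" "smooth_fun V f" "smooth_fun V g"
  shows "smooth_fun V (\<lambda>q. B (\<sigma> q) (f q) (g q))"
proof (rule smooth_fun_cong[OF V(1)])
  have b: "smooth_fun V (\<lambda>q. B (\<sigma> q) a b)" for a b
    by (rule smooth_fun_compose[OF smooth_B open_C V(1) sec_smooth_on[OF V(1,2)]])
      (use V(2) in \<open>auto intro: sec_cone\<close>)
  show "smooth_fun V (\<lambda>q. \<Sum>i\<in>UNIV. f q $ i *\<^sub>R (\<Sum>j\<in>UNIV. g q $ j *\<^sub>R B (\<sigma> q) (axis i 1) (axis j 1)))"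
    by (intro smooth_fun_sum smooth_fun_scaleR V(1) smooth_fun_nth[OF V(1,3)] smooth_fun_nth[OF V(1,4)] b)
  fix q assume "q \<in> V"
  then have c: "\<sigma> q \<in> cone W" using V(2) sec_cone by blast
  have l: "linear (\<lambda>a. B (\<sigma> q) a b)" for b
  proof -
    have "(\<lambda>a. B (\<sigma> q) a b) = B (\<sigma> q) b" using B_sym[OF c] by blast
    then show ?thesis using linear_B[OF c] by simp
  qed
  show "(\<Sum>i\<in>UNIV. f q $ i *\<^sub>R (\<Sum>j\<in>UNIV. g q $ j *\<^sub>R B (\<sigma> q) (axis i 1) (axis j 1))) = B (\<sigma> q) (f q) (g q)"
    unfolding linear_axis_expansion[OF linear_B[OF c], of _ "g q", symmetric]
    by (rule linear_axis_expansion[OF l, of "f q" "g q", symmetric])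
qed

lemma lift_tensor:
  assumes "p \<in> W"
  shows "linear (B (\<sigma> p) a)" "B (\<sigma> p) a b = B (\<sigma> p) b a" "Om (B (\<sigma> p) a b) d = Om (B (\<sigma> p) a d) b"
proof -
  have c: "\<sigma> p \<in> cone W" using sec_cone assms by blast
  show "linear (B (\<sigma> p) a)" by (rule linear_B[OF c])
  show "B (\<sigma> p) a b = B (\<sigma> p) b a" by (rule B_sym[OF c])
  show "Om (B (\<sigma> p) a b) d = Om (B (\<sigma> p) a d) b" by (rule Om_B_sym[OF c])
qed

sublocale can: canonical \<omega> W \<sigma> s \<theta> "\<lambda>p. B (\<sigma> p)"
  by (intro canonical.intro canonical_axioms.intro root_section_axioms) (rule lift_tensor smooth_fun_B; assumption)+

text \<open>Through \<sigma> the path lifts to a curve that \<Phi> sends into the isotropic plane of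
  the flat geodesic; \<open>plane_curve\<close> then controls its acceleration.\<close>

lemma unparam_geodesic_lift:
  assumes V: "open V" "V \<subseteq> W" and im: "immersed_path I \<gamma>" "\<gamma> ` I \<subseteq> V"
    and flat: "flat_contact_geodesic \<omega> I (\<lambda>t. \<phi> (\<gamma> t))"
  shows "unparam_geodesic V can.Nb I \<gamma>"
proof -
  obtain L where L: "subspace L" "dim L = 2" "\<forall>u\<in>L. \<forall>v\<in>L. Om u v = 0" "\<forall>t\<in>I. line_of (\<phi> (\<gamma> t)) \<subseteq> L"
    using flat unfolding flat_contact_geodesic_def by blast
  have L3: "Om u v = 0" if "u \<in> L" "v \<in> L" for u v using L(3) that by blast
  have sc: "smooth_curve I \<gamma>" "open I" and v0: "\<And>t. t \<in> I \<Longrightarrow> velocity \<gamma> t \<noteq> (\<lambda>f. 0)"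
    using im(1) unfolding immersed_path_def by blast+
  have gW: "\<gamma> ` I \<subseteq> W" using im V by blast
  note vs = velocity_section[OF sc gW]
  have cc: "\<sigma> (\<gamma> r) \<in> cone W" if "r \<in> I" for r using gW that sec_cone by blast
  have imm: "fd (\<lambda>s. \<sigma> (\<gamma> s)) r 1 \<noteq> k *\<^sub>R \<sigma> (\<gamma> r)" if "r \<in> I" for r k
  proof
    assume "fd (\<lambda>s. \<sigma> (\<gamma> s)) r 1 = k *\<^sub>R \<sigma> (\<gamma> r)"
    then have "velocity \<gamma> r = (\<lambda>f. 0)"
      using vs(1)[OF that] cc[OF that] by (simp add: dproj_cmul dproj_self mem_cone)
    then show False using v0[OF that] by blast
  qed
  have PL: "\<Phi> (\<sigma> (\<gamma> r)) \<in> L" if r: "r \<in> I" for r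
  proof -
    have gr: "\<gamma> r \<in> W" using gW r by blast
    have "line_of (proj (\<Phi> (\<sigma> (\<gamma> r)))) \<subseteq> L"
      using L(4) r lift[OF cc[OF r]] proj_sec[OF gr] by simp
    then show ?thesis
      unfolding line_of_proj[OF Phi_nonzero[OF cc[OF r]]] using span_base[of "\<Phi> (\<sigma> (\<gamma> r))"] by blast
  qed
  show ?thesis
  proof (rule can.unparam_geodesic_Nb[OF V im])
    fix r assume r: "r \<in> I"
    note pc = plane_curve[where c = "\<lambda>s. \<sigma> (\<gamma> s)", OF sc(2) vs(4)[OF r] cc imm L(1,2) L3 PL r]
    show "Om (\<sigma> (\<gamma> r)) (fd (\<lambda>s. \<sigma> (\<gamma> s)) r 1) = 0" by (rule pc(1))
    show "\<exists>\<alpha> \<beta>. fd (\<lambda>r. fd (\<lambda>s. \<sigma> (\<gamma> s)) r 1) r 1 + B (\<sigma> (\<gamma> r)) (fd (\<lambda>s. \<sigma> (\<gamma> s)) r 1) (fd (\<lambda>s. \<sigma> (\<gamma> s)) r 1)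
       = \<alpha> *\<^sub>R \<sigma> (\<gamma> r) + \<beta> *\<^sub>R fd (\<lambda>s. \<sigma> (\<gamma> s)) r 1" by (rule pc(2))
  qed
qed

lemma representative_pullback:
  assumes V: "open V" "V \<subseteq> W"
  shows "representative V (pullback_contact_geodesic \<omega> Dom \<phi>) \<theta> can.Nb"
  by (rule can.representative_Nb[OF V])
    (rule unparam_geodesic_lift[OF V], auto simp: pullback_contact_geodesic_def)

text \<open>The path is the preimage under \<phi> of the projected straight line through
  \<open>\<Phi> u\<close> in the direction \<open>fd \<Phi> u a\<close>. The remaining work is a
  field on \<open>V\<close> that extends its velocity.\<close>

lemma geodesic_exists:
  assumes V: "open V" "V \<subseteq> W" and p: "p \<in> V" and v: "v \<in> contact_plane \<omega> p" "v \<noteq> (\<lambda>f. 0)"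
  shows "\<exists>I \<gamma> r X W'. pullback_contact_geodesic \<omega> Dom \<phi> I \<gamma> \<and> \<gamma> ` I \<subseteq> V \<and> r \<in> I \<and> \<gamma> r = p \<and>
      velocity \<gamma> r = v \<and> open W' \<and> W' \<subseteq> V \<and> vector_field W' X \<and> (\<forall>s\<in>I. \<gamma> s \<in> W' \<and> X (\<gamma> s) = velocity \<gamma> s)"
proof -
  have pW: "p \<in> W" using p V by blast
  have VD: "V \<subseteq> Dom" using V U_Dom by blast
  define \<psi> where "\<psi> = inv_into Dom \<phi>"
  have bij: "bij_betw \<phi> Dom Ran" "open Ran" "smooth_map Ran \<psi>"
    using contacto unfolding contactomorphism_def \<psi>_def by blast+
  have inv: "\<psi> (\<phi> q) = q" if "q \<in> Dom" for q
    using that bij(1) unfolding \<psi>_def by (simp add: bij_betw_def)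
  have inv': "\<phi> (\<psi> q) = q" if "q \<in> Ran" for q
    using that bij(1) unfolding \<psi>_def by (simp add: bij_betw_inv_into_right)
  have phiR: "\<phi> q \<in> Ran" if "q \<in> Dom" for q using that bij(1) by (auto simp: bij_betw_def)
  define u where "u = \<sigma> p"
  define a where "a = dv v \<sigma>"
  have uc: "u \<in> cone W" unfolding u_def using sec_cone[OF pW pW] .
  have u0: "u \<noteq> 0" and up: "proj u = p" unfolding u_def using sec_nonzero[OF pW] proj_sec[OF pW] by auto
  have tv: "v \<in> tangent p" and Oa: "Om u a = 0" using v(1) contact_plane_eq[OF pW] by (auto simp: u_def a_def)
  have va: "v = dproj u a" unfolding u_def a_def by (rule dproj_dv[OF pW tv, symmetric])
  have an: "a \<noteq> k *\<^sub>R u" for k using v(2) va u0 by (auto simp: dproj_cmul dproj_self)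
  define f0 where "f0 = \<Phi> u"
  define b where "b = fd \<Phi> u a"
  have f00: "f0 \<noteq> 0" unfolding f0_def by (rule Phi_nonzero[OF uc])
  have bn: "b \<noteq> k *\<^sub>R f0" for k unfolding b_def f0_def by (rule DPhi_not_multiple[OF uc an])
  have Ofb: "Om f0 b = 0" unfolding f0_def b_def Phi_contact[OF uc] Oa by simp
  have line0: "f0 + s *\<^sub>R b \<noteq> 0" for s
  proof
    assume h: "f0 + s *\<^sub>R b = 0"
    have "s \<noteq> 0" using h f00 by auto
    then have "b = (1 / s) *\<^sub>R (s *\<^sub>R b)" by simp
    moreover have "s *\<^sub>R b = (- 1) *\<^sub>R f0" using h by (simp add: add_eq_0_iff)
    ultimately have "b = (1 / s) *\<^sub>R ((- 1) *\<^sub>R f0)" by (simp only:)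
    then have "b = (- 1 / s) *\<^sub>R f0" by simp
    then show False using bn by blast
  qed
  define \<gamma>0 where "\<gamma>0 = (\<lambda>s. proj (f0 + s *\<^sub>R b))"
  define V' where "V' = Ran \<inter> \<psi> -` V"
  have oV': "open V'" unfolding V'_def using bij(2,3) V(1) unfolding smooth_map_def by (intro continuous_open_preimage) blast+
  define I0 where "I0 = (\<lambda>s. f0 + s *\<^sub>R b) -` cone V'"
  have "open I0" unfolding I0_def by (intro open_vimage open_cone oV' continuous_intros)
  have g00: "\<gamma>0 0 = \<phi> p" unfolding \<gamma>0_def f0_def using lift[OF uc] up by simp
  have "0 \<in> I0"
    using g00 f00 phiR inv p VD unfolding I0_def V'_def \<gamma>0_def by (auto simp: mem_cone)
  then obtain \<delta> where \<delta>: "\<delta> > 0" "ball 0 \<delta> \<subseteq> I0" using \<open>open I0\<close> openE by blast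
  define I where "I = ball (0::real) \<delta>"
  have oI: "open I" "connected I" "0 \<in> I" unfolding I_def using \<delta> by (auto intro: convex_connected)
  have gV': "\<gamma>0 s \<in> V'" if "s \<in> I" for s
    using that \<delta>(2) unfolding I_def I0_def \<gamma>0_def by (auto simp: mem_cone)
  define \<gamma> where "\<gamma> = (\<lambda>s. \<psi> (\<gamma>0 s))"
  have gV: "\<gamma> s \<in> V" if "s \<in> I" for s using gV'[OF that] unfolding V'_def \<gamma>_def by blast
  have gV2: "\<gamma> ` I \<subseteq> V" "\<gamma> ` I \<subseteq> W" using gV V by auto
  have phig: "\<phi> (\<gamma> s) = \<gamma>0 s" if "s \<in> I" for s
    using gV'[OF that] inv' unfolding V'_def \<gamma>_def by blast
  have sc0: "smooth_curve I \<gamma>0" unfolding \<gamma>0_def by (rule smooth_curve_line(1)[OF oI(1) line0])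
  have sc: "smooth_curve I \<gamma>"
    unfolding smooth_curve_def
  proof (intro conjI allI impI)
    have "continuous_on I \<gamma>0" using sc0 unfolding smooth_curve_def by blast
    moreover have "continuous_on Ran \<psi>" using bij(3) unfolding smooth_map_def by blast
    ultimately show "continuous_on I \<gamma>"
      unfolding \<gamma>_def using continuous_on_compose2[of Ran \<psi> I \<gamma>0] gV' by (auto simp: V'_def)
    fix W0 and f :: "'m ix projspace \<Rightarrow> real" assume W0: "open W0 \<and> smooth_fun W0 f"
    have s1: "smooth_fun (Ran \<inter> \<psi> -` W0) (\<lambda>q. f (\<psi> q))" using bij(3) W0 unfolding smooth_map_def by blast
    have o1: "open (Ran \<inter> \<psi> -` W0)"
      using bij(2,3) W0 unfolding smooth_map_def by (intro continuous_open_preimage) blast+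
    have "I \<inter> \<gamma>0 -` (Ran \<inter> \<psi> -` W0) = I \<inter> \<gamma> -` W0"
      unfolding \<gamma>_def using gV' by (auto simp: V'_def)
    then show "smooth_on (I \<inter> \<gamma> -` W0) (\<lambda>t. f (\<gamma> t))"
      using smooth_curve_fun[OF sc0 o1 s1] by (simp add: \<gamma>_def)
  qed
  define c where "c = (\<lambda>s. \<sigma> (\<gamma> s))"
  note vs = velocity_section[OF sc oI(1) gV2(2), folded c_def]
  have smc: "smooth_on I c" using vs(4)[OF oI(3)] .
  have cW: "c s \<in> cone W" if "s \<in> I" for s unfolding c_def using gV2(2) that sec_cone by blast
  have cp: "proj (c s) = \<gamma> s" if "s \<in> I" for s unfolding c_def using gV2(2) that proj_sec by blast
  \<comment> \<open>Along the lifted curve, \<Phi> agrees with the straight line only up to a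
    factor; the quotient of inner products exhibits this factor as a smooth function.\<close>
  define \<rho> where "\<rho> = (\<lambda>s. (\<Phi> (c s) \<bullet> (f0 + s *\<^sub>R b)) / ((f0 + s *\<^sub>R b) \<bullet> (f0 + s *\<^sub>R b)))"
  have Pc: "\<Phi> (c s) = \<rho> s *\<^sub>R (f0 + s *\<^sub>R b)" and rho0: "\<rho> s \<noteq> 0" if s: "s \<in> I" for s
  proof -
    have "proj (f0 + s *\<^sub>R b) = proj (\<Phi> (c s))"
      using lift[OF cW[OF s]] cp[OF s] phig[OF s] by (simp add: \<gamma>0_def)
    then obtain k where k: "k \<noteq> 0" "\<Phi> (c s) = k *\<^sub>R (f0 + s *\<^sub>R b)"
      using proj_eq_iff[OF line0 Phi_nonzero[OF cW[OF s]]] by blast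
    then have "\<rho> s = k" using line0[of s] by (simp add: \<rho>_def)
    then show "\<Phi> (c s) = \<rho> s *\<^sub>R (f0 + s *\<^sub>R b)" "\<rho> s \<noteq> 0" using k by auto
  qed
  have sml: "smooth_on I (\<lambda>s. f0 + s *\<^sub>R b)"
    by (intro smooth_on_add smooth_on_scaleR smooth_on_const smooth_on_ident oI(1))
  have smP: "smooth_on I (\<lambda>s. \<Phi> (c s))"
    by (rule smooth_on_compose[OF Phi_smooth smc oI(1) open_C cW])
  have smr: "smooth_on I \<rho>"
    unfolding \<rho>_def
    by (intro smooth_on_divide smooth_on_bilinear[OF bounded_bilinear_inner] oI(1) smP sml)
      (use line0 in simp)
  have DPc: "fd \<Phi> (c s) (fd c s 1) = fd \<rho> s 1 *\<^sub>R (f0 + s *\<^sub>R b) + \<rho> s *\<^sub>R b" if s: "s \<in> I" for s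
  proof -
    have "fd (\<lambda>s. \<Phi> (c s)) s 1 = fd \<Phi> (c s) (fd c s 1)"
      by (rule fd_compose[OF smooth_on_differentiable[OF smc oI(1) s] smooth_on_differentiable[OF Phi_smooth open_C cW[OF s]]])
    moreover have "fd (\<lambda>s. \<Phi> (c s)) s = fd (\<lambda>s. \<rho> s *\<^sub>R (f0 + s *\<^sub>R b)) s"
      by (rule fd_open_cong[OF oI(1) s Pc])
    moreover have "fd (\<lambda>s. f0 + s *\<^sub>R b) s 1 = b"
    proof -
      have "((\<lambda>s. f0 + s *\<^sub>R b) has_derivative (\<lambda>r. r *\<^sub>R b)) (at s)" by (auto intro!: derivative_eq_intros)
      from fd_eq[OF this] show ?thesis by simp
    qed
    ultimately show ?thesis
      using fd_bilinear[OF bounded_bilinear_scaleR smooth_on_differentiable[OF smr oI(1) s] smooth_on_differentiable[OF sml oI(1) s], of 1]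
      by (simp add: add.commute)
  qed
  have DPc2: "fd \<Phi> (c s) (fd c s 1) = (fd \<rho> s 1 / \<rho> s) *\<^sub>R \<Phi> (c s) + \<rho> s *\<^sub>R b" if s: "s \<in> I" for s
    unfolding DPc[OF s] Pc[OF s] using rho0[OF s] by simp
  have der: "fd c s 1 = (fd \<rho> s 1 / \<rho> s) *\<^sub>R c s + DPhi_inv (c s) (\<rho> s *\<^sub>R b)" if s: "s \<in> I" for s
    by (rule DPhi_inj[OF cW[OF s]])
      (simp add: DPc2[OF s] linear_add[OF linear_DPhi[OF cW[OF s]]] linear_cmul[OF linear_DPhi[OF cW[OF s]]]
        DPhi_self[OF cW[OF s]] DPhi_DPhi_inv[OF cW[OF s]])
  have vel: "velocity \<gamma> s = dproj (c s) (DPhi_inv (c s) (\<rho> s *\<^sub>R b))" if s: "s \<in> I" for s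
  proof -
    have "c s \<noteq> 0" using cW[OF s] by (simp add: mem_cone)
    then show ?thesis
      using vs(1)[OF s] der[OF s] by (simp add: c_def add.commute[of "_ *\<^sub>R _"] dproj_add_self)
  qed
  have vel0: "velocity \<gamma> s \<noteq> (\<lambda>f. 0)" if s: "s \<in> I" for s
  proof
    assume h: "velocity \<gamma> s = (\<lambda>f. 0)"
    have cs0: "c s \<noteq> 0" using cW[OF s] by (simp add: mem_cone)
    obtain k where "DPhi_inv (c s) (\<rho> s *\<^sub>R b) = k *\<^sub>R c s"
      using dproj_eq_zeroD[OF cs0] h vel[OF s] by metis
    then have "\<rho> s *\<^sub>R b = k *\<^sub>R \<Phi> (c s)"
      using DPhi_DPhi_inv[OF cW[OF s], of "\<rho> s *\<^sub>R b"] DPhi_self[OF cW[OF s]]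
      by (simp add: linear_cmul[OF linear_DPhi[OF cW[OF s]]])
    then have "\<rho> s *\<^sub>R b = \<rho> s *\<^sub>R (k *\<^sub>R (f0 + s *\<^sub>R b))" using Pc[OF s] by (simp add: mult.commute)
    then have e: "b = k *\<^sub>R (f0 + s *\<^sub>R b)" using rho0[OF s] by (simp only: scaleR_cancel_left) simp
    have "(1 - k * s) *\<^sub>R b = k *\<^sub>R f0" using e by (simp add: algebra_simps)
    show False
    proof (cases "1 - k * s = 0")
      case True
      then have "k *\<^sub>R f0 = 0" using \<open>(1 - k * s) *\<^sub>R b = k *\<^sub>R f0\<close> by simp
      then have "k = 0" using f00 by simp
      then show False using True by simp
    next
      case False
      then have "b = (k / (1 - k * s)) *\<^sub>R f0"
        using \<open>(1 - k * s) *\<^sub>R b = k *\<^sub>R f0\<close>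
        by (metis (no_types, lifting) divide_inverse mult.commute right_inverse scaleR_one scaleR_scaleR)
      then show False using bn by blast
    qed
  qed
  have im: "immersed_path I \<gamma>" unfolding immersed_path_def using oI sc vel0 by blast
  have im0: "immersed_path I \<gamma>0"
    unfolding immersed_path_def
  proof (intro conjI ballI oI(1,2) sc0)
    fix s assume s: "s \<in> I"
    show "velocity \<gamma>0 s \<noteq> (\<lambda>f. 0)"
    proof
      assume "velocity \<gamma>0 s = (\<lambda>f. 0)"
      then have "dproj (f0 + s *\<^sub>R b) b = (\<lambda>f. 0)"
        unfolding \<gamma>0_def using smooth_curve_line(2)[where I = I and a = f0 and b = b, OF oI(1) line0 s] by simp
      then obtain k where e: "b = k *\<^sub>R (f0 + s *\<^sub>R b)" using dproj_eq_zeroD[OF line0] by blast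
      have k: "(1 - k * s) *\<^sub>R b = k *\<^sub>R f0" using e by (simp add: algebra_simps)
      show False
      proof (cases "1 - k * s = 0")
        case True
        then have "k *\<^sub>R f0 = 0" using k by simp
        then show False using True f00 by simp
      next
        case False
        then have "b = (k / (1 - k * s)) *\<^sub>R f0"
          using k by (metis (no_types, lifting) divide_inverse mult.commute right_inverse scaleR_one scaleR_scaleR)
        then show False using bn by blast
      qed
    qed
  qed
  have flat: "flat_contact_geodesic \<omega> I (\<lambda>s. \<phi> (\<gamma> s))"
    unfolding flat_contact_geodesic_def
  proof (intro conjI exI[of _ "span {f0, b}"] ballI)
    show "immersed_path I (\<lambda>s. \<phi> (\<gamma> s))" by (rule immersed_path_cong[OF im0]) (simp add: phig)
    have "b \<notin> span {f0}" using bn by (auto simp: span_singleton)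
    then have "dim {b, f0} = 2" using f00 by (simp add: dim_insert)
    then show "dim (span {f0, b}) = 2" by (simp add: insert_commute)
    show "subspace (span {f0, b})" by simp
    show "Om x y = 0" if "x \<in> span {f0, b}" "y \<in> span {f0, b}" for x y
    proof -
      have 1: "Om f0 y = 0 \<and> Om b y = 0"
      proof (rule span_induct[OF that(2)])
        show "subspace {y. Om f0 y = 0 \<and> Om b y = 0}"
          by (rule subspaceI) (auto simp: Om.add_right Om.scaleR_right Om.zero_right)
        show "Om f0 z = 0 \<and> Om b z = 0" if "z \<in> {f0, b}" for z
          using that Ofb Om_skew[of b f0] by auto
      qed
      show ?thesis
      proof (rule span_induct[OF that(1)])
        show "subspace {x. Om x y = 0}"
          by (rule subspaceI) (auto simp: Om.add_left Om.scaleR_left Om.zero_left)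
        show "Om z y = 0" if "z \<in> {f0, b}" for z using that 1 by auto
      qed
    qed
    fix s assume s: "s \<in> I"
    have "f0 + s *\<^sub>R b \<in> span {f0, b}" by (intro span_add span_scale span_base) auto
    then show "line_of (\<phi> (\<gamma> s)) \<subseteq> span {f0, b}"
      unfolding phig[OF s] \<gamma>0_def line_of_proj[OF line0] by (intro span_minimal) auto
  qed
  have hor: "velocity \<gamma> s \<in> contact_plane \<omega> (\<gamma> s)" if s: "s \<in> I" for s
  proof -
    have gW: "\<gamma> s \<in> W" using gV2 s by blast
    have "Om (\<Phi> (c s)) (fd \<Phi> (c s) (fd c s 1)) = 0"
      unfolding DPc2[OF s] Om.add_right Om.scaleR_right using Pc[OF s] Ofb
      by (simp add: Om.scaleR_left Om.add_left)
    then have "Om (c s) (fd c s 1) = 0" unfolding Phi_contact[OF cW[OF s]] by simp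
    then show ?thesis
      using contact_plane_eq[OF gW] vs(2,3)[OF s] by (simp add: c_def)
  qed
  have pb: "pullback_contact_geodesic \<omega> Dom \<phi> I \<gamma>"
    unfolding pullback_contact_geodesic_def using im gV2(1) VD hor flat by blast
  have g0: "\<gamma> 0 = p" unfolding \<gamma>_def g00 using inv p VD by blast
  have c0: "c 0 = u" unfolding c_def g0 u_def ..
  have r1: "\<rho> 0 = 1"
    using f00 by (simp add: \<rho>_def c0 f0_def[symmetric])
  have v0: "velocity \<gamma> 0 = v"
    unfolding vel[OF oI(3)] c0 r1 va by (simp add: b_def DPhi_inv_DPhi[OF uc])
  \<comment> \<open>A functional that vanishes on the direction \<open>b\<close> but not on
    \<open>f0\<close>. Divided by its value at \<open>f0\<close> and composed with \<Phi> it is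
    defined off the curve and equals the factor \<open>\<rho>\<close> on it, which extends the
    velocity formula \<open>vel\<close>.\<close>
  obtain d where d: "Om b d = 0" "Om d f0 \<noteq> 0"
    using ex_perp_Om_nonzero[of b f0] bn
  proof -
    have b0: "b \<noteq> 0" using bn[of 0] by simp
    have "f0 \<noteq> k *\<^sub>R b" for k
    proof
      assume h: "f0 = k *\<^sub>R b"
      then have "k \<noteq> 0" using f00 by auto
      then have "b = (1 / k) *\<^sub>R f0" using h by simp
      then show False using bn by blast
    qed
    then show ?thesis using ex_perp_Om_nonzero[OF b0] that by blast
  qed
  define X where "X = (\<lambda>q. dproj (\<sigma> q) (DPhi_inv (\<sigma> q) ((Om (\<Phi> (\<sigma> q)) d / Om f0 d) *\<^sub>R b)))"
  have f0d: "Om f0 d \<noteq> 0" using d(2) Om_skew[of f0 d] by simp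
  have "smooth_on (cone W) (\<lambda>z. (Om (\<Phi> z) d / Om f0 d) *\<^sub>R b)"
    by (intro smooth_on_scaleR smooth_on_divide smooth_on_bilinear[OF bounded_bilinear_Om] smooth_on_const open_C Phi_smooth)
      (use f0d in simp)
  then have "smooth_on (cone W) (\<lambda>z. DPhi_inv z ((Om (\<Phi> z) d / Om f0 d) *\<^sub>R b))" by (rule smooth_DPhi_inv)
  then have "smooth_fun V (\<lambda>q. DPhi_inv (\<sigma> q) ((Om (\<Phi> (\<sigma> q)) d / Om f0 d) *\<^sub>R b))"
    by (rule smooth_fun_compose[OF _ open_C V(1) sec_smooth_on[OF V]]) (use V sec_cone in blast)
  then have Xv: "vector_field V X" unfolding X_def by (rule vector_field_dproj[OF V])
  have Xg: "X (\<gamma> s) = velocity \<gamma> s" if s: "s \<in> I" for s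
  proof -
    have "Om (\<Phi> (c s)) d = \<rho> s * Om f0 d"
      unfolding Pc[OF s] by (simp add: Om.scaleR_left Om.add_left d(1))
    then show ?thesis unfolding X_def vel[OF s] c_def using f0d by simp
  qed
  show ?thesis
    using pb gV2(1) oI(3) g0 v0 V(1) Xv gV Xg by blast
qed

end

subsection \<open>Local square roots and local lifts\<close>

lemma proj_section_restrict: "proj_section W \<sigma> \<Longrightarrow> open V \<Longrightarrow> V \<subseteq> W \<Longrightarrow> proj_section V \<sigma>"
  unfolding proj_section_def by (auto intro: smooth_fun_subset)

lemma root_section_restrict:
  assumes "root_section \<omega> W \<sigma> s \<theta>" "open V" "V \<subseteq> W" shows "root_section \<omega> V \<sigma> s \<theta>"
  using assms(1) proj_section_restrict[OF _ assms(2,3)] assms(3)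
  unfolding root_section_def root_section_axioms_def by blast

lemma contact_lift_restrict:
  assumes "contact_lift \<omega> U \<Phi> \<epsilon> Dom Ran \<phi>" "open V" "V \<subseteq> U" shows "contact_lift \<omega> V \<Phi> \<epsilon> Dom Ran \<phi>"
proof -
  interpret contact_lift \<omega> U \<Phi> \<epsilon> Dom Ran \<phi> by (rule assms(1))
  have c: "u \<in> cone U" if "u \<in> cone V" for u using that cone_mono[OF assms(3)] by blast
  show ?thesis
  proof (intro contact_lift.intro symp_lift.intro symp_axioms symp_lift_axioms.intro contact_lift_axioms.intro)
    show "open V" by (rule assms(2))
    show "smooth_on (cone V) \<Phi>"
      by (rule smooth_on_subset[OF Phi_smooth open_C open_cone[OF assms(2)] cone_mono[OF assms(3)]])
    show "\<epsilon> = 1 \<or> \<epsilon> = - 1" by (rule eps)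
    show "contactomorphism \<omega> Dom Ran \<phi>" by (rule contacto)
    show "V \<subseteq> Dom" using assms(3) U_Dom by (rule order_trans)
    fix u assume "u \<in> cone V"
    then have u: "u \<in> cone U" by (rule c)
    show "\<Phi> (r *\<^sub>R u) = r *\<^sub>R \<Phi> u" if "r \<noteq> 0" for r by (rule Phi_hom[OF u that])
    show "Omega \<omega> (\<Phi> u) (fd \<Phi> u w) = \<epsilon> * Omega \<omega> u w" for w by (rule Phi_contact[OF u])
    show "proj (\<Phi> u) = \<phi> (proj u)" by (rule lift[OF u])
  qed
qed

lemma affine_connection_restrict:
  assumes A: "affine_connection V n" and V': "V' \<subseteq> V" shows "affine_connection V' n"
  unfolding affine_connection_def
  by (rule allI, rule impI, rule A[unfolded affine_connection_def, THEN spec, THEN mp]) (use V' in auto)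

lemma unparam_geodesic_restrict:
  assumes "unparam_geodesic V n I \<gamma>" "V' \<subseteq> V" "\<gamma> ` I \<subseteq> V'" shows "unparam_geodesic V' n I \<gamma>"
  unfolding unparam_geodesic_def
proof (intro conjI ballI allI impI)
  show "immersed_path I \<gamma>" "\<gamma> ` I \<subseteq> V'" using assms unfolding unparam_geodesic_def by blast+
  fix t W X J assume "t \<in> I" "open W \<and> W \<subseteq> V' \<and> vector_field W X \<and> open J \<and> t \<in> J \<and> J \<subseteq> I \<and>
        (\<forall>s\<in>J. \<gamma> s \<in> W \<and> X (\<gamma> s) = velocity \<gamma> s)"
  then show "\<exists>c. n (\<gamma> t) (velocity \<gamma> t) X = (\<lambda>f. c * velocity \<gamma> t f)"
    using assms(1)[unfolded unparam_geodesic_def, THEN conjunct2, THEN conjunct2, rule_format, of t W X J] assms(2) by auto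
qed

lemma representative_restrict:
  assumes R: "representative V \<G> \<theta> m" and V': "V' \<subseteq> V" shows "representative V' \<G> \<theta> m"
proof -
  note A = R[unfolded representative_def]
  show ?thesis
    unfolding representative_def
  proof (intro conjI allI impI ballI)
    show "affine_connection V' m" by (rule affine_connection_restrict[OF rep_conn[OF R] V'])
    show "unparam_geodesic V' m I \<gamma>" if "\<G> I \<gamma> \<and> \<gamma> ` I \<subseteq> V'" for I \<gamma>
      by (rule unparam_geodesic_restrict[OF rep_geodesic[OF R] V']) (use that V' in auto)
  next
    fix W X Y p assume "open W \<and> W \<subseteq> V' \<and> vector_field W X \<and> vector_field W Y" "p \<in> W"
    then show "X p (\<lambda>q. \<theta> q (Y q)) - \<theta> p (cov m X Y p) = 0"
      using rep_theta[OF R, of W X Y p] V' by auto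
  next
    fix W X Y Z p assume "open W \<and> W \<subseteq> V' \<and> vector_field W X \<and> vector_field W Y \<and> vector_field W Z" "p \<in> W"
    then show "X p (ext_deriv \<theta> Y Z) - ext_deriv \<theta> (cov m X Y) Z p - ext_deriv \<theta> Y (cov m X Z) p = 0"
      using rep_dtheta[OF R, of W X Y Z p] V' by auto
  next
    fix W ch E p i assume h: "open W \<and> W \<subseteq> V' \<and> adapted_coframe W \<theta> ch E" "p \<in> W"
    then have "open W \<and> W \<subseteq> V \<and> adapted_coframe W \<theta> ch E" using V' by auto
    note T = A[THEN conjunct2, THEN conjunct2, THEN conjunct2, THEN conjunct2, THEN spec, of W, THEN spec, of ch, THEN spec, of E,
        THEN mp, OF this, THEN bspec, OF h(2), THEN spec, of i]
    show "ch \<alpha> p (torsion m (E None) (E (Some i)) p) = 0" "ch \<alpha> p (torsion m (E (Some i)) (E None) p) = 0" for \<alpha>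
      using T by blast+
    show "(\<Sum>k\<in>UNIV. ch (Some k) p (torsion m (E (Some i)) (E (Some k)) p)) = 0"
      "(\<Sum>k\<in>UNIV. ch (Some k) p (torsion m (E (Some k)) (E (Some i)) p)) = 0"
      using T by blast+
  qed
qed

lemma open_smooth_pos:
  fixes f :: "'k::finite projspace \<Rightarrow> real"
  assumes "open V" "smooth_fun V f" shows "open {q \<in> V. f q > 0}"
proof -
  have "cone {q \<in> V. f q > 0} = cone V \<inter> (\<lambda>u. f (proj u)) -` {0<..}"
    by (auto simp: mem_cone)
  moreover have "open (cone V \<inter> (\<lambda>u. f (proj u)) -` {0<..})"
    by (rule continuous_open_preimage[OF smooth_on_imp_continuous_on open_cone[OF assms(1)]])
      (use assms(2) in \<open>auto simp: smooth_fun_def\<close>)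
  ultimately show ?thesis unfolding open_projspace_def by simp
qed

lemma smooth_fun_sqrt:
  fixes f :: "'k::finite projspace \<Rightarrow> real"
  assumes "open V" "smooth_fun V f" "\<And>q. q \<in> V \<Longrightarrow> f q > 0" shows "smooth_fun V (\<lambda>q. sqrt (f q))"
  using assms(2) unfolding smooth_fun_def
  by (rule smooth_on_real_sqrt[OF open_cone[OF assms(1)]]) (simp add: assms(3) mem_cone)

context symp
begin

lemma ex_normalized_section:
  "\<exists>W \<sigma> \<tau>. p \<in> W \<and> proj_section W \<sigma> \<and> (\<forall>q\<in>W. Om (\<sigma> q) \<tau> = 1)"
proof -
  obtain u where u: "u \<noteq> 0" "proj u = p" using proj_surj by blast
  obtain \<tau> where t: "Om u \<tau> = 1" using ex_Om_1[OF u(1)] by blast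
  have l: "linear (\<lambda>z. Om z \<tau>)" by (intro linearI) (simp_all add: Om.add_left Om.scaleR_left)
  define W where "W = proj ` {u. Om u \<tau> \<noteq> 0}"
  define \<sigma> where "\<sigma> = descend (\<lambda>u. (1 / Om u \<tau>) *\<^sub>R u)"
  note L = linear_functional_section[OF l, folded W_def \<sigma>_def]
  interpret proj_section W \<sigma> by (rule L(1))
  have "Om (\<sigma> q) \<tau> = 1" if q: "q \<in> W" for q
  proof -
    have "\<sigma> q \<in> cone W" by (rule sec_cone[OF q q])
    then have n: "Om (\<sigma> q) \<tau> \<noteq> 0" using L(2) by blast
    from L(3)[OF n] have "\<sigma> q = (1 / Om (\<sigma> q) \<tau>) *\<^sub>R \<sigma> q" unfolding proj_sec[OF q] .
    from arg_cong[OF this, of "\<lambda>z. Om z \<tau>"] show ?thesis using n by (simp add: Om.scaleR_left)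
  qed
  moreover have "p \<in> W" unfolding W_def using u t by force
  ultimately show ?thesis using proj_section_axioms by blast
qed

lemma ex_root_section: "\<exists>W \<sigma> \<theta>. p \<in> W \<and> root_section \<omega> W \<sigma> 1 \<theta>"
proof -
  obtain W \<sigma> \<tau> where "p \<in> W" and s: "proj_section W \<sigma>" using ex_normalized_section by blast
  moreover have "root_section \<omega> W \<sigma> 1 (\<lambda>q v. 1 / 2 * Om (\<sigma> q) (dv v \<sigma>))"
    by (intro root_section.intro symp_axioms s root_section_axioms.intro) simp_all
  ultimately show ?thesis by blast
qed

text \<open>For any section \<open>\<sigma>0\<close>, the form \<theta> is a nonvanishing function
  \<open>k\<close> times the pullback of \<Omega>(u, du), because both have the contact planes as
  kernels. Rescaling the section by \<open>h\<close> multiplies the pullback by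
  \<open>h * h\<close>, so \<open>h\<close> is the square root of twice the absolute value of
  \<open>k\<close>.\<close>

lemma local_root:
  assumes V: "open V" and th: "contact_form \<omega> V \<theta>" and p: "p \<in> V"
  shows "\<exists>W \<sigma> s. p \<in> W \<and> W \<subseteq> V \<and> root_section \<omega> W \<sigma> s \<theta>"
proof -
  obtain W0 \<sigma>0 \<tau> where W0: "p \<in> W0" "proj_section W0 \<sigma>0" "\<forall>q\<in>W0. Om (\<sigma>0 q) \<tau> = 1"
    using ex_normalized_section by blast
  define W1 where "W1 = W0 \<inter> V"
  have o1: "open W1" unfolding W1_def using W0(2) V unfolding proj_section_def by blast
  interpret proj_section W1 \<sigma>0
    by (rule proj_section_restrict[OF W0(2) o1]) (simp add: W1_def)
  have W1V: "W1 \<subseteq> V" unfolding W1_def by blast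
  have tau: "Om (\<sigma>0 q) \<tau> = 1" if "q \<in> W1" for q using that W0(3) unfolding W1_def by blast
  have of: "one_form V \<theta>" using th unfolding contact_form_def by blast
  have ker: "{v \<in> tangent q. \<theta> q v = 0} = contact_plane \<omega> q" if "q \<in> V" for q
    using th that unfolding contact_form_def by blast
  define k where "k = (\<lambda>q. \<theta> q (dproj (\<sigma>0 q) \<tau>))"
  have sk: "smooth_fun W1 k"
  proof -
    have "vector_field W1 (\<lambda>q. dproj (\<sigma>0 q) \<tau>)"
      by (rule vector_field_dproj[OF o1 order_refl smooth_fun_const[OF o1]])
    then show ?thesis using of o1 W1V unfolding one_form_def k_def by blast
  qed
  have tk: "\<theta> q v = k q * Om (\<sigma>0 q) (dv v \<sigma>0)" if q: "q \<in> W1" and v: "v \<in> tangent q" for q v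
  proof -
    have qV: "q \<in> V" using q W1V by blast
    note s0 = sec_nonzero[OF q]
    have "\<theta> q (dproj (\<sigma>0 q) w) = \<theta> q (dproj (\<sigma>0 q) \<tau>) * Om (\<sigma>0 q) w" for w
    proof (rule functional_on_perp[OF tau[OF q]])
      show "linear (\<lambda>w. \<theta> q (dproj (\<sigma>0 q) w))"
      proof (rule linearI)
        show "\<theta> q (dproj (\<sigma>0 q) (a + b)) = \<theta> q (dproj (\<sigma>0 q) a) + \<theta> q (dproj (\<sigma>0 q) b)" for a b
          using one_form_linear[OF of qV dproj_tangent[OF q] dproj_tangent[OF q], of 1 a 1 b]
          by (simp add: dproj_add[OF s0])
        show "\<theta> q (dproj (\<sigma>0 q) (r *\<^sub>R b)) = r *\<^sub>R \<theta> q (dproj (\<sigma>0 q) b)" for r b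
          using one_form_cmul[OF of qV dproj_tangent[OF q]] by (simp add: dproj_cmul[OF s0])
      qed
      fix w assume "Om (\<sigma>0 q) w = 0"
      then have "dproj (\<sigma>0 q) w \<in> contact_plane \<omega> (proj (\<sigma>0 q))"
        unfolding contact_plane_proj[OF s0 Om_self] by blast
      then show "\<theta> q (dproj (\<sigma>0 q) w) = 0" using ker[OF qV] proj_sec[OF q] by auto
    qed
    from this[of "dv v \<sigma>0"] show ?thesis unfolding dproj_dv[OF q v] k_def .
  qed
  have k0: "k q \<noteq> 0" if q: "q \<in> W1" for q
  proof
    assume "k q = 0"
    then have "dproj (\<sigma>0 q) \<tau> \<in> contact_plane \<omega> (proj (\<sigma>0 q))"
      using ker[of q] q W1V dproj_tangent[OF q] proj_sec[OF q] unfolding k_def by auto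
    then obtain w where w: "dproj (\<sigma>0 q) \<tau> = dproj (\<sigma>0 q) w" "Om (\<sigma>0 q) w = 0"
      unfolding contact_plane_proj[OF sec_nonzero[OF q] Om_self] by blast
    then obtain c where "w = \<tau> + c *\<^sub>R \<sigma>0 q" using dproj_eqD[OF sec_nonzero[OF q]] by blast
    then show False using w(2) tau[OF q] by (simp add: Om.add_right Om.scaleR_right)
  qed
  have p1: "p \<in> W1" unfolding W1_def using W0 p by blast
  \<comment> \<open>The sign of \<open>k\<close> at \<open>p\<close>; the neighbourhood is then cut
    down to where \<open>k\<close> keeps it.\<close>
  define s where "s = sgn (k p)"
  have s1: "s = 1 \<or> s = -1" unfolding s_def using k0[OF p1] by (auto simp: sgn_real_def)
  have ss: "smooth_fun W1 (\<lambda>q. s * k q)" by (rule smooth_fun_mult[OF o1 smooth_fun_const[OF o1] sk])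
  define W where "W = {q \<in> W1. s * k q > 0}"
  have oW: "open W" unfolding W_def by (rule open_smooth_pos[OF o1 ss])
  have WW1: "W \<subseteq> W1" unfolding W_def by blast
  have pos: "s * k q > 0" if "q \<in> W" for q using that unfolding W_def by blast
  have pW: "p \<in> W" unfolding W_def s_def using p1 k0[OF p1] by (auto simp: sgn_real_def)
  define h where "h = (\<lambda>q. sqrt (2 * (s * k q)))"
  have hs: "smooth_fun W h"
    unfolding h_def
    by (rule smooth_fun_sqrt[OF oW smooth_fun_mult[OF oW smooth_fun_const[OF oW] smooth_fun_subset[OF ss o1 oW WW1]]])
      (use pos in simp)
  have h2: "h q * h q = 2 * (s * k q)" "h q \<noteq> 0" if "q \<in> W" for q
  proof -
    have "s * k q > 0" by (rule pos[OF that])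
    then have "h q > 0" "h q * h q = 2 * (s * k q)" unfolding h_def by simp_all
    then show "h q * h q = 2 * (s * k q)" "h q \<noteq> 0" by simp_all
  qed
  have s0W: "smooth_fun W \<sigma>0" by (rule smooth_fun_subset[OF sec_smooth o1 oW WW1])
  have "root_section \<omega> W (\<lambda>q. h q *\<^sub>R \<sigma>0 q) s \<theta>"
  proof (intro root_section.intro symp_axioms root_section_axioms.intro proj_section.intro oW s1
      smooth_fun_scaleR[OF oW hs s0W])
    fix q assume q: "q \<in> W"
    then have q1: "q \<in> W1" using WW1 by blast
    show "h q *\<^sub>R \<sigma>0 q \<noteq> 0" using h2(2)[OF q] sec_nonzero[OF q1] by simp
    show "proj (h q *\<^sub>R \<sigma>0 q) = q" unfolding proj_scale[OF h2(2)[OF q]] by (rule proj_sec[OF q1])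
    fix v assume v: "v \<in> tangent q"
    have "dv v (\<lambda>q. h q *\<^sub>R \<sigma>0 q) = h q *\<^sub>R dv v \<sigma>0 + v h *\<^sub>R \<sigma>0 q"
      by (rule dv_scaleR_fun[OF v q oW hs s0W])
    then have "Om (h q *\<^sub>R \<sigma>0 q) (dv v (\<lambda>q. h q *\<^sub>R \<sigma>0 q)) = (h q * h q) * Om (\<sigma>0 q) (dv v \<sigma>0)"
      by (simp add: Om.add_right Om.scaleR_right Om.scaleR_left)
    then show "\<theta> q v = s / 2 * Om (h q *\<^sub>R \<sigma>0 q) (dv v (\<lambda>q. h q *\<^sub>R \<sigma>0 q))"
      unfolding h2(1)[OF q] tk[OF q1 v] using s1 by auto
  qed
  then show ?thesis using pW WW1 W1V by blast
qed

text \<open>Normalizing one coordinate to 1 gives a lift \<open>g\<close> of degree zero. Since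
  \<phi> preserves the contact planes, \<open>g\<close> pulls \<Omega>(u, du) back to a nonvanishing
  multiple of itself, and a factor \<open>h\<close> of degree one reduces the multiple to a
  sign.\<close>

lemma local_lift:
  assumes C: "contactomorphism \<omega> Dom Ran \<phi>" and p: "p \<in> Dom"
  shows "\<exists>W \<Phi> \<epsilon>. p \<in> W \<and> contact_lift \<omega> W \<Phi> \<epsilon> Dom Ran \<phi>"
proof -
  define \<psi> where "\<psi> = inv_into Dom \<phi>"
  have c: "open Dom" "open Ran" "bij_betw \<phi> Dom Ran" "smooth_map Dom \<phi>" "smooth_map Ran \<psi>"
    "\<And>q. q \<in> Dom \<Longrightarrow> pushforward \<phi> q ` contact_plane \<omega> q = contact_plane \<omega> (\<phi> q)"
    using C unfolding contactomorphism_def \<psi>_def by blast+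
  have phiR: "\<phi> q \<in> Ran" if "q \<in> Dom" for q using that c(3) by (auto simp: bij_betw_def)
  have inv: "\<psi> (\<phi> q) = q" if "q \<in> Dom" for q
    using that c(3) unfolding \<psi>_def by (simp add: bij_betw_def)
  have cont: "continuous_on Dom \<phi>" using c(4) unfolding smooth_map_def by blast
  have pull: "smooth_fun (Dom \<inter> \<phi> -` W) (\<lambda>q. f (\<phi> q))" if "open W" "smooth_fun W f" for W and f :: "'m ix projspace \<Rightarrow> real"
    using c(4) that unfolding smooth_map_def by blast
  have opull: "open (Dom \<inter> \<phi> -` W)" if "open W" for W
    by (rule continuous_open_preimage[OF cont c(1) that])
  obtain y0 where y0: "y0 \<noteq> 0" "proj y0 = \<phi> p" using proj_surj by blast
  then obtain k where k: "y0 $ k \<noteq> 0" by (metis vec_eq_iff zero_index)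
  define W1 where "W1 = Dom \<inter> \<phi> -` chart k"
  have o1: "open W1" unfolding W1_def by (rule opull[OF open_chart])
  have p1: "p \<in> W1" unfolding W1_def chart_def using p k y0(2)[symmetric] by auto
  define g where "g = (\<lambda>u. \<chi> i. chart_coord k i (\<phi> (proj u)))"
  have sg: "smooth_on (cone W1) g"
    unfolding smooth_on_vec_iff[OF open_cone[OF o1]] g_def
    using pull[OF open_chart smooth_chart_coord] unfolding smooth_fun_def W1_def by simp
  have oC: "open (cone W1)" by (rule open_cone[OF o1])
  have pg: "proj (g u) = \<phi> (proj u)" "g u \<noteq> 0" if u: "u \<in> cone W1" for u
  proof -
    have "\<phi> (proj u) \<in> chart k" using u by (simp add: mem_cone W1_def)
    then obtain y where y: "\<phi> (proj u) = proj y" "y $ k \<noteq> 0" unfolding chart_def by blast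
    have gy: "g u = (1 / y $ k) *\<^sub>R y" unfolding g_def y(1) by (simp add: chart_coord_proj[OF y(2)] vec_eq_iff)
    show "proj (g u) = \<phi> (proj u)" unfolding gy y(1) by (rule proj_scale) (use y(2) in simp)
    show "g u \<noteq> 0" unfolding gy using y(2) by auto
  qed
  have gr: "g (r *\<^sub>R u) = g u" if "r \<noteq> 0" for r u unfolding g_def by (simp add: proj_scale[OF that])
  have Dgr: "r *\<^sub>R fd g (r *\<^sub>R u) w = fd g u w" if "r \<noteq> 0" "u \<in> cone W1" for r u w
    using fd_scaled[OF oC scale_in_cone sg, of r 1 u w] gr that by simp
  have pf: "pushforward \<phi> (proj u) (dproj u w) = dproj (g u) (fd g u w)" if u: "u \<in> cone W1" for u w
  proof
    fix f
    have e: "proj (g u) = \<phi> (proj u)" by (rule pg(1)[OF u])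
    show "pushforward \<phi> (proj u) (dproj u w) f = dproj (g u) (fd g u w) f"
    proof (cases "smooth_at (\<phi> (proj u)) f")
      case True
      then obtain V where V: "open V" "\<phi> (proj u) \<in> V" "smooth_fun V f" unfolding smooth_at_def by blast
      have "u \<in> cone (Dom \<inter> \<phi> -` V)" using u V by (simp add: mem_cone W1_def)
      from dproj_apply[OF pull[OF V(1,3)] opull[OF V(1)] this]
      have "dproj u w (\<lambda>q. f (\<phi> q)) = fd (\<lambda>z. f (\<phi> (proj z))) u w" .
      also have "fd (\<lambda>z. f (\<phi> (proj z))) u = fd (\<lambda>z. f (proj (g z))) u"
        by (rule fd_open_cong[OF oC u]) (simp add: pg(1))
      also have "fd (\<lambda>z. f (proj (g z))) u w = fd (\<lambda>z. f (proj z)) (g u) (fd g u w)"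
        by (rule fd_compose[OF smooth_on_differentiable[OF sg oC u] differentiableI[OF smooth_at_has_derivative]])
          (use True e pg(2)[OF u] in simp_all)
      finally show ?thesis using True by (simp add: pushforward_def dproj_def e)
    qed (simp add: pushforward_def dproj_def e)
  qed
  have perp: "Om (g u) (fd g u w) = 0" if u: "u \<in> cone W1" and w: "Om u w = 0" for u w
  proof -
    have u0: "u \<noteq> 0" and uD: "proj u \<in> Dom" using u by (auto simp: mem_cone W1_def)
    have "dproj u w \<in> contact_plane \<omega> (proj u)" unfolding contact_plane_proj[OF u0 Om_self] using w by blast
    then have "dproj (g u) (fd g u w) \<in> contact_plane \<omega> (proj (g u))"
      unfolding pf[OF u, symmetric] pg(1)[OF u] using c(6)[OF uD] by blast
    then obtain w' where w': "dproj (g u) (fd g u w) = dproj (g u) w'" "Om (g u) w' = 0"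
      unfolding contact_plane_proj[OF pg(2)[OF u] Om_self] by blast
    then obtain d where "w' = fd g u w + d *\<^sub>R g u" using dproj_eqD[OF pg(2)[OF u]] by blast
    then show ?thesis using w'(2) by (simp add: Om.add_right Om.scaleR_right)
  qed
  \<comment> \<open>The smooth inverse makes the pushforward injective. Hence a vector outside the
    contact plane cannot be pushed into the contact plane, which is \<open>nz\<close> below.\<close>
  have inj: "v = v'" if v: "v \<in> tangent q" "v' \<in> tangent q" and q: "q \<in> Dom"
    and e: "pushforward \<phi> q v = pushforward \<phi> q v'" for q v v'
  proof
    fix f
    show "v f = v' f"
    proof (cases "smooth_at q f")
      case True
      then obtain V where V: "open V" "q \<in> V" "smooth_fun V f" unfolding smooth_at_def by blast
      have sm: "smooth_fun (Ran \<inter> \<psi> -` V) (\<lambda>q. f (\<psi> q))" using c(5) V unfolding smooth_map_def by blast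
      have o: "open (Ran \<inter> \<psi> -` V)"
        using c(2,5) V(1) unfolding smooth_map_def by (intro continuous_open_preimage) blast+
      have sa: "smooth_at (\<phi> q) (\<lambda>q. f (\<psi> q))"
        by (rule smooth_fun_imp_smooth_at[OF sm o]) (use q V phiR inv in auto)
      have "v f = pushforward \<phi> q v (\<lambda>q. f (\<psi> q))" if "v \<in> tangent q" for v
        using sa fun_tvec_cong[OF that c(1) q, of f "\<lambda>q. f (\<psi> (\<phi> q))"] inv by (simp add: pushforward_def)
      then show ?thesis using v e by metis
    next
      case False
      obtain u w w' where "u \<noteq> 0" "q = proj u" "v = dproj u w" "v' = dproj u w'"
        using proj_surj[of q] v tangent_proj by (metis rangeE)
      then show ?thesis using False by (simp add: dproj_def)
    qed
  qed
  have nz: "Om (g u) (fd g u w) \<noteq> 0" if u: "u \<in> cone W1" and w: "Om u w \<noteq> 0" for u w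
  proof
    assume h: "Om (g u) (fd g u w) = 0"
    have u0: "u \<noteq> 0" and uD: "proj u \<in> Dom" using u by (auto simp: mem_cone W1_def)
    have "dproj (g u) (fd g u w) \<in> contact_plane \<omega> (proj (g u))"
      unfolding contact_plane_proj[OF pg(2)[OF u] Om_self] using h by blast
    then have "pushforward \<phi> (proj u) (dproj u w) \<in> pushforward \<phi> (proj u) ` contact_plane \<omega> (proj u)"
      unfolding pf[OF u] pg(1)[OF u] c(6)[OF uD] .
    then obtain w' where w': "pushforward \<phi> (proj u) (dproj u w) = pushforward \<phi> (proj u) (dproj u w')" "Om u w' = 0"
      unfolding contact_plane_proj[OF u0 Om_self] by blast
    have "dproj u w = dproj u w'"
      by (rule inj[OF _ _ uD w'(1)]) (use tangent_proj[OF u0] in blast)+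
    then obtain d where "w' = w + d *\<^sub>R u" using dproj_eqD[OF u0] by blast
    then show False using w w'(2) by (simp add: Om.add_right Om.scaleR_right)
  qed
  obtain u0 where u0: "u0 \<noteq> 0" "proj u0 = p" using proj_surj by blast
  obtain \<tau> where tau: "Om u0 \<tau> = 1" using ex_Om_1[OF u0(1)] by blast
  \<comment> \<open>The second factor \<open>Om u \<tau>\<close> makes \<open>m\<close> invariant
    under scaling of \<open>u\<close>, so its sign is a condition on points of projective
    space.\<close>
  define m where "m = (\<lambda>u. Om (g u) (fd g u \<tau>) * Om u \<tau>)"
  have lt: "smooth_on (cone W1) (\<lambda>u. Om u \<tau>)"
    by (rule smooth_on_bounded_linear[OF Om.bounded_linear_left oC smooth_on_ident[OF oC]])
  have sm: "smooth_on (cone W1) m"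
    unfolding m_def
    by (rule smooth_on_mult[OF oC smooth_on_bilinear[OF bounded_bilinear_Om oC sg smooth_on_fd[OF sg]] lt])
  have mr: "m (r *\<^sub>R u) = m u" if "r \<noteq> 0" "u \<in> cone W1" for r u
    unfolding m_def gr[OF that(1)] Dgr[OF that, of \<tau>, symmetric] by (simp add: Om.scaleR_left Om.scaleR_right)
  have u0c: "u0 \<in> cone W1" using u0 p1 by (simp add: mem_cone)
  have m0: "m u0 \<noteq> 0" unfolding m_def using nz[OF u0c, of \<tau>] tau by simp
  define s where "s = sgn (m u0)"
  have s1: "s = 1 \<or> s = -1" unfolding s_def using m0 by (auto simp: sgn_real_def)
  define W where "W = proj ` {u. u \<in> cone W1 \<and> s * m u > 0}"
  have sm': "smooth_on (cone W1) (\<lambda>u. s * m u)" by (rule smooth_on_mult[OF oC smooth_on_const[OF oC] sm])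
  have oset: "open {u. u \<in> cone W1 \<and> s * m u > 0}"
  proof -
    have "{u. u \<in> cone W1 \<and> s * m u > 0} = cone W1 \<inter> (\<lambda>u. s * m u) -` {0<..}" by auto
    then show ?thesis
      using continuous_open_preimage[OF smooth_on_imp_continuous_on[OF sm'] oC, of "{0<..}"] by simp
  qed
  have z0: "\<not> (0 \<in> cone W1 \<and> s * m 0 > 0)" by (simp add: mem_cone)
  have scl: "r *\<^sub>R u \<in> cone W1 \<and> s * m (r *\<^sub>R u) > 0" if "r \<noteq> 0" "u \<in> cone W1 \<and> s * m u > 0" for u r
    using that scale_in_cone[of u W1 r] mr[of r u] by simp
  note OP = open_proj_Collect[where P = "\<lambda>u. u \<in> cone W1 \<and> s * m u > 0", OF oset z0 scl, folded W_def]
  note oW = OP(1) and cW = OP(2)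
  have pW: "p \<in> W"
    unfolding W_def using u0 u0c m0 by (intro image_eqI[of _ _ u0]) (auto simp: s_def sgn_real_def)
  \<comment> \<open>Chosen so that \<open>h u * h u\<close> times
    \<open>Om (g u) (fd g u \<tau>) / Om u \<tau>\<close>, the multiple to be normalized, is the
    sign \<open>s\<close>.\<close>
  define h where "h = (\<lambda>u. Om u \<tau> / sqrt (s * m u))"
  have oCW: "open (cone W)" by (rule open_cone[OF oW])
  have CW1: "cone W \<subseteq> cone W1" using cW by blast
  have hs: "smooth_on (cone W) h"
    unfolding h_def
    by (intro smooth_on_divide smooth_on_real_sqrt oCW smooth_on_subset[OF lt oC oCW CW1] smooth_on_subset[OF sm' oC oCW CW1])
      (use cW in auto)
  have gW: "smooth_on (cone W) g" by (rule smooth_on_subset[OF sg oC oCW CW1])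
  define \<Phi> where "\<Phi> = (\<lambda>u. h u *\<^sub>R g u)"
  have h0: "h u \<noteq> 0" if "u \<in> cone W" for u
    using that cW[of u] unfolding h_def m_def by auto
  have "contact_lift \<omega> W \<Phi> s Dom Ran \<phi>"
  proof (intro contact_lift.intro symp_lift.intro symp_axioms symp_lift_axioms.intro contact_lift_axioms.intro oW C s1)
    show "smooth_on (cone W) \<Phi>" unfolding \<Phi>_def by (rule smooth_on_scaleR[OF oCW hs gW])
    show "W \<subseteq> Dom" unfolding W_def by (auto simp: mem_cone W1_def)
    fix u assume u: "u \<in> cone W"
    then have u1: "u \<in> cone W1" and pos: "s * m u > 0" using cW by blast+
    show "\<Phi> (r *\<^sub>R u) = r *\<^sub>R \<Phi> u" if "r \<noteq> 0" for r
      unfolding \<Phi>_def h_def gr[OF that] mr[OF that u1] by (simp add: Om.scaleR_left)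
    show "proj (\<Phi> u) = \<phi> (proj u)"
      unfolding \<Phi>_def proj_scale[OF h0[OF u]] by (rule pg(1)[OF u1])
    fix w
    have "fd \<Phi> u w = h u *\<^sub>R fd g u w + fd h u w *\<^sub>R g u"
      unfolding \<Phi>_def
      by (rule fd_bilinear[OF bounded_bilinear_scaleR smooth_on_differentiable[OF hs oCW u] smooth_on_differentiable[OF gW oCW u]])
    then have e1: "Om (\<Phi> u) (fd \<Phi> u w) = (h u * h u) * Om (g u) (fd g u w)"
      unfolding \<Phi>_def by (simp add: Om.add_right Om.scaleR_right Om.scaleR_left)
    have tn: "Om u \<tau> \<noteq> 0" using pos unfolding m_def by auto
    have e2: "Om (g u) (fd g u w) = Om (g u) (fd g u \<tau>) / Om u \<tau> * Om u w"
    proof -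
      have lin: "linear (\<lambda>w. Om (g u) (fd g u w))"
        by (intro linearI) (simp_all add: linear_add[OF linear_fd[OF sg oC u1]] linear_cmul[OF linear_fd[OF sg oC u1]]
            Om.add_right Om.scaleR_right)
      have "Om u ((1 / Om u \<tau>) *\<^sub>R \<tau>) = 1" using tn by (simp add: Om.scaleR_right)
      from functional_on_perp[OF this lin perp[OF u1], of w] show ?thesis
        by (simp add: linear_cmul[OF linear_fd[OF sg oC u1]] Om.scaleR_right)
    qed
    have "h u * h u = Om u \<tau> * Om u \<tau> / (s * m u)"
      unfolding h_def using pos by (simp add: real_sqrt_mult[symmetric])
    then have "Om (\<Phi> u) (fd \<Phi> u w) = Om u \<tau> * Om u \<tau> / (s * m u) * (Om (g u) (fd g u \<tau>) / Om u \<tau> * Om u w)"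
      unfolding e1 e2 by simp
    also have "\<dots> = (m u / (s * m u)) * Om u w"
      using tn by (simp add: m_def)
    also have "\<dots> = s * Om u w" using s1 pos by auto
    finally show "Om (\<Phi> u) (fd \<Phi> u w) = s * Om u w" .
  qed
  then show ?thesis using pW by blast
qed

lemma symp_lift_id: assumes "open U" shows "symp_lift \<omega> U (\<lambda>u. u) 1"
proof (intro symp_lift.intro symp_axioms symp_lift_axioms.intro assms smooth_on_ident open_cone)
  have "fd (\<lambda>u. u) u = (\<lambda>w. w)" for u :: "real ^ 'm ix" by (rule fd_eq[OF has_derivative_ident])
  then show "Om u (fd (\<lambda>u. u) u w) = 1 * Om u w" for u w by simp
qed simp_all

lemma B_id: assumes "open U" "u \<in> cone U" shows "symp_lift.B \<omega> (\<lambda>u. u) 1 u a b = 0"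
proof -
  interpret symp_lift \<omega> U "\<lambda>u. u" 1 by (rule symp_lift_id[OF assms(1)])
  have "fd (\<lambda>u. u) u = (\<lambda>w. w)" for u :: "real ^ 'm ix" by (rule fd_eq[OF has_derivative_ident])
  then have "D2 u a b = 0" by (simp add: D2_def frechet_derivative_const)
  then show ?thesis unfolding B_def by (simp add: linear_0[OF linear_DPhi_inv[OF assms(2)]])
qed

lemma contact_lift_id: assumes "open U" shows "contact_lift \<omega> U (\<lambda>u. u) 1 UNIV UNIV (\<lambda>p. p)"
proof (intro contact_lift.intro symp_lift_id assms contact_lift_axioms.intro)
  have sm: "smooth_map UNIV (\<lambda>p :: 'm ix projspace. p)"
    unfolding smooth_map_def by (simp add: continuous_on_id)
  have iv: "inv_into UNIV (\<lambda>p :: 'm ix projspace. p) = (\<lambda>p. p)"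
    by (rule ext) (metis (no_types) UNIV_I f_inv_into_f rangeI)
  have pf: "pushforward (\<lambda>p. p) p v = v" if v: "v \<in> tangent p" for p :: "'m ix projspace" and v
  proof
    fix f
    obtain u w where "u \<noteq> 0" "p = proj u" "v = dproj u w" using v by (rule tangentE)
    then show "pushforward (\<lambda>p. p) p v f = v f" by (simp add: pushforward_def dproj_def)
  qed
  have ct: "v \<in> tangent p" if "v \<in> contact_plane \<omega> p" for v p
    using that unfolding contact_plane_def tangent_def by blast
  have "pushforward (\<lambda>p. p) p ` contact_plane \<omega> p = contact_plane \<omega> p" for p
    using pf[OF ct] by force
  then show "contactomorphism \<omega> UNIV UNIV (\<lambda>p. p)"
    unfolding contactomorphism_def iv using sm by (simp add: bij_betw_def)
qed simp_all

end

subsection \<open>The contact Schwarzian in terms of a symplectic lift\<close>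

context lift_section
begin

lemma Nb_on_H:
  assumes p: "p \<in> W" and v: "v \<in> contact_plane \<omega> p" and Y: "Y p \<in> contact_plane \<omega> p"
  shows "can.Nb p v Y = dproj (\<sigma> p) (pi p (dv v (\<lambda>q. dv (Y q) \<sigma>) + B (\<sigma> p) (dv v \<sigma>) (dv (Y p) \<sigma>))
    + v (\<lambda>q. th q (dv (Y q) \<sigma>)) *\<^sub>R t p)"
proof -
  have "th p (dv v \<sigma>) = 0" "th p (dv (Y p) \<sigma>) = 0"
    using v Y contact_plane_eq[OF p] by (auto simp: th_def)
  then show ?thesis by (simp add: can.Nb_def can.Nvec_def can.KK_def can.horiz_def)
qed

lemma pullback_on_H:
  assumes V: "open V" "V \<subseteq> W" and R: "representative V (pullback_contact_geodesic \<omega> Dom \<phi>) \<theta> n"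
    and W': "open W'" "W' \<subseteq> V" "p \<in> W'" and v: "v \<in> contact_plane \<omega> p"
    and Y: "vector_field W' Y" "Y p \<in> contact_plane \<omega> p"
  shows "n p v Y = dproj (\<sigma> p) (pi p (dv v (\<lambda>q. dv (Y q) \<sigma>) + B (\<sigma> p) (dv v \<sigma>) (dv (Y p) \<sigma>))
    + v (\<lambda>q. th q (dv (Y q) \<sigma>)) *\<^sub>R t p)"
proof -
  have p: "p \<in> W" using W' V by blast
  have "n p v Y = can.Nb p v Y"
    by (rule representative_unique[OF V R representative_pullback[OF V] geodesic_exists[OF V] W' v Y])
  then show ?thesis using Nb_on_H[where Y = Y, OF p v Y(2)] by simp
qed

end

context root_section
begin

lemma lift_section_id: "lift_section \<omega> W (\<lambda>u. u) 1 UNIV UNIV (\<lambda>p. p) \<sigma> s \<theta>"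
  by (intro lift_section.intro contact_lift_id[OF W_open] root_section_axioms)

lemma ex_flat_representative:
  assumes V: "open V" "V \<subseteq> W" shows "\<exists>n. representative V (flat_contact_geodesic \<omega>) \<theta> n"
proof -
  interpret id: lift_section \<omega> W "\<lambda>u. u" 1 UNIV UNIV "\<lambda>p. p" \<sigma> s \<theta> by (rule lift_section_id)
  have "representative V (flat_contact_geodesic \<omega>) \<theta> id.can.Nb"
    by (rule id.can.representative_Nb[OF V], rule id.unparam_geodesic_lift[OF V])
      (auto simp: flat_contact_geodesic_def)
  then show ?thesis by blast
qed

lemma flat_on_H:
  assumes V: "open V" "V \<subseteq> W" and R: "representative V (flat_contact_geodesic \<omega>) \<theta> n"
    and W': "open W'" "W' \<subseteq> V" "p \<in> W'" and v: "v \<in> contact_plane \<omega> p"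
    and Y: "vector_field W' Y" "Y p \<in> contact_plane \<omega> p"
  shows "n p v Y = dproj (\<sigma> p) (pi p (dv v (\<lambda>q. dv (Y q) \<sigma>)) + v (\<lambda>q. th q (dv (Y q) \<sigma>)) *\<^sub>R t p)"
proof -
  interpret id: lift_section \<omega> W "\<lambda>u. u" 1 UNIV UNIV "\<lambda>p. p" \<sigma> s \<theta> by (rule lift_section_id)
  have p: "p \<in> W" using W' V by blast
  have R2: "representative V (flat_contact_geodesic \<omega>) \<theta> id.can.Nb"
    by (rule id.can.representative_Nb[OF V], rule id.unparam_geodesic_lift[OF V])
      (auto simp: flat_contact_geodesic_def)
  have ex: "\<exists>I \<gamma> r X W'. flat_contact_geodesic \<omega> I \<gamma> \<and> \<gamma> ` I \<subseteq> V \<and> r \<in> I \<and> \<gamma> r = p \<and>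
      velocity \<gamma> r = v \<and> open W' \<and> W' \<subseteq> V \<and> vector_field W' X \<and> (\<forall>s\<in>I. \<gamma> s \<in> W' \<and> X (\<gamma> s) = velocity \<gamma> s)"
    if pv: "p \<in> V" "v \<in> contact_plane \<omega> p" "v \<noteq> (\<lambda>f. 0)" for p v
  proof -
    obtain I \<gamma> r X W' where h: "pullback_contact_geodesic \<omega> UNIV (\<lambda>p. p) I \<gamma>" "\<gamma> ` I \<subseteq> V" "r \<in> I" "\<gamma> r = p"
      "velocity \<gamma> r = v" "open W'" "W' \<subseteq> V" "vector_field W' X" "\<forall>s\<in>I. \<gamma> s \<in> W' \<and> X (\<gamma> s) = velocity \<gamma> s"
      using id.geodesic_exists[OF V pv] by (elim exE conjE)
    have "flat_contact_geodesic \<omega> I \<gamma>" using h(1) unfolding pullback_contact_geodesic_def by blast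
    then show ?thesis using h(2-) by (intro exI conjI)
  qed
  have "n p v Y = id.can.Nb p v Y"
    by (rule representative_unique[OF V R R2 ex W' v Y])
  moreover have "symp_lift.B \<omega> (\<lambda>u. u) 1 (\<sigma> p) a b = 0" for a b
    by (rule B_id[OF W_open sec_cone[OF p p]])
  ultimately show ?thesis using id.Nb_on_H[where Y = Y, OF p v Y(2)] by simp
qed

end

text \<open>The explicit formulas differ by \<open>pi p\<close> of \<open>B\<close>. As
  \<open>B\<close> is already \<Omega>-orthogonal to \<open>\<sigma> p\<close>, the projection
  changes it by a multiple of \<open>\<sigma> p\<close> only, and \<open>dproj\<close> kills
  that.\<close>

lemma (in lift_section) representative_difference:
  assumes V: "open V" "V \<subseteq> W" and R': "representative V (pullback_contact_geodesic \<omega> Dom \<phi>) \<theta> n'"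
    and R: "representative V (flat_contact_geodesic \<omega>) \<theta> n"
    and X: "X p \<in> contact_plane \<omega> p" and Y: "vector_field V Y" "Y p \<in> contact_plane \<omega> p" and p: "p \<in> V"
  shows "(\<lambda>f. cov n' X Y p f - cov n X Y p f) = dproj (\<sigma> p) (B (\<sigma> p) (dv (X p) \<sigma>) (dv (Y p) \<sigma>))"
proof -
  have pW: "p \<in> W" using p V by blast
  have c: "\<sigma> p \<in> cone W" by (rule sec_cone[OF pW pW])
  note s0 = sec_nonzero[OF pW]
  define Z where "Z = B (\<sigma> p) (dv (X p) \<sigma>) (dv (Y p) \<sigma>)"
  have "pi p Z = Z + (- (s / 2 * Om Z (t p))) *\<^sub>R \<sigma> p"
    using B_perp[OF c] by (simp add: pi_def th_def Z_def)
  then have Zp: "dproj (\<sigma> p) (pi p Z) = dproj (\<sigma> p) Z" by (simp only: dproj_add_self[OF s0])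
  show ?thesis
    unfolding cov_def pullback_on_H[where Y = Y, OF V R' V(1) order_refl p X Y] flat_on_H[where Y = Y, OF V R V(1) order_refl p X Y]
      Z_def[symmetric] Zp[symmetric] linear_add[OF linear_pi] dproj_add[OF s0] by simp
qed

text \<open>Every admissible choice in the definite description gives this value
  (\<open>val\<close>): near the point its \<theta> has a square root, and restriction makes
  \<open>representative_difference\<close> applicable. One explicit choice (\<open>ex\<close>) shows
  that the description is met.\<close>

lemma (in contact_lift) schwarzian_eq:
  assumes u: "u \<in> cone U" and a: "Om u a = 0" and b: "Om u b = 0"
  shows "contact_schwarzian \<omega> Dom \<phi> (proj u) (dproj u a) (dproj u b) = dproj u (B u a b)"
proof -
  have u0: "u \<noteq> 0" and pU: "proj u \<in> U" using u by (auto simp: mem_cone)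
  define p where "p = proj u"
  have pU: "p \<in> U" unfolding p_def by (rule pU)
  have H: "dproj u a \<in> contact_plane \<omega> p" "dproj u b \<in> contact_plane \<omega> p"
    unfolding p_def contact_plane_proj[OF u0 Om_self] using a b by blast+
  \<comment> \<open>Independence of the section: \<open>B\<close> has degree -1 in the base point
    and both arguments scale with \<open>r\<close>, so the value scales like a representative of a
    tangent vector; radial parts of the arguments vanish by \<open>B_self\<close>.\<close>
  have key: "dproj (\<sigma> p) (B (\<sigma> p) (dv (dproj u a) \<sigma>) (dv (dproj u b) \<sigma>)) = dproj u (B u a b)"
    if S: "proj_section W \<sigma>" and pW: "p \<in> W" for W \<sigma>
  proof -
    interpret proj_section W \<sigma> by (rule S)
    obtain r where r: "r \<noteq> 0" "\<sigma> p = r *\<^sub>R u"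
      using proj_eq_iff[OF u0 sec_nonzero[OF pW]] proj_sec[OF pW] unfolding p_def by auto
    have x: "\<exists>c. dv (dproj u a) \<sigma> = r *\<^sub>R a + c *\<^sub>R u" for a
    proof -
      have "dproj u a \<in> tangent p" unfolding p_def tangent_proj[OF u0] by blast
      then have "dproj (r *\<^sub>R u) (dv (dproj u a) \<sigma>) = dproj u a" using dproj_dv[OF pW] r(2) by simp
      then have "dproj u a = dproj u ((1 / r) *\<^sub>R dv (dproj u a) \<sigma>)" unfolding dproj_scale_divide[OF u0 r(1)] by simp
      then obtain c where c: "(1 / r) *\<^sub>R dv (dproj u a) \<sigma> = a + c *\<^sub>R u" using dproj_eqD[OF u0] by blast
      have "r *\<^sub>R ((1 / r) *\<^sub>R dv (dproj u a) \<sigma>) = r *\<^sub>R a + (r * c) *\<^sub>R u" unfolding c by (simp add: algebra_simps)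
      then show ?thesis using r(1) by auto
    qed
    obtain c d where cd: "dv (dproj u a) \<sigma> = r *\<^sub>R a + c *\<^sub>R u" "dv (dproj u b) \<sigma> = r *\<^sub>R b + d *\<^sub>R u"
      using x by meson
    have l: "B u (x *\<^sub>R a + y *\<^sub>R u) z = x *\<^sub>R B u a z" for x y a z
      unfolding B_sym[OF u, of _ z]
      by (simp add: linear_add[OF linear_B[OF u]] linear_cmul[OF linear_B[OF u]] B_self[OF u])
    have l2: "B u z (x *\<^sub>R a + y *\<^sub>R u) = x *\<^sub>R B u z a" for x y a z
      by (simp add: linear_add[OF linear_B[OF u]] linear_cmul[OF linear_B[OF u]] B_self[OF u])
    have "B (r *\<^sub>R u) (r *\<^sub>R a + c *\<^sub>R u) (r *\<^sub>R b + d *\<^sub>R u) = r *\<^sub>R B u a b"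
      unfolding B_hom[OF u r(1)] l l2 using r(1) by simp
    then show ?thesis unfolding cd r(2) by (simp only: dproj_scale[OF u0 r(1)])
  qed
  have val: "z = dproj u (B u a b)"
    if V: "open V" "p \<in> V" "V \<subseteq> Dom" and cf: "contact_form \<omega> V \<theta>"
      and R': "representative V (pullback_contact_geodesic \<omega> Dom \<phi>) \<theta> n'"
      and R: "representative V (flat_contact_geodesic \<omega>) \<theta> n"
      and X: "X p = dproj u a" and Y: "vector_field V Y" "Y p = dproj u b"
      and z: "z = (\<lambda>f. cov n' X Y p f - cov n X Y p f)" for V \<theta> n' n X Y z
  proof -
    obtain W \<sigma> s where W: "p \<in> W" "W \<subseteq> V" "root_section \<omega> W \<sigma> s \<theta>" using local_root[OF V(1) cf V(2)] by blast
    have oW: "open W" using W(3) unfolding root_section_def proj_section_def by blast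
    define W' where "W' = W \<inter> U"
    have W': "open W'" "W' \<subseteq> W" "W' \<subseteq> U" "p \<in> W'" unfolding W'_def using oW U_open W pU by auto
    have RS: "root_section \<omega> W' \<sigma> s \<theta>" by (rule root_section_restrict[OF W(3) W'(1,2)])
    interpret L: lift_section \<omega> W' \<Phi> \<epsilon> Dom Ran \<phi> \<sigma> s \<theta>
      by (rule lift_section.intro[OF contact_lift_restrict[OF contact_lift_axioms W'(1,3)] RS])
    have W'V: "W' \<subseteq> V" using W W' by blast
    have "z = dproj (\<sigma> p) (B (\<sigma> p) (dv (X p) \<sigma>) (dv (Y p) \<sigma>))"
      unfolding z
      by (rule L.representative_difference[OF W'(1) order_refl representative_restrict[OF R' W'V]
            representative_restrict[OF R W'V] _ vector_field_subset[OF Y(1) W'V] _ W'(4)])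
        (use X Y H in simp_all)
    then show ?thesis unfolding X Y(2) key[OF L.proj_section_axioms W'(4)] .
  qed
  obtain W0 \<sigma> \<theta> where W0: "p \<in> W0" "root_section \<omega> W0 \<sigma> 1 \<theta>" using ex_root_section by blast
  have oW0: "open W0" using W0(2) unfolding root_section_def proj_section_def by blast
  define W where "W = W0 \<inter> U"
  have W: "open W" "W \<subseteq> W0" "W \<subseteq> U" "p \<in> W" unfolding W_def using oW0 U_open W0 pU by auto
  interpret L: lift_section \<omega> W \<Phi> \<epsilon> Dom Ran \<phi> \<sigma> 1 \<theta>
    by (rule lift_section.intro[OF contact_lift_restrict[OF contact_lift_axioms W(1,3)] root_section_restrict[OF W0(2) W(1,2)]])
  obtain n where n: "representative W (flat_contact_geodesic \<omega>) \<theta> n"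
    using L.ex_flat_representative[OF W(1) order_refl] by blast
  \<comment> \<open>A constant vector projected into the contact plane at each point: a contact
    field with a prescribed value at \<open>p\<close>.\<close>
  define F where "F = (\<lambda>v q. dproj (\<sigma> q) (L.pi q (dv v \<sigma>)))"
  have Fv: "vector_field W (F v)" for v
    unfolding F_def
    by (rule L.vector_field_dproj[OF W(1) order_refl L.smooth_pi[OF W(1) order_refl smooth_fun_const[OF W(1)]]])
  have FH: "F v q \<in> contact_plane \<omega> q" if q: "q \<in> W" for v q
    using L.contact_plane_eq[OF q] L.dproj_tangent[OF q] L.dv_dproj_perp[OF q L.Om_pi(2)[OF q]] L.Om_pi(1)[OF q]
    by (simp add: F_def)
  have Fp: "F v p = v" if v: "v \<in> contact_plane \<omega> p" for v
  proof -
    have tv: "v \<in> tangent p" and "Om (\<sigma> p) (dv v \<sigma>) = 0" using L.contact_plane_eq[OF W(4)] v by blast+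
    then have "L.pi p (dv v \<sigma>) = dv v \<sigma>" using L.Om_t_tangent(2)[OF W(4) tv] by (intro L.pi_id)
    then show ?thesis unfolding F_def using L.dproj_dv[OF W(4) tv] by simp
  qed
  have WD: "W \<subseteq> Dom" using W U_Dom by blast
  have ex: "\<exists>V \<theta> nabla' nabla X Y. open V \<and> p \<in> V \<and> V \<subseteq> Dom \<and> contact_form \<omega> V \<theta> \<and>
        representative V (pullback_contact_geodesic \<omega> Dom \<phi>) \<theta> nabla' \<and> representative V (flat_contact_geodesic \<omega>) \<theta> nabla \<and>
        vector_field V X \<and> vector_field V Y \<and>
        (\<forall>q\<in>V. X q \<in> contact_plane \<omega> q \<and> Y q \<in> contact_plane \<omega> q) \<and>
        X p = dproj u a \<and> Y p = dproj u b \<and>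
        dproj u (B u a b) = (\<lambda>f. cov nabla' X Y p f - cov nabla X Y p f)"
  proof (rule exI[of _ W], rule exI[of _ \<theta>], rule exI[of _ L.can.Nb], rule exI[of _ n],
      rule exI[of _ "F (dproj u a)"], rule exI[of _ "F (dproj u b)"], intro conjI)
    show cf: "contact_form \<omega> W \<theta>" by (rule L.contact_form_root[OF W(1) order_refl])
    show R: "representative W (pullback_contact_geodesic \<omega> Dom \<phi>) \<theta> L.can.Nb"
      by (rule L.representative_pullback[OF W(1) order_refl])
    show Fa: "F (dproj u a) p = dproj u a" and Fb: "F (dproj u b) p = dproj u b" using Fp H by blast+
    show "dproj u (B u a b) = (\<lambda>f. cov L.can.Nb (F (dproj u a)) (F (dproj u b)) p f - cov n (F (dproj u a)) (F (dproj u b)) p f)"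
      by (rule val[where X = "F (dproj u a)" and Y = "F (dproj u b)", OF W(1,4) WD cf R n Fa Fv Fb refl, symmetric])
  qed (use W WD n Fv FH in blast)+
  show ?thesis
    unfolding contact_schwarzian_def difference_tensor_def p_def[symmetric]
  proof (rule the_equality)
    fix z
    assume "\<exists>V \<theta> nabla' nabla X Y. open V \<and> p \<in> V \<and> V \<subseteq> Dom \<and> contact_form \<omega> V \<theta> \<and>
        representative V (pullback_contact_geodesic \<omega> Dom \<phi>) \<theta> nabla' \<and> representative V (flat_contact_geodesic \<omega>) \<theta> nabla \<and>
        vector_field V X \<and> vector_field V Y \<and>
        (\<forall>q\<in>V. X q \<in> contact_plane \<omega> q \<and> Y q \<in> contact_plane \<omega> q) \<and>
        X p = dproj u a \<and> Y p = dproj u b \<and>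
        z = (\<lambda>f. cov nabla' X Y p f - cov nabla X Y p f)"
    then obtain V \<theta> n' n X Y where h: "open V" "p \<in> V" "V \<subseteq> Dom" "contact_form \<omega> V \<theta>"
        "representative V (pullback_contact_geodesic \<omega> Dom \<phi>) \<theta> n'" "representative V (flat_contact_geodesic \<omega>) \<theta> n"
        "vector_field V Y" "X p = dproj u a" "Y p = dproj u b"
        "z = (\<lambda>f. cov n' X Y p f - cov n X Y p f)"
      by (elim exE conjE)
    show "z = dproj u (B u a b)" by (rule val[OF h(1-6,8,7,9,10)])
  qed (rule ex)
qed

subsection \<open>Vanishing of the contact Schwarzian\<close>

lemma proj_action_proj:
  fixes A :: "real ^ 'k::finite ^ 'k"
  assumes "u \<noteq> 0" shows "proj_action A (proj u) = proj (A *v u)"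
proof -
  have "(*v) A ` span {u} = span {A *v u}"
    by (auto simp: span_singleton matrix_vector_mult_scaleR image_image)
  then show ?thesis unfolding proj_action_def line_of_proj[OF assms] unfolding proj_def by simp
qed

text \<open>\<Phi> and \<open>A\<close> lift the same map, so \<Phi> is \<open>A\<close> times a
  function \<open>h\<close>. Comparing their contact identities gives
  \<open>h * h = \<epsilon>\<close>, so \<open>h\<close> has zero derivative and \<Phi> has no
  second derivative.\<close>

lemma (in contact_lift) lift_of_linear:
  assumes A: "A \<in> Sp \<omega>" and e: "\<And>q. q \<in> U \<Longrightarrow> \<phi> q = proj_action A q" and u: "u \<in> cone U"
  shows "\<exists>h. (h = 1 \<or> h = -1) \<and> (\<forall>w. fd \<Phi> u w = h *\<^sub>R (A *v w))" "D2 u a b = 0"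
proof -
  have inv: "invertible A" and OA: "\<And>x y. Om (A *v x) (A *v y) = Om x y" using A unfolding Sp_def by blast+
  have A0: "A *v x \<noteq> 0" if "x \<noteq> 0" for x
  proof
    assume "A *v x = 0"
    then have "Om x y = 0" for y using OA[of x y] by (simp add: Om.zero_left)
    then have "x = 0" by (intro Om_eqI) (simp add: Om.zero_left)
    then show False using that by blast
  qed
  define h where "h = (\<lambda>x. (\<Phi> x \<bullet> (A *v x)) / ((A *v x) \<bullet> (A *v x)))"
  have Ph: "\<Phi> x = h x *\<^sub>R (A *v x)" if x: "x \<in> cone U" for x
  proof -
    have x0: "x \<noteq> 0" and xU: "proj x \<in> U" using x by (auto simp: mem_cone)
    have "proj (A *v x) = proj (\<Phi> x)"
      unfolding lift[OF x] e[OF xU] proj_action_proj[OF x0] ..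
    then obtain r where "\<Phi> x = r *\<^sub>R (A *v x)" using proj_eq_iff[OF A0[OF x0] Phi_nonzero[OF x]] by blast
    then show ?thesis using A0[OF x0] by (simp add: h_def)
  qed
  have sA: "smooth_on (cone U) (\<lambda>x. A *v x)"
    by (rule smooth_on_bounded_linear[OF matrix_vector_mul_bounded_linear open_C smooth_on_ident[OF open_C]])
  have sh: "smooth_on (cone U) h"
    unfolding h_def
    by (intro smooth_on_divide smooth_on_bilinear[OF bounded_bilinear_inner] open_C Phi_smooth sA)
      (use A0 in \<open>simp add: mem_cone\<close>)
  have dA: "fd (\<lambda>x. A *v x) x w = A *v w" for x w
    using fd_eq[OF bounded_linear_imp_has_derivative[OF matrix_vector_mul_bounded_linear[of A]]] by simp
  have DP: "fd \<Phi> x w = h x *\<^sub>R (A *v w) + fd h x w *\<^sub>R (A *v x)" if x: "x \<in> cone U" for x w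
  proof -
    have "fd \<Phi> x = fd (\<lambda>x. h x *\<^sub>R (A *v x)) x" by (rule fd_open_cong[OF open_C x Ph])
    then show ?thesis
      using fd_bilinear[OF bounded_bilinear_scaleR smooth_on_differentiable[OF sh open_C x] smooth_on_differentiable[OF sA open_C x], of w]
      by (simp add: dA)
  qed
  have hh: "h x * h x = \<epsilon>" if x: "x \<in> cone U" for x
  proof -
    have "x \<noteq> 0" using x by (simp add: mem_cone)
    then obtain \<tau> where t: "Om x \<tau> = 1" using ex_Om_1 by blast
    have "Om (h x *\<^sub>R (A *v x)) (h x *\<^sub>R (A *v \<tau>) + fd h x \<tau> *\<^sub>R (A *v x)) = \<epsilon>"
      using Phi_contact[OF x, of \<tau>] unfolding DP[OF x] Ph[OF x] t by simp
    then show ?thesis by (simp add: Om.add_right Om.scaleR_left Om.scaleR_right OA t)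
  qed
  have dh: "fd h x w = 0" if x: "x \<in> cone U" for x w
  proof -
    have "fd (\<lambda>x. h x * h x) x = fd (\<lambda>x. \<epsilon>) x" by (rule fd_open_cong[OF open_C x hh])
    then have "2 * h x * fd h x w = 0"
      using fd_bilinear[OF bounded_bilinear_mult smooth_on_differentiable[OF sh open_C x] smooth_on_differentiable[OF sh open_C x], of w]
      by (simp add: frechet_derivative_const)
    moreover have "h x \<noteq> 0" using hh[OF x] eps by auto
    ultimately show ?thesis by simp
  qed
  have DP': "fd \<Phi> x w = h x *\<^sub>R (A *v w)" if x: "x \<in> cone U" for x w
    using DP[OF x] dh[OF x] by simp
  have "h u = 1 \<or> h u = -1"
  proof -
    have "h u * h u = 1" using hh[OF u] eps by (metis (no_types) not_square_less_zero less_minus_one_simps(1))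
    then show ?thesis by (simp add: square_eq_1_iff)
  qed
  then show "\<exists>h. (h = 1 \<or> h = -1) \<and> (\<forall>w. fd \<Phi> u w = h *\<^sub>R (A *v w))" using DP'[OF u] by blast
  have "D2 u a b = fd (\<lambda>x. h x *\<^sub>R (A *v a)) u b"
    unfolding D2_def by (rule fun_cong[OF fd_open_cong[OF open_C u DP']])
  also have "\<dots> = fd h u b *\<^sub>R (A *v a)"
    using fd_eq[OF has_derivative_scaleR_left[OF smooth_on_has_derivative[OF sh open_C u], of "A *v a"]]
    by simp
  finally show "D2 u a b = 0" by (simp add: dh[OF u])
qed

text \<open>A vanishing Schwarzian makes \<open>B\<close> radial on the complement of the base
  point, which the cubic form \<open>Q\<close> does not see there, so \<open>D2_zero\<close> and
  \<open>locally_linear\<close> apply. With \<open>\<epsilon> = 1\<close> the derivative of \<Phi>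
  is symplectic, not just up to sign.\<close>

lemma (in contact_lift) linear_if_schwarzian_zero:
  assumes z: "\<And>p v w. p \<in> U \<Longrightarrow> v \<in> contact_plane \<omega> p \<Longrightarrow> w \<in> contact_plane \<omega> p \<Longrightarrow>
      contact_schwarzian \<omega> Dom \<phi> p v w = (\<lambda>f. 0)"
    and e1: "\<epsilon> = 1" and p: "p \<in> U"
  shows "\<exists>A N. A \<in> Sp \<omega> \<and> open N \<and> p \<in> N \<and> N \<subseteq> U \<and> (\<forall>q\<in>N. \<phi> q = proj_action A q)"
proof -
  have Q0: "Q x a b c = 0" if x: "x \<in> cone U" and abc: "Om x a = 0" "Om x b = 0" "Om x c = 0" for x a b c
  proof -
    have x0: "x \<noteq> 0" and xU: "proj x \<in> U" using x by (auto simp: mem_cone)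
    have H: "dproj x a \<in> contact_plane \<omega> (proj x)" if "Om x a = 0" for a
      unfolding contact_plane_proj[OF x0 Om_self] using that by blast
    have "dproj x (B x a b) = (\<lambda>f. 0)"
      unfolding schwarzian_eq[OF x abc(1,2), symmetric] by (rule z[OF xU H[OF abc(1)] H[OF abc(2)]])
    then obtain k where "B x a b = k *\<^sub>R x" using dproj_eq_zeroD[OF x0] by blast
    then have "\<epsilon> * Q x a b c = 0" unfolding Q_B[OF x, symmetric] using abc(3) by (simp add: Om.scaleR_left)
    then show ?thesis by simp
  qed
  obtain u where u: "u \<noteq> 0" "proj u = p" using proj_surj by blast
  then have uc: "u \<in> cone U" using p by (simp add: mem_cone)
  have "\<exists>e>0. ball u e \<subseteq> cone U \<and> (\<forall>x\<in>ball u e. \<Phi> x = fd \<Phi> u x)"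
    by (rule locally_linear[OF D2_zero[OF Q0] uc])
  then obtain e where e: "e > 0" "ball u e \<subseteq> cone U" "\<And>x. x \<in> ball u e \<Longrightarrow> \<Phi> x = fd \<Phi> u x" by blast
  define A where "A = matrix (fd \<Phi> u)"
  have Av: "A *v x = fd \<Phi> u x" for x
    unfolding A_def by (rule matrix_works) (rule linear_DPhi[OF uc, unfolded linear_matrix_vector_mul_eq[symmetric]] | rule linear_DPhi[OF uc])
  have "A \<in> Sp \<omega>"
  proof -
    have "inj ((*v) A)" by (rule injI) (simp add: Av DPhi_inj[OF uc])
    then have "invertible A" by (simp add: invertible_left_inverse matrix_left_invertible_injective)
    then show ?thesis unfolding Sp_def using DPhi_symplectic[OF uc] by (simp add: Av e1)
  qed
  moreover have "0 \<notin> cone U" by (simp add: mem_cone)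
  then have "0 \<notin> ball u e" using e(2) by blast
  then have "open (proj ` ball u e)" by (rule open_proj_image[OF open_ball])
  moreover have "p \<in> proj ` ball u e" using u e(1) by (intro image_eqI[of _ _ u]) auto
  moreover have "proj ` ball u e \<subseteq> U" using e(2) by (auto simp: mem_cone)
  moreover have "\<forall>q\<in>proj ` ball u e. \<phi> q = proj_action A q"
  proof
    fix q assume "q \<in> proj ` ball u e"
    then obtain x where x: "x \<in> ball u e" "q = proj x" by blast
    then have xc: "x \<in> cone U" using e(2) by blast
    then have x0: "x \<noteq> 0" by (simp add: mem_cone)
    show "\<phi> q = proj_action A q"
      unfolding x(2) proj_action_proj[OF x0] Av e(3)[OF x(1), symmetric] by (rule lift[OF xc, symmetric])
  qed
  ultimately show ?thesis by blast
qed

text \<open>The pushforward of \<open>dproj u w\<close> is represented over \<open>\<Phi> u\<close>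
  by \<open>fd \<Phi> u w\<close>, so \<open>Phi_contact\<close> compares the sides of the contact
  planes directly.\<close>

lemma (in contact_lift) eps_1_if_cooriented:
  assumes c: "preserves_coorientation \<omega> U \<phi>" and p: "p \<in> U"
  shows "\<epsilon> = 1"
proof -
  obtain u where u: "u \<noteq> 0" "proj u = p" using proj_surj by blast
  then have uc: "u \<in> cone U" using p by (simp add: mem_cone)
  obtain w where w: "Om u w = 1" using ex_Om_1[OF u(1)] by blast
  have pf: "pushforward \<phi> (proj u) (dproj u w) = dproj (\<Phi> u) (fd \<Phi> u w)"
  proof
    fix f
    show "pushforward \<phi> (proj u) (dproj u w) f = dproj (\<Phi> u) (fd \<Phi> u w) f"
    proof (cases "smooth_at (\<phi> (proj u)) f")
      case True
      then obtain V where V: "open V" "\<phi> (proj u) \<in> V" "smooth_fun V f" unfolding smooth_at_def by blast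
      have sm: "smooth_map Dom \<phi>" "open Dom" using contacto unfolding contactomorphism_def by blast+
      have s: "smooth_fun (Dom \<inter> \<phi> -` V) (\<lambda>q. f (\<phi> q))" using sm(1) V unfolding smooth_map_def by blast
      have o: "open (Dom \<inter> \<phi> -` V)"
        using sm V(1) unfolding smooth_map_def by (intro continuous_open_preimage) blast+
      have "u \<in> cone (Dom \<inter> \<phi> -` V)" using uc V U_Dom by (auto simp: mem_cone)
      from dproj_apply[OF s o this]
      have "dproj u w (\<lambda>q. f (\<phi> q)) = fd (\<lambda>z. f (\<phi> (proj z))) u w" .
      also have "fd (\<lambda>z. f (\<phi> (proj z))) u = fd (\<lambda>z. f (proj (\<Phi> z))) u"
        by (rule fd_open_cong[OF open_C uc]) (simp add: lift)
      also have "fd (\<lambda>z. f (proj (\<Phi> z))) u w = fd (\<lambda>z. f (proj z)) (\<Phi> u) (fd \<Phi> u w)"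
        by (rule fd_compose[OF smooth_on_differentiable[OF Phi_smooth open_C uc] differentiableI[OF smooth_at_has_derivative]])
          (use True lift[OF uc] Phi_nonzero[OF uc] in simp_all)
      finally show ?thesis using True by (simp add: pushforward_def dproj_def lift[OF uc])
    qed (simp add: pushforward_def dproj_def lift[OF uc])
  qed
  have "Om (\<Phi> u) (fd \<Phi> u w) > 0"
    using c[unfolded preserves_coorientation_def, rule_format, of u "\<Phi> u" w "fd \<Phi> u w"]
      u p Phi_nonzero[OF uc] lift[OF uc] pf w by simp
  then show ?thesis unfolding Phi_contact[OF uc] w using eps by auto
qed

lemma preserves_coorientation_subset:
  "preserves_coorientation \<omega> U \<phi> \<Longrightarrow> V \<subseteq> U \<Longrightarrow> preserves_coorientation \<omega> V \<phi>"
  unfolding preserves_coorientation_def by blast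

context symp
begin

lemma restricted_lift:
  assumes C: "contactomorphism \<omega> Dom Ran \<phi>" and N: "open N" "N \<subseteq> Dom" "p \<in> N"
  obtains W \<Phi> \<epsilon> where "p \<in> W" "W \<subseteq> N" "contact_lift \<omega> W \<Phi> \<epsilon> Dom Ran \<phi>"
proof -
  obtain W \<Phi> \<epsilon> where W: "p \<in> W" "contact_lift \<omega> W \<Phi> \<epsilon> Dom Ran \<phi>" using local_lift[OF C] N by blast
  have "open W" using W(2) unfolding contact_lift_def symp_lift_def symp_lift_axioms_def by blast
  then have "contact_lift \<omega> (W \<inter> N) \<Phi> \<epsilon> Dom Ran \<phi>"
    using contact_lift_restrict[OF W(2)] N(1) by blast
  then show ?thesis using that W(1) N(3) by blast
qed

lemma schwarzian_zero_if_linear: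
  assumes C: "contactomorphism \<omega> Dom Ran \<phi>" and U: "open U" "U \<subseteq> Dom" and A: "A \<in> Sp \<omega>"
    and e: "\<And>q. q \<in> U \<Longrightarrow> \<phi> q = proj_action A q" and p: "p \<in> U"
    and v: "v \<in> contact_plane \<omega> p" and w: "w \<in> contact_plane \<omega> p"
  shows "contact_schwarzian \<omega> Dom \<phi> p v w = (\<lambda>f. 0)"
proof -
  obtain W \<Phi> \<epsilon> where W: "p \<in> W" "W \<subseteq> U" "contact_lift \<omega> W \<Phi> \<epsilon> Dom Ran \<phi>"
    using restricted_lift[OF C U p] by blast
  interpret contact_lift \<omega> W \<Phi> \<epsilon> Dom Ran \<phi> by (rule W(3))
  obtain u where u: "u \<noteq> 0" "proj u = p" using proj_surj by blast
  then have uc: "u \<in> cone W" using W(1) by (simp add: mem_cone)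
  obtain a b where ab: "v = dproj u a" "Om u a = 0" "w = dproj u b" "Om u b = 0"
    using v w unfolding u(2)[symmetric] contact_plane_proj[OF u(1) Om_self] by blast
  have "D2 u a b = 0" by (rule lift_of_linear(2)[OF A _ uc]) (use e W(2) in blast)
  then have "B u a b = 0" unfolding B_def by (simp add: linear_0[OF linear_DPhi_inv[OF uc]])
  then show ?thesis
    unfolding ab(1,3) u(2)[symmetric] schwarzian_eq[OF uc ab(2,4)] by (simp add: dproj_zero[OF u(1)])
qed

text \<open>Both matrices equal, up to sign, the derivative of one lift at one point, and a sign
  does not change the action on lines.\<close>

lemma proj_action_unique:
  assumes C: "contactomorphism \<omega> Dom Ran \<phi>" and N: "open N" "N \<subseteq> Dom" "q \<in> N"
    and A: "A \<in> Sp \<omega>" "\<And>q. q \<in> N \<Longrightarrow> \<phi> q = proj_action A q"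
    and A': "A' \<in> Sp \<omega>" "\<And>q. q \<in> N \<Longrightarrow> \<phi> q = proj_action A' q"
  shows "proj_action A = proj_action A'"
proof -
  obtain W \<Phi> \<epsilon> where W: "q \<in> W" "W \<subseteq> N" "contact_lift \<omega> W \<Phi> \<epsilon> Dom Ran \<phi>"
    using restricted_lift[OF C N] by blast
  interpret contact_lift \<omega> W \<Phi> \<epsilon> Dom Ran \<phi> by (rule W(3))
  obtain u where u: "u \<noteq> 0" "proj u = q" using proj_surj by blast
  then have uc: "u \<in> cone W" using W(1) by (simp add: mem_cone)
  have "\<exists>h. (h = 1 \<or> h = -1) \<and> (\<forall>w. fd \<Phi> u w = h *\<^sub>R (A *v w))"
    by (rule lift_of_linear(1)[OF A(1) _ uc]) (use A(2) W(2) in blast)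
  then obtain h where h: "h = 1 \<or> h = -1" "\<And>w. fd \<Phi> u w = h *\<^sub>R (A *v w)" by blast
  have "\<exists>h. (h = 1 \<or> h = -1) \<and> (\<forall>w. fd \<Phi> u w = h *\<^sub>R (A' *v w))"
    by (rule lift_of_linear(1)[OF A'(1) _ uc]) (use A'(2) W(2) in blast)
  then obtain h' where h': "h' = 1 \<or> h' = -1" "\<And>w. fd \<Phi> u w = h' *\<^sub>R (A' *v w)" by blast
  have AA: "A *v w = (h * h') *\<^sub>R (A' *v w)" for w
  proof -
    have "h *\<^sub>R (A *v w) = h' *\<^sub>R (A' *v w)" using h(2)[of w] h'(2)[of w] by simp
    then have "h *\<^sub>R (h *\<^sub>R (A *v w)) = h *\<^sub>R (h' *\<^sub>R (A' *v w))" by (rule arg_cong)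
    then show ?thesis using h(1) by auto
  qed
  show ?thesis
  proof
    fix q :: "'m ix projspace"
    obtain x where x: "x \<noteq> 0" "proj x = q" using proj_surj by blast
    have "proj (A *v x) = proj (A' *v x)" unfolding AA by (rule proj_scale) (use h(1) h'(1) in auto)
    then show "proj_action A q = proj_action A' q" unfolding x(2)[symmetric] proj_action_proj[OF x(1)] .
  qed
qed

text \<open>Local linearity provides a matrix for each point of \<open>U\<close>; matrices of
  overlapping neighbourhoods have the same action, and connectedness makes the action
  constant.\<close>

theorem schwarzian_zero_iff_linear:
  assumes C: "contactomorphism \<omega> Dom Ran \<phi>" and U: "open U" "connected U" "U \<subseteq> Dom"
    and co: "preserves_coorientation \<omega> U \<phi>"
  shows "(\<forall>p\<in>U. \<forall>v\<in>contact_plane \<omega> p. \<forall>w\<in>contact_plane \<omega> p. contact_schwarzian \<omega> Dom \<phi> p v w = (\<lambda>f. 0))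
    \<longleftrightarrow> (\<exists>A\<in>Sp \<omega>. \<forall>p\<in>U. \<phi> p = proj_action A p)"
proof
  assume "\<exists>A\<in>Sp \<omega>. \<forall>p\<in>U. \<phi> p = proj_action A p"
  then obtain A where "A \<in> Sp \<omega>" "\<And>q. q \<in> U \<Longrightarrow> \<phi> q = proj_action A q" by blast
  then show "\<forall>p\<in>U. \<forall>v\<in>contact_plane \<omega> p. \<forall>w\<in>contact_plane \<omega> p. contact_schwarzian \<omega> Dom \<phi> p v w = (\<lambda>f. 0)"
    using schwarzian_zero_if_linear[OF C U(1,3)] by blast
next
  assume z: "\<forall>p\<in>U. \<forall>v\<in>contact_plane \<omega> p. \<forall>w\<in>contact_plane \<omega> p. contact_schwarzian \<omega> Dom \<phi> p v w = (\<lambda>f. 0)"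
  have loc: "\<exists>A N. A \<in> Sp \<omega> \<and> open N \<and> p \<in> N \<and> N \<subseteq> U \<and> (\<forall>q\<in>N. \<phi> q = proj_action A q)" if p: "p \<in> U" for p
  proof -
    obtain W \<Phi> \<epsilon> where W: "p \<in> W" "W \<subseteq> U" "contact_lift \<omega> W \<Phi> \<epsilon> Dom Ran \<phi>"
      using restricted_lift[OF C U(1,3) p] by blast
    interpret contact_lift \<omega> W \<Phi> \<epsilon> Dom Ran \<phi> by (rule W(3))
    have e1: "\<epsilon> = 1" by (rule eps_1_if_cooriented[OF preserves_coorientation_subset[OF co W(2)] W(1)])
    have "\<exists>A N. A \<in> Sp \<omega> \<and> open N \<and> p \<in> N \<and> N \<subseteq> W \<and> (\<forall>q\<in>N. \<phi> q = proj_action A q)"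
      by (rule linear_if_schwarzian_zero[OF _ e1 W(1)]) (use z W(2) in blast)
    then show ?thesis using W(2) by blast
  qed
  show "\<exists>A\<in>Sp \<omega>. \<forall>p\<in>U. \<phi> p = proj_action A p"
  proof (cases "U = {}")
    case True
    have "mat 1 \<in> Sp \<omega>" unfolding Sp_def invertible_def by (auto intro: exI[of _ "mat 1"])
    then show ?thesis using True by blast
  next
    case False
    then obtain p0 where p0: "p0 \<in> U" by blast
    obtain A N where AN: "\<And>p. p \<in> U \<Longrightarrow> A p \<in> Sp \<omega>" "\<And>p. p \<in> U \<Longrightarrow> open (N p)" "\<And>p. p \<in> U \<Longrightarrow> p \<in> N p"
      "\<And>p. p \<in> U \<Longrightarrow> N p \<subseteq> U" "\<And>p q. p \<in> U \<Longrightarrow> q \<in> N p \<Longrightarrow> \<phi> q = proj_action (A p) q"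
      using loc by metis
    \<comment> \<open>The matrix is determined only up to sign, so local constancy is asserted for
      its action.\<close>
    have const: "proj_action (A p) = proj_action (A p0)" if p: "p \<in> U" for p
    proof (rule connected_local_const[where f = "\<lambda>p. proj_action (A p)", OF U(2) p p0])
      show "\<forall>a\<in>U. eventually (\<lambda>b. proj_action (A a) = proj_action (A b)) (at a within U)"
      proof
        fix a assume a: "a \<in> U"
        have "proj_action (A a) = proj_action (A b)" if b: "b \<in> N a" for b
        proof -
          have bU: "b \<in> U" using AN(4)[OF a] b by blast
          have NN: "N a \<inter> N b \<subseteq> Dom" and bb: "b \<in> N a \<inter> N b" using AN(4)[OF a] U(3) b AN(3)[OF bU] by blast+
          show ?thesis
          proof (rule proj_action_unique[where A = "A a" and A' = "A b", OF C open_Int[OF AN(2)[OF a] AN(2)[OF bU]] NN bb])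
            show "A a \<in> Sp \<omega>" "A b \<in> Sp \<omega>" using AN(1) a bU by blast+
          next
            fix q assume "q \<in> N a \<inter> N b"
            then show "\<phi> q = proj_action (A a) q" "\<phi> q = proj_action (A b) q" using AN(5)[OF a] AN(5)[OF bU] by blast+
          qed
        qed
        then show "eventually (\<lambda>b. proj_action (A a) = proj_action (A b)) (at a within U)"
          unfolding eventually_at_topological using AN(2,3)[OF a] by blast
      qed
    qed
    have "\<phi> p = proj_action (A p0) p" if p: "p \<in> U" for p
      using AN(5)[OF p AN(3)[OF p]] const[OF p] by simp
    then show ?thesis using AN(1)[OF p0] by blast
  qed
qed

end

subsection \<open>Curvature identities in a parallel frame\<close>

text \<open>The structure equations of a parallel adapted frame: its brackets are minus the torsion,
  which is the exterior derivative of \<theta>, with components \<open>k\<close>, times the Reeb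
  field \<open>T\<close>.\<close>

locale parallel_frame = symp \<omega> for \<omega> :: "real ^ 'm::finite ^ 'm" +
  fixes W :: "'m ix projspace set" and X :: "'m \<Rightarrow> 'm ix vfield" and T :: "'m ix vfield"
    and k :: "'m \<Rightarrow> 'm \<Rightarrow> 'm ix projspace \<Rightarrow> real"
  assumes W_open: "open W" and X_field: "vector_field W (X i)" and T_field: "vector_field W T"
    and k_smooth: "smooth_fun W (k i j)"
    and k_skew: "p \<in> W \<Longrightarrow> k i j p = - k j i p"
    and k_det: "p \<in> W \<Longrightarrow> det (\<chi> i j. k i j p) \<noteq> 0"
    and k_const: "p \<in> W \<Longrightarrow> X l p (k i j) = 0"
    and bracket_XX: "p \<in> W \<Longrightarrow> bracket (X i) (X j) p = (\<lambda>f. - k i j p * T p f)"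
    and bracket_TX: "p \<in> W \<Longrightarrow> bracket T (X i) p = (\<lambda>f. 0)"
begin

lemma X_tangent: "p \<in> W \<Longrightarrow> X i p \<in> tangent p" and T_tangent: "p \<in> W \<Longrightarrow> T p \<in> tangent p"
  by (rule vector_field_tangent[OF X_field], assumption) (rule vector_field_tangent[OF T_field])

lemma commute_XX:
  assumes "smooth_fun W g" "p \<in> W"
  shows "dv (X i p) (\<lambda>q. dv (X j q) g) - dv (X j p) (\<lambda>q. dv (X i q) g) = - k i j p *\<^sub>R dv (T p) g"
  unfolding dv_bracket[OF assms(1) W_open assms(2), symmetric] bracket_XX[OF assms(2)] dv_cmul ..

lemma commute_TX:
  assumes "smooth_fun W g" "p \<in> W"
  shows "dv (T p) (\<lambda>q. dv (X i q) g) = dv (X i p) (\<lambda>q. dv (T q) g)"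
  using dv_bracket[OF assms(1) W_open assms(2), of T "X i"] unfolding bracket_TX[OF assms(2)] dv_zero by simp

end

text \<open>Such \<open>f\<close> are the local frames \<open>\<sigma>\<close> and \<open>\<Phi> \<circ> \<sigma>\<close> of the cone; the lowest order part of
  \<open>X\<^sub>i (X\<^sub>j f)\<close> is then determined by the other structure functions.\<close>

locale framed_map = parallel_frame \<omega> W X T k
  for \<omega> :: "real ^ 'm::finite ^ 'm" and W X T k +
  fixes f :: "'m ix projspace \<Rightarrow> real ^ 'm ix" and c :: real
    and S :: "'m \<Rightarrow> 'm \<Rightarrow> 'm \<Rightarrow> 'm ix projspace \<Rightarrow> real" and lam :: "'m \<Rightarrow> 'm \<Rightarrow> 'm ix projspace \<Rightarrow> real"
  assumes c: "c * c = 1" and f_smooth: "smooth_fun W f"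
    and S_smooth: "smooth_fun W (S i j l)" and lam_smooth: "smooth_fun W (lam i j)"
    and f_X: "p \<in> W \<Longrightarrow> Om (f p) (dv (X i p) f) = 0"
    and f_T: "p \<in> W \<Longrightarrow> Om (f p) (dv (T p) f) = 2 * c"
    and T_X: "p \<in> W \<Longrightarrow> Om (dv (T p) f) (dv (X i p) f) = 0"
    and X_X: "p \<in> W \<Longrightarrow> Om (dv (X i p) f) (dv (X j p) f) = c * k i j p"
    and struct_eq: "p \<in> W \<Longrightarrow> dv (X i p) (\<lambda>q. dv (X j q) f) =
      (\<Sum>l\<in>UNIV. S i j l p *\<^sub>R dv (X l p) f) + lam i j p *\<^sub>R f p - (k i j p / 2) *\<^sub>R dv (T p) f"
begin

abbreviation g :: "'m \<Rightarrow> 'm ix projspace \<Rightarrow> real ^ 'm ix" where "g i \<equiv> \<lambda>q. dv (X i q) f"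
abbreviation g0 :: "'m ix projspace \<Rightarrow> real ^ 'm ix" where "g0 \<equiv> \<lambda>q. dv (T q) f"

lemma g_smooth: "smooth_fun W (g i)" and g0_smooth: "smooth_fun W g0"
  by (rule vector_field_smooth_dv[OF X_field W_open order_refl f_smooth],
      rule vector_field_smooth_dv[OF T_field W_open order_refl f_smooth])

lemma c_nz: "c \<noteq> 0" using c by auto

lemma pairings:
  assumes "p \<in> W"
  shows "Om (f p) (g i p) = 0" "Om (g i p) (f p) = 0" "Om (f p) (g0 p) = 2 * c" "Om (g0 p) (f p) = - (2 * c)"
    "Om (g0 p) (g i p) = 0" "Om (g i p) (g0 p) = 0" "Om (g i p) (g j p) = c * k i j p"
  using f_X[OF assms] f_T[OF assms] T_X[OF assms] X_X[OF assms]
    Om_skew[of "g i p" "f p"] Om_skew[of "g0 p" "f p"] Om_skew[of "g i p" "g0 p"] by simp_all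

lemma pairings_comb:
  assumes "p \<in> W"
  defines "z \<equiv> \<lambda>a b d. (\<Sum>l\<in>UNIV. a l *\<^sub>R g l p) + b *\<^sub>R f p + d *\<^sub>R g0 p"
  shows "Om (z a b d) (f p) = - 2 * c * d" "Om (z a b d) (g0 p) = 2 * c * b"
    "Om (z a b d) (g j p) = c * (\<Sum>l\<in>UNIV. a l * k l j p)"
  by (simp_all add: z_def Om.add_left Om.sum_left Om.scaleR_left pairings[OF assms(1)] sum_distrib_left mult_ac)

text \<open>The pairings of \<open>f\<close>, \<open>g0\<close> and the \<open>g l\<close> form a
  hyperbolic plane and the invertible block \<open>k\<close>. So these vectors are a basis, and the
  identities below arise by comparing coefficients in it.\<close>

lemma independent:
  assumes p: "p \<in> W" and z: "(\<Sum>l\<in>UNIV. a l *\<^sub>R g l p) + b *\<^sub>R f p + d *\<^sub>R g0 p = 0"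
  shows "a l = 0" "b = 0" "d = 0"
proof -
  note P = pairings_comb[OF p, of a b d, unfolded z Om.zero_left]
  show "b = 0" "d = 0" using P(1,2) c_nz by simp_all
  have "(\<Sum>l\<in>UNIV. a l * k l j p) = 0" for j using P(3)[of j] c_nz by simp
  then show "a l = 0" by (rule row_kernel[OF k_det[OF p]])
qed

lemma nondegenerate:
  assumes p: "p \<in> W" and z: "Om z (f p) = 0" "Om z (g0 p) = 0" "\<And>i. Om z (g i p) = 0"
  shows "z = 0"
proof -
  define L where "L = (\<lambda>x :: real ^ 'm ix. (\<Sum>l\<in>UNIV. x $ Some (Some l) *\<^sub>R g l p) + x $ None *\<^sub>R f p + x $ Some None *\<^sub>R g0 p)"
  have lin: "linear L"
    unfolding L_def
    by (intro linearI) (simp_all add: scaleR_add_left sum.distrib scaleR_right_distrib scaleR_sum_right)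
  have "inj L"
  proof (rule linear_injective_0[OF lin, THEN iffD2], intro allI impI)
    fix x assume "L x = 0"
    note I = independent[OF p this[unfolded L_def]]
    have "x $ a = 0" for a
    proof (cases a)
      case (Some b)
      then show ?thesis using I(1,3) by (cases b) simp_all
    qed (use I(2) in simp)
    then show "x = 0" by (simp add: vec_eq_iff)
  qed
  then have surj: "surj L" by (rule linear_inj_imp_surj[OF lin])
  show ?thesis
  proof (rule Om_eqI)
    fix w
    obtain x where "w = L x" using surj by (metis surjD)
    then show "Om z w = Om 0 w"
      by (simp add: L_def Om.add_right Om.sum_right Om.scaleR_right z Om.zero_left)
  qed
qed

text \<open>The \<open>g0\<close> term of \<open>struct_eq\<close> already accounts for the whole
  commutator of two frame fields, so the other coefficients have no skew part.\<close>

lemma struct_sym: assumes p: "p \<in> W" shows "S i j l p = S j i l p" "lam i j p = lam j i p"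
proof -
  have "(\<Sum>l\<in>UNIV. (S i j l p - S j i l p) *\<^sub>R g l p) + (lam i j p - lam j i p) *\<^sub>R f p + 0 *\<^sub>R g0 p = 0"
  proof -
    have "a - a' + (b - b') + 0 *\<^sub>R g0 p = 0"
      if "a + b - (x / 2) *\<^sub>R v - (a' + b' - (- x / 2) *\<^sub>R v) = - x *\<^sub>R v" for a b a' b' v :: "real ^ 'm ix" and x
    proof -
      have "x *\<^sub>R v = (x / 2) *\<^sub>R v + (x / 2) *\<^sub>R v" by (simp add: scaleR_add_left[symmetric])
      then show ?thesis using that by (simp add: algebra_simps)
    qed
    from this[OF commute_XX[OF f_smooth p, of i j, unfolded struct_eq[OF p] k_skew[OF p, of j i]]]
    show ?thesis by (simp add: sum_subtractf scaleR_diff_left)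
  qed
  from independent(1,2)[OF p this] show "S i j l p = S j i l p" "lam i j p = lam j i p" by simp_all
qed

lemma Om_derivative:
  assumes "p \<in> W" "smooth_fun W a" "smooth_fun W b" "\<And>q. q \<in> W \<Longrightarrow> Om (a q) (b q) = h q"
  shows "X i p h = Om (a p) (dv (X i p) b) + Om (dv (X i p) a) (b p)"
  using tvec_bilinear[OF bounded_bilinear_Om X_tangent[OF assms(1)] assms(1) W_open assms(2,3)]
    fun_tvec_cong[OF X_tangent[OF assms(1)] W_open assms(1), of "\<lambda>q. Om (a q) (b q)" h] assms(4) by simp

text \<open>Constancy of \<open>k\<close> along the frame puts \<open>S i\<close> into the
  symplectic Lie algebra of \<open>k\<close>, whose elements are traceless.\<close>

lemma trace_S: assumes p: "p \<in> W" shows "(\<Sum>l\<in>UNIV. S i l l p) = 0"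
proof (rule symplectic_trace_sum[where k = "\<lambda>i j. k i j p" and M = "\<lambda>j r. S i j r p", OF k_skew[OF p] k_det[OF p]])
  fix j l
  have Sk: "Om (dv (X i p) (g j)) (g l p) = c * (\<Sum>r\<in>UNIV. S i j r p * k r l p)" for j l
    unfolding struct_eq[OF p] using pairings_comb(3)[OF p, of "\<lambda>l. S i j l p" "lam i j p" "- k i j p / 2" l] by simp
  have "X i p (\<lambda>q. c * k j l q) = 0"
    using tvec_cmul[OF X_tangent[OF p] p W_open k_smooth] k_const[OF p] by simp
  then have "Om (g j p) (dv (X i p) (g l)) + Om (dv (X i p) (g j)) (g l p) = 0"
    using Om_derivative[OF p g_smooth g_smooth, of j l "\<lambda>q. c * k j l q" i] X_X by simp
  then have "Om (dv (X i p) (g j)) (g l p) = Om (dv (X i p) (g l)) (g j p)"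
    using Om_skew[of "g j p" "dv (X i p) (g l)"] by simp
  then show "(\<Sum>r\<in>UNIV. S i j r p * k r l p) = (\<Sum>r\<in>UNIV. S i l r p * k r j p)"
    unfolding Sk using c_nz by simp
qed

text \<open>Twice \<open>lam\<close> with one index raised by \<open>k\<close>; by
  \<open>derivative_g0\<close> these are the components of the derivative of \<open>g0\<close> along
  the frame.\<close>

definition N :: "'m \<Rightarrow> 'm \<Rightarrow> 'm ix projspace \<Rightarrow> real" where
  "N j r p = (\<Sum>l\<in>UNIV. 2 * lam j l p * matrix_inv (\<chi> i j. k i j p) $ l $ r)"

lemma N_k: assumes p: "p \<in> W" shows "(\<Sum>r\<in>UNIV. N j r p * k r l p) = 2 * lam j l p"
proof -
  let ?K = "\<chi> i j. k i j p"
  have "(\<Sum>r\<in>UNIV. N j r p * k r l p) = (\<Sum>r\<in>UNIV. \<Sum>i\<in>UNIV. 2 * lam j i p * (matrix_inv ?K $ i $ r * k r l p))"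
    unfolding N_def sum_distrib_right by (simp add: mult.assoc)
  also have "\<dots> = (\<Sum>i\<in>UNIV. 2 * lam j i p * (matrix_inv ?K ** ?K) $ i $ l)"
    by (subst sum.swap) (simp add: matrix_matrix_mult_def sum_distrib_left)
  also have "\<dots> = 2 * lam j l p"
    unfolding matrix_inv_mult(2)[OF k_det[OF p]] by (simp add: mat_def if_distrib cong: if_cong)
  finally show ?thesis .
qed

lemma trace_N: assumes p: "p \<in> W" shows "(\<Sum>l\<in>UNIV. N l l p) = 0"
  by (rule symplectic_trace_sum[where k = "\<lambda>i j. k i j p" and M = "\<lambda>j r. N j r p", OF k_skew[OF p] k_det[OF p]])
    (simp only: N_k[OF p] struct_sym(2)[OF p])

text \<open>Differentiating the constant pairings of \<open>g0\<close> with \<open>f\<close> and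
  with the \<open>g l\<close> gives the pairings of the derivative, and \<open>nondegenerate\<close>
  reads off its coefficients. Only those of the \<open>g r\<close> are compared later, so \<nu>
  stays existential.\<close>

lemma derivative_g0:
  assumes p: "p \<in> W"
  shows "\<exists>\<nu>. dv (X j p) g0 = (\<Sum>r\<in>UNIV. N j r p *\<^sub>R g r p) + \<nu> *\<^sub>R f p"
proof -
  have XS: "X j p (\<lambda>q. x) = 0" for x by (rule tvec_const[OF X_tangent[OF p]])
  have 1: "Om (dv (X j p) g0) (f p) = 0"
    using Om_derivative[OF p g0_smooth f_smooth, of "\<lambda>q. - (2 * c)" j] pairings(4,5)[of p] p XS pairings(4) by simp
  have 2: "Om (dv (X j p) g0) (g l p) = 2 * c * lam j l p" for l
  proof -
    have "Om (g0 p) (dv (X j p) (g l)) + Om (dv (X j p) g0) (g l p) = 0"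
      using Om_derivative[OF p g0_smooth g_smooth, of l "\<lambda>q. 0" j] T_X XS by simp
    moreover have "Om (g0 p) (dv (X j p) (g l)) = - (2 * c * lam j l p)"
      unfolding struct_eq[OF p]
      by (simp add: Om.add_right Om.diff_right Om.sum_right Om.scaleR_right pairings[OF p])
    ultimately show ?thesis by simp
  qed
  \<comment> \<open>Solves for the coefficient of \<open>f p\<close> by pairing with
    \<open>g0 p\<close>, using \<open>Om (f p) (g0 p) = 2 * c\<close> and
    \<open>c * c = 1\<close>.\<close>
  define \<nu> where "\<nu> = c / 2 * Om (dv (X j p) g0) (g0 p)"
  have "dv (X j p) g0 - ((\<Sum>r\<in>UNIV. N j r p *\<^sub>R g r p) + \<nu> *\<^sub>R f p) = 0"
  proof (rule nondegenerate[OF p])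
    note P = pairings_comb[OF p, of "\<lambda>r. N j r p" \<nu> 0, unfolded scaleR_zero_left add_0_right]
    show "Om (dv (X j p) g0 - ((\<Sum>r\<in>UNIV. N j r p *\<^sub>R g r p) + \<nu> *\<^sub>R f p)) (f p) = 0"
      unfolding Om.diff_left P 1 by simp
    show "Om (dv (X j p) g0 - ((\<Sum>r\<in>UNIV. N j r p *\<^sub>R g r p) + \<nu> *\<^sub>R f p)) (g0 p) = 0"
      unfolding Om.diff_left P unfolding \<nu>_def using c by (simp add: mult.assoc[symmetric])
    show "Om (dv (X j p) g0 - ((\<Sum>r\<in>UNIV. N j r p *\<^sub>R g r p) + \<nu> *\<^sub>R f p)) (g l p) = 0" for l
      unfolding Om.diff_left P 2 N_k[OF p] by simp
  qed
  then show ?thesis by (auto simp: algebra_simps)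
qed

text \<open>Only the coefficients of the \<open>g m\<close> are kept. The \<open>lam\<close> term
  arises from differentiating \<open>f\<close>, the \<open>N\<close> term from differentiating
  \<open>g0\<close>.\<close>

lemma third_derivative:
  assumes p: "p \<in> W"
  shows "\<exists>b d. dv (X l p) (\<lambda>q. dv (X i q) (g j)) =
    (\<Sum>m\<in>UNIV. (X l p (S i j m) + (\<Sum>r\<in>UNIV. S i j r p * S l r m p) + (if m = l then lam i j p else 0)
      - k i j p / 2 * N l m p) *\<^sub>R g m p) + b *\<^sub>R f p + d *\<^sub>R g0 p"
proof -
  note tX = X_tangent[OF p, of l]
  obtain \<nu> where \<nu>: "dv (X l p) g0 = (\<Sum>r\<in>UNIV. N l r p *\<^sub>R g r p) + \<nu> *\<^sub>R f p" using derivative_g0[OF p] by blast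
  have s1: "smooth_fun W (\<lambda>q. S i j r q *\<^sub>R g r q)" for r
    by (rule smooth_fun_scaleR[OF W_open S_smooth g_smooth])
  have s2: "smooth_fun W (\<lambda>q. \<Sum>r\<in>UNIV. S i j r q *\<^sub>R g r q)" by (rule smooth_fun_sum[OF W_open s1])
  have s3: "smooth_fun W (\<lambda>q. lam i j q *\<^sub>R f q)" by (rule smooth_fun_scaleR[OF W_open lam_smooth f_smooth])
  have s4: "smooth_fun W (\<lambda>q. (- 1 / 2) * k i j q)"
    by (rule smooth_fun_mult[OF W_open smooth_fun_const[OF W_open] k_smooth])
  have s5: "smooth_fun W (\<lambda>q. ((- 1 / 2) * k i j q) *\<^sub>R g0 q)" by (rule smooth_fun_scaleR[OF W_open s4 g0_smooth])
  have k0: "X l p (\<lambda>q. (- 1 / 2) * k i j q) = 0"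
    using tvec_cmul[OF tX p W_open k_smooth, of "- 1 / 2" i j] k_const[OF p] by simp
  have e: "dv (X l p) (\<lambda>q. dv (X i q) (g j))
      = dv (X l p) (\<lambda>q. (\<Sum>r\<in>UNIV. S i j r q *\<^sub>R g r q) + lam i j q *\<^sub>R f q + ((- 1 / 2) * k i j q) *\<^sub>R g0 q)"
    by (rule dv_cong[OF tX W_open p]) (simp add: struct_eq)
  have Sg: "dv (X l p) (\<lambda>q. \<Sum>r\<in>UNIV. S i j r q *\<^sub>R g r q)
      = (\<Sum>r\<in>UNIV. S i j r p *\<^sub>R dv (X l p) (g r)) + (\<Sum>r\<in>UNIV. X l p (S i j r) *\<^sub>R g r p)"
    unfolding dv_sum_fun[OF tX p W_open s1] dv_scaleR_fun[OF tX p W_open S_smooth g_smooth] sum.distrib ..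
  have SS: "(\<Sum>r\<in>UNIV. S i j r p *\<^sub>R dv (X l p) (g r)) =
      (\<Sum>m\<in>UNIV. (\<Sum>r\<in>UNIV. S i j r p * S l r m p) *\<^sub>R g m p)
      + (\<Sum>r\<in>UNIV. S i j r p * lam l r p) *\<^sub>R f p - (\<Sum>r\<in>UNIV. S i j r p * (k l r p / 2)) *\<^sub>R g0 p"
  proof -
    have "(\<Sum>r\<in>UNIV. S i j r p *\<^sub>R (\<Sum>m\<in>UNIV. S l r m p *\<^sub>R g m p)) = (\<Sum>m\<in>UNIV. (\<Sum>r\<in>UNIV. S i j r p * S l r m p) *\<^sub>R g m p)"
      unfolding scaleR_sum_right scaleR_sum_left by (subst sum.swap) simp
    then show ?thesis
      unfolding struct_eq[OF p] scaleR_diff_right scaleR_add_right sum_subtractf sum.distrib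
      by (simp add: scaleR_sum_left)
  qed
  have gl: "lam i j p *\<^sub>R g l p = (\<Sum>m\<in>UNIV. (if m = l then lam i j p else 0) *\<^sub>R g m p)"
    by (simp add: if_distrib[of "\<lambda>x. x *\<^sub>R _"] cong: if_cong)
  have "dv (X l p) (\<lambda>q. dv (X i q) (g j)) =
      (\<Sum>m\<in>UNIV. (\<Sum>r\<in>UNIV. S i j r p * S l r m p) *\<^sub>R g m p) + (\<Sum>m\<in>UNIV. X l p (S i j m) *\<^sub>R g m p)
      + (\<Sum>m\<in>UNIV. (if m = l then lam i j p else 0) *\<^sub>R g m p) - (\<Sum>m\<in>UNIV. (k i j p / 2 * N l m p) *\<^sub>R g m p)
      + ((\<Sum>r\<in>UNIV. S i j r p * lam l r p) + X l p (lam i j) - k i j p / 2 * \<nu>) *\<^sub>R f p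
      + (- (\<Sum>r\<in>UNIV. S i j r p * (k l r p / 2))) *\<^sub>R g0 p"
    unfolding e dv_add_fun[OF tX p W_open smooth_fun_add[OF W_open s2 s3] s5] dv_add_fun[OF tX p W_open s2 s3] Sg SS
      dv_scaleR_fun[OF tX p W_open lam_smooth f_smooth] dv_scaleR_fun[OF tX p W_open s4 g0_smooth] k0 \<nu> gl[symmetric]
    by (simp add: algebra_simps scaleR_sum_right sum_negf)
  also have "\<dots> = (\<Sum>m\<in>UNIV. (X l p (S i j m) + (\<Sum>r\<in>UNIV. S i j r p * S l r m p) + (if m = l then lam i j p else 0)
      - k i j p / 2 * N l m p) *\<^sub>R g m p) + ((\<Sum>r\<in>UNIV. S i j r p * lam l r p) + X l p (lam i j) - k i j p / 2 * \<nu>) *\<^sub>R f p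
      + (- (\<Sum>r\<in>UNIV. S i j r p * (k l r p / 2))) *\<^sub>R g0 p"
    by (simp only: scaleR_add_left scaleR_diff_left sum.distrib sum_subtractf add_ac)
  finally show ?thesis by blast
qed

text \<open>The coefficient of \<open>g m\<close> in the commutator of \<open>X l\<close> and
  \<open>X i\<close> applied to \<open>g j\<close>. The bracket relation turns that commutator into
  \<open>- k l i p\<close> times the derivative of \<open>g j\<close> along \<open>T\<close>, which
  equals the derivative of \<open>g0\<close> along \<open>X j\<close>.\<close>

lemma curvature_coefficient:
  assumes p: "p \<in> W"
  defines "A \<equiv> \<lambda>l i j m. X l p (S i j m) + (\<Sum>r\<in>UNIV. S i j r p * S l r m p) + (if m = l then lam i j p else 0)
      - k i j p / 2 * N l m p"
  shows "A l i j m - A i l j m = - k l i p * N j m p"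
proof -
  obtain b d where 1: "dv (X l p) (\<lambda>q. dv (X i q) (g j)) = (\<Sum>m\<in>UNIV. A l i j m *\<^sub>R g m p) + b *\<^sub>R f p + d *\<^sub>R g0 p"
    using third_derivative[OF p, of l i j] unfolding A_def by blast
  obtain b' d' where 2: "dv (X i p) (\<lambda>q. dv (X l q) (g j)) = (\<Sum>m\<in>UNIV. A i l j m *\<^sub>R g m p) + b' *\<^sub>R f p + d' *\<^sub>R g0 p"
    using third_derivative[OF p, of i l j] unfolding A_def by blast
  obtain \<nu> where 3: "dv (T p) (g j) = (\<Sum>m\<in>UNIV. N j m p *\<^sub>R g m p) + \<nu> *\<^sub>R f p"
    using derivative_g0[OF p, of j] unfolding commute_TX[OF f_smooth p] by blast
  have "(\<Sum>m\<in>UNIV. (A l i j m - A i l j m + k l i p * N j m p) *\<^sub>R g m p) + (b - b' + k l i p * \<nu>) *\<^sub>R f p + (d - d') *\<^sub>R g0 p = 0"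
    using commute_XX[OF g_smooth p, of l i j] unfolding 1 2 3
    by (simp add: scaleR_add_left scaleR_diff_left sum.distrib sum_subtractf scaleR_sum_right sum_negf algebra_simps)
  from independent(1)[OF p this, of m] show ?thesis by simp
qed

text \<open>The trace \<open>m = l\<close> of \<open>curvature_coefficient\<close>, summed over
  \<open>l\<close>. The traces of \<open>S\<close> and \<open>N\<close> vanish;
  \<open>lam i j p\<close> collects the weight \<open>CARD('m)\<close> from the Kronecker delta,
  minus 1 from its swapped copy, plus 1 from the term \<open>k l j p / 2 * N i l p\<close>, and plus
  2 from the right side.\<close>

theorem lam_eq:
  assumes p: "p \<in> W"
  shows "(\<Sum>l\<in>UNIV. X l p (S i j l)) - (\<Sum>r\<in>UNIV. \<Sum>l\<in>UNIV. S r i l p * S l j r p) + (real CARD('m) + 2) * lam i j p = 0"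
proof -
  have "(\<Sum>l\<in>UNIV. X l p (S i j l) + (\<Sum>r\<in>UNIV. S i j r p * S l r l p) + lam i j p - k i j p / 2 * N l l p
      - (X i p (S l j l) + (\<Sum>r\<in>UNIV. S l j r p * S i r l p) + (if l = i then lam l j p else 0) - k l j p / 2 * N i l p))
    = (\<Sum>l\<in>UNIV. - k l i p * N j l p)"
    by (rule sum.cong[OF refl]) (use curvature_coefficient[OF p, of l i j l for l] in \<open>simp only: simp_thms if_True\<close>)
  moreover have "(\<Sum>l\<in>UNIV. \<Sum>r\<in>UNIV. S i j r p * S l r l p) = 0"
  proof -
    have "(\<Sum>l\<in>UNIV. \<Sum>r\<in>UNIV. S i j r p * S l r l p) = (\<Sum>r\<in>UNIV. S i j r p * (\<Sum>l\<in>UNIV. S r l l p))"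
      unfolding sum_distrib_left by (subst sum.swap) (simp only: struct_sym(1)[OF p])
    then show ?thesis using trace_S[OF p] by simp
  qed
  moreover have "(\<Sum>l\<in>UNIV. X i p (S l j l)) = 0"
  proof -
    have "(\<Sum>l\<in>UNIV. X i p (S l j l)) = X i p (\<lambda>q. \<Sum>l\<in>UNIV. S l j l q)"
      by (rule tvec_sum_fun[OF X_tangent[OF p] p W_open S_smooth, symmetric])
    also have "\<dots> = X i p (\<lambda>q. 0)"
      by (rule fun_tvec_cong[OF X_tangent[OF p] W_open p]) (simp only: struct_sym(1)[of _ _ j] trace_S)
    finally show ?thesis using tvec_const[OF X_tangent[OF p]] by simp
  qed
  moreover have "(\<Sum>l\<in>UNIV. k i j p / 2 * N l l p) = 0"
    unfolding sum_distrib_left[symmetric] trace_N[OF p] by simp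
  moreover have "(\<Sum>l\<in>UNIV. k l j p / 2 * N i l p) = lam i j p" "(\<Sum>l\<in>UNIV. - k l i p * N j l p) = - 2 * lam i j p"
  proof -
    have "(\<Sum>l\<in>UNIV. k l j p / 2 * N i l p) = (\<Sum>l\<in>UNIV. N i l p * k l j p) / 2"
      unfolding sum_divide_distrib by (simp add: mult.commute)
    then show "(\<Sum>l\<in>UNIV. k l j p / 2 * N i l p) = lam i j p" unfolding N_k[OF p] by simp
    have "(\<Sum>l\<in>UNIV. - k l i p * N j l p) = - (\<Sum>l\<in>UNIV. N j l p * k l i p)"
      unfolding sum_negf[symmetric] by (simp add: mult.commute)
    then show "(\<Sum>l\<in>UNIV. - k l i p * N j l p) = - 2 * lam i j p"
      unfolding N_k[OF p] using struct_sym(2)[OF p, of i j] by simp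
  qed
  moreover have "(\<Sum>l\<in>UNIV. \<Sum>r\<in>UNIV. S l j r p * S i r l p) = (\<Sum>r\<in>UNIV. \<Sum>l\<in>UNIV. S r i l p * S l j r p)"
    by (subst sum.swap) (simp only: struct_sym(1)[OF p, of i] mult.commute)
  moreover have "(\<Sum>l\<in>UNIV. if l = i then lam l j p else 0) = lam i j p" by simp
  ultimately show ?thesis
    by (simp add: sum.distrib sum_subtractf algebra_simps)
qed

end

subsection \<open>Parallel adapted coframes of the flat structure\<close>

locale parallel_coframe = root_section \<omega> W \<sigma> s \<theta>
  for \<omega> :: "real ^ 'm::finite ^ 'm" and W \<sigma> s \<theta> +
  fixes nabla :: "'m ix conn" and ch :: "'m option \<Rightarrow> 'm ix oneform" and E :: "'m option \<Rightarrow> 'm ix vfield"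
  assumes rep: "representative W (flat_contact_geodesic \<omega>) \<theta> nabla"
    and adapted: "adapted_coframe W \<theta> ch E"
    and parallel: "p \<in> W \<Longrightarrow> v \<in> tangent p \<Longrightarrow> nabla p v (E \<alpha>) = (\<lambda>f. 0)"
begin

abbreviation e :: "'m \<Rightarrow> 'm ix projspace \<Rightarrow> real ^ 'm ix" where "e i \<equiv> \<lambda>q. dv (E (Some i) q) \<sigma>"

text \<open>The components of the exterior derivative of \<theta> in the frame, by
  \<open>ext_deriv_eq\<close>.\<close>

definition kappa :: "'m \<Rightarrow> 'm \<Rightarrow> 'm ix projspace \<Rightarrow> real" where "kappa i j q = s * Om (e i q) (e j q)"

text \<open>The \<sigma>-component of the second derivatives of \<sigma> along the frame;
  \<open>sec_coeff_zero\<close> shows that it vanishes.\<close>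

definition sec_coeff :: "'m \<Rightarrow> 'm \<Rightarrow> 'm ix projspace \<Rightarrow> real" where
  "sec_coeff i j q = s / 2 * Om (dv (E (Some i) q) (e j)) (t q)"

lemma E_field: "vector_field W (E \<alpha>)" and ch_form: "one_form W (ch \<alpha>)"
  using adapted unfolding adapted_coframe_def by blast+

lemma E_tangent: "p \<in> W \<Longrightarrow> E \<alpha> p \<in> tangent p"
  by (rule vector_field_tangent[OF E_field])

lemma E_None: "p \<in> W \<Longrightarrow> E None p = T p"
  by (rule coframe_Reeb(1)[OF W_open order_refl adapted])

lemma dv_E_None: "p \<in> W \<Longrightarrow> dv (E None p) \<sigma> = t p"
  using E_None dv_T by simp

lemma e_smooth: "smooth_fun W (e i)"
  by (rule field_smooth[OF W_open order_refl E_field])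

lemma de_smooth: "smooth_fun W (\<lambda>q. dv (E \<alpha> q) (e j))"
  by (rule vector_field_smooth_dv[OF E_field W_open order_refl e_smooth])

lemma e_perp:
  assumes "p \<in> W"
  shows "Om (\<sigma> p) (e i p) = 0" "Om (t p) (e i p) = 0" "Om (e i p) (\<sigma> p) = 0" "Om (e i p) (t p) = 0"
  using coframe_K[OF W_open order_refl adapted assms, of i] Om_skew[of "e i p"] by (simp_all add: K_def)

lemma e_contact: "p \<in> W \<Longrightarrow> E (Some i) p \<in> contact_plane \<omega> p"
  using contact_plane_eq E_tangent e_perp(1) by simp

lemma kappa_smooth: "smooth_fun W (kappa i j)" and sec_coeff_smooth: "smooth_fun W (sec_coeff i j)"
  unfolding kappa_def sec_coeff_def
  by (intro smooth_fun_mult[OF W_open] smooth_fun_const[OF W_open] smooth_fun_bilinear[OF bounded_bilinear_Om W_open]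
      e_smooth de_smooth t_smooth)+

text \<open>Parallelism for the flat representative says that \<open>pi\<close> of the derivative
  vanishes, which leaves multiples of \<open>\<sigma> p\<close> and \<open>t p\<close>. The second
  one is the \<theta>-component, found by differentiating \<open>th q (e j q) = 0\<close>.\<close>

lemma derivative_e:
  assumes p: "p \<in> W"
  shows "dv (E (Some i) p) (e j) = sec_coeff i j p *\<^sub>R \<sigma> p - (kappa i j p / 2) *\<^sub>R t p"
proof -
  let ?v = "E (Some i) p" and ?d = "dv (E (Some i) p) (e j)"
  have tv: "?v \<in> tangent p" by (rule E_tangent[OF p])
  have z: "?v (\<lambda>q. th q (e j q)) = 0"
    using fun_tvec_cong[OF tv W_open p, of "\<lambda>q. th q (e j q)" "\<lambda>q. 0"] tvec_const[OF tv] e_perp(1)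
    by (simp add: th_def)
  have "dproj (\<sigma> p) (pi p ?d + ?v (\<lambda>q. th q (e j q)) *\<^sub>R t p) = (\<lambda>f. 0)"
    unfolding flat_on_H[where Y = "E (Some j)" and v = "E (Some i) p", OF W_open order_refl rep W_open order_refl p e_contact[OF p] E_field e_contact[OF p], symmetric]
    by (rule parallel[OF p tv])
  then have "dproj (\<sigma> p) (pi p ?d) = (\<lambda>f. 0)" unfolding z by simp
  then obtain c where c: "pi p ?d = c *\<^sub>R \<sigma> p" using dproj_eq_zeroD[OF sec_nonzero[OF p]] by blast
  have "c = 0" using Om_pi(2)[OF p, of ?d] Om_t_sec(1)[OF p] unfolding c by (simp add: Om.scaleR_right)
  then have "?d = sec_coeff i j p *\<^sub>R \<sigma> p + th p ?d *\<^sub>R t p" using c by (simp add: pi_def sec_coeff_def diff_eq_eq add.commute)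
  moreover have "th p ?d = - (kappa i j p / 2)"
    using tvec_theta(2)[OF W_open order_refl E_field E_field p, of "Some i" "Some j"] unfolding z
    by (simp add: kappa_def)
  ultimately show ?thesis by simp
qed

lemma bracket_E:
  assumes p: "p \<in> W"
  shows "bracket (E (Some i)) (E (Some j)) p = (\<lambda>f. - kappa i j p * E None p f)"
proof -
  note s0 = sec_nonzero[OF p]
  have k: "kappa j i p = - kappa i j p" unfolding kappa_def using Om_skew[of "e j p" "e i p"] by simp
  have "bracket (E (Some i)) (E (Some j)) p = dproj (\<sigma> p) (- kappa i j p *\<^sub>R t p + (sec_coeff i j p - sec_coeff j i p) *\<^sub>R \<sigma> p)"
    unfolding bracket_dproj[OF W_open order_refl E_field E_field p] derivative_e[OF p] k
    by (rule arg_cong[of _ _ "dproj (\<sigma> p)"]) (simp add: vec_eq_iff field_simps)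
  also have "\<dots> = (\<lambda>f. - kappa i j p * T p f)"
    unfolding dproj_add_self[OF s0] T_def dproj_cmul[OF s0] ..
  finally show ?thesis unfolding E_None[OF p] .
qed

text \<open>For parallel fields the torsion is minus the bracket, and the normalization of a
  representative makes the torsion with the Reeb field vanish.\<close>

lemma bracket_E_None:
  assumes p: "p \<in> W"
  shows "bracket (E None) (E (Some i)) p = (\<lambda>f. 0)"
proof -
  have "torsion nabla (E None) (E (Some i)) p = (\<lambda>f. (- 1) * bracket (E None) (E (Some i)) p f)"
    by (simp add: torsion_def cov_def parallel[OF p E_tangent[OF p]])
  note ch0 = rep_torsion_Reeb[OF rep W_open order_refl adapted p, of _ i, unfolded this]
  have bt: "bracket (E None) (E (Some i)) p \<in> tangent p"
    by (rule bracket_tangent[OF W_open order_refl E_field E_field p])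
  show ?thesis
  proof (rule coframe_eqI[OF W_open order_refl adapted p bt zero_in_tangent])
    show "ch \<alpha> p (bracket (E None) (E (Some i)) p) = ch \<alpha> p (\<lambda>f. 0)" for \<alpha>
      using ch0[of \<alpha>] unfolding one_form_cmul[OF ch_form p bt] one_form_zero[OF ch_form p] by simp
  qed
qed

lemma kappa_const:
  assumes p: "p \<in> W"
  shows "E (Some l) p (kappa i j) = 0"
proof -
  note tv = E_tangent[OF p, of "Some l"]
  have "E (Some l) p (\<lambda>q. Om (e i q) (e j q)) = 0"
    unfolding tvec_bilinear[OF bounded_bilinear_Om tv p W_open e_smooth e_smooth] derivative_e[OF p]
    by (simp add: Om.diff_left Om.diff_right Om.scaleR_left Om.scaleR_right e_perp[OF p])
  then show ?thesis
    unfolding kappa_def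
    using tvec_cmul[OF tv p W_open smooth_fun_bilinear[OF bounded_bilinear_Om W_open e_smooth e_smooth], of s i j] by simp
qed

sublocale frame: parallel_frame \<omega> W "\<lambda>i. E (Some i)" "E None" kappa
proof
  fix p i j assume p: "p \<in> W"
  show "kappa i j p = - kappa j i p" unfolding kappa_def using Om_skew[of "e i p" "e j p"] by simp
next
  fix p assume p: "p \<in> W"
  have "(\<chi> i j. kappa i j p) = (\<chi> i. s *s (\<chi> i j. Om (e i p) (e j p)) $ i)"
    by (simp add: kappa_def vec_eq_iff)
  then show "det (\<chi> i j. kappa i j p) \<noteq> 0"
    using coframe_K_det[OF W_open order_refl adapted p] by (simp only: det_rows_mul) simp
qed (rule W_open E_field kappa_smooth kappa_const bracket_E bracket_E_None; assumption?)+

text \<open>\<sigma> itself satisfies the hypotheses of \<open>framed_map\<close> with vanishing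
  first order coefficients, so \<open>lam_eq\<close> reduces to \<open>CARD('m) + 2\<close> times
  \<open>sec_coeff\<close>.\<close>

lemma sec_coeff_zero:
  assumes "p \<in> W" shows "sec_coeff i j p = 0"
proof -
  interpret F: framed_map \<omega> W "\<lambda>i. E (Some i)" "E None" kappa \<sigma> s "\<lambda>i j l q. 0" sec_coeff
  proof
    show "s * s = 1" by simp
    show "smooth_fun W \<sigma>" by (rule sec_smooth)
    show "smooth_fun W (\<lambda>q. 0::real)" by (rule smooth_fun_const[OF W_open])
    show "smooth_fun W (sec_coeff i j)" for i j by (rule sec_coeff_smooth)
    fix p i j assume p: "p \<in> W"
    show "Om (\<sigma> p) (e i p) = 0" by (rule e_perp(1)[OF p])
    show "Om (\<sigma> p) (dv (E None p) \<sigma>) = 2 * s" unfolding dv_E_None[OF p] by (rule Om_t_sec(2)[OF p])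
    show "Om (dv (E None p) \<sigma>) (e i p) = 0" unfolding dv_E_None[OF p] by (rule e_perp(2)[OF p])
    show "Om (e i p) (e j p) = s * kappa i j p" by (simp add: kappa_def)
    show "dv (E (Some i) p) (e j) = (\<Sum>l\<in>UNIV. 0 *\<^sub>R e l p) + sec_coeff i j p *\<^sub>R \<sigma> p - (kappa i j p / 2) *\<^sub>R dv (E None p) \<sigma>"
      unfolding dv_E_None[OF p] by (simp add: derivative_e[OF p])
  qed
  have "E (Some l) p (\<lambda>q. 0) = 0" for l by (rule tvec_const[OF E_tangent[OF assms]])
  then show ?thesis using F.lam_eq[OF assms, of i j] by simp
qed

end

subsection \<open>The contact Schwarzian in a parallel coframe\<close>

lemma adapted_coframe_restrict:
  assumes "adapted_coframe V \<theta> ch E" "open V" "W \<subseteq> V" shows "adapted_coframe W \<theta> ch E"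
proof -
  have "one_form W \<eta>" if "one_form V \<eta>" for \<eta> :: "'a ix oneform"
    using that assms(3) unfolding one_form_def by (meson subset_iff subset_trans)
  moreover have "vector_field W X" if "vector_field V X" for X :: "'a ix vfield"
    by (rule vector_field_subset[OF that assms(3)])
  moreover have "reeb_field W \<theta> T" if "reeb_field V \<theta> T" for T :: "'a ix vfield"
    using that assms(3) vector_field_subset unfolding reeb_field_def by (meson subset_iff subset_trans)
  ultimately show ?thesis using assms(1,3) unfolding adapted_coframe_def by (meson subset_iff)
qed

locale schwarzian_frame = lift_section \<omega> W \<Phi> \<epsilon> Dom Ran \<phi> \<sigma> s \<theta> + parallel_coframe \<omega> W \<sigma> s \<theta> nabla ch E
  for \<omega> :: "real ^ 'm::finite ^ 'm" and W \<Phi> \<epsilon> Dom Ran \<phi> \<sigma> s \<theta> nabla ch E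
begin

definition S :: "'m \<Rightarrow> 'm \<Rightarrow> 'm \<Rightarrow> 'm ix projspace \<Rightarrow> real" where
  "S i j l q = ch (Some l) q (contact_schwarzian \<omega> Dom \<phi> q (E (Some i) q) (E (Some j) q))"

text \<open>The radial component of \<open>B\<close> (\<open>B_expand\<close>), invisible in the
  Schwarzian because \<open>dproj\<close> kills it; it becomes the zeroth order term of the
  system.\<close>

definition lam :: "'m \<Rightarrow> 'm \<Rightarrow> 'm ix projspace \<Rightarrow> real" where
  "lam i j q = s / 2 * Om (B (\<sigma> q) (e i q) (e j q)) (t q)"

abbreviation F :: "'m ix projspace \<Rightarrow> real ^ 'm ix" where "F \<equiv> \<lambda>q. \<Phi> (\<sigma> q)"

lemma section_cone: "p \<in> W \<Longrightarrow> \<sigma> p \<in> cone W"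
  by (rule sec_cone)

lemma Be_smooth: "smooth_fun W (\<lambda>q. B (\<sigma> q) (e i q) (e j q))"
  by (rule smooth_fun_B[OF W_open order_refl e_smooth e_smooth])

lemma S_eq:
  assumes p: "p \<in> W" shows "S i j l p = ch (Some l) p (dproj (\<sigma> p) (B (\<sigma> p) (e i p) (e j p)))"
  using schwarzian_eq[OF section_cone[OF p] e_perp(1)[OF p] e_perp(1)[OF p], of i j]
  unfolding S_def proj_sec[OF p] dproj_dv[OF p E_tangent[OF p]] by simp

lemma S_smooth: "smooth_fun W (S i j l)"
proof (rule smooth_fun_cong[OF W_open])
  have "vector_field W (\<lambda>q. dproj (\<sigma> q) (B (\<sigma> q) (e i q) (e j q)))"
    by (rule vector_field_dproj[OF W_open order_refl Be_smooth])
  then show "smooth_fun W (\<lambda>q. ch (Some l) q (dproj (\<sigma> q) (B (\<sigma> q) (e i q) (e j q))))"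
    using ch_form[of "Some l"] W_open unfolding one_form_def by blast
qed (simp add: S_eq)

lemma lam_smooth: "smooth_fun W (lam i j)"
  unfolding lam_def
  by (rule smooth_fun_mult[OF W_open smooth_fun_const[OF W_open] smooth_fun_bilinear[OF bounded_bilinear_Om W_open Be_smooth t_smooth]])

lemma B_expand:
  assumes p: "p \<in> W"
  shows "B (\<sigma> p) (e i p) (e j p) = (\<Sum>l\<in>UNIV. S i j l p *\<^sub>R e l p) + lam i j p *\<^sub>R \<sigma> p"
proof -
  let ?b = "B (\<sigma> p) (e i p) (e j p)"
  have b: "Om (\<sigma> p) ?b = 0" by (rule B_perp[OF section_cone[OF p]])
  have pb: "pi p ?b = ?b - lam i j p *\<^sub>R \<sigma> p" by (simp add: pi_def th_def b lam_def)
  have "dproj (\<sigma> p) (?b - lam i j p *\<^sub>R \<sigma> p) = dproj (\<sigma> p) ?b"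
    using dproj_add_self[OF sec_nonzero[OF p], of ?b "- lam i j p"] by simp
  then have "pi p ?b = (\<Sum>l\<in>UNIV. S i j l p *\<^sub>R e l p)"
    using coframe_K_expand[OF W_open order_refl adapted p pi_in_K[OF p], of ?b] unfolding pb S_eq[OF p] by simp
  then show ?thesis unfolding pb by (simp add: diff_eq_eq)
qed

lemma dv_F:
  assumes p: "p \<in> W" and v: "v \<in> tangent p" shows "dv v F = fd \<Phi> (\<sigma> p) (dv v \<sigma>)"
  by (rule dv_compose[OF v p W_open sec_smooth Phi_smooth open_C section_cone])

lemma second_derivative_F:
  assumes p: "p \<in> W"
  shows "dv (E (Some i) p) (\<lambda>q. dv (E (Some j) q) F)
    = D2 (\<sigma> p) (e i p) (e j p) + fd \<Phi> (\<sigma> p) (dv (E (Some i) p) (e j))"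
proof -
  let ?v = "E (Some i) p"
  note tv = E_tangent[OF p, of "Some i"]
  have n: "smooth_fun W (\<lambda>q. e j q $ a)" for a by (rule smooth_fun_nth[OF W_open e_smooth])
  have d: "smooth_fun W (\<lambda>q. fd \<Phi> (\<sigma> q) (axis a 1))" for a
    by (rule smooth_fun_compose[OF DPhi_smooth open_C W_open sec_smooth section_cone])
  have da: "dv ?v (\<lambda>q. fd \<Phi> (\<sigma> q) (axis a 1)) = D2 (\<sigma> p) (axis a 1) (e i p)" for a
    unfolding D2_def by (rule dv_compose[OF tv p W_open sec_smooth DPhi_smooth open_C section_cone])
  have "dv ?v (\<lambda>q. dv (E (Some j) q) F) = dv ?v (\<lambda>q. \<Sum>a\<in>UNIV. e j q $ a *\<^sub>R fd \<Phi> (\<sigma> q) (axis a 1))"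
  proof (rule dv_cong[OF tv W_open p])
    fix q assume q: "q \<in> W"
    show "dv (E (Some j) q) F = (\<Sum>a\<in>UNIV. e j q $ a *\<^sub>R fd \<Phi> (\<sigma> q) (axis a 1))"
      unfolding dv_F[OF q E_tangent[OF q]] by (rule linear_axis_expansion[OF linear_DPhi[OF section_cone[OF q]]])
  qed
  also have "\<dots> = (\<Sum>a\<in>UNIV. e j p $ a *\<^sub>R D2 (\<sigma> p) (axis a 1) (e i p))
      + (\<Sum>a\<in>UNIV. ?v (\<lambda>q. e j q $ a) *\<^sub>R fd \<Phi> (\<sigma> p) (axis a 1))"
    unfolding dv_sum_fun[OF tv p W_open smooth_fun_scaleR[OF W_open n d]] dv_scaleR_fun[OF tv p W_open n d] da sum.distrib ..
  also have "(\<Sum>a\<in>UNIV. e j p $ a *\<^sub>R D2 (\<sigma> p) (axis a 1) (e i p)) = D2 (\<sigma> p) (e j p) (e i p)"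
    by (rule linear_axis_expansion[OF linear_D2_left[OF section_cone[OF p]], symmetric])
  also have "\<dots> = D2 (\<sigma> p) (e i p) (e j p)" by (rule D2_sym[OF section_cone[OF p]])
  also have "(\<Sum>a\<in>UNIV. ?v (\<lambda>q. e j q $ a) *\<^sub>R fd \<Phi> (\<sigma> p) (axis a 1)) = fd \<Phi> (\<sigma> p) (dv ?v (e j))"
    unfolding linear_axis_expansion[OF linear_DPhi[OF section_cone[OF p]], of "dv ?v (e j)"] by (simp add: dv_def)
  finally show ?thesis .
qed

text \<open>As \<open>fd \<Phi>\<close> is symplectic up to \<epsilon>, the composition
  \<open>F\<close> inherits the pairings of \<sigma> with \<open>s\<close> replaced by
  \<open>\<epsilon> * s\<close>. Its second derivatives are the image of \<open>B\<close>, split by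
  \<open>B_expand\<close>, plus the image of \<open>derivative_e\<close>, where only the Reeb term
  survives.\<close>

sublocale framed: framed_map \<omega> W "\<lambda>i. E (Some i)" "E None" kappa F "\<epsilon> * s" S lam
proof
  show "\<epsilon> * s * (\<epsilon> * s) = 1" using eps sgn by auto
  show "smooth_fun W F" by (rule smooth_fun_compose[OF Phi_smooth open_C W_open sec_smooth section_cone])
  show "smooth_fun W (S i j l)" for i j l by (rule S_smooth)
  show "smooth_fun W (lam i j)" for i j by (rule lam_smooth)
  fix p i j assume p: "p \<in> W"
  note C = section_cone[OF p]
  note dF = dv_F[OF p E_tangent[OF p]]
  have F: "F p = fd \<Phi> (\<sigma> p) (\<sigma> p)" by (rule DPhi_self[OF C, symmetric])
  show "Om (F p) (dv (E (Some i) p) F) = 0"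
    unfolding dF F DPhi_symplectic[OF C] e_perp[OF p] by simp
  show "Om (F p) (dv (E None p) F) = 2 * (\<epsilon> * s)"
    unfolding dF F DPhi_symplectic[OF C] dv_E_None[OF p] Om_t_sec(2)[OF p] by simp
  show "Om (dv (E None p) F) (dv (E (Some i) p) F) = 0"
    unfolding dF DPhi_symplectic[OF C] dv_E_None[OF p] e_perp[OF p] by simp
  show "Om (dv (E (Some i) p) F) (dv (E (Some j) p) F) = \<epsilon> * s * kappa i j p"
    unfolding dF DPhi_symplectic[OF C] kappa_def by simp
  note L = linear_DPhi[OF C]
  have "D2 (\<sigma> p) (e i p) (e j p) = (\<Sum>l\<in>UNIV. S i j l p *\<^sub>R dv (E (Some l) p) F) + lam i j p *\<^sub>R F p"
    unfolding DPhi_B[OF C, symmetric] B_expand[OF p] dF F linear_add[OF L] linear_sum[OF L] linear_cmul[OF L] ..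
  moreover have "fd \<Phi> (\<sigma> p) (dv (E (Some i) p) (e j)) = - (kappa i j p / 2) *\<^sub>R dv (E None p) F"
    unfolding derivative_e[OF p] sec_coeff_zero[OF p] dF dv_E_None[OF p]
    using linear_cmul[OF L, of "- (kappa i j p / 2)" "t p"] by simp
  ultimately show "dv (E (Some i) p) (\<lambda>q. dv (E (Some j) q) F) =
      (\<Sum>l\<in>UNIV. S i j l p *\<^sub>R dv (E (Some l) p) F) + lam i j p *\<^sub>R F p - (kappa i j p / 2) *\<^sub>R dv (E None p) F"
    unfolding second_derivative_F[OF p] by simp
qed

text \<open>Symmetrizing cancels the Reeb derivatives, whose coefficients \<open>kappa\<close> are
  skew, and doubles the rest; \<open>lam_eq\<close> then eliminates \<open>lam\<close>, with
  \<open>CARD('m) + 2 = 2 * n\<close>.\<close>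

theorem schwarzian_system:
  assumes q: "q \<in> W" and n: "CARD('m) = 2 * n - 2" "n \<ge> 2"
  shows "E (Some i) q (\<lambda>r. E (Some j) r (\<lambda>q. \<Phi> (\<sigma> q) $ a)) + E (Some j) q (\<lambda>r. E (Some i) r (\<lambda>q. \<Phi> (\<sigma> q) $ a))
    = 2 * (\<Sum>k\<in>UNIV. S i j k q * E (Some k) q (\<lambda>q. \<Phi> (\<sigma> q) $ a))
      - 1 / real n * ((\<Sum>k\<in>UNIV. E (Some k) q (S i j k)) - (\<Sum>k\<in>UNIV. \<Sum>l\<in>UNIV. S k i l q * S l j k q)) * \<Phi> (\<sigma> q) $ a"
proof -
  define R where "R = (\<Sum>k\<in>UNIV. E (Some k) q (S i j k)) - (\<Sum>k\<in>UNIV. \<Sum>l\<in>UNIV. S k i l q * S l j k q)"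
  have "real CARD('m) + 2 = 2 * real n" using n by simp
  then have "R + 2 * real n * lam i j q = 0"
    using framed.lam_eq[OF q, of i j] unfolding R_def by simp
  then have lam: "2 * lam i j q = - 1 / real n * R" using n by (simp add: field_simps)
  have d: "E \<alpha> q (\<lambda>r. E \<beta> r (\<lambda>q. \<Phi> (\<sigma> q) $ a)) = dv (E \<alpha> q) (\<lambda>r. dv (E \<beta> r) F) $ a"
    "E \<alpha> q (\<lambda>q. \<Phi> (\<sigma> q) $ a) = dv (E \<alpha> q) F $ a" for \<alpha> \<beta>
    by (simp_all add: dv_def)
  have "dv (E (Some i) q) (\<lambda>r. dv (E (Some j) r) F) + dv (E (Some j) q) (\<lambda>r. dv (E (Some i) r) F)
      = 2 *\<^sub>R (\<Sum>l\<in>UNIV. S i j l q *\<^sub>R dv (E (Some l) q) F) + (2 * lam i j q) *\<^sub>R F q"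
    unfolding framed.struct_eq[OF q] framed.struct_sym[OF q, of j i] frame.k_skew[OF q, of j i]
    by (simp add: vec_eq_iff)
  from arg_cong[OF this, of "\<lambda>x. x $ a"] show ?thesis
    unfolding d R_def[symmetric] lam by simp
qed

lemma form_root: "form_root \<omega> W \<theta> \<sigma>"
  unfolding form_root_def
  using sec_smooth sec_nonzero proj_sec sgn root by (auto simp: dv_def intro!: bexI[of _ s])

lemma E1_section_Phi: "E1_section W (\<lambda>u. \<Phi> u $ a)"
  unfolding E1_section_def using Phi_hom smooth_on_vec_iff[OF open_C, of \<Phi>] Phi_smooth by simp

text \<open>The combination of differentials is tested on a vector that the surjective map
  \<open>fd \<Phi> u\<close> sends to a coordinate axis.\<close>

lemma E1_independent_Phi: "E1_independent W (\<lambda>a u. \<Phi> u $ a)"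
  unfolding E1_independent_def
proof (intro ballI allI impI)
  fix u c and a :: "'m ix"
  assume u: "u \<in> cone W" and z: "\<forall>w. (\<Sum>a\<in>UNIV. c a * frechet_derivative (\<lambda>u. \<Phi> u $ a) (at u) w) = 0"
  obtain w where w: "fd \<Phi> u w = axis a 1" using DPhi_surj[OF u] by blast
  have "(\<Sum>b\<in>UNIV. c b * fd \<Phi> u w $ b) = 0"
    using z[rule_format, of w] fd_vec_nth[OF smooth_on_differentiable[OF Phi_smooth open_C u]] by simp
  then show "c a = 0" unfolding w by (simp add: axis_def if_distrib cong: if_cong)
qed

lemma affine_coord_Phi:
  assumes q: "q \<in> W" and A: "\<phi> q \<in> affine_chart"
  shows "\<Phi> (\<sigma> q) $ None \<noteq> 0" "affine_coord \<alpha> (\<phi> q) = \<Phi> (\<sigma> q) $ Some \<alpha> / \<Phi> (\<sigma> q) $ None"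
proof -
  have P: "\<phi> q = proj (\<Phi> (\<sigma> q))" using lift[OF section_cone[OF q]] proj_sec[OF q] by simp
  note P0 = Phi_nonzero[OF section_cone[OF q]]
  obtain u where u: "\<phi> q = proj u" "u $ None \<noteq> 0" using A unfolding affine_chart_def by blast
  have u0: "u \<noteq> 0" using u(2) by auto
  obtain r where "r \<noteq> 0" "\<Phi> (\<sigma> q) = r *\<^sub>R u" using u(1) P proj_eq_iff[OF u0 P0] by metis
  then show "\<Phi> (\<sigma> q) $ None \<noteq> 0" using u(2) by simp
  have "affine_coord \<alpha> (\<phi> q) = descend (\<lambda>u. u $ Some \<alpha> / u $ None) (proj (\<Phi> (\<sigma> q)))"
    unfolding affine_coord_def descend_def P Let_def ..
  also have "\<dots> = \<Phi> (\<sigma> q) $ Some \<alpha> / \<Phi> (\<sigma> q) $ None"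
    by (rule descend_proj[OF P0]) simp
  finally show "affine_coord \<alpha> (\<phi> q) = \<Phi> (\<sigma> q) $ Some \<alpha> / \<Phi> (\<sigma> q) $ None" .
qed

end

section \<open>Assembling the local data and both statements\<close>

lemma (in symp) ex_schwarzian_frame:
  assumes C: "contactomorphism \<omega> Dom Ran \<phi>" and V: "open V" "V \<subseteq> Dom" "p \<in> V" and cf: "contact_form \<omega> V \<theta>"
    and R: "representative V (flat_contact_geodesic \<omega>) \<theta> nabla" and A: "adapted_coframe V \<theta> ch E"
    and P: "\<forall>\<alpha>. \<forall>p\<in>V. \<forall>v\<in>tangent p. nabla p v (E \<alpha>) = (\<lambda>f. 0)"
  obtains W \<Phi> \<epsilon> \<sigma> s where "p \<in> W" "W \<subseteq> V" "schwarzian_frame \<omega> W \<Phi> \<epsilon> Dom Ran \<phi> \<sigma> s \<theta> nabla ch E"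
proof -
  obtain W1 \<sigma> s where W1: "p \<in> W1" "W1 \<subseteq> V" "root_section \<omega> W1 \<sigma> s \<theta>"
    using local_root[OF V(1) cf V(3)] by blast
  have "open W1" using W1(3) unfolding root_section_def proj_section_def by blast
  then obtain W \<Phi> \<epsilon> where W: "p \<in> W" "W \<subseteq> W1" "contact_lift \<omega> W \<Phi> \<epsilon> Dom Ran \<phi>"
    using restricted_lift[OF C, of W1 p] W1 V by blast
  have oW: "open W" using W(3) unfolding contact_lift_def symp_lift_def symp_lift_axioms_def by blast
  have WV: "W \<subseteq> V" using W W1 by blast
  have RS: "root_section \<omega> W \<sigma> s \<theta>" by (rule root_section_restrict[OF W1(3) oW W(2)])
  have "schwarzian_frame \<omega> W \<Phi> \<epsilon> Dom Ran \<phi> \<sigma> s \<theta> nabla ch E"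
    by (intro schwarzian_frame.intro lift_section.intro parallel_coframe.intro parallel_coframe_axioms.intro W(3) RS
        representative_restrict[OF R WV] adapted_coframe_restrict[OF A V(1) WV]) (use P WV in blast)
  then show ?thesis using that W(1) WV by blast
qed

theorem mainTheorem2:
  fixes n :: nat
    and \<omega> :: "real ^ 'm::finite ^ 'm"
    and D D' :: "'m ix projspace set"
    and \<phi> :: "'m ix projspace \<Rightarrow> 'm ix projspace"
  assumes "n \<ge> 2" and "CARD('m) = 2 * n - 2"
    and "\<forall>p q. \<omega> $ p $ q = - \<omega> $ q $ p" and "invertible \<omega>"
    and "contactomorphism \<omega> D D' \<phi>"
  shows
    "(\<forall>U. open U \<and> connected U \<and> U \<subseteq> D \<and> preserves_coorientation \<omega> U \<phi> \<longrightarrow>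
        (\<forall>p\<in>U. \<forall>v\<in>contact_plane \<omega> p. \<forall>w\<in>contact_plane \<omega> p.
           contact_schwarzian \<omega> D \<phi> p v w = (\<lambda>f. 0)) \<longleftrightarrow>
        (\<exists>A\<in>Sp \<omega>. \<forall>p\<in>U. \<phi> p = proj_action A p))
     \<and>
     (\<forall>V \<theta> nabla th E S.
        open V \<and> V \<subseteq> D \<and> contact_form \<omega> V \<theta> \<and>
        representative V (flat_contact_geodesic \<omega>) \<theta> nabla \<and>
        adapted_coframe V \<theta> th E \<and>
        (\<forall>\<alpha>. \<forall>p\<in>V. \<forall>v\<in>tangent p. nabla p v (E \<alpha>) = (\<lambda>f. 0)) \<and>
        S = (\<lambda>i j k q. th (Some k) q
               (contact_schwarzian \<omega> D \<phi> q (E (Some i) q) (E (Some j) q)))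
        \<longrightarrow>
        (\<forall>p\<in>V. \<exists>W \<sigma> F. open W \<and> p \<in> W \<and> W \<subseteq> V \<and> form_root \<omega> W \<theta> \<sigma> \<and>
           (\<forall>a :: 'm ix. E1_section W (F a)) \<and> E1_independent W F \<and>
           (\<forall>a. let f = (\<lambda>q. F a (\<sigma> q)) in
              \<forall>q\<in>W. \<forall>i j.
                E (Some i) q (\<lambda>r. E (Some j) r f) + E (Some j) q (\<lambda>r. E (Some i) r f)
                = 2 * (\<Sum>k\<in>UNIV. S i j k q * E (Some k) q f)
                  - 1 / real n *
                    ((\<Sum>k\<in>UNIV. E (Some k) q (S i j k))
                      - (\<Sum>k\<in>UNIV. \<Sum>l\<in>UNIV. S k i l q * S l j k q)) * f q) \<and>
           (\<forall>q\<in>W. \<phi> q \<in> affine_chart \<longrightarrow>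
              F None (\<sigma> q) \<noteq> 0 \<and>
              (\<forall>\<alpha>. affine_coord \<alpha> (\<phi> q) = F (Some \<alpha>) (\<sigma> q) / F None (\<sigma> q)))))"
proof -
  interpret symp \<omega>
  proof
    show "\<omega> $ p $ q = - \<omega> $ q $ p" for p q using assms(3) by blast
    show "invertible \<omega>" by (rule assms(4))
    show "2 \<le> CARD('m)" using assms(1,2) by simp
  qed
  show ?thesis
  proof (rule conjI; intro allI impI)
    fix U assume "open U \<and> connected U \<and> U \<subseteq> D \<and> preserves_coorientation \<omega> U \<phi>"
    then show "(\<forall>p\<in>U. \<forall>v\<in>contact_plane \<omega> p. \<forall>w\<in>contact_plane \<omega> p. contact_schwarzian \<omega> D \<phi> p v w = (\<lambda>f. 0))
        \<longleftrightarrow> (\<exists>A\<in>Sp \<omega>. \<forall>p\<in>U. \<phi> p = proj_action A p)"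
      using schwarzian_zero_iff_linear[OF assms(5), of U] by blast
  next
    fix V \<theta> nabla th E S
    assume H: "open V \<and> V \<subseteq> D \<and> contact_form \<omega> V \<theta> \<and>
        representative V (flat_contact_geodesic \<omega>) \<theta> nabla \<and>
        adapted_coframe V \<theta> th E \<and>
        (\<forall>\<alpha>. \<forall>p\<in>V. \<forall>v\<in>tangent p. nabla p v (E \<alpha>) = (\<lambda>f. 0)) \<and>
        S = (\<lambda>i j k q. th (Some k) q
               (contact_schwarzian \<omega> D \<phi> q (E (Some i) q) (E (Some j) q)))"
    then have V: "open V" "V \<subseteq> D" "contact_form \<omega> V \<theta>" "representative V (flat_contact_geodesic \<omega>) \<theta> nabla"
      "adapted_coframe V \<theta> th E" and P: "\<forall>\<alpha>. \<forall>p\<in>V. \<forall>v\<in>tangent p. nabla p v (E \<alpha>) = (\<lambda>f. 0)"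
      and S: "S = (\<lambda>i j k q. th (Some k) q (contact_schwarzian \<omega> D \<phi> q (E (Some i) q) (E (Some j) q)))"
      by - (elim conjE, assumption)+

    show "\<forall>p\<in>V. \<exists>W \<sigma> F. open W \<and> p \<in> W \<and> W \<subseteq> V \<and> form_root \<omega> W \<theta> \<sigma> \<and>
           (\<forall>a :: 'm ix. E1_section W (F a)) \<and> E1_independent W F \<and>
           (\<forall>a. let f = (\<lambda>q. F a (\<sigma> q)) in
              \<forall>q\<in>W. \<forall>i j.
                E (Some i) q (\<lambda>r. E (Some j) r f) + E (Some j) q (\<lambda>r. E (Some i) r f)
                = 2 * (\<Sum>k\<in>UNIV. S i j k q * E (Some k) q f)
                  - 1 / real n *
                    ((\<Sum>k\<in>UNIV. E (Some k) q (S i j k))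
                      - (\<Sum>k\<in>UNIV. \<Sum>l\<in>UNIV. S k i l q * S l j k q)) * f q) \<and>
           (\<forall>q\<in>W. \<phi> q \<in> affine_chart \<longrightarrow>
              F None (\<sigma> q) \<noteq> 0 \<and>
              (\<forall>\<alpha>. affine_coord \<alpha> (\<phi> q) = F (Some \<alpha>) (\<sigma> q) / F None (\<sigma> q)))"
    proof
      fix p assume p: "p \<in> V"
      obtain W \<Phi> \<epsilon> \<sigma> s where W: "p \<in> W" "W \<subseteq> V" and fr: "schwarzian_frame \<omega> W \<Phi> \<epsilon> D D' \<phi> \<sigma> s \<theta> nabla th E"
        by (rule ex_schwarzian_frame[where nabla = nabla and E = E, OF assms(5) V(1,2) p V(3-5) P])
      interpret fr: schwarzian_frame \<omega> W \<Phi> \<epsilon> D D' \<phi> \<sigma> s \<theta> nabla th E by (rule fr)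
      have SS: "S = fr.S" unfolding S by (intro ext) (rule fr.S_def[symmetric])
      show "\<exists>W \<sigma> F. open W \<and> p \<in> W \<and> W \<subseteq> V \<and> form_root \<omega> W \<theta> \<sigma> \<and>
           (\<forall>a :: 'm ix. E1_section W (F a)) \<and> E1_independent W F \<and>
           (\<forall>a. let f = (\<lambda>q. F a (\<sigma> q)) in
              \<forall>q\<in>W. \<forall>i j.
                E (Some i) q (\<lambda>r. E (Some j) r f) + E (Some j) q (\<lambda>r. E (Some i) r f)
                = 2 * (\<Sum>k\<in>UNIV. S i j k q * E (Some k) q f)
                  - 1 / real n *
                    ((\<Sum>k\<in>UNIV. E (Some k) q (S i j k))
                      - (\<Sum>k\<in>UNIV. \<Sum>l\<in>UNIV. S k i l q * S l j k q)) * f q) \<and>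
           (\<forall>q\<in>W. \<phi> q \<in> affine_chart \<longrightarrow>
              F None (\<sigma> q) \<noteq> 0 \<and>
              (\<forall>\<alpha>. affine_coord \<alpha> (\<phi> q) = F (Some \<alpha>) (\<sigma> q) / F None (\<sigma> q)))"
        unfolding SS Let_def
        \<comment> \<open>The sections are the components of the homogeneous lift, one for each
          coordinate of the linear space, and the root of \<theta> is the section along which the
          frame was studied.\<close>
        by (intro exI[of _ W] exI[of _ \<sigma>] exI[of _ "\<lambda>a u. \<Phi> u $ a"] conjI allI ballI impI)
          (rule fr.W_open W fr.form_root fr.E1_section_Phi fr.E1_independent_Phi fr.schwarzian_system[OF _ assms(2,1)]
            fr.affine_coord_Phi; assumption?)+
    qed
  qed
qed

end
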